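(* Let $\omega$ be a weight function on a locally compact group $G$. Then the following assertions are equivalent. (a) $M_*(G,\omega)^*$ is Arens regular. (b) $L^1(G,\omega)$ is Arens regular. (c) $M(G,\omega)$ is Arens regular. (d) $L^1(G,\omega)^{**}$ is Arens regular. (e) $M(G,\omega)^{**}$ is Arens regular. (f) $L_0^\infty(G,1/\omega)^*$ is Arens regular. (g) $G$ is finite or $\Omega$ is zero cluster. In this case, $G$ is discrete and countable.
   Context: All groups are Hausdorff locally compact. A weight (weight function) on $G$ is a continuous function $\omega:G\to[1,\infty)$ with $\omega(e)=1$ and $\omega(xy)\le\omega(x)\omega(y)$ for all $x,y\in G$. Define $\Omega:G\times G\to(0,1]$ by $\Omega(x,y)=\omega(xy)/(\omega(x)\omega(y))$. A function $F:G\times G\to\mathbb{C}$ is zero cluster if for every pair of sequences $(x_n)_n$ and $(y_m)_m$ of distinct elements of $G$, $\lim_n\lim_m F(x_n,y_m)=\lim_m\lim_n F(x_n,y_m)=0$ whenever both iterated limits exist. $L^1(G,\omega)$ is the Banach algebra (under convolution, norm $\|\phi\|_\omega=\|\omega\phi\|_1$) of measurable $\phi$ with $\omega\phi\in L^1(G)$. $M(G,\omega)$ is the Banach algebra (under convolution, norm $\|\mu\|_\omega=\|\omega\mu\|$) of complex regular Borel measures $\mu$ on $G$ with $\omega\mu\in M(G)$. A functional $\lambda\in M(G,\omega)^*$ vanishes at infinity if for every $\varepsilon>0$ there is a compact $K\subseteq G$ with $|\langle\lambda,\mu\rangle|<\varepsilon$ for all $\mu\in M(G,\omega)$ with $|\mu|(K)=0$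 and $\|\mu\|_\omega=1$. $M_*(G,\omega)$ is the (norm closed) subspace of $M(G,\omega)^*$ of all functionals that vanish at infinity. $L^\infty(G,1/\omega)$ is the space of measurable $f$ with $\|f\|_{\infty,\omega}=\|f/\omega\|_\infty<\infty$ (essential supremum norm), and $L_0^\infty(G,1/\omega)$ is its subspace of functions that vanish at infinity (for every $\varepsilon>0$ there is a compact $K$ with $\|f\chi_{G\setminus K}\|_{\infty,\omega}<\varepsilon$). First Arens product: for a Banach algebra $\mathfrak A$, $f\in\mathfrak A^*$, $a,b\in\mathfrak A$, $\Phi,\Psi\in\mathfrak A^{**}$, put $\langle fa,b\rangle=\langle f,ab\rangle$, $\langle\Psi f,a\rangle=\langle\Psi,fa\rangle$, $\langle\Phi\diamond\Psi,f\rangle=\langle\Phi,\Psi f\rangle$. Second duals carry this product. The same formulas, with $\mathfrak A=M(G,\omega)$ and $f$ in the left introverted subspace $M_*(G,\omega)$ of $M(G,\omega)^*$ (resp. $\mathfrak A=L^1(G,\omega)$ and $f\in L_0^\infty(G,1/\omega)\subseteq L^1(G,\omega)^*$), define the product making $M_*(G,\omega)^*$ (resp. $L_0^\infty(G,1/\omega)^*$) a Banach algebra. A Banach algebra $\mathfrak A$ is Arens regular if for every $\Phi\in\mathfrak A^{**}$ the map $\Psi\mapsto\Phi\diamond\Psi$ is weak$^*$-weak$^*$ continuous on $\mathfrak A^{**}$. *)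

theory Defs
  imports "HOL-Analysis.Analysis" "HOL-Probability.Essential_Supremum"
begin

section \<open>Normed algebras of functions, duals and Arens products\<close>

text \<open>All the spaces below depend on a weight, so they are carrier sets rather than types. Each of
  them consists of complex-valued functions (functions on the group, set functions, or functionals)
  with the pointwise complex vector space operations, so a structure only has to record the carrier,
  the norm and the product.

  \<open>vnorm\<close> may be a seminorm, as for spaces of integrable functions: a functional bounded with
  respect to \<open>vnorm\<close> is constant on classes of elements at distance 0, so the dual (and all that is
  built from it) is the dual of the quotient space.\<close>

record 'x falgebra =
  carr :: "('x \<Rightarrow> complex) set"
  vnorm :: "('x \<Rightarrow> complex) \<Rightarrow> real"
  vmult :: "('x \<Rightarrow> complex) \<Rightarrow> ('x \<Rightarrow> complex) \<Rightarrow> ('x \<Rightarrow> complex)"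

text \<open>Functionals are extended by 0 outside the carrier, so that equality of functionals is equality
  on the carrier.\<close>

definition top_dual ::
  "('x \<Rightarrow> complex) set \<Rightarrow> (('x \<Rightarrow> complex) \<Rightarrow> real) \<Rightarrow> (('x \<Rightarrow> complex) \<Rightarrow> complex) set" where
  "top_dual V N = {f.
     (\<forall>a\<in>V. \<forall>b\<in>V. f (\<lambda>x. a x + b x) = f a + f b) \<and>
     (\<forall>c. \<forall>a\<in>V. f (\<lambda>x. c * a x) = c * f a) \<and>
     (\<exists>C. \<forall>a\<in>V. cmod (f a) \<le> C * N a) \<and>
     (\<forall>a. a \<notin> V \<longrightarrow> f a = 0)}"

definition dual_norm ::
  "('x \<Rightarrow> complex) set \<Rightarrow> (('x \<Rightarrow> complex) \<Rightarrow> real) \<Rightarrow> (('x \<Rightarrow> complex) \<Rightarrow> complex) \<Rightarrow> real" where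
  "dual_norm V N f = (SUP a\<in>{a\<in>V. N a \<le> 1}. cmod (f a))"

definition weak_star ::
  "('x \<Rightarrow> complex) set \<Rightarrow> (('x \<Rightarrow> complex) \<Rightarrow> real) \<Rightarrow> (('x \<Rightarrow> complex) \<Rightarrow> complex) topology" where
  "weak_star V N =
     pullback_topology (top_dual V N) (\<lambda>f. restrict f V) (product_topology (\<lambda>_. euclidean) V)"

definition adual :: "'x falgebra \<Rightarrow> (('x \<Rightarrow> complex) \<Rightarrow> complex) set" where
  "adual A = top_dual (carr A) (vnorm A)"

definition adual_norm :: "'x falgebra \<Rightarrow> (('x \<Rightarrow> complex) \<Rightarrow> complex) \<Rightarrow> real" where
  "adual_norm A = dual_norm (carr A) (vnorm A)"

text \<open>The functionals \<open>f a\<close> and \<open>\<Psi> f\<close>, and the first Arens product of functionals on a left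
  introverted subspace \<open>X\<close> of the dual of \<open>A\<close>.\<close>

definition func_act ::
  "'x falgebra \<Rightarrow> (('x \<Rightarrow> complex) \<Rightarrow> complex) \<Rightarrow> ('x \<Rightarrow> complex) \<Rightarrow> (('x \<Rightarrow> complex) \<Rightarrow> complex)" where
  "func_act A f a = (\<lambda>b. if b \<in> carr A then f (vmult A a b) else 0)"

definition bidual_act ::
  "'x falgebra \<Rightarrow> ((('x \<Rightarrow> complex) \<Rightarrow> complex) \<Rightarrow> complex) \<Rightarrow> (('x \<Rightarrow> complex) \<Rightarrow> complex)
     \<Rightarrow> (('x \<Rightarrow> complex) \<Rightarrow> complex)" where
  "bidual_act A \<Psi> f = (\<lambda>a. if a \<in> carr A then \<Psi> (func_act A f a) else 0)"

definition arens_mult ::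
  "'x falgebra \<Rightarrow> (('x \<Rightarrow> complex) \<Rightarrow> complex) set \<Rightarrow>
     ((('x \<Rightarrow> complex) \<Rightarrow> complex) \<Rightarrow> complex) \<Rightarrow> ((('x \<Rightarrow> complex) \<Rightarrow> complex) \<Rightarrow> complex) \<Rightarrow>
     ((('x \<Rightarrow> complex) \<Rightarrow> complex) \<Rightarrow> complex)" where
  "arens_mult A X \<Phi> \<Psi> = (\<lambda>f. if f \<in> X then \<Phi> (bidual_act A \<Psi> f) else 0)"

definition introverted_dual ::
  "'x falgebra \<Rightarrow> (('x \<Rightarrow> complex) \<Rightarrow> complex) set \<Rightarrow> (('x \<Rightarrow> complex) \<Rightarrow> complex) falgebra" where
  "introverted_dual A X =
     \<lparr> carr = top_dual X (adual_norm A),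
       vnorm = dual_norm X (adual_norm A),
       vmult = arens_mult A X \<rparr>"

definition bidual :: "'x falgebra \<Rightarrow> (('x \<Rightarrow> complex) \<Rightarrow> complex) falgebra" where
  "bidual A = introverted_dual A (adual A)"

definition arens_regular :: "'x falgebra \<Rightarrow> bool" where
  "arens_regular A \<longleftrightarrow>
     (\<forall>\<Phi>\<in>carr (bidual A).
        continuous_map (weak_star (adual A) (adual_norm A)) (weak_star (adual A) (adual_norm A))
          (\<lambda>\<Psi>. vmult (bidual A) \<Phi> \<Psi>))"

section \<open>Complex regular Borel measures\<close>

text \<open>A complex measure is a set function on the Borel sets, extended by 0 to all other sets.\<close>

definition complex_borel_measure :: "('a::topological_space set \<Rightarrow> complex) \<Rightarrow> bool" where
  "complex_borel_measure \<mu> \<longleftrightarrow>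
     (\<forall>A::nat \<Rightarrow> 'a set. range A \<subseteq> sets borel \<and> disjoint_family A \<longrightarrow>
        (\<lambda>n. \<mu> (A n)) sums \<mu> (\<Union>n. A n)) \<and>
     (\<forall>E. E \<notin> sets borel \<longrightarrow> \<mu> E = 0)"

text \<open>The total variation measure of \<open>\<mu>\<close>.\<close>

definition variation :: "('a::topological_space set \<Rightarrow> complex) \<Rightarrow> 'a measure" where
  "variation \<mu> = measure_of UNIV (sets borel)
     (\<lambda>E. SUP P\<in>{P. finite P \<and> P \<subseteq> sets borel \<and> disjoint P \<and> \<Union>P \<subseteq> E}.
        (\<Sum>B\<in>P. ennreal (cmod (\<mu> B))))"

text \<open>The positive part in the Jordan decomposition of a finite signed measure; \<open>ennreal\<close> maps
  negative reals to 0.\<close>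

definition jordan_pos :: "('a::topological_space set \<Rightarrow> real) \<Rightarrow> 'a measure" where
  "jordan_pos \<rho> = measure_of UNIV (sets borel)
     (\<lambda>E. SUP B\<in>{B \<in> sets borel. B \<subseteq> E}. ennreal (\<rho> B))"

definition cm_integral :: "('a::topological_space set \<Rightarrow> complex) \<Rightarrow> ('a \<Rightarrow> complex) \<Rightarrow> complex" where
  "cm_integral \<mu> f =
     (integral\<^sup>L (jordan_pos (\<lambda>E. Re (\<mu> E))) f - integral\<^sup>L (jordan_pos (\<lambda>E. - Re (\<mu> E))) f)
     + \<i> * (integral\<^sup>L (jordan_pos (\<lambda>E. Im (\<mu> E))) f - integral\<^sup>L (jordan_pos (\<lambda>E. - Im (\<mu> E))) f)"

definition regular_complex_measures :: "('a::topological_space set \<Rightarrow> complex) set" where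
  "regular_complex_measures = {\<mu>. complex_borel_measure \<mu> \<and>
     (\<forall>E\<in>sets borel.
        emeasure (variation \<mu>) E = (SUP K\<in>{K. compact K \<and> K \<subseteq> E}. emeasure (variation \<mu>) K) \<and>
        emeasure (variation \<mu>) E = (INF U\<in>{U. open U \<and> E \<subseteq> U}. emeasure (variation \<mu>) U))}"

definition weighted_measure ::
  "('a \<Rightarrow> real) \<Rightarrow> ('a::topological_space set \<Rightarrow> complex) \<Rightarrow> ('a set \<Rightarrow> complex)" where
  "weighted_measure \<omega> \<mu> E =
     (if E \<in> sets borel then cm_integral \<mu> (\<lambda>x. complex_of_real (\<omega> x) * indicator E x) else 0)"

section \<open>Weighted algebras on a locally compact group\<close>

text \<open>Groups are written additively, but are not assumed to be commutative.\<close>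

definition weight :: "('a::topological_group_add \<Rightarrow> real) \<Rightarrow> bool" where
  "weight \<omega> \<longleftrightarrow> continuous_on UNIV \<omega> \<and> (\<forall>x. 1 \<le> \<omega> x) \<and> \<omega> 0 = 1 \<and>
     (\<forall>x y. \<omega> (x + y) \<le> \<omega> x * \<omega> y)"

definition weight_Omega :: "('a::topological_group_add \<Rightarrow> real) \<Rightarrow> 'a \<times> 'a \<Rightarrow> real" where
  "weight_Omega \<omega> = (\<lambda>(x, y). \<omega> (x + y) / (\<omega> x * \<omega> y))"

definition zero_cluster :: "('a \<times> 'a \<Rightarrow> complex) \<Rightarrow> bool" where
  "zero_cluster F \<longleftrightarrow>
     (\<forall>(x::nat \<Rightarrow> 'a) (y::nat \<Rightarrow> 'a) a b l l'.
        inj x \<and> inj y \<and>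
        (\<forall>n. (\<lambda>m. F (x n, y m)) \<longlonglongrightarrow> a n) \<and> a \<longlonglongrightarrow> l \<and>
        (\<forall>m. (\<lambda>n. F (x n, y m)) \<longlonglongrightarrow> b m) \<and> b \<longlonglongrightarrow> l' \<longrightarrow>
        l = 0 \<and> l' = 0)"

text \<open>Regularity is that of a Radon measure: outer regular on Borel sets, inner regular on open
  sets.\<close>

definition left_haar_measure :: "'a::{topological_group_add, t2_space} measure \<Rightarrow> bool" where
  "left_haar_measure m \<longleftrightarrow>
     sets m = sets borel \<and> emeasure m UNIV \<noteq> 0 \<and>
     (\<forall>K. compact K \<longrightarrow> emeasure m K < \<infinity>) \<and>
     (\<forall>E\<in>sets borel. \<forall>x. emeasure m ((\<lambda>y. x + y) ` E) = emeasure m E) \<and>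
     (\<forall>E\<in>sets borel. emeasure m E = (INF U\<in>{U. open U \<and> E \<subseteq> U}. emeasure m U)) \<and>
     (\<forall>U. open U \<longrightarrow> emeasure m U = (SUP K\<in>{K. compact K \<and> K \<subseteq> U}. emeasure m K))"

definition L1_alg ::
  "'a::{topological_group_add, t2_space} measure \<Rightarrow> ('a \<Rightarrow> real) \<Rightarrow> 'a falgebra" where
  "L1_alg m \<omega> =
     \<lparr> carr = {\<phi>. \<phi> \<in> borel_measurable m \<and> integrable m (\<lambda>x. complex_of_real (\<omega> x) * \<phi> x)},
       vnorm = (\<lambda>\<phi>. \<integral>x. cmod (complex_of_real (\<omega> x) * \<phi> x) \<partial>m),
       vmult = (\<lambda>\<phi> \<psi> x. \<integral>y. \<phi> y * \<psi> (- y + x) \<partial>m) \<rparr>"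

definition M_alg :: "('a::{topological_group_add, t2_space} \<Rightarrow> real) \<Rightarrow> 'a set falgebra" where
  "M_alg \<omega> =
     \<lparr> carr = {\<mu> \<in> regular_complex_measures.
                 integrable (variation \<mu>) \<omega> \<and> weighted_measure \<omega> \<mu> \<in> regular_complex_measures},
       vnorm = (\<lambda>\<mu>. measure (variation (weighted_measure \<omega> \<mu>)) UNIV),
       vmult = (\<lambda>\<mu> \<nu> E. if E \<in> sets borel
                 then cm_integral \<mu> (\<lambda>x. cm_integral \<nu> (\<lambda>y. indicator E (x + y))) else 0) \<rparr>"

definition M_star ::
  "('a::{topological_group_add, t2_space} \<Rightarrow> real) \<Rightarrow> (('a set \<Rightarrow> complex) \<Rightarrow> complex) set" where
  "M_star \<omega> = {\<Lambda> \<in> adual (M_alg \<omega>).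
     \<forall>\<epsilon>>0. \<exists>K. compact K \<and>
       (\<forall>\<mu>\<in>carr (M_alg \<omega>). emeasure (variation \<mu>) K = 0 \<and> vnorm (M_alg \<omega>) \<mu> = 1 \<longrightarrow>
          cmod (\<Lambda> \<mu>) < \<epsilon>)}"

definition Linf_norm :: "'a measure \<Rightarrow> ('a \<Rightarrow> real) \<Rightarrow> ('a \<Rightarrow> complex) \<Rightarrow> ennreal" where
  "Linf_norm m \<omega> f = esssup m (\<lambda>x. ennreal (cmod (f x) / \<omega> x))"

definition Linf :: "'a measure \<Rightarrow> ('a \<Rightarrow> real) \<Rightarrow> ('a \<Rightarrow> complex) set" where
  "Linf m \<omega> = {f. f \<in> borel_measurable m \<and> Linf_norm m \<omega> f < \<infinity>}"

definition Linf0 :: "'a::topological_space measure \<Rightarrow> ('a \<Rightarrow> real) \<Rightarrow> ('a \<Rightarrow> complex) set" where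
  "Linf0 m \<omega> = {f \<in> Linf m \<omega>.
     \<forall>\<epsilon>>0. \<exists>K. compact K \<and> Linf_norm m \<omega> (\<lambda>x. f x * indicator (- K) x) < ennreal \<epsilon>}"

text \<open>The functional on \<open>L1_alg m \<omega>\<close> with which \<open>f\<close> is identified. On \<open>Linf0 m \<omega>\<close> this is isometric
  even if \<open>m\<close> is not sigma-finite, because elements of \<open>Linf0 m \<omega>\<close> vanish almost everywhere outside
  some sigma-compact set. The dual of \<open>Linf0 m \<omega>\<close> is therefore the dual of \<open>Linf0_functionals m \<omega>\<close>
  with the functional norm.\<close>

definition Linf_functional ::
  "'a::{topological_group_add, t2_space} measure \<Rightarrow> ('a \<Rightarrow> real) \<Rightarrow> ('a \<Rightarrow> complex)
     \<Rightarrow> (('a \<Rightarrow> complex) \<Rightarrow> complex)" where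
  "Linf_functional m \<omega> f = (\<lambda>\<phi>. if \<phi> \<in> carr (L1_alg m \<omega>) then \<integral>x. f x * \<phi> x \<partial>m else 0)"

definition Linf0_functionals ::
  "'a::{topological_group_add, t2_space} measure \<Rightarrow> ('a \<Rightarrow> real) \<Rightarrow> (('a \<Rightarrow> complex) \<Rightarrow> complex) set" where
  "Linf0_functionals m \<omega> = Linf_functional m \<omega> ` Linf0 m \<omega>"

end

theory Submission
 imports Defs "HOL-Library.Diagonal_Subsequence" "HOL-Probability.Giry_Monad"
begin

text \<open>All six algebras are \<open>A\<close> or \<open>introverted_dual A X\<close>, where
  \<open>A\<close> is \<open>L1_alg\<close> or \<open>M_alg\<close> and \<open>X\<close> is its dual
  or the space of functionals vanishing at infinity. The structure used for one of them must
  therefore survive passage to the dual, so supports, restrictions and smallness of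
  \<open>\<Omega>\<close> enter as norm inequalities only, and these dualise. Products of singular
  elements are negligible for a combinatorial reason. A singular functional has a finitely additive
  variation that vanishes on finite sets. If its values on infinitely many translates of a
  functional were large compared with \<open>\<omega>\<close>, the sets
  \<open>{y. \<delta> <= \<Omega> (x, y)}\<close> would carry mass bounded below and contain a half
  graph, on which one iterated limit of \<open>\<Omega>\<close> is at least \<open>\<delta>\<close>.
  \<open>M_alg\<close> has point masses over every group; for \<open>L1_alg\<close> discreteness has
  to be forced first. The measure theory is long because the group may be neither second countable
  nor \<sigma>-compact: Borel sets of the square need not be generated by rectangles and Haar
  measure need not be \<sigma>-finite, so Fubini's theorem and the duality of L1 are rebuilt from
  compact approximation.\<close>

abbreviation BM :: "('a::topological_space => 'b::topological_space) set" where "BM \<equiv> borel_measurable borel"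
abbreviation Borel :: "'a::topological_space set set" where "Borel \<equiv> sets borel"

text \<open>Arens regularity makes the two iterated limits of \<open>F (a\<^sub>n b\<^sub>m)\<close> agree for bounded sequences. Applied to point
 masses this forces \<open>\<Omega>\<close> to be zero cluster; applied to normalised indicators on shrinking neighbourhoods of 0
 it excludes non-discrete groups. Conversely, a zero cluster \<open>\<Omega>\<close> makes the group discrete and countable. Then an
 element of any of the second duals is the sum of an atomic and a singular part, and \<open>\<Omega>\<close> being zero cluster
 kills the products of singular elements, so that multiplication is weak* continuous in each variable. Both
 implications only use restriction operators and point masses; \<open>M\<^sub>*\<close> and \<open>L\<^sub>0\<^sup>\<infinity>\<close> are the functionals that vanish at
 infinity with respect to restriction.\<close>

section \<open>Seminormed spaces of functions and their duals\<close>

lemma top_dual_add: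
 "F \<in> top_dual V N ==> a \<in> V ==> b \<in> V ==> F (%x. a x + b x) = F a + F b"
 by (simp add: top_dual_def)

lemma top_dual_scale:
 "F \<in> top_dual V N ==> a \<in> V ==> F (%x. c * a x) = c * F a"
 by (simp add: top_dual_def)

lemma top_dual_outside: "F \<in> top_dual V N ==> a \<notin> V ==> F a = 0"
 by (simp add: top_dual_def)

lemma top_dual_bounded:
 assumes "F \<in> top_dual V N" obtains C where "\<forall>a\<in>V. cmod (F a) <= C * N a"
proof -
 have "\<exists>C. \<forall>a\<in>V. cmod (F a) <= C * N a" using assms by (simp add: top_dual_def)
 then show ?thesis using that by blast
qed

lemma top_dualI:
 assumes "!!a b. a \<in> V ==> b \<in> V ==> F (%x. a x + b x) = F a + F b"
  and "!!c a. a \<in> V ==> F (%x. c * a x) = c * F a"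
  and "!!a. a \<in> V ==> cmod (F a) <= C * N a"
  and "!!a. a \<notin> V ==> F a = 0"
 shows "F \<in> top_dual V N"
 unfolding top_dual_def using assms(1,2,4) by (auto intro!: exI[of _ C] assms(3))

text \<open>\<open>N\<close> is only a seminorm because elements of \<open>L1_alg\<close> are
  functions, not classes modulo null sets; \<open>functional_eq_of_norm_diff\<close> says that
  functionals do not see the difference.\<close>

locale seminormed_funs =
 fixes V :: "('x => complex) set" and N :: "('x => complex) => real"
 assumes zero_in: "(%x. 0) \<in> V"
  and add_in: "a \<in> V ==> b \<in> V ==> (%x. a x + b x) \<in> V"
  and scale_in: "a \<in> V ==> (%x. c * a x) \<in> V"
  and norm_nonneg: "a \<in> V ==> 0 <= N a"
  and norm_add: "a \<in> V ==> b \<in> V ==> N (%x. a x + b x) <= N a + N b"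
  and norm_scale: "a \<in> V ==> N (%x. c * a x) = cmod c * N a"
begin

lemma norm_zero: "N (%x. 0) = 0"
 using norm_scale[OF zero_in, of 0] by simp

lemma diff_in: "a \<in> V ==> b \<in> V ==> (%x. a x - b x) \<in> V"
 using add_in[of a "%x. (-1) * b x"] scale_in[of b "-1"] by simp

lemma sum_in: "finite I ==> (!!i. i \<in> I ==> a i \<in> V) ==> (%x. \<Sum>i\<in>I. c i * a i x) \<in> V"
proof (induction I rule: finite_induct)
 case empty then show ?case using zero_in by simp
next
 case (insert j J)
 then show ?case using add_in[OF scale_in[of "a j" "c j"], of "%x. \<Sum>i\<in>J. c i * a i x"] by simp
qed

lemma functional_sum:
 assumes "F \<in> top_dual V N"
 shows "finite I ==> (!!i. i \<in> I ==> a i \<in> V) ==> F (%x. \<Sum>i\<in>I. c i * a i x) = (\<Sum>i\<in>I. c i * F (a i))"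
proof (induction I rule: finite_induct)
 case empty then show ?case using top_dual_scale[OF assms zero_in, of 0] by simp
next
 case (insert j J)
 then show ?case
  using top_dual_add[OF assms scale_in[of "a j" "c j"] sum_in[of J a c]] top_dual_scale[OF assms, of "a j" "c j"]
  by simp
qed

lemma functional_zero: "F \<in> top_dual V N ==> F (%x. 0) = 0"
 using top_dual_scale[OF _ zero_in, of F N 0] by simp

lemma functional_diff:
 assumes "F \<in> top_dual V N" "a \<in> V" "b \<in> V"
 shows "F (%x. a x - b x) = F a - F b"
 using top_dual_add[OF assms(1,2) scale_in[OF assms(3)], of "-1"] top_dual_scale[OF assms(1,3), of "-1"] by simp

lemma bdd_above_unit_ball:
 assumes "F \<in> top_dual V N"
 shows "bdd_above ((%a. cmod (F a)) ` {a \<in> V. N a <= 1})"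
proof -
 obtain C where C: "\<forall>a\<in>V. cmod (F a) <= C * N a" by (rule top_dual_bounded[OF assms])
 show ?thesis
 proof (rule bdd_aboveI2)
  fix a assume a: "a \<in> {a \<in> V. N a <= 1}"
  have "C * N a <= \<bar>C\<bar> * 1" using a norm_nonneg[of a] by (intro mult_mono) auto
  then show "cmod (F a) <= \<bar>C\<bar>" using C a by force
 qed
qed

lemma dual_norm_nonneg:
 assumes "F \<in> top_dual V N" shows "0 <= dual_norm V N F"
proof -
 have "cmod (F (%x. 0)) <= dual_norm V N F"
  unfolding dual_norm_def by (rule cSUP_upper[OF _ bdd_above_unit_ball[OF assms]]) (simp add: zero_in norm_zero)
 then show ?thesis using norm_ge_zero order_trans by blast
qed

lemma dual_norm_bound:
 assumes F: "F \<in> top_dual V N" and a: "a \<in> V"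
 shows "cmod (F a) <= dual_norm V N F * N a"
\<comment> \<open>For \<open>N a = 0\<close> there is no rescaling to norm 1; the bound contained in
  \<open>top_dual\<close> gives \<open>F a = 0\<close> directly.\<close>
proof (cases "N a = 0")
 case True
 obtain C where "\<forall>a\<in>V. cmod (F a) <= C * N a" by (rule top_dual_bounded[OF F])
 then show ?thesis using a True by force
next
 case False
 then have p: "N a > 0" using norm_nonneg[OF a] by simp
 define b where "b = (%x. complex_of_real (1 / N a) * a x)"
 have b: "b \<in> V" "N b <= 1"
  unfolding b_def using scale_in[OF a, of "complex_of_real (1 / N a)"]
   norm_scale[OF a, of "complex_of_real (1 / N a)"] p by (simp_all add: norm_divide)
 have "cmod (F b) <= dual_norm V N F"
  unfolding dual_norm_def by (rule cSUP_upper[OF _ bdd_above_unit_ball[OF F]]) (simp add: b)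
 moreover have "cmod (F b) = cmod (F a) / N a"
  unfolding b_def top_dual_scale[OF F a] using p by (simp add: norm_mult norm_divide)
 ultimately show ?thesis using p by (simp add: field_simps)
qed

lemma dual_norm_le:
 assumes "0 <= C" "!!a. a \<in> V ==> cmod (F a) <= C * N a"
 shows "dual_norm V N F <= C"
 unfolding dual_norm_def
proof (rule cSUP_least)
 show "{a \<in> V. N a <= 1} \<noteq> {}" using zero_in norm_zero by force
next
 fix a assume a: "a \<in> {a \<in> V. N a <= 1}"
 have "C * N a <= C * 1" using a assms(1) by (intro mult_left_mono) auto
 then show "cmod (F a) <= C" using assms(2)[of a] a by simp
qed

lemma functional_eq_of_norm_diff:
 assumes "F \<in> top_dual V N" "a \<in> V" "b \<in> V" "N (%x. a x - b x) = 0"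
 shows "F a = F b"
 using dual_norm_bound[OF assms(1) diff_in[OF assms(2,3)]] functional_diff[OF assms(1-3)] assms(4) by simp

lemma seminormed_funs_subspace:
 assumes "W \<subseteq> V" "(%x. 0) \<in> W" "!!a b. a \<in> W ==> b \<in> W ==> (%x. a x + b x) \<in> W"
  "!!c a. a \<in> W ==> (%x. c * a x) \<in> W"
 shows "seminormed_funs W N"
 using assms norm_nonneg norm_add norm_scale by unfold_locales (auto simp: subset_iff)

lemma seminormed_funs_dual: "seminormed_funs (top_dual V N) (dual_norm V N)"
proof
 show "(%x. 0) \<in> top_dual V N" by (rule top_dualI[where C=0]) auto
next
 fix F G assume F: "F \<in> top_dual V N" and G: "G \<in> top_dual V N"
 have b: "cmod (F a + G a) <= (dual_norm V N F + dual_norm V N G) * N a" if "a \<in> V" for a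
  using norm_triangle_ineq[of "F a" "G a"] dual_norm_bound[OF F that] dual_norm_bound[OF G that]
  by (simp add: distrib_right)
 show "(%x. F x + G x) \<in> top_dual V N"
  by (rule top_dualI[OF _ _ b])
   (simp_all add: top_dual_add[OF F] top_dual_add[OF G] top_dual_scale[OF F] top_dual_scale[OF G]
    top_dual_outside[OF F] top_dual_outside[OF G] distrib_left)
 show "dual_norm V N (%x. F x + G x) <= dual_norm V N F + dual_norm V N G"
  using b dual_norm_nonneg[OF F] dual_norm_nonneg[OF G] by (intro dual_norm_le) auto
next
 fix F assume F: "F \<in> top_dual V N"
 show "0 <= dual_norm V N F" by (rule dual_norm_nonneg[OF F])
 fix c :: complex
 have b: "cmod (d * F a) <= (cmod d * dual_norm V N F) * N a" if "a \<in> V" for a d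
  using dual_norm_bound[OF F that] mult_left_mono[of _ _ "cmod d"] by (simp add: norm_mult mult.assoc)
 show s: "(%x. c * F x) \<in> top_dual V N"
  by (rule top_dualI[OF _ _ b])
   (simp_all add: top_dual_add[OF F] top_dual_scale[OF F] top_dual_outside[OF F] distrib_left)
 have le: "dual_norm V N (%x. c * F x) <= cmod c * dual_norm V N F"
  using b dual_norm_nonneg[OF F] by (intro dual_norm_le) auto
 have "cmod c * dual_norm V N F <= dual_norm V N (%x. c * F x)" if "c \<noteq> 0"
 proof -
  have "dual_norm V N F <= dual_norm V N (%x. c * F x) / cmod c"
  proof (rule dual_norm_le)
   show "0 <= dual_norm V N (%x. c * F x) / cmod c" using dual_norm_nonneg[OF s] by simp
   fix a assume "a \<in> V"
   from dual_norm_bound[OF s this] that show "cmod (F a) <= dual_norm V N (%x. c * F x) / cmod c * N a"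
    by (simp add: norm_mult field_simps)
  qed
  then show ?thesis using that by (simp add: field_simps)
 qed
 then show "dual_norm V N (%x. c * F x) = cmod c * dual_norm V N F"
  using le dual_norm_nonneg[OF s] by (cases "c = 0") auto
qed

end

text \<open>The canonical embedding into the dual of \<open>X\<close>; weak-star limits of such
  evaluations supply the functionals of the double limit argument.\<close>

definition evaluation :: "(('x => complex) => complex) set => ('x => complex) => (('x => complex) => complex) => complex"
 where "evaluation X a = (%F. if F \<in> X then F a else 0)"

text \<open>Bilinearity is stated after applying a functional: convolutions of integrable functions
  are additive only almost everywhere, which bounded functionals cannot distinguish from
  equality.\<close>

locale seminormed_algebra = seminormed_funs "carr A" "vnorm A" for A :: "'x falgebra" +
 assumes mult_in: "a \<in> carr A ==> b \<in> carr A ==> vmult A a b \<in> carr A"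
  and norm_mult_le: "a \<in> carr A ==> b \<in> carr A ==> vnorm A (vmult A a b) <= vnorm A a * vnorm A b"
  and mult_add_left: "F \<in> adual A ==> a \<in> carr A ==> a' \<in> carr A ==> b \<in> carr A ==>
   F (vmult A (%x. a x + a' x) b) = F (vmult A a b) + F (vmult A a' b)"
  and mult_add_right: "F \<in> adual A ==> a \<in> carr A ==> b \<in> carr A ==> b' \<in> carr A ==>
   F (vmult A a (%x. b x + b' x)) = F (vmult A a b) + F (vmult A a b')"
  and mult_scale_left: "F \<in> adual A ==> a \<in> carr A ==> b \<in> carr A ==>
   F (vmult A (%x. c * a x) b) = c * F (vmult A a b)"
  and mult_scale_right: "F \<in> adual A ==> a \<in> carr A ==> b \<in> carr A ==>
   F (vmult A a (%x. c * b x)) = c * F (vmult A a b)"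
begin

sublocale dual: seminormed_funs "adual A" "adual_norm A"
 unfolding adual_def adual_norm_def by (rule seminormed_funs_dual)

lemma adual_bound: "F \<in> adual A ==> a \<in> carr A ==> cmod (F a) <= adual_norm A F * vnorm A a"
 unfolding adual_def adual_norm_def by (rule dual_norm_bound)

lemma adual_norm_le:
 "0 <= C ==> (!!a. a \<in> carr A ==> cmod (F a) <= C * vnorm A a) ==> adual_norm A F <= C"
 unfolding adual_norm_def by (rule dual_norm_le)

lemma adual_product_bound:
 assumes "F \<in> adual A" "a \<in> carr A" "b \<in> carr A"
 shows "cmod (F (vmult A a b)) <= adual_norm A F * (vnorm A a * vnorm A b)"
 by (rule order_trans[OF adual_bound[OF assms(1) mult_in[OF assms(2,3)]]])
  (intro mult_left_mono norm_mult_le assms dual.norm_nonneg)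

lemma func_act_in_adual:
 assumes "F \<in> adual A" "a \<in> carr A" shows "func_act A F a \<in> adual A"
 unfolding adual_def
 by (rule top_dualI[where C="adual_norm A F * vnorm A a"])
  (use assms adual_product_bound[OF assms] in "simp_all add: func_act_def add_in scale_in mult_add_right mult_scale_right mult.assoc")

lemma func_act_norm:
 assumes "F \<in> adual A" "a \<in> carr A" shows "adual_norm A (func_act A F a) <= adual_norm A F * vnorm A a"
 by (rule adual_norm_le)
  (use assms adual_product_bound[OF assms] in "simp_all add: func_act_def mult.assoc norm_nonneg dual.norm_nonneg")

lemma func_act_apply: "b \<in> carr A ==> func_act A F a b = F (vmult A a b)"
 by (simp add: func_act_def)

lemma func_act_add_right:
 "F \<in> adual A ==> a \<in> carr A ==> a' \<in> carr A ==>
  func_act A F (%x. a x + a' x) = (%b. func_act A F a b + func_act A F a' b)"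
 by (auto simp: func_act_def mult_add_left)

lemma func_act_scale_right:
 "F \<in> adual A ==> a \<in> carr A ==> func_act A F (%x. c * a x) = (%b. c * func_act A F a b)"
 by (auto simp: func_act_def mult_scale_left)

lemma func_act_add_left: "func_act A (%b. F b + G b) a = (%b. func_act A F a b + func_act A G a b)"
 by (auto simp: func_act_def)

lemma func_act_scale_left: "func_act A (%b. c * F b) a = (%b. c * func_act A F a b)"
 by (auto simp: func_act_def)

end

locale dual_subspace = seminormed_algebra A for A :: "'x falgebra" +
 fixes X :: "(('x => complex) => complex) set"
 assumes subspace_subset: "X \<subseteq> adual A"
  and subspace_zero: "(%a. 0) \<in> X"
  and subspace_add: "F \<in> X ==> G \<in> X ==> (%a. F a + G a) \<in> X"
  and subspace_scale: "F \<in> X ==> (%a. c * F a) \<in> X"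
begin

abbreviation "X' \<equiv> top_dual X (adual_norm A)"
abbreviation "norm' \<equiv> dual_norm X (adual_norm A)"

lemma in_adual: "F \<in> X ==> F \<in> adual A"
 using subspace_subset by blast

sublocale sub: seminormed_funs X "adual_norm A"
 by (rule dual.seminormed_funs_subspace[OF subspace_subset subspace_zero subspace_add subspace_scale])

sublocale sub_dual: seminormed_funs X' norm'
 by (rule sub.seminormed_funs_dual)

text \<open>Stated before \<open>X\<close> is known to be introverted, since it is a first step
  towards introversion, both for the whole dual and for the functionals vanishing at
  infinity.\<close>

lemma bidual_act_in_adual:
 assumes P: "\<Psi> \<in> X'" and F: "F \<in> X" and act: "!!a. a \<in> carr A ==> func_act A F a \<in> X"
 shows "a \<in> carr A ==> cmod (bidual_act A \<Psi> F a) <= norm' \<Psi> * adual_norm A F * vnorm A a"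
  and "bidual_act A \<Psi> F \<in> adual A"
proof -
 show b: "cmod (bidual_act A \<Psi> F a) <= norm' \<Psi> * adual_norm A F * vnorm A a" if a: "a \<in> carr A" for a
 proof -
  have "cmod (\<Psi> (func_act A F a)) <= norm' \<Psi> * adual_norm A (func_act A F a)"
   by (rule sub.dual_norm_bound[OF P act[OF a]])
  also have "\<dots> <= norm' \<Psi> * (adual_norm A F * vnorm A a)"
   by (intro mult_left_mono func_act_norm in_adual F a sub_dual.norm_nonneg P)
  finally show ?thesis using a by (simp add: bidual_act_def mult.assoc)
 qed
 show "bidual_act A \<Psi> F \<in> adual A"
  unfolding adual_def
  by (rule top_dualI[OF _ _ b])
   (use P in_adual[OF F] act in "simp_all add: bidual_act_def add_in scale_in func_act_add_right func_act_scale_right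
     top_dual_add top_dual_scale")
qed

end

text \<open>Introverted subspaces of the dual. The whole dual is one of them, so that the results below
 apply to biduals.\<close>

locale introverted = dual_subspace A X for A :: "'x falgebra" and X +
 assumes func_act_in: "F \<in> X ==> a \<in> carr A ==> func_act A F a \<in> X"
  and bidual_act_in: "\<Psi> \<in> top_dual X (adual_norm A) ==> F \<in> X ==> bidual_act A \<Psi> F \<in> X"
begin

lemma bidual_act_bound:
 "\<Psi> \<in> X' ==> F \<in> X ==> a \<in> carr A ==>
  cmod (bidual_act A \<Psi> F a) <= norm' \<Psi> * adual_norm A F * vnorm A a"
 by (rule bidual_act_in_adual(1)[OF _ _ func_act_in])

lemma bidual_act_norm:
 assumes "\<Psi> \<in> X'" "F \<in> X"
 shows "adual_norm A (bidual_act A \<Psi> F) <= norm' \<Psi> * adual_norm A F"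
 by (rule adual_norm_le) (use assms bidual_act_bound[OF assms] sub_dual.norm_nonneg sub.norm_nonneg in auto)

lemma bidual_act_add: "\<Psi> \<in> X' ==> F \<in> X ==> G \<in> X ==>
  bidual_act A \<Psi> (%b. F b + G b) = (%a. bidual_act A \<Psi> F a + bidual_act A \<Psi> G a)"
 by (auto simp: bidual_act_def func_act_add_left top_dual_add func_act_in)

lemma bidual_act_scale: "\<Psi> \<in> X' ==> F \<in> X ==>
  bidual_act A \<Psi> (%b. c * F b) = (%a. c * bidual_act A \<Psi> F a)"
 by (auto simp: bidual_act_def func_act_scale_left top_dual_scale func_act_in)

lemma arens_mult_apply: "F \<in> X ==> arens_mult A X \<Phi> \<Psi> F = \<Phi> (bidual_act A \<Psi> F)"
 by (simp add: arens_mult_def)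

lemma arens_mult_bound:
 assumes "\<Phi> \<in> X'" "\<Psi> \<in> X'" "F \<in> X"
 shows "cmod (arens_mult A X \<Phi> \<Psi> F) <= norm' \<Phi> * norm' \<Psi> * adual_norm A F"
proof -
 have "cmod (\<Phi> (bidual_act A \<Psi> F)) <= norm' \<Phi> * adual_norm A (bidual_act A \<Psi> F)"
  by (rule sub.dual_norm_bound[OF assms(1) bidual_act_in[OF assms(2,3)]])
 also have "\<dots> <= norm' \<Phi> * (norm' \<Psi> * adual_norm A F)"
  by (intro mult_left_mono bidual_act_norm assms sub_dual.norm_nonneg)
 finally show ?thesis using assms by (simp add: arens_mult_def mult.assoc)
qed

lemma arens_mult_in: "\<Phi> \<in> X' ==> \<Psi> \<in> X' ==> arens_mult A X \<Phi> \<Psi> \<in> X'"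
 by (rule top_dualI[where C="norm' \<Phi> * norm' \<Psi>"])
  (use arens_mult_bound in "simp_all add: arens_mult_def subspace_add subspace_scale bidual_act_add
    bidual_act_scale top_dual_add top_dual_scale bidual_act_in")

lemma bidual_act_left_add:
 "bidual_act A (%F. \<Psi> F + \<Psi>' F) F = (%a. bidual_act A \<Psi> F a + bidual_act A \<Psi>' F a)"
 by (auto simp: bidual_act_def)

lemma bidual_act_left_scale: "bidual_act A (%F. c * \<Psi> F) F = (%a. c * bidual_act A \<Psi> F a)"
 by (auto simp: bidual_act_def)

lemma dual_algebra_simps [simp]:
 "carr (introverted_dual A X) = X'" "vnorm (introverted_dual A X) = norm'"
 "vmult (introverted_dual A X) = arens_mult A X"
 by (simp_all add: introverted_dual_def)

text \<open>The dual with the Arens product is again a \<open>seminormed_algebra\<close>, so results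
  about Arens regularity apply to second duals without change.\<close>

sublocale dual_algebra: seminormed_algebra "introverted_dual A X"
proof (unfold_locales, unfold dual_algebra_simps)
 fix \<Phi> \<Psi> assume p: "\<Phi> \<in> X'" "\<Psi> \<in> X'"
 show "norm' (arens_mult A X \<Phi> \<Psi>) <= norm' \<Phi> * norm' \<Psi>"
  by (rule sub.dual_norm_le) (use p arens_mult_bound sub_dual.norm_nonneg in auto)
 show "arens_mult A X \<Phi> \<Psi> \<in> X'" by (rule arens_mult_in[OF p])
next
 fix G assume "G \<in> adual (introverted_dual A X)"
 then have G: "G \<in> top_dual X' norm'" by (simp add: adual_def)
 fix \<Phi> \<Psi> assume p: "\<Phi> \<in> X'" "\<Psi> \<in> X'"
 fix c
 have "arens_mult A X (%x. c * \<Phi> x) \<Psi> = (%F. c * arens_mult A X \<Phi> \<Psi> F)" by (auto simp: arens_mult_def)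
 then show "G (arens_mult A X (%x. c * \<Phi> x) \<Psi>) = c * G (arens_mult A X \<Phi> \<Psi>)"
  using top_dual_scale[OF G arens_mult_in[OF p]] by simp
 have "arens_mult A X \<Phi> (%x. c * \<Psi> x) = (%F. c * arens_mult A X \<Phi> \<Psi> F)"
  using p by (auto simp: arens_mult_def bidual_act_left_scale top_dual_scale bidual_act_in)
 then show "G (arens_mult A X \<Phi> (%x. c * \<Psi> x)) = c * G (arens_mult A X \<Phi> \<Psi>)"
  using top_dual_scale[OF G arens_mult_in[OF p]] by simp
 fix \<Theta> assume t: "\<Theta> \<in> X'"
 have "arens_mult A X (%x. \<Phi> x + \<Theta> x) \<Psi> = (%F. arens_mult A X \<Phi> \<Psi> F + arens_mult A X \<Theta> \<Psi> F)"
  by (auto simp: arens_mult_def)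
 then show "G (arens_mult A X (%x. \<Phi> x + \<Theta> x) \<Psi>) = G (arens_mult A X \<Phi> \<Psi>) + G (arens_mult A X \<Theta> \<Psi>)"
  using top_dual_add[OF G arens_mult_in[OF p] arens_mult_in[OF t p(2)]] by simp
 have "arens_mult A X \<Phi> (%x. \<Psi> x + \<Theta> x) = (%F. arens_mult A X \<Phi> \<Psi> F + arens_mult A X \<Phi> \<Theta> F)"
  using p t by (auto simp: arens_mult_def bidual_act_left_add top_dual_add bidual_act_in)
 then show "G (arens_mult A X \<Phi> (%x. \<Psi> x + \<Theta> x)) = G (arens_mult A X \<Phi> \<Psi>) + G (arens_mult A X \<Phi> \<Theta>)"
  using top_dual_add[OF G arens_mult_in[OF p] arens_mult_in[OF p(1) t]] by simp
qed (rule sub_dual.zero_in sub_dual.add_in sub_dual.scale_in sub_dual.norm_nonneg sub_dual.norm_add sub_dual.norm_scale; assumption)+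

lemma evaluation_in:
 assumes "a \<in> carr A" shows "evaluation X a \<in> X'" "norm' (evaluation X a) <= vnorm A a"
proof -
 have b: "cmod (evaluation X a F) <= vnorm A a * adual_norm A F" if "F \<in> X" for F
  using adual_bound[OF in_adual[OF that] assms] that by (simp add: evaluation_def mult.commute)
 show "evaluation X a \<in> X'"
  by (rule top_dualI[OF _ _ b]) (auto simp: evaluation_def subspace_add subspace_scale)
 show "norm' (evaluation X a) <= vnorm A a"
  by (rule sub.dual_norm_le) (use b norm_nonneg[OF assms] in auto)
qed

lemma evaluation_apply: "F \<in> X ==> evaluation X a F = F a"
 by (simp add: evaluation_def)

lemma bidual_act_evaluation: "F \<in> X ==> b \<in> carr A ==>
  bidual_act A (evaluation X b) F = (%a. if a \<in> carr A then F (vmult A a b) else 0)"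
 by (auto simp: bidual_act_def evaluation_def func_act_in func_act_apply)

text \<open>Both Arens actions of an evaluation reduce to the product of \<open>A\<close>; this is
  what transfers double limits from \<open>A\<close> to the dual algebra.\<close>

lemma arens_mult_evaluation:
 "a \<in> carr A ==> b \<in> carr A ==> arens_mult A X (evaluation X a) (evaluation X b) = evaluation X (vmult A a b)"
proof
 fix F assume a: "a \<in> carr A" "b \<in> carr A"
 show "arens_mult A X (evaluation X a) (evaluation X b) F = evaluation X (vmult A a b) F"
 proof (cases "F \<in> X")
  case True
  then show ?thesis
   using bidual_act_in[OF evaluation_in(1)[OF a(2)] True] a
   by (simp add: arens_mult_apply evaluation_apply bidual_act_evaluation)
 qed (simp add: arens_mult_def evaluation_def)
qed

end

lemma (in seminormed_algebra) introverted_adual: "introverted A (adual A)"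
proof -
 interpret dual_subspace A "adual A"
  by unfold_locales (use dual.zero_in dual.add_in dual.scale_in in auto)
 show ?thesis
  by unfold_locales (use func_act_in_adual bidual_act_in_adual(2) in auto)
qed

section \<open>Arens regularity and iterated limits\<close>

lemma topspace_weak_star: "topspace (weak_star V N) = top_dual V N"
 by (auto simp: weak_star_def topspace_pullback_topology)

lemma continuous_map_weak_star_eval:
 assumes "a \<in> V" shows "continuous_map (weak_star V N) euclidean (%\<Psi>. \<Psi> a)"
proof -
 have "continuous_map (weak_star V N) euclidean ((%x. x a) \<circ> (%f. restrict f V))"
  unfolding weak_star_def
  by (rule continuous_map_pullback) (rule continuous_map_product_projection[OF assms])
 then show ?thesis using assms by (simp add: o_def)
qed

lemma continuous_map_into_weak_star:
 assumes "!!x. x \<in> topspace T ==> h x \<in> top_dual V N"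
  and "!!a. a \<in> V ==> continuous_map T euclidean (%x. h x a)"
 shows "continuous_map T (weak_star V N) h"
 unfolding weak_star_def
proof (rule continuous_map_pullback')
 show "continuous_map T (product_topology (%_. euclidean) V) ((%f. restrict f V) \<circ> h)"
  unfolding continuous_map_componentwise using assms(2) by (auto simp: o_def)
 show "topspace T \<subseteq> h -` top_dual V N" using assms(1) by auto
qed

lemma limitin_weak_star:
 assumes "!!m. \<Psi>s m \<in> top_dual V N" "\<Psi> \<in> top_dual V N"
  and "!!a. a \<in> V ==> ((%m. \<Psi>s m a) \<longlongrightarrow> \<Psi> a) U"
 shows "limitin (weak_star V N) \<Psi>s \<Psi> U"
proof -
 have l: "limitin (product_topology (%_. euclidean) V) (%m. restrict (\<Psi>s m) V) (restrict \<Psi> V) U"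
  unfolding limitin_componentwise using assms(3) by (auto simp: limitin_canonical_iff)
 show ?thesis
  unfolding limitin_def topspace_weak_star
 proof (intro conjI allI impI assms(2))
  fix S assume "openin (weak_star V N) S & \<Psi> \<in> S"
  then obtain W where W: "openin (product_topology (%_. euclidean) V) W"
   "S = (%f. restrict f V) -` W \<inter> top_dual V N" "\<Psi> \<in> S"
   by (auto simp: weak_star_def openin_pullback_topology)
  have "eventually (%m. restrict (\<Psi>s m) V \<in> W) U"
   using l W unfolding limitin_def by auto
  then show "\<forall>\<^sub>F m in U. \<Psi>s m \<in> S" by eventually_elim (use W assms(1) in auto)
 qed
qed

text \<open>Zorn's lemma for the reversed order: smaller filters are finer, and a minimal proper
  filter below \<open>sequentially\<close> is a free ultrafilter.\<close>

lemma ex_free_ultrafilter: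
 obtains U :: "nat filter" where "U \<noteq> bot" "U <= sequentially"
  "\<forall>P. eventually P U \<or> eventually (%n. \<not> P n) U"
proof -
 define A where "A = {F :: nat filter. F \<noteq> bot & F <= sequentially}"
 have "\<exists>m\<in>A. \<forall>a\<in>A. a <= m --> a = m"
 proof (rule predicate_Zorn[of A "%x y. y <= x"])
  show "partial_order_on A (relation_of (%x y. y <= x) A)"
   by (rule partial_order_on_relation_ofI) auto
 next
  fix C assume C: "C \<in> Chains (relation_of (%x y. y <= x) A)"
  have CA: "C \<subseteq> A" using C by (rule Chains_relation_of)
  have ch: "x <= y \<or> y <= x" if "x \<in> C" "y \<in> C" for x y
   using C that unfolding Chains_def relation_of_def by auto
  show "\<exists>u\<in>A. \<forall>a\<in>C. u <= a"
  proof (cases "C = {}")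
   case True
   have "sequentially \<in> A" by (simp add: A_def)
   then show ?thesis using True by blast
  next
   case False
   \<comment> \<open>In a chain the infimum of a finite nonempty subset is one of its members, hence
     proper; \<open>Inf_filter_not_bot\<close> extends properness to the whole chain.\<close>
   have fin: "X \<subseteq> C ==> X \<noteq> {} ==> Inf X \<in> X" if "finite X" for X
    using that
   proof (induction X rule: finite_induct)
    case (insert x X)
    show ?case
    proof (cases "X = {}")
     case f: False
     then have "Inf X \<in> X" using insert by auto
     then have "x <= Inf X \<or> Inf X <= x" using ch insert.prems(1) by blast
     then show ?thesis using \<open>Inf X \<in> X\<close> by (auto simp: inf.absorb1 inf.absorb2)
    qed auto
   qed auto
   have "Inf C \<noteq> bot"
   proof (rule Inf_filter_not_bot)
    fix X assume X: "X \<subseteq> C" "finite X"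
    show "Inf X \<noteq> bot"
    proof (cases "X = {}")
     case False
     then have "Inf X \<in> A" using fin[OF X(2,1)] X CA by blast
     then show ?thesis by (simp add: A_def)
    qed (auto simp: trivial_limit_def)
   qed
   moreover obtain c where "c \<in> C" using False by blast
   then have "Inf C <= sequentially" using CA Inf_lower[of c C] by (auto simp: A_def intro: order_trans)
   ultimately have "Inf C \<in> A" by (simp add: A_def)
   then show ?thesis by (auto intro: Inf_lower)
  qed
 qed
 then obtain U where U: "U \<in> A" "!!F. F \<in> A ==> F <= U ==> F = U" by blast
 show ?thesis
 proof (rule that[of U])
  show "U \<noteq> bot" "U <= sequentially" using U(1) by (auto simp: A_def)
  have "eventually P U \<or> eventually (%n. \<not> P n) U" for P
  proof (cases "eventually (%n. \<not> P n) U")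
   case False
   \<comment> \<open>If the complement of \<open>P\<close> is not in \<open>U\<close>, adding
     \<open>P\<close> to \<open>U\<close> keeps it proper, and minimality forces \<open>P\<close> to
     be in \<open>U\<close> already.\<close>
   define F where "F = inf U (principal {n. P n})"
   have "F \<noteq> bot" using False unfolding F_def trivial_limit_def eventually_inf_principal by simp
   moreover have "F <= sequentially" using U(1) by (auto simp: A_def F_def intro: le_infI1)
   ultimately have "F = U" by (intro U(2)) (auto simp: A_def F_def)
   moreover have "eventually P F" unfolding F_def eventually_inf_principal by simp
   ultimately show ?thesis by simp
  qed simp
  then show "\<forall>P. eventually P U \<or> eventually (%n. \<not> P n) U" by blast
 qed
qed

lemma ultrafilter_tendsto:
 fixes f :: "nat => complex"
 assumes U: "U \<noteq> bot" "!!P. eventually P U \<or> eventually (%n. \<not> P n) U"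
  and b: "!!n. cmod (f n) <= C"
 shows "(f \<longlongrightarrow> Lim U f) U"
proof -
 have "compact (cball (0::complex) C)" by simp
 then obtain l where l: "inf (nhds l) (filtermap f U) \<noteq> bot"
  unfolding compact_filter using b U(1)
  by (elim allE[of _ "filtermap f U"]) (auto simp: eventually_filtermap filtermap_bot_iff)
 have "(f \<longlongrightarrow> l) U"
 proof (rule topological_tendstoI)
  fix S assume S: "open S" "l \<in> S"
  show "eventually (%n. f n \<in> S) U"
  proof (rule ccontr)
   assume "\<not> ?thesis"
   then have "eventually (%n. f n \<notin> S) U" using U(2) by blast
   then have "eventually (%z. z \<notin> S) (filtermap f U)" by (simp add: eventually_filtermap)
   moreover have "eventually (%z. z \<in> S) (nhds l)" using S by (rule eventually_nhds_in_open)
   ultimately have "eventually (%z. False) (inf (nhds l) (filtermap f U))"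
    unfolding eventually_inf by blast
   then show False using l by (simp add: trivial_limit_def)
  qed
 qed
 then show ?thesis using tendsto_Lim[OF U(1)] by metis
qed

context introverted
begin

text \<open>The weak-star limit of the evaluations at a bounded sequence along an ultrafilter. All
  the limits exist by compactness, so linearity and the bound carry over.\<close>

lemma ultrafilter_functional:
 assumes U: "U \<noteq> bot" "!!P. eventually P U \<or> eventually (%n. \<not> P n) U"
  and a: "!!n::nat. a n \<in> carr A" "!!n. vnorm A (a n) <= C"
 shows "(%F. if F \<in> X then Lim U (%n. F (a n)) else 0) \<in> X'"
  and "F \<in> X ==> ((%n. F (a n)) \<longlongrightarrow> Lim U (%n. F (a n))) U"
proof -
 have b: "cmod (F (a n)) <= C * adual_norm A F" if "F \<in> X" for F n
 proof -
  have "cmod (F (a n)) <= adual_norm A F * vnorm A (a n)" by (rule adual_bound[OF in_adual[OF that] a(1)])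
  also have "\<dots> <= adual_norm A F * C" by (intro mult_left_mono a sub.norm_nonneg that)
  finally show ?thesis by (simp add: mult.commute)
 qed
 have t: "((%n. F (a n)) \<longlongrightarrow> Lim U (%n. F (a n))) U" if "F \<in> X" for F
  by (rule ultrafilter_tendsto[OF U b[OF that]])
 show "F \<in> X ==> ((%n. F (a n)) \<longlongrightarrow> Lim U (%n. F (a n))) U" by (rule t)
 show "(%F. if F \<in> X then Lim U (%n. F (a n)) else 0) \<in> X'"
 proof (rule top_dualI[where C=C])
  fix F G assume F: "F \<in> X" and G: "G \<in> X"
  have "Lim U (%n. F (a n) + G (a n)) = Lim U (%n. F (a n)) + Lim U (%n. G (a n))"
   by (rule tendsto_Lim[OF U(1) tendsto_add[OF t[OF F] t[OF G]]])
  then show "(if (%x. F x + G x) \<in> X then Lim U (%n. F (a n) + G (a n)) else 0) =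
   (if F \<in> X then Lim U (%n. F (a n)) else 0) + (if G \<in> X then Lim U (%n. G (a n)) else 0)"
   using F G subspace_add[OF F G] by simp
 next
  fix F c assume F: "F \<in> X"
  have "Lim U (%n. c * F (a n)) = c * Lim U (%n. F (a n))"
   by (rule tendsto_Lim[OF U(1) tendsto_mult_left[OF t[OF F]]])
  then show "(if (%x. c * F x) \<in> X then Lim U (%n. c * F (a n)) else 0) = c * (if F \<in> X then Lim U (%n. F (a n)) else 0)"
   using F subspace_scale[OF F] by simp
 next
  fix F assume F: "F \<in> X"
  have "cmod (Lim U (%n. F (a n))) <= C * adual_norm A F"
   by (rule tendsto_upperbound[OF tendsto_norm[OF t[OF F]] _ U(1)]) (simp add: b[OF F])
  then show "cmod (if F \<in> X then Lim U (%n. F (a n)) else 0) <= C * adual_norm A F" using F by simp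
 qed simp
qed

end

context seminormed_algebra
begin

interpretation whole: introverted A "adual A"
 by (rule introverted_adual)

text \<open>Evaluation at a fixed \<open>G\<close> is weak-star continuous by definition, so
  regularity follows once \<open>\<Phi> (bidual_act A \<Psi> F)\<close>, as a function of
  \<open>\<Psi>\<close>, is represented by some \<open>G\<close>.\<close>

lemma arens_regularI:
 assumes "!!\<Phi> F. \<Phi> \<in> whole.X' ==> F \<in> adual A ==>
  \<exists>G\<in>adual A. \<forall>\<Psi>\<in>whole.X'. \<Phi> (bidual_act A \<Psi> F) = \<Psi> G"
 shows "arens_regular A"
 unfolding arens_regular_def bidual_def whole.dual_algebra_simps
proof (intro ballI continuous_map_into_weak_star)
 fix \<Phi> \<Psi> assume "\<Phi> \<in> whole.X'" "\<Psi> \<in> topspace (weak_star (adual A) (adual_norm A))"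
 then show "arens_mult A (adual A) \<Phi> \<Psi> \<in> whole.X'"
  unfolding topspace_weak_star by (rule whole.arens_mult_in)
next
 fix \<Phi> F assume P: "\<Phi> \<in> whole.X'" and F: "F \<in> adual A"
 obtain G where G: "G \<in> adual A" "\<forall>\<Psi>\<in>whole.X'. \<Phi> (bidual_act A \<Psi> F) = \<Psi> G" using assms[OF P F] by blast
 show "continuous_map (weak_star (adual A) (adual_norm A)) euclidean (%\<Psi>. arens_mult A (adual A) \<Phi> \<Psi> F)"
  by (rule continuous_map_eq[OF continuous_map_weak_star_eval[OF G(1)]])
   (use G(2) in "simp add: topspace_weak_star whole.arens_mult_apply[OF F]")
qed

text \<open>The easy half of Grothendieck's double limit criterion: cluster points of the two sequences in
 the second dual can be multiplied in either order.\<close>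

lemma arens_regular_iterated_limits:
 assumes reg: "arens_regular A" and F: "F \<in> adual A"
  and a: "!!n::nat. a n \<in> carr A" "!!n. vnorm A (a n) <= C"
  and b: "!!n::nat. b n \<in> carr A" "!!n. vnorm A (b n) <= C"
  and \<alpha>: "!!n. (%m. F (vmult A (a n) (b m))) \<longlonglongrightarrow> \<alpha> n" "\<alpha> \<longlonglongrightarrow> l"
  and \<beta>: "!!m. (%n. F (vmult A (a n) (b m))) \<longlonglongrightarrow> \<beta> m" "\<beta> \<longlonglongrightarrow> l'"
 shows "l = l'"
proof -
 obtain U :: "nat filter" where U: "U \<noteq> bot" "U <= sequentially"
  and ultra: "\<forall>P. eventually P U \<or> eventually (%n. \<not> P n) U" by (rule ex_free_ultrafilter)
 have U3: "eventually P U \<or> eventually (%n. \<not> P n) U" for P using ultra by blast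
 have seqU: "(f \<longlongrightarrow> z) U" if "f \<longlonglongrightarrow> z" for f :: "nat => complex" and z
  using that U(2) by (rule tendsto_mono[rotated])
 define \<Phi> where "\<Phi> = (%F. if F \<in> adual A then Lim U (%n. F (a n)) else 0)"
 define \<Psi> where "\<Psi> = (%F. if F \<in> adual A then Lim U (%n. F (b n)) else 0)"
 have P: "\<Phi> \<in> whole.X'" unfolding \<Phi>_def by (rule whole.ultrafilter_functional[OF U(1) U3 a])
 have Q: "\<Psi> \<in> whole.X'" unfolding \<Psi>_def by (rule whole.ultrafilter_functional[OF U(1) U3 b])
 let ?e = "%m. evaluation (adual A) (b m)"
 have e: "?e m \<in> whole.X'" for m by (rule whole.evaluation_in[OF b(1)])
 have "limitin (weak_star (adual A) (adual_norm A)) ?e \<Psi> U"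
 proof (rule limitin_weak_star[OF e Q])
  fix G assume "G \<in> adual A"
  then show "((%m. ?e m G) \<longlongrightarrow> \<Psi> G) U"
   using whole.ultrafilter_functional(2)[OF U(1) U3 b] by (simp add: \<Psi>_def evaluation_def)
 qed
 \<comment> \<open>The single use of regularity: multiplication by \<open>\<Phi>\<close> on the left
   may be passed to the limit in its second factor.\<close>
 moreover have "continuous_map (weak_star (adual A) (adual_norm A)) euclidean (%\<Psi>. arens_mult A (adual A) \<Phi> \<Psi> F)"
 proof -
  have "continuous_map (weak_star (adual A) (adual_norm A)) (weak_star (adual A) (adual_norm A)) (arens_mult A (adual A) \<Phi>)"
   using reg P unfolding arens_regular_def bidual_def whole.dual_algebra_simps by blast
  from continuous_map_compose[OF this continuous_map_weak_star_eval[OF F]]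
  show ?thesis by (simp add: o_def)
 qed
 ultimately have lim: "((%m. arens_mult A (adual A) \<Phi> (?e m) F) \<longlongrightarrow> arens_mult A (adual A) \<Phi> \<Psi> F) U"
  by (auto simp: o_def dest: continuous_map_limit)
 have "arens_mult A (adual A) \<Phi> (?e m) F = \<beta> m" for m
 proof -
  have "arens_mult A (adual A) \<Phi> (?e m) F = Lim U (%n. F (vmult A (a n) (b m)))"
   using whole.bidual_act_in[OF e[of m] F] a(1)
   by (simp add: whole.arens_mult_apply[OF F] \<Phi>_def whole.bidual_act_evaluation[OF F b(1)])
  then show ?thesis using tendsto_Lim[OF U(1) seqU[OF \<beta>(1)]] by simp
 qed
 then have 1: "arens_mult A (adual A) \<Phi> \<Psi> F = l'"
  using lim tendsto_unique[OF U(1) _ seqU[OF \<beta>(2)]] by simp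
 \<comment> \<open>In the opposite order the iterated limit is the definition of the first Arens
   product: \<open>\<Psi>\<close> acts before \<open>\<Phi>\<close>.\<close>
 have "bidual_act A \<Psi> F (a n) = \<alpha> n" for n
 proof -
  have "bidual_act A \<Psi> F (a n) = Lim U (%m. F (vmult A (a n) (b m)))"
   using func_act_in_adual[OF F a(1)] a(1) b(1) by (simp add: bidual_act_def \<Psi>_def func_act_apply)
  then show ?thesis using tendsto_Lim[OF U(1) seqU[OF \<alpha>(1)]] by simp
 qed
 then have "arens_mult A (adual A) \<Phi> \<Psi> F = Lim U \<alpha>"
  using whole.bidual_act_in[OF Q F] by (simp add: whole.arens_mult_apply[OF F] \<Phi>_def)
 then have "arens_mult A (adual A) \<Phi> \<Psi> F = l" using tendsto_Lim[OF U(1) seqU[OF \<alpha>(2)]] by simp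
 with 1 show ?thesis by simp
qed

end

lemma (in introverted) evaluation_dual_in:
 assumes F: "F \<in> X" shows "evaluation X' F \<in> adual (introverted_dual A X)"
 unfolding adual_def dual_algebra_simps
proof (rule top_dualI[where C="adual_norm A F"])
 fix \<Phi> assume "\<Phi> \<in> X'"
 then show "cmod (evaluation X' F \<Phi>) <= adual_norm A F * norm' \<Phi>"
  using sub.dual_norm_bound[OF _ F] by (simp add: evaluation_def mult.commute)
qed (auto simp: evaluation_def sub_dual.add_in sub_dual.scale_in)

text \<open>Evaluation at \<open>F\<close> is a functional on the dual algebra and the embedding of
  \<open>A\<close> is multiplicative, so the double limit test there reads off values of
  \<open>F\<close> on products in \<open>A\<close>. \<open>F\<close> must lie in \<open>X\<close>,
  which is why test functionals vanishing at infinity are constructed later.\<close>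

lemma (in introverted) regular_dual_iterated_limits:
 assumes reg: "arens_regular (introverted_dual A X)" and F: "F \<in> X"
  and a: "!!n::nat. a n \<in> carr A" "!!n. vnorm A (a n) <= C"
  and b: "!!n::nat. b n \<in> carr A" "!!n. vnorm A (b n) <= C"
  and \<alpha>: "!!n. (%m. F (vmult A (a n) (b m))) \<longlonglongrightarrow> \<alpha> n" "\<alpha> \<longlonglongrightarrow> l"
  and \<beta>: "!!m. (%n. F (vmult A (a n) (b m))) \<longlonglongrightarrow> \<beta> m" "\<beta> \<longlonglongrightarrow> l'"
 shows "l = l'"
proof -
 define G where "G = evaluation X' F"
 have G: "G \<in> adual (introverted_dual A X)"
  unfolding G_def by (rule evaluation_dual_in[OF F])
 have v: "G (vmult (introverted_dual A X) (evaluation X (a n)) (evaluation X (b m))) = F (vmult A (a n) (b m))" for n m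
  unfolding dual_algebra_simps arens_mult_evaluation[OF a(1) b(1)] G_def
  using evaluation_in(1)[OF mult_in[OF a(1) b(1)]] F by (simp add: evaluation_apply evaluation_def[of X'])
 show ?thesis
  by (rule dual_algebra.arens_regular_iterated_limits[OF reg G, of "%n. evaluation X (a n)" C
     "%n. evaluation X (b n)", unfolded v, OF _ _ _ _ \<alpha> \<beta>])
   (use evaluation_in a b order_trans in "auto intro: order_trans[OF evaluation_in(2)]")
qed

section \<open>Zero cluster functions\<close>

text \<open>Greedy choice: the finitely many earlier indices exclude only finitely many candidates,
  so an admissible larger index always remains.\<close>

lemma strict_mono_choice:
 assumes "!!S::nat set. finite S ==> finite {k. \<not> Q S k}"
 shows "\<exists>r::nat => nat. strict_mono r & (\<forall>n. Q (r ` {..<n}) (r n))"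
proof -
 define nxt where "nxt S = (SOME k. (\<forall>i\<in>S. i < k) & Q S k)" for S
 have nxt: "(\<forall>i\<in>S. i < nxt S) & Q S (nxt S)" if "finite S" for S
 proof -
  have "finite ({k. \<not> Q S k} \<union> (\<Union>i\<in>S. {..i}))" using assms[OF that] that by simp
  then obtain k where "k \<notin> {k. \<not> Q S k} \<union> (\<Union>i\<in>S. {..i})"
   using infinite_UNIV_nat ex_new_if_finite by blast
  then have "(\<forall>i\<in>S. i < k) & Q S k" by (auto simp: not_le)
  then show ?thesis unfolding nxt_def by (rule someI)
 qed
 define st where "st = rec_nat {} (%_ S. insert (nxt S) S)"
 define r where "r n = nxt (st n)" for n
 have st0: "st 0 = {}" and stS: "st (Suc n) = insert (r n) (st n)" for n by (simp_all add: st_def r_def)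
 have st: "st n = r ` {..<n}" for n by (induction n) (auto simp: st0 stS lessThan_Suc)
 have f: "finite (r ` {..<n})" for n by simp
 have "r n < r (Suc n)" for n
  using nxt[OF f[of "Suc n"]] unfolding r_def[of "Suc n"] st by auto
 then have "strict_mono r" by (simp add: strict_mono_Suc_iff)
 moreover have "Q (r ` {..<n}) (r n)" for n using nxt[OF f[of n]] by (simp add: r_def[of n] st)
 ultimately show ?thesis by blast
qed

text \<open>Distinct sums allow a functional to be prescribed independently on the pairs
  \<open>(n, m)\<close>. Indices are chosen one after another so that a new term of either sequence
  creates no coincidence with earlier ones; by cancellation this excludes only finitely many
  indices.\<close>

lemma subsequences_with_injective_sums:
 fixes x y :: "nat => 'a::group_add"
 assumes x: "inj x" and y: "inj y"
 obtains p q :: "nat => nat" where "strict_mono p" "strict_mono q" "inj (%(n, m). x (p n) + y (q m))"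
proof -
 define Q where "Q S k \<longleftrightarrow> (\<forall>i\<in>S. \<forall>j\<in>S. \<forall>m\<in>S. x k + y m \<noteq> x i + y j & x m + y k \<noteq> x i + y j)" for S k
 have "finite {k. \<not> Q S k}" if S: "finite S" for S
 proof -
  have "finite (\<Union>i\<in>S. \<Union>j\<in>S. \<Union>m\<in>S. x -` {x i + y j - y m} \<union> y -` {- x m + (x i + y j)})"
   using S by (intro finite_UN_I finite_UnI finite_vimageI x y) auto
  moreover have "{k. \<not> Q S k} \<subseteq> (\<Union>i\<in>S. \<Union>j\<in>S. \<Union>m\<in>S. x -` {x i + y j - y m} \<union> y -` {- x m + (x i + y j)})"
  proof -
   have "a + b = c \<longleftrightarrow> a = c - b" "a + b = c \<longleftrightarrow> b = - a + c" for a b c :: 'a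
    by (simp add: eq_diff_eq) (metis add_minus_cancel minus_add_cancel)
   then have "x k = x i + y j - y m \<or> y k = - x m + (x i + y j)"
    if "x k + y m = x i + y j \<or> x m + y k = x i + y j" for k i j m using that by blast
   then show ?thesis unfolding Q_def by (simp only: subset_iff UN_iff Un_iff vimage_eq singleton_iff mem_Collect_eq) blast
  qed
  ultimately show ?thesis by (rule finite_subset[rotated])
 qed
 from strict_mono_choice[of Q, OF this] obtain r :: "nat => nat"
  where r: "strict_mono r" "\<forall>n. Q (r ` {..<n}) (r n)" by auto
 have less: "r i < r j \<longleftrightarrow> i < j" for i j using r(1) by (simp add: strict_mono_less)
 have Q1: "x (r k) + y (r m) \<noteq> x (r i) + y (r j)" "x (r m) + y (r k) \<noteq> x (r i) + y (r j)"
  if "i < k" "j < k" "m < k" for i j k m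
  using r(2)[rule_format, of k] that unfolding Q_def by auto
 \<comment> \<open>Both subsequences come from one sequence \<open>r\<close>: even positions serve
   \<open>x\<close>, odd positions serve \<open>y\<close>, so the two never use the same
   index.\<close>
 let ?p = "%n::nat. r (2 * n)" and ?q = "%n::nat. r (2 * n + 1)"
 show ?thesis
 proof (rule that[of ?p ?q])
  show "strict_mono ?p" "strict_mono ?q" using less by (auto simp: strict_mono_def)
  show "inj (%(n, m). x (?p n) + y (?q m))"
  proof (rule injI, clarify)
   fix n m i j assume eq: "x (?p n) + y (?q m) = x (?p i) + y (?q j)"
   have inj: "r k = r l \<longleftrightarrow> k = l" for k l using strict_mono_eq[OF r(1)] by blast
   have "n = i \<or> m = j"
   proof (rule ccontr)
    assume "\<not> ?thesis"
    then have ne: "n \<noteq> i" "m \<noteq> j" by auto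
    \<comment> \<open>If both indices differ, the largest of the four positions occurs just once,
      and its choice excluded this equation. Otherwise one summand can be cancelled.\<close>
    let ?M = "Max {2*n, 2*m+1, 2*i, 2*j+1}"
    have M: "2*n <= ?M" "2*m+1 <= ?M" "2*i <= ?M" "2*j+1 <= ?M" by auto
    have "?M \<in> {2*n, 2*m+1, 2*i, 2*j+1}" by (rule Max_in) auto
    then consider "?M = 2*n" | "?M = 2*m+1" | "?M = 2*i" | "?M = 2*j+1" by auto
    then show False
    proof cases
     case 1 with M ne have "2*m+1 < 2*n" "2*i < 2*n" "2*j+1 < 2*n" by presburger+
     then show False using Q1(1)[of "2*i" "2*n" "2*j+1" "2*m+1"] eq by simp
    next
     case 2 with M ne have "2*n < 2*m+1" "2*i < 2*m+1" "2*j+1 < 2*m+1" by presburger+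
     then show False using Q1(2)[of "2*i" "2*m+1" "2*j+1" "2*n"] eq by simp
    next
     case 3 with M ne have "2*n < 2*i" "2*m+1 < 2*i" "2*j+1 < 2*i" by presburger+
     then show False using Q1(1)[of "2*n" "2*i" "2*m+1" "2*j+1"] eq by simp
    next
     case 4 with M ne have "2*n < 2*j+1" "2*m+1 < 2*j+1" "2*i < 2*j+1" by presburger+
     then show False using Q1(2)[of "2*n" "2*j+1" "2*m+1" "2*i"] eq by simp
    qed
   qed
   then show "n = i & m = j"
    using eq injD[OF x] injD[OF y] inj by (auto, metis Suc_eq_plus1 inj mult_left_cancel nat.inject zero_neq_numeral, metis inj mult_left_cancel zero_neq_numeral)
  qed
 qed
qed

section \<open>Subsequences along which both iterated limits exist\<close>

lemma bounded_convergent_subsequence: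
 fixes f :: "nat => complex"
 assumes "!!n. cmod (f n) <= C"
 obtains r :: "nat => nat" and l where "strict_mono r" "(f \<circ> r) \<longlonglongrightarrow> l"
proof -
 have "seq_compact (cball (0::complex) C)" by (intro compact_imp_seq_compact) simp
 then show ?thesis by (rule seq_compactE[of _ f]) (use assms that in auto)
qed

lemma diagonal_convergent_subsequence:
 fixes f :: "nat => nat => complex"
 assumes "!!n m. cmod (f n m) <= C"
 obtains s :: "nat => nat" where "strict_mono s" "\<forall>n. convergent (%m. f n (s m))"
proof -
 interpret subseqs "%n s. convergent (%m. f n (s m))"
 proof
  fix n and s :: "nat => nat"
  obtain r l where "strict_mono r" "((%m. f n (s m)) \<circ> r) \<longlonglongrightarrow> l"
   using bounded_convergent_subsequence[of "%m. f n (s m)" C] assms by blast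
  then show "\<exists>r'. strict_mono r' & convergent (%m. f n ((s \<circ> r') m))"
   by (auto simp: o_def convergent_def)
 qed
 have "convergent (%m. f n (diagseq m))" for n
 proof -
  have "convergent (%m. f n ((diagseq \<circ> ((+) (Suc n))) m))"
  proof (rule diagseq_holds)
   fix r s :: "nat => nat" and n
   assume "strict_mono r" "convergent (%m. f n (s m))"
   then show "convergent (%m. f n ((s \<circ> r) m))"
    using LIMSEQ_subseq_LIMSEQ[of "%m. f n (s m)"] by (auto simp: o_def convergent_def)
  qed
  then show ?thesis
   using convergent_ignore_initial_segment[of "%m. f n (diagseq m)" "Suc n"] by (simp add: o_def add.commute)
 qed
 then show ?thesis using that subseq_diagseq by blast
qed

text \<open>First all limits over \<open>m\<close> are secured, then, along a subsequence of
  \<open>n\<close>, all limits over \<open>n\<close>; later thinning preserves both and makes the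
  two sequences of inner limits converge.\<close>

lemma iterated_limits_subsequences:
 fixes f :: "nat => nat => complex"
 assumes b: "!!n m. cmod (f n m) <= C"
 obtains r s :: "nat => nat" and \<alpha> \<beta> l l' where "strict_mono r" "strict_mono s"
  "\<forall>n. (%m. f (r n) (s m)) \<longlonglongrightarrow> \<alpha> n" "\<alpha> \<longlonglongrightarrow> l"
  "\<forall>m. (%n. f (r n) (s m)) \<longlonglongrightarrow> \<beta> m" "\<beta> \<longlonglongrightarrow> l'"
proof -
 obtain s1 where s1: "strict_mono s1" "\<forall>n. convergent (%m. f n (s1 m))"
  using diagonal_convergent_subsequence[of f C] b by blast
 obtain r1 where r1: "strict_mono r1" "\<forall>m. convergent (%n. f (r1 n) (s1 m))"
  using diagonal_convergent_subsequence[of "%m n. f n (s1 m)" C] b by blast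
 define \<alpha> where "\<alpha> n = lim (%m. f (r1 n) (s1 m))" for n
 have \<alpha>: "(%m. f (r1 n) (s1 m)) \<longlonglongrightarrow> \<alpha> n" for n
  using s1(2) unfolding \<alpha>_def convergent_LIMSEQ_iff by blast
 define \<beta> where "\<beta> m = lim (%n. f (r1 n) (s1 m))" for m
 have \<beta>: "(%n. f (r1 n) (s1 m)) \<longlonglongrightarrow> \<beta> m" for m
  using r1(2) unfolding \<beta>_def convergent_LIMSEQ_iff by blast
 have "cmod (\<alpha> n) <= C" for n
  by (rule Lim_norm_ubound[OF _ \<alpha>]) (auto simp: b)
 then obtain r2 l where r2: "strict_mono r2" "(\<alpha> \<circ> r2) \<longlonglongrightarrow> l"
  using bounded_convergent_subsequence[of \<alpha> C] by blast
 have "cmod (\<beta> n) <= C" for n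
  by (rule Lim_norm_ubound[OF _ \<beta>]) (auto simp: b)
 then obtain s2 l' where s2: "strict_mono s2" "(\<beta> \<circ> s2) \<longlonglongrightarrow> l'"
  using bounded_convergent_subsequence[of \<beta> C] by blast
 show ?thesis
 proof (rule that[of "r1 \<circ> r2" "s1 \<circ> s2" "\<alpha> \<circ> r2" l "\<beta> \<circ> s2" l'])
  show "\<forall>n. (%m. f ((r1 \<circ> r2) n) ((s1 \<circ> s2) m)) \<longlonglongrightarrow> (\<alpha> \<circ> r2) n"
   using LIMSEQ_subseq_LIMSEQ[OF \<alpha> s2(1)] by (simp add: o_def)
  show "\<forall>m. (%n. f ((r1 \<circ> r2) n) ((s1 \<circ> s2) m)) \<longlonglongrightarrow> (\<beta> \<circ> s2) m"
   using LIMSEQ_subseq_LIMSEQ[OF \<beta> r2(1)] by (simp add: o_def)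
 qed (use strict_mono_o r1 r2 s1 s2 in auto)
qed

section \<open>Weights and consequences of the zero cluster property\<close>

lemma weight_ge_1: "weight \<omega> ==> 1 <= \<omega> x" and weight_mult: "weight \<omega> ==> \<omega> (x + y) <= \<omega> x * \<omega> y"
 and weight_continuous: "weight \<omega> ==> continuous_on UNIV \<omega>"
 by (auto simp: weight_def)

lemma weight_pos: "weight \<omega> ==> 0 < \<omega> x" "weight \<omega> ==> 0 <= \<omega> x"
 using weight_ge_1[of \<omega> x] by simp_all

lemma weight_Omega_range:
 assumes "weight \<omega>" shows "0 <= weight_Omega \<omega> p" "weight_Omega \<omega> p <= 1"
 using weight_pos[OF assms] weight_mult[OF assms]
 by (auto simp: weight_Omega_def divide_simps split: prod.split)

text \<open>On a half graph where \<open>\<Omega>\<close> is at least \<open>\<delta>\<close>, one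
  of the two inner limits eventually stays in the graph, so its iterated limit is at least
  \<open>\<delta>\<close>.\<close>

lemma zero_cluster_no_half_graph:
 assumes w: "weight \<omega>" and z: "zero_cluster (%p. complex_of_real (weight_Omega \<omega> p))"
  and x: "inj x" and y: "inj (y :: nat => _)" and d: "\<delta> > 0"
  and h: "(\<forall>i j. i <= j --> \<delta> <= weight_Omega \<omega> (x i, y j)) \<or> (\<forall>i j. j <= i --> \<delta> <= weight_Omega \<omega> (x i, y j))"
 shows False
proof -
 define f where "f n m = complex_of_real (weight_Omega \<omega> (x n, y m))" for n m
 have fb: "cmod (f n m) <= 1" for n m using weight_Omega_range[OF w] by (simp add: f_def)
 obtain r s \<alpha> \<beta> l l' where rs: "strict_mono r" "strict_mono s"
  and \<alpha>: "\<forall>n. (%m. f (r n) (s m)) \<longlonglongrightarrow> \<alpha> n" "\<alpha> \<longlonglongrightarrow> l"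
  and \<beta>: "\<forall>m. (%n. f (r n) (s m)) \<longlonglongrightarrow> \<beta> m" "\<beta> \<longlonglongrightarrow> l'"
  by (rule iterated_limits_subsequences[of f, OF fb])
 have "inj (x \<circ> r) & inj (y \<circ> s)" using rs x y by (auto intro: inj_compose simp: strict_mono_imp_inj_on)
 then have ll: "l = 0 & l' = 0"
  using z[unfolded zero_cluster_def, rule_format, of "x \<circ> r" "y \<circ> s" \<alpha> l \<beta> l'] \<alpha> \<beta> by (simp add: f_def)
 \<comment> \<open>A subsequence index is at least its position, so \<open>r n <= s m\<close> holds
   for all \<open>m\<close> from \<open>r n\<close> on.\<close>
 have sub: "n <= r n" "n <= s n" for n using rs by (auto intro: seq_suble)
 have low: "\<delta> <= cmod z" if "g \<longlonglongrightarrow> z" "eventually (%n. \<delta> <= cmod (g n)) sequentially" for g z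
  by (rule tendsto_lowerbound[OF tendsto_norm[OF that(1)] that(2)]) simp
 from h show False
 proof
  assume h: "\<forall>i j. i <= j --> \<delta> <= weight_Omega \<omega> (x i, y j)"
  have "eventually (%m. \<delta> <= cmod (f (r n) (s m))) sequentially" for n
   using eventually_ge_at_top[of "r n"]
  proof eventually_elim
   case (elim m)
   then have "r n <= s m" using sub(2)[of m] by linarith
   then show ?case using h weight_Omega_range(1)[OF w] by (simp add: f_def)
  qed
  then have "\<delta> <= cmod (\<alpha> n)" for n using low \<alpha>(1) by blast
  then have "\<delta> <= cmod l" by (intro low[OF \<alpha>(2)]) simp
  then show False using ll d by simp
 next
  assume h: "\<forall>i j. j <= i --> \<delta> <= weight_Omega \<omega> (x i, y j)"
  have "eventually (%n. \<delta> <= cmod (f (r n) (s m))) sequentially" for m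
   using eventually_ge_at_top[of "s m"]
  proof eventually_elim
   case (elim n)
   then have "s m <= r n" using sub(1)[of n] by linarith
   then show ?case using h weight_Omega_range(1)[OF w] by (simp add: f_def)
  qed
  then have "\<delta> <= cmod (\<beta> n)" for n using low \<beta>(1) by blast
  then have "\<delta> <= cmod l'" by (intro low[OF \<beta>(2)]) simp
  then show False using ll d by simp
 qed
qed

text \<open>Since \<open>\<omega>\<close> is at least 1, a bound \<open>C\<close> on both weights
  gives \<open>\<Omega>\<close> at least \<open>1 / (C * C)\<close>; one injective sequence used
  twice is then a half graph.\<close>

lemma zero_cluster_finite_level_set:
 assumes w: "weight \<omega>" and z: "zero_cluster (%p. complex_of_real (weight_Omega \<omega> p))"
  and b: "!!x. x \<in> S ==> \<omega> x <= C"
 shows "finite S"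
proof (rule ccontr)
 assume "infinite S"
 then obtain x :: "nat => _" where x: "inj x" "range x \<subseteq> S" using infinite_countable_subset by blast
 have c: "\<omega> (x n) <= C" for n using b x(2) by blast
 have C: "C > 0" using c[of 0] weight_pos[OF w, of "x 0"] by linarith
 have "1 / (C * C) <= weight_Omega \<omega> (x i, x j)" for i j
  unfolding weight_Omega_def prod.case
  by (intro frac_le mult_mono c mult_pos_pos weight_pos[OF w] weight_ge_1[OF w]) (use C in auto)
 then show False using zero_cluster_no_half_graph[OF w z x(1) x(1), of "1 / (C * C)"] C by auto
qed

lemma zero_cluster_countable:
 fixes \<omega> :: "'a::{topological_group_add} => real"
 assumes w: "weight \<omega>" and z: "zero_cluster (%p. complex_of_real (weight_Omega \<omega> p))"
 shows "countable (UNIV :: 'a set)"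
proof -
 have "(UNIV :: 'a set) = (\<Union>n::nat. {x. \<omega> x <= real n})" using real_arch_simple by auto
 moreover have "countable {x. \<omega> x <= real n}" for n
  by (intro countable_finite zero_cluster_finite_level_set[OF w z]) auto
 ultimately show ?thesis by (metis countable_UN countableI_type)
qed

text \<open>By continuity, \<open>\<omega> y < \<omega> x + 1\<close> defines a neighbourhood of
  \<open>x\<close>, and it is finite; in a Hausdorff space its other points can be removed.\<close>

lemma zero_cluster_open_singleton:
 fixes \<omega> :: "'a::{topological_group_add, t2_space} => real"
 assumes w: "weight \<omega>" and z: "zero_cluster (%p. complex_of_real (weight_Omega \<omega> p))"
 shows "open {x :: 'a}"
proof -
 let ?U = "{y. \<omega> y < \<omega> x + 1}"
 have "open ?U" using weight_continuous[OF w] by (intro open_Collect_less) auto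
 moreover have "finite ?U" by (rule zero_cluster_finite_level_set[OF w z, of _ "\<omega> x + 1"]) auto
 ultimately have "open (?U - (?U - {x}))" by (intro open_Diff finite_imp_closed) auto
 also have "?U - (?U - {x}) = {x}" by auto
 finally show ?thesis .
qed

section \<open>Algebras containing the point masses\<close>

text \<open>Abstract point masses \<open>e x\<close> and coefficient functionals
  \<open>coord t\<close>. By \<open>coord_sum\<close> the coefficients form a weighted absolutely
  summable family, so any \<open>k\<close> growing no faster than \<open>\<omega>\<close> defines a
  functional, \<open>coord_series k\<close>.\<close>

locale atoms = seminormed_algebra A for A :: "'x falgebra" +
 fixes \<omega> :: "'g::{topological_group_add, t2_space} => real" and e :: "'g => 'x => complex"
  and coord :: "'g => ('x => complex) => complex"
 assumes weight: "weight \<omega>"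
  and atom_in: "e x \<in> carr A" and atom_norm: "vnorm A (e x) <= \<omega> x"
  and coord_in: "coord t \<in> adual A"
  and coord_sum: "finite T ==> b \<in> carr A ==> (\<Sum>t\<in>T. \<omega> t * cmod (coord t b)) <= vnorm A b"
  and coord_mult: "coord t (vmult A (e x) (e y)) = (if t = x + y then 1 else 0)"
begin

lemma coord_abs_summable:
 assumes b: "b \<in> carr A" and k: "!!t. cmod (k t) <= M * \<omega> t"
 shows "(%t. cmod (k t * coord t b)) summable_on T"
  and "infsum (%t. cmod (k t * coord t b)) T <= M * vnorm A b"
proof -
 have M: "0 <= M"
 proof -
  have "0 <= M * \<omega> 0" using k[of 0] norm_ge_zero order_trans by blast
  then show ?thesis using weight_pos(1)[OF weight, of 0] by (simp add: zero_le_mult_iff)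
 qed
 have n: "(\<Sum>t\<in>S. cmod (k t * coord t b)) <= M * vnorm A b" if "finite S" for S
 proof -
  have "(\<Sum>t\<in>S. cmod (k t * coord t b)) <= (\<Sum>t\<in>S. M * (\<omega> t * cmod (coord t b)))"
  proof (rule sum_mono)
   fix t show "cmod (k t * coord t b) <= M * (\<omega> t * cmod (coord t b))"
    using mult_right_mono[OF k[of t], of "cmod (coord t b)"] by (simp add: norm_mult mult.assoc)
  qed
  also have "\<dots> <= M * vnorm A b"
   unfolding sum_distrib_left[symmetric] by (rule mult_left_mono[OF coord_sum[OF that b] M])
  finally show ?thesis .
 qed
 show s: "(%t. cmod (k t * coord t b)) summable_on T"
  by (rule nonneg_bdd_above_summable_on) (use n in "auto intro!: bdd_aboveI2")
 show "infsum (%t. cmod (k t * coord t b)) T <= M * vnorm A b"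
  by (rule infsum_le_finite_sums[OF s]) (use n in simp)
qed

definition coord_series :: "('g => complex) => ('x => complex) => complex" where
 "coord_series k b = (if b \<in> carr A then \<Sum>\<^sub>\<infinity>t. k t * coord t b else 0)"

lemma coord_series_in:
 assumes k: "!!t. cmod (k t) <= M * \<omega> t"
 shows "coord_series k \<in> adual A"
 unfolding adual_def
proof (rule top_dualI[where C=M])
 have c: "coord t \<in> top_dual (carr A) (vnorm A)" for t using coord_in by (simp add: adual_def)
 note s = coord_abs_summable(1)[OF _ k]
 fix a b assume a: "a \<in> carr A" and b: "b \<in> carr A"
 show "coord_series k (%x. a x + b x) = coord_series k a + coord_series k b"
  using a b add_in[OF a b] abs_summable_summable[OF s[OF a]] abs_summable_summable[OF s[OF b]]
  by (simp add: coord_series_def top_dual_add[OF c] distrib_left infsum_add)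
 fix z
 show "coord_series k (%x. z * a x) = z * coord_series k a"
  using a scale_in[OF a] by (simp add: coord_series_def top_dual_scale[OF c] mult.left_commute infsum_cmult_right')
 show "cmod (coord_series k a) <= M * vnorm A a"
  using order_trans[OF norm_infsum_bound[OF s[OF a]] coord_abs_summable(2)[OF a k]] a
  by (simp add: coord_series_def)
qed (simp add: coord_series_def)

lemma infsum_single: "(\<Sum>\<^sub>\<infinity>t. k t * (if t = x then 1 else 0)) = (k x :: complex)"
proof -
 have "(\<Sum>\<^sub>\<infinity>t. k t * (if t = x then 1 else 0)) = (\<Sum>\<^sub>\<infinity>t\<in>{x}. k t)"
  by (rule infsum_cong_neutral) auto
 then show ?thesis by simp
qed

text \<open>Chosen so that its values on products of normalised point masses are those of
  \<open>\<Omega>\<close>, cut off where the sum of the two points leaves \<open>T\<close>.\<close>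

definition weight_functional :: "'g set => ('x => complex) => complex" where
 "weight_functional T = coord_series (%t. if t \<in> T then complex_of_real (\<omega> t) else 0)"

lemma weight_functional_in: "weight_functional T \<in> adual A"
 unfolding weight_functional_def
 by (rule coord_series_in[where M=1]) (use weight_pos(2)[OF weight] in auto)

lemma weight_functional_product:
 "weight_functional T (vmult A (e x) (e y)) = (if x + y \<in> T then complex_of_real (\<omega> (x + y)) else 0)"
 by (simp add: weight_functional_def coord_series_def mult_in atom_in coord_mult infsum_single)

text \<open>The functional that sees only products with \<open>n <= m\<close> has iterated limits
  \<open>l\<close> and 0, since for fixed \<open>m\<close> all but finitely many \<open>n\<close>
  are cut off; regularity equates them. The opposite half of the index set treats
  \<open>l'\<close>.\<close>

theorem zero_cluster_if_arens_regular:
 assumes reg: "arens_regular A"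
 shows "zero_cluster (%p. complex_of_real (weight_Omega \<omega> p))"
 unfolding zero_cluster_def
proof (intro allI impI)
 fix x y :: "nat => 'g" and a b l l'
 assume h: "inj x & inj y &
  (\<forall>n. (%m. complex_of_real (weight_Omega \<omega> (x n, y m))) \<longlonglongrightarrow> a n) & a \<longlonglongrightarrow> l &
  (\<forall>m. (%n. complex_of_real (weight_Omega \<omega> (x n, y m))) \<longlonglongrightarrow> b m) & b \<longlonglongrightarrow> l'"
 then have "inj x" "inj y" by auto
 then obtain p q :: "nat => nat" where pq: "strict_mono p" "strict_mono q" and inj: "inj (%(n, m). x (p n) + y (q m))"
  by (rule subsequences_with_injective_sums)
 define X where "X = x \<circ> p"
 define Y where "Y = y \<circ> q"
 have lim: "(%m. complex_of_real (weight_Omega \<omega> (X n, Y m))) \<longlonglongrightarrow> (a \<circ> p) n" "(a \<circ> p) \<longlonglongrightarrow> l"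
  "(%n. complex_of_real (weight_Omega \<omega> (X n, Y m))) \<longlonglongrightarrow> (b \<circ> q) m" "(b \<circ> q) \<longlonglongrightarrow> l'" for n m
  using h LIMSEQ_subseq_LIMSEQ[OF _ pq(1), of a l] LIMSEQ_subseq_LIMSEQ[OF _ pq(2), of b l']
   LIMSEQ_subseq_LIMSEQ[OF _ pq(2), of "%m. complex_of_real (weight_Omega \<omega> (x (p n), y m))" "a (p n)"]
   LIMSEQ_subseq_LIMSEQ[OF _ pq(1), of "%n. complex_of_real (weight_Omega \<omega> (x n, y (q m)))" "b (q m)"]
  unfolding X_def Y_def by (auto simp: o_def)
 define u where "u z = (%t. complex_of_real (1 / \<omega> z) * e z t)" for z
 have u: "u z \<in> carr A" for z unfolding u_def by (rule scale_in[OF atom_in])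
 have un: "vnorm A (u z) <= 1" for z
  unfolding u_def norm_scale[OF atom_in] using atom_norm[of z] weight_pos[OF weight, of z] by (simp add: norm_divide)
 \<comment> \<open>\<open>T R\<close> collects the sums of the index pairs in \<open>R\<close>; by
   injectivity no other pair has its sum in it.\<close>
 define T where "T R = {X i + Y j | i j. R i j}" for R :: "nat => nat => bool"
 have T: "X n + Y m \<in> T R \<longleftrightarrow> R n m" for n m R
  using injD[OF inj, of "(n, m)"] unfolding T_def X_def Y_def by fastforce
 have F: "weight_functional (T R) (vmult A (u (X n)) (u (Y m))) =
   (if R n m then complex_of_real (weight_Omega \<omega> (X n, Y m)) else 0)" for R n m
  unfolding u_def mult_scale_left[OF weight_functional_in atom_in scale_in[OF atom_in]]
   mult_scale_right[OF weight_functional_in atom_in atom_in] weight_functional_product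
  by (simp add: T weight_Omega_def)
 have "l = 0"
 proof (rule arens_regular_iterated_limits[OF reg weight_functional_in[of "T (\<le>)"],
   of "%n. u (X n)" 1 "%n. u (Y n)" "a \<circ> p" l "%m. 0", OF u un u un, unfolded F])
  show "(%m. if n <= m then complex_of_real (weight_Omega \<omega> (X n, Y m)) else 0) \<longlonglongrightarrow> (a \<circ> p) n" for n
   by (rule Lim_transform_eventually[OF lim(1)]) (use eventually_ge_at_top[of n] in "eventually_elim, simp")
  show "(%n. if n <= m then complex_of_real (weight_Omega \<omega> (X n, Y m)) else 0) \<longlonglongrightarrow> 0" for m
   by (rule Lim_transform_eventually[OF tendsto_const]) (use eventually_gt_at_top[of m] in "eventually_elim, simp")
 qed (use lim in auto)
 moreover have "0 = l'"
 proof (rule arens_regular_iterated_limits[OF reg weight_functional_in[of "T (\<ge>)"],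
   of "%n. u (X n)" 1 "%n. u (Y n)" "%n. 0" 0 "b \<circ> q", OF u un u un, unfolded F])
  show "(%n. if m <= n then complex_of_real (weight_Omega \<omega> (X n, Y m)) else 0) \<longlonglongrightarrow> (b \<circ> q) m" for m
   by (rule Lim_transform_eventually[OF lim(3)]) (use eventually_ge_at_top[of m] in "eventually_elim, simp")
  show "(%m. if m <= n then complex_of_real (weight_Omega \<omega> (X n, Y m)) else 0) \<longlonglongrightarrow> 0" for n
   by (rule Lim_transform_eventually[OF tendsto_const]) (use eventually_gt_at_top[of n] in "eventually_elim, simp")
 qed (use lim in auto)
 ultimately show "l = 0 & l' = 0" by simp
qed

end

text \<open>\<open>coord_sum\<close> passes to the dual: align the phases of the numbers
  \<open>\<Phi> (coord t)\<close> in a finite combination \<open>G\<close> of coordinates; the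
  inequality in \<open>A\<close> gives \<open>G\<close> norm at most 1.\<close>

lemma (in introverted) atoms_dual:
 fixes \<omega> :: "'g::{topological_group_add, t2_space} => real"
 assumes at: "atoms A \<omega> e coord" and c: "!!t. coord t \<in> X"
 shows "atoms (introverted_dual A X) \<omega> (%x. evaluation X (e x)) (%t. evaluation X' (coord t))"
proof -
 interpret at: atoms A \<omega> e coord by (rule at)
 show ?thesis
 proof
  show "weight \<omega>" by (rule at.weight)
  fix x show "evaluation X (e x) \<in> carr (introverted_dual A X)" using evaluation_in(1)[OF at.atom_in] by simp
  show "vnorm (introverted_dual A X) (evaluation X (e x)) <= \<omega> x"
   using evaluation_in(2)[OF at.atom_in] at.atom_norm order_trans by fastforce
  fix t show "evaluation X' (coord t) \<in> adual (introverted_dual A X)" by (rule evaluation_dual_in[OF c])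
  fix y
  show "evaluation X' (coord t) (vmult (introverted_dual A X) (evaluation X (e x)) (evaluation X (e y))) =
    (if t = x + y then 1 else 0)"
   using evaluation_in(1)[OF mult_in[OF at.atom_in at.atom_in]]
   by (simp add: arens_mult_evaluation at.atom_in evaluation_def[of X'] evaluation_apply c at.coord_mult)
 next
  fix T :: "'g set" and \<Phi> assume T: "finite T" and "\<Phi> \<in> carr (introverted_dual A X)"
  then have P: "\<Phi> \<in> X'" by simp
  define k where "k t = (if \<Phi> (coord t) = 0 then 0 else complex_of_real (cmod (\<Phi> (coord t))) / \<Phi> (coord t))" for t
  have k: "cmod (k t) <= 1" "k t * \<Phi> (coord t) = complex_of_real (cmod (\<Phi> (coord t)))" for t
   by (auto simp: k_def norm_divide)
  define G where "G = (%b. \<Sum>t\<in>T. (complex_of_real (\<omega> t) * k t) * coord t b)"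
  have G: "G \<in> X" unfolding G_def by (rule sub.sum_in[OF T c])
  have "adual_norm A G <= 1"
  proof (rule adual_norm_le)
   fix b assume b: "b \<in> carr A"
   have "cmod (G b) <= (\<Sum>t\<in>T. \<omega> t * cmod (coord t b))"
    unfolding G_def
   proof (rule sum_norm_le)
    fix t
    have "\<omega> t * cmod (k t) * cmod (coord t b) <= \<omega> t * 1 * cmod (coord t b)"
     by (intro mult_right_mono mult_left_mono k weight_pos(2)[OF at.weight]) auto
    then show "cmod (complex_of_real (\<omega> t) * k t * coord t b) <= \<omega> t * cmod (coord t b)"
     using weight_pos(2)[OF at.weight, of t] by (simp add: norm_mult)
   qed
   then show "cmod (G b) <= 1 * vnorm A b" using at.coord_sum[OF T b] by simp
  qed simp
  then have "norm' \<Phi> * adual_norm A G <= norm' \<Phi>"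
   using sub_dual.norm_nonneg[OF P] by (simp add: mult_left_le)
  moreover have "\<Phi> G = complex_of_real (\<Sum>t\<in>T. \<omega> t * cmod (\<Phi> (coord t)))"
   unfolding G_def sub.functional_sum[OF P T c] using k(2) by (simp add: mult.assoc)
  moreover have "cmod (\<Phi> G) <= norm' \<Phi> * adual_norm A G" by (rule sub.dual_norm_bound[OF P G])
  moreover have "0 <= (\<Sum>t\<in>T. \<omega> t * cmod (\<Phi> (coord t)))"
   by (intro sum_nonneg mult_nonneg_nonneg weight_pos(2)[OF at.weight]) auto
  ultimately show "(\<Sum>t\<in>T. \<omega> t * cmod (evaluation X' (coord t) \<Phi>)) <= vnorm (introverted_dual A X) \<Phi>"
   using P by (simp add: evaluation_def del: of_real_sum)
 qed
qed

section \<open>Restriction operators\<close>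

text \<open>\<open>restr_norm\<close> together with the triangle inequality makes the norm additive
  over complementary sets, as for measures and integrable functions.\<close>

locale restriction = seminormed_algebra A for A :: "'x falgebra" +
 fixes \<rho> :: "'g::topological_space set => ('x => complex) => 'x => complex"
 assumes restr_in: "E \<in> Borel ==> a \<in> carr A ==> \<rho> E a \<in> carr A"
  and restr_add: "E \<in> Borel ==> a \<in> carr A ==> b \<in> carr A ==> \<rho> E (%x. a x + b x) = (%x. \<rho> E a x + \<rho> E b x)"
  and restr_scale: "E \<in> Borel ==> a \<in> carr A ==> \<rho> E (%x. c * a x) = (%x. c * \<rho> E a x)"
  and restr_Int: "E \<in> Borel ==> E' \<in> Borel ==> a \<in> carr A ==> \<rho> E (\<rho> E' a) = \<rho> (E \<inter> E') a"
  and restr_UNIV: "a \<in> carr A ==> \<rho> UNIV a = a"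
  and restr_Un: "E \<in> Borel ==> E' \<in> Borel ==> E \<inter> E' = {} ==> a \<in> carr A ==>
   \<rho> (E \<union> E') a = (%x. \<rho> E a x + \<rho> E' a x)"
  and restr_norm: "E \<in> Borel ==> a \<in> carr A ==> vnorm A (\<rho> E a) + vnorm A (\<rho> (- E) a) <= vnorm A a"
begin

lemma compl_borel: "E \<in> Borel ==> - E \<in> sets (borel :: 'g measure)"
 by (simp add: borel_comp)

lemma restr_split: "E \<in> Borel ==> a \<in> carr A ==> (%x. \<rho> E a x + \<rho> (- E) a x) = a"
 using restr_Un[of E "- E" a] restr_UNIV compl_borel by simp

lemma restr_norm_le: "E \<in> Borel ==> a \<in> carr A ==> vnorm A (\<rho> E a) <= vnorm A a"
 using restr_norm[of E a] norm_nonneg[OF restr_in[OF compl_borel, of E a]] by simp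

lemma restr_empty: "a \<in> carr A ==> \<rho> {} a = (%x. 0)"
 using restr_Un[of "{}" "{}" a] by (auto simp: fun_eq_iff)

text \<open>The adjoint of restriction to \<open>E\<close>.\<close>

definition cut :: "'g set => (('x => complex) => complex) => ('x => complex) => complex" where
 "cut E F = (%a. if a \<in> carr A then F (\<rho> E a) else 0)"

text \<open>Additivity of the norm on \<open>A\<close> turns into a maximum on the dual, as for
  essentially bounded functions.\<close>

lemma cut_bound:
 assumes "F \<in> adual A" "G \<in> adual A" "E \<in> Borel" "a \<in> carr A"
 shows "cmod (cut E F a + cut (- E) G a) <= max (adual_norm A F) (adual_norm A G) * vnorm A a"
proof -
 have "cmod (F (\<rho> E a)) <= max (adual_norm A F) (adual_norm A G) * vnorm A (\<rho> E a)"
  by (rule order_trans[OF adual_bound[OF assms(1) restr_in[OF assms(3,4)]]])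
   (intro mult_right_mono norm_nonneg restr_in assms, simp)
 moreover have "cmod (G (\<rho> (- E) a)) <= max (adual_norm A F) (adual_norm A G) * vnorm A (\<rho> (- E) a)"
  by (rule order_trans[OF adual_bound[OF assms(2) restr_in[OF compl_borel[OF assms(3)] assms(4)]]])
   (intro mult_right_mono norm_nonneg restr_in compl_borel assms, simp)
 moreover have "max (adual_norm A F) (adual_norm A G) * (vnorm A (\<rho> E a) + vnorm A (\<rho> (- E) a))
   <= max (adual_norm A F) (adual_norm A G) * vnorm A a"
  using dual.norm_nonneg[OF assms(1)] by (intro mult_left_mono restr_norm assms) simp
 ultimately show ?thesis
  using assms(4) norm_triangle_ineq[of "F (\<rho> E a)" "G (\<rho> (- E) a)"] by (simp add: cut_def distrib_left)
qed

lemma cut_in_adual: "F \<in> adual A ==> E \<in> Borel ==> cut E F \<in> adual A"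
proof -
 assume F: "F \<in> adual A" and E: "E \<in> Borel"
 then have F': "F \<in> top_dual (carr A) (vnorm A)" by (simp add: adual_def)
 have "cmod (cut E F a) <= adual_norm A F * vnorm A a" if a: "a \<in> carr A" for a
  using adual_bound[OF F restr_in[OF E a]] mult_left_mono[OF restr_norm_le[OF E a] dual.norm_nonneg[OF F]] a
  by (simp add: cut_def)
 then show ?thesis
  unfolding adual_def
  by (intro top_dualI[where C="adual_norm A F"])
   (use E in "simp_all add: cut_def add_in scale_in restr_add restr_scale restr_in top_dual_add[OF F'] top_dual_scale[OF F']")
qed

lemma cut_norm_le: "F \<in> adual A ==> E \<in> Borel ==> adual_norm A (cut E F) <= adual_norm A F"
proof (rule adual_norm_le)
 fix a assume F: "F \<in> adual A" and E: "E \<in> Borel" and a: "a \<in> carr A"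
 show "cmod (cut E F a) <= adual_norm A F * vnorm A a"
  using adual_bound[OF F restr_in[OF E a]] mult_left_mono[OF restr_norm_le[OF E a] dual.norm_nonneg[OF F]] a
  by (simp add: cut_def)
qed (rule dual.norm_nonneg)

lemma cut_norm_max:
 assumes "F \<in> adual A" "G \<in> adual A" "E \<in> Borel"
 shows "adual_norm A (%a. cut E F a + cut (- E) G a) <= max (adual_norm A F) (adual_norm A G)"
 by (rule adual_norm_le) (use dual.norm_nonneg[OF assms(1)] cut_bound[OF assms] in auto)

lemma cut_add: "cut E (%a. F a + G a) = (%a. cut E F a + cut E G a)"
 and cut_scale: "cut E (%a. c * F a) = (%a. c * cut E F a)"
 by (auto simp: cut_def)

lemma cut_cut: "E \<in> Borel ==> E' \<in> Borel ==> cut E (cut E' F) = cut (E' \<inter> E) F"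
 by (auto simp: cut_def restr_in restr_Int)

lemma cut_Un:
 assumes "F \<in> adual A" "E \<in> Borel" "E' \<in> Borel" "E \<inter> E' = {}"
 shows "cut (E \<union> E') F = (%a. cut E F a + cut E' F a)"
 using assms(1) unfolding adual_def
 by (auto simp: cut_def restr_Un[OF assms(2-)] top_dual_add restr_in assms(2,3))

lemma cut_UNIV: "F \<in> adual A ==> cut UNIV F = F"
 by (auto simp: cut_def restr_UNIV adual_def top_dual_outside)

lemma cut_split: "F \<in> adual A ==> E \<in> Borel ==> (%a. cut E F a + cut (- E) F a) = F"
 using cut_Un[of F E "- E"] compl_borel by (simp add: cut_UNIV)

end

locale subspace_restriction = restriction A \<rho> + dual_subspace A X
 for A :: "'x falgebra" and X and \<rho> :: "'g::topological_space set => ('x => complex) => 'x => complex" +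
 assumes cut_in: "F \<in> X ==> E \<in> Borel ==> cut E F \<in> X"
begin

text \<open>The second adjoint of restriction. Its norm is additive over complementary sets again,
  which lets the construction be iterated.\<close>

definition dual_restr :: "'g set => ((('x => complex) => complex) => complex) => (('x => complex) => complex) => complex" where
 "dual_restr E \<Phi> = (%F. if F \<in> X then \<Phi> (cut E F) else 0)"

lemma dual_restr_bound:
 assumes "\<Phi> \<in> X'" "E \<in> Borel" "F \<in> X"
 shows "cmod (dual_restr E \<Phi> F) <= norm' \<Phi> * adual_norm A F"
 using sub.dual_norm_bound[OF assms(1) cut_in[OF assms(3,2)]]
  mult_left_mono[OF cut_norm_le[OF in_adual[OF assms(3)] assms(2)] sub_dual.norm_nonneg[OF assms(1)]] assms(3)
 by (simp add: dual_restr_def)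

lemma dual_restr_in: "\<Phi> \<in> X' ==> E \<in> Borel ==> dual_restr E \<Phi> \<in> X'"
 by (rule top_dualI[where C="norm' \<Phi>"])
  (use dual_restr_bound in "simp_all add: dual_restr_def subspace_add subspace_scale cut_add cut_scale cut_in top_dual_add top_dual_scale")

lemma dual_restr_norm:
 assumes P: "\<Phi> \<in> X'" and E: "E \<in> Borel"
 shows "norm' (dual_restr E \<Phi>) + norm' (dual_restr (- E) \<Phi>) <= norm' \<Phi>"
proof -
 define r where "r = norm' \<Phi>"
 have r: "0 <= r" unfolding r_def by (rule sub_dual.norm_nonneg[OF P])
 have E': "- E \<in> Borel" by (rule compl_borel[OF E])
 text \<open>Two functionals of norm at most 1, cut to complementary sets, add up to one of norm at most 1;
  their values may be assumed to be nonnegative reals.\<close>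
 have 1: "cmod (dual_restr E \<Phi> F) + cmod (dual_restr (- E) \<Phi> G) <= r"
  if F: "F \<in> X" "adual_norm A F <= 1" and G: "G \<in> X" "adual_norm A G <= 1" for F G
 proof -
  define c where "c z = (if z = 0 then 0 else complex_of_real (cmod z) / z)" for z :: complex
  have c: "cmod (c z) <= 1" "c z * z = complex_of_real (cmod z)" for z by (auto simp: c_def norm_divide)
  define F' where "F' = (%a. c (\<Phi> (cut E F)) * F a)"
  define G' where "G' = (%a. c (\<Phi> (cut (- E) G)) * G a)"
  have mem: "F' \<in> X" "G' \<in> X" unfolding F'_def G'_def using F G by (auto intro: subspace_scale)
  have n: "adual_norm A F' <= 1" "adual_norm A G' <= 1"
   unfolding F'_def G'_def sub.norm_scale[OF F(1)] sub.norm_scale[OF G(1)]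
   using c(1) F(2) G(2) sub.norm_nonneg[OF F(1)] sub.norm_nonneg[OF G(1)]
   by (auto intro!: mult_le_one)
  have "\<Phi> (%a. cut E F' a + cut (- E) G' a) = complex_of_real (cmod (\<Phi> (cut E F)) + cmod (\<Phi> (cut (- E) G)))"
   using top_dual_add[OF P cut_in[OF mem(1) E] cut_in[OF mem(2) E']]
   by (simp add: F'_def G'_def cut_scale top_dual_scale[OF P] cut_in F G E E' c)
  then have "cmod (\<Phi> (cut E F)) + cmod (\<Phi> (cut (- E) G)) = cmod (\<Phi> (%a. cut E F' a + cut (- E) G' a))"
   by (simp del: of_real_add)
  also have "\<dots> <= r * adual_norm A (%a. cut E F' a + cut (- E) G' a)"
   unfolding r_def by (intro sub.dual_norm_bound P subspace_add cut_in mem E E')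
  also have "\<dots> <= r * 1"
   using cut_norm_max[OF in_adual[OF mem(1)] in_adual[OF mem(2)] E] n by (intro mult_left_mono r) linarith
  finally show ?thesis using F G by (simp add: dual_restr_def)
 qed
 have "norm' (dual_restr E \<Phi>) <= r - cmod (dual_restr (- E) \<Phi> G)" if G: "G \<in> X" "adual_norm A G <= 1" for G
  unfolding dual_norm_def
  by (rule cSUP_least) (use 1[OF _ _ G] subspace_zero sub.norm_zero in \<open>auto simp: le_diff_eq intro!: exI[of _ "%a. 0"]\<close>)
 then have "norm' (dual_restr (- E) \<Phi>) <= r - norm' (dual_restr E \<Phi>)"
  unfolding dual_norm_def[of X _ "dual_restr (- E) \<Phi>"]
  by (intro cSUP_least) (use subspace_zero sub.norm_zero in \<open>auto simp: le_diff_eq add.commute intro!: exI[of _ "%a. 0"]\<close>)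
 then show ?thesis by (simp add: r_def)
qed

end

locale introverted_restriction = subspace_restriction A X \<rho> + introverted A X
 for A :: "'x falgebra" and X and \<rho> :: "'g::topological_space set => ('x => complex) => 'x => complex"
begin

lemma restriction_dual: "restriction (introverted_dual A X) dual_restr"
proof (unfold_locales, unfold dual_algebra_simps)
 fix E E' :: "'g set" and \<Phi> \<Psi> c
 assume E: "E \<in> Borel" and P: "\<Phi> \<in> X'"
 show "dual_restr E \<Phi> \<in> X'" by (rule dual_restr_in[OF P E])
 show "dual_restr E (%x. \<Phi> x + \<Psi> x) = (%x. dual_restr E \<Phi> x + dual_restr E \<Psi> x)"
  by (auto simp: dual_restr_def)
 show "dual_restr E (%x. c * \<Phi> x) = (%x. c * dual_restr E \<Phi> x)" by (auto simp: dual_restr_def)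
 show "norm' (dual_restr E \<Phi>) + norm' (dual_restr (- E) \<Phi>) <= norm' \<Phi>" by (rule dual_restr_norm[OF P E])
 assume E': "E' \<in> Borel"
 show "dual_restr E (dual_restr E' \<Phi>) = dual_restr (E \<inter> E') \<Phi>"
  by (auto simp: dual_restr_def cut_in E E' cut_cut)
 assume "E \<inter> E' = {}"
 then show "dual_restr (E \<union> E') \<Phi> = (%x. dual_restr E \<Phi> x + dual_restr E' \<Phi> x)"
  by (auto simp: dual_restr_def cut_Un[OF in_adual E E'] top_dual_add[OF P] cut_in E E')
next
 fix \<Phi> assume "\<Phi> \<in> X'"
 then show "dual_restr UNIV \<Phi> = \<Phi>" by (auto simp: dual_restr_def cut_UNIV[OF in_adual] top_dual_outside)
qed

end

section \<open>A combinatorial lemma on finitely additive set functions\<close>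

text \<open>Later \<open>\<mu> E\<close> is the norm of a singular functional restricted to
  \<open>E\<close>. Being real-valued and monotone, it is bounded by \<open>\<mu> UNIV\<close>;
  countable additivity cannot be expected.\<close>

locale additive_set_function =
 fixes \<mu> :: "'g set => real"
 assumes nonneg: "0 <= \<mu> E" and superadditive: "E \<inter> E' = {} ==> \<mu> E + \<mu> E' <= \<mu> (E \<union> E')"
  and subadditive: "\<mu> (E \<union> E') <= \<mu> E + \<mu> E'" and vanishes_finite: "finite E ==> \<mu> E = 0"
begin

lemma mono: "E \<subseteq> E' ==> \<mu> E <= \<mu> E'"
 using superadditive[of E "E' - E"] nonneg[of "E' - E"] by (simp add: Un_absorb1)

lemma subadditive_UN: "finite B ==> \<mu> (\<Union>i\<in>B. E i) <= (\<Sum>i\<in>B. \<mu> (E i))"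
proof (induction B rule: finite_induct)
 case (insert j B) then show ?case using subadditive[of "E j" "\<Union>i\<in>B. E i"] by simp
qed (simp add: vanishes_finite)

text \<open>If every set had only small overlap within \<open>D\<close> with all but finitely many
  others, one could keep choosing sets that each add mass \<open>\<zeta> / 2\<close>, and would
  exceed \<open>\<mu> UNIV\<close>.\<close>

lemma large_intersections:
 assumes I: "infinite I" and \<zeta>: "0 < \<zeta>" "!!i. i \<in> I ==> \<zeta> <= \<mu> (D \<inter> E i)"
 shows "\<exists>i\<in>I. \<exists>\<zeta>'>0. infinite {j\<in>I. \<zeta>' <= \<mu> (D \<inter> E i \<inter> E j)}"
proof (rule ccontr)
 assume "\<not> ?thesis"
 then have fin: "finite {j\<in>I. \<zeta>' <= \<mu> (D \<inter> E i \<inter> E j)}" if "i \<in> I" "\<zeta>' > 0" for i \<zeta>'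
  using that by blast
 have ex: "\<exists>B. finite B & B \<subseteq> I & real n * (\<zeta> / 2) <= \<mu> (\<Union>i\<in>B. D \<inter> E i)" for n
 proof (induction n)
  case 0 then show ?case using nonneg by (intro exI[of _ "{}"]) auto
 next
  case (Suc n)
  then obtain B where B: "finite B" "B \<subseteq> I" "real n * (\<zeta> / 2) <= \<mu> (\<Union>i\<in>B. D \<inter> E i)" by blast
  \<comment> \<open>Small enough that the overlaps with all sets chosen so far together cost at most
    \<open>\<zeta> / 2\<close>; the summand 1 covers \<open>B = {}\<close>.\<close>
  define \<zeta>' where "\<zeta>' = \<zeta> / (2 * (real (card B) + 1))"
  have \<zeta>': "\<zeta>' > 0" "real (card B) * \<zeta>' <= \<zeta> / 2" using \<zeta>(1) by (auto simp: \<zeta>'_def field_simps)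
  have "finite (\<Union>i\<in>B. {j\<in>I. \<zeta>' <= \<mu> (D \<inter> E i \<inter> E j)})" using B fin \<zeta>' by blast
  then have "\<not> I \<subseteq> (\<Union>i\<in>B. {j\<in>I. \<zeta>' <= \<mu> (D \<inter> E i \<inter> E j)})" using I finite_subset by blast
  then obtain j where j: "j \<in> I" "!!i. i \<in> B ==> \<mu> (D \<inter> E i \<inter> E j) < \<zeta>'" by force
  let ?U = "\<Union>i\<in>B. D \<inter> E i"
  have "\<mu> (D \<inter> E j \<inter> ?U) = \<mu> (\<Union>i\<in>B. D \<inter> E i \<inter> E j)" by (rule arg_cong[of _ _ \<mu>]) auto
  also have "\<dots> <= (\<Sum>i\<in>B. \<mu> (D \<inter> E i \<inter> E j))" by (rule subadditive_UN[OF B(1)])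
  also have "\<dots> <= real (card B) * \<zeta>'" by (rule sum_bounded_above) (use j(2) in "auto intro: less_imp_le")
  also have "\<dots> <= \<zeta> / 2" by (rule \<zeta>'(2))
  finally have 1: "\<mu> (D \<inter> E j \<inter> ?U) <= \<zeta> / 2" .
  have "\<zeta> <= \<mu> (D \<inter> E j)" by (rule \<zeta>(2)[OF j(1)])
  also have "D \<inter> E j = (D \<inter> E j \<inter> ?U) \<union> (D \<inter> E j - ?U)" by blast
  also have "\<mu> \<dots> <= \<mu> (D \<inter> E j \<inter> ?U) + \<mu> (D \<inter> E j - ?U)" by (rule subadditive)
  finally have 2: "\<zeta> / 2 <= \<mu> (D \<inter> E j - ?U)" using 1 by simp
  have "\<mu> ?U + \<mu> (D \<inter> E j - ?U) <= \<mu> (?U \<union> (D \<inter> E j - ?U))" by (rule superadditive) blast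
  also have "?U \<union> (D \<inter> E j - ?U) = (\<Union>i\<in>insert j B. D \<inter> E i)" by blast
  finally have "real (Suc n) * (\<zeta> / 2) <= \<mu> (\<Union>i\<in>insert j B. D \<inter> E i)" using B(3) 2 by (simp add: algebra_simps)
  then show ?case using B j(1) by (intro exI[of _ "insert j B"]) auto
 qed
 obtain n where "\<mu> UNIV < real n * (\<zeta> / 2)" using \<zeta>(1) reals_Archimedean3[of "\<zeta> / 2"] by auto
 then show False using ex[of n] mono[of _ UNIV] by (meson not_less order_trans subset_UNIV)
qed

text \<open>Iterating \<open>large_intersections\<close> keeps the intersection \<open>D\<close> of
  the chosen sets in large overlap with infinitely many candidates. Positive mass makes such an
  intersection infinite, so a fresh \<open>y\<close> in it exists, and it lies in all sets chosen so
  far.\<close>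

lemma half_graph:
 fixes E :: "'i => 'g set"
 assumes I: "infinite I" and \<zeta>: "0 < \<zeta>" "!!i. i \<in> I ==> \<zeta> <= \<mu> (E i)"
 obtains x :: "nat => 'i" and y where "inj x" "inj y" "\<forall>n m. n <= m --> y m \<in> E (x n)"
proof -
 \<comment> \<open>State of the construction: current intersection \<open>D\<close>, remaining index
   set \<open>J\<close>, points \<open>Y\<close> already used.\<close>
 define good where "good = (%(D, J, Y). infinite J & (\<exists>\<zeta>>0. \<forall>i\<in>J. \<zeta> <= \<mu> (D \<inter> E i)) & finite (Y :: 'g set))"
 define step where "step = (%(D, J, Y) (D', J', Y') x y. x \<in> J & J' \<subseteq> J - {x} & D' = D \<inter> E x &
  y \<in> D' & y \<notin> Y & Y' = insert y Y)"
 have "\<exists>f. \<forall>n. good (f n) & (\<exists>x y. step (f n) (f (Suc n)) x y)"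
 proof (rule dependent_nat_choice)
  have "good (UNIV, I, {})" using I \<zeta> by (auto simp: good_def)
  then show "\<exists>s. good s" ..
 next
  fix s and n :: nat
  assume g: "good s"
  obtain D J Y where s: "s = (D, J, Y)" by (cases s) auto
  from g s obtain \<delta> where J: "infinite J" "finite Y" and \<delta>: "\<delta> > 0" "!!i. i \<in> J ==> \<delta> <= \<mu> (D \<inter> E i)"
   by (auto simp: good_def)
  obtain x \<delta>' where x: "x \<in> J" "\<delta>' > 0" "infinite {j\<in>J. \<delta>' <= \<mu> (D \<inter> E x \<inter> E j)}"
   using large_intersections[where E=E and D=D, OF J(1) \<delta>] by blast
  define J' where "J' = {j\<in>J. \<delta>' <= \<mu> (D \<inter> E x \<inter> E j)} - {x}"
  have J': "infinite J'" using x(3) by (simp add: J'_def)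
  have "\<delta> <= \<mu> (D \<inter> E x)" by (rule \<delta>(2)[OF x(1)])
  then have "infinite (D \<inter> E x)" using \<delta>(1) vanishes_finite[of "D \<inter> E x"] by linarith
  then have "\<not> D \<inter> E x \<subseteq> Y" using finite_subset[OF _ J(2)] by auto
  then obtain y where y: "y \<in> D \<inter> E x" "y \<notin> Y" by blast
  have "good (D \<inter> E x, J', insert y Y)" using J' x(2) J(2) by (auto simp: good_def J'_def)
  moreover have "step s (D \<inter> E x, J', insert y Y) x y" using x(1) y by (auto simp: step_def s J'_def)
  ultimately show "\<exists>t. good t & (\<exists>x y. step s t x y)" by (intro exI conjI)
 qed
 then obtain f where f: "\<forall>n. \<exists>x y. step (f n) (f (Suc n)) x y" by auto
 define D where "D n = fst (f n)" for n
 define J where "J n = fst (snd (f n))" for n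
 define Y where "Y n = snd (snd (f n))" for n
 have "\<forall>n. \<exists>p. fst p \<in> J n & J (Suc n) \<subseteq> J n - {fst p} & D (Suc n) = D n \<inter> E (fst p) &
  snd p \<in> D (Suc n) & snd p \<notin> Y n & Y (Suc n) = insert (snd p) (Y n)"
  using f unfolding step_def D_def J_def Y_def by (simp add: case_prod_beta)
 from choice[OF this] obtain p where p: "\<forall>n. fst (p n) \<in> J n & J (Suc n) \<subseteq> J n - {fst (p n)} &
  D (Suc n) = D n \<inter> E (fst (p n)) & snd (p n) \<in> D (Suc n) & snd (p n) \<notin> Y n & Y (Suc n) = insert (snd (p n)) (Y n)" ..
 define x where "x n = fst (p n)" for n
 define y where "y n = snd (p n)" for n
 have xy: "x n \<in> J n" "J (Suc n) \<subseteq> J n - {x n}" "D (Suc n) = D n \<inter> E (x n)"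
  "y n \<in> D (Suc n)" "y n \<notin> Y n" "Y (Suc n) = insert (y n) (Y n)" for n
  unfolding x_def y_def using p by blast+
 have J: "J m \<subseteq> J n" if "n <= m" for n m
  using that by (rule lift_Suc_antimono_le[of J, rotated]) (use xy(2) in blast)
 have D: "D m \<subseteq> D n" if "n <= m" for n m
  using that by (rule lift_Suc_antimono_le[of D, rotated]) (use xy(3) in blast)
 have Y: "Y n \<subseteq> Y m" if "n <= m" for n m
  using that by (rule lift_Suc_mono_le[of Y, rotated]) (use xy(6) in blast)
 have "x n \<noteq> x m" if "n < m" for n m
  using J[of "Suc n" m] xy(1)[of m] xy(2)[of n] that by auto
 then have "inj x" by (metis injI linorder_neqE_nat)
 moreover have "y n \<noteq> y m" if "n < m" for n m
  using Y[of "Suc n" m] xy(5)[of m] xy(6)[of n] that by auto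
 then have "inj y" by (metis injI linorder_neqE_nat)
 moreover have "y m \<in> E (x n)" if "n <= m" for n m
  using D[of "Suc n" "Suc m"] xy(3)[of n] xy(4)[of m] that by auto
 ultimately show ?thesis by (intro that[of x y]) auto
qed

end

section \<open>Zero cluster weights on discrete groups\<close>

text \<open>The algebra of summable functions on a discrete group and its second dual have the same
 structure: an element is the sum of an atomic part, determined by its coordinates, and of a singular
 part whose coordinates vanish, and products of singular elements are negligible.\<close>

locale banded = atoms A \<omega> e coord + restriction A \<rho>
 for A :: "'x falgebra" and \<omega> :: "'g::{topological_group_add, t2_space} => real" and e coord
  and \<rho> :: "'g set => ('x => complex) => 'x => complex" +
 assumes all_borel: "(E :: 'g set) \<in> Borel"
  and coord_atom: "coord t (e x) = (if t = x then 1 else 0)"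
  and restr_singleton: "a \<in> carr A ==> \<rho> {x} a = (%t. coord x a * e x t)"
  and atom_mult_restr: "b \<in> carr A ==> 0 <= c ==> (!!y. y \<in> E ==> \<omega> (x + y) <= c * (\<omega> x * \<omega> y)) ==>
   vnorm A (vmult A (e x) (\<rho> E b)) <= c * \<omega> x * vnorm A b"
  and restr_mult_atom: "b \<in> carr A ==> 0 <= c ==> (!!y. y \<in> E ==> \<omega> (y + x) <= c * (\<omega> y * \<omega> x)) ==>
   vnorm A (vmult A (\<rho> E b) (e x)) <= c * \<omega> x * vnorm A b"
  and singular_mult: "F \<in> adual A ==> a \<in> carr A ==> b \<in> carr A ==>
   (!!t. coord t a = 0) ==> (!!t. coord t b = 0) ==> F (vmult A a b) = 0"
  and atomic_part: "a \<in> carr A ==> \<exists>p\<in>carr A. (\<forall>t. coord t p = coord t a) &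
   (\<forall>\<eta>>0. \<exists>T. finite T & vnorm A (%x. p x - \<rho> T a x) < \<eta>)"
begin

text \<open>Restrict \<open>a\<close> to \<open>E\<close> and then to \<open>{t}\<close>, compute
  the result in two ways, and compare the coefficients of \<open>e t\<close> by applying
  \<open>coord t\<close>.\<close>

lemma coord_restr: "a \<in> carr A ==> coord t (\<rho> E a) = (if t \<in> E then coord t a else 0)"
proof -
 assume a: "a \<in> carr A"
 have "(%s. coord t (\<rho> E a) * e t s) = \<rho> ({t} \<inter> E) a"
  using restr_singleton[OF restr_in[OF all_borel a]] restr_Int[OF all_borel all_borel a, of "{t}" E] by simp
 also have "\<dots> = (%s. (if t \<in> E then coord t a else 0) * e t s)"
  using restr_singleton[OF a] restr_empty[OF a] by auto
 finally have "coord t (%s. coord t (\<rho> E a) * e t s) = coord t (%s. (if t \<in> E then coord t a else 0) * e t s)" by simp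
 then show ?thesis
  using top_dual_scale[OF coord_in[of t, unfolded adual_def] atom_in[of t]] coord_atom[of t t] by simp
qed

lemma restr_finite: "finite T ==> a \<in> carr A ==> \<rho> T a = (%s. \<Sum>x\<in>T. coord x a * e x s)"
proof (induction T rule: finite_induct)
 case empty then show ?case by (simp add: restr_empty)
next
 case (insert x T)
 then have "\<rho> ({x} \<union> T) a = (%s. \<rho> {x} a s + \<rho> T a s)" by (intro restr_Un all_borel) auto
 then show ?case using insert by (simp add: restr_singleton)
qed

lemma cut_finite:
 assumes T: "finite T" and F: "F \<in> adual A"
 shows "cut T F = (%a. \<Sum>x\<in>T. F (e x) * coord x a)"
proof
 fix a show "cut T F a = (\<Sum>x\<in>T. F (e x) * coord x a)"
 proof (cases "a \<in> carr A")
  case True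
  then show ?thesis
   using functional_sum[OF F[unfolded adual_def] T, of e "%x. coord x a"] atom_in
   by (simp add: cut_def restr_finite[OF T] mult.commute)
 next
  case False
  then show ?thesis using top_dual_outside[OF coord_in[unfolded adual_def]] by (simp add: cut_def)
 qed
qed

end

locale banded_introverted = banded A \<omega> e coord \<rho> + introverted_restriction A X \<rho>
 for A :: "'x falgebra" and \<omega> :: "'g::{topological_group_add, t2_space} => real" and e coord
  and \<rho> :: "'g set => ('x => complex) => 'x => complex" and X +
 assumes coord_mem: "coord t \<in> X"
begin

lemma cut_finite_zero:
 assumes P: "\<Psi> \<in> X'" "!!t. \<Psi> (coord t) = 0" and T: "finite T" and F: "F \<in> X"
 shows "\<Psi> (cut T F) = 0"
 unfolding cut_finite[OF T in_adual[OF F]] sub.functional_sum[OF P(1) T coord_mem] by (simp add: P(2))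

text \<open>\<open>G\<close> behaves like a function vanishing at infinity: it is determined by its
  values on point masses, which are small relative to \<open>\<omega>\<close> off a finite set.
  Hence \<open>G\<close> is a norm limit of finite cuts, and those are combinations of coordinates,
  which \<open>\<Psi>\<close> kills.\<close>

lemma singular_functional_eq_0:
 assumes P: "\<Psi> \<in> X'" "!!t. \<Psi> (coord t) = 0" and G: "G \<in> X"
  and sing: "!!b. b \<in> carr A ==> (!!t. coord t b = 0) ==> G b = 0"
  and fin: "!!\<eta>. \<eta> > 0 ==> finite {x. \<eta> * \<omega> x <= cmod (G (e x))}"
 shows "\<Psi> G = 0"
proof -
 have G': "G \<in> top_dual (carr A) (vnorm A)" using in_adual[OF G] by (simp add: adual_def)
 have bound: "cmod (\<Psi> G) <= norm' \<Psi> * \<eta>" if \<eta>: "\<eta> > 0" for \<eta>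
 proof -
  define S where "S = {x. \<eta> * \<omega> x <= cmod (G (e x))}"
  have S: "finite S" unfolding S_def by (rule fin[OF \<eta>])
  have "adual_norm A (cut (- S) G) <= \<eta>"
  proof (rule adual_norm_le)
   fix a assume a: "a \<in> carr A"
   define b where "b = \<rho> (- S) a"
   have b: "b \<in> carr A" "vnorm A b <= vnorm A a"
    unfolding b_def using a restr_in restr_norm_le all_borel by auto
   obtain p where p: "p \<in> carr A" "!!t. coord t p = coord t b"
    and appr: "!!\<zeta>. \<zeta> > 0 ==> \<exists>T. finite T & vnorm A (%x. p x - \<rho> T b x) < \<zeta>"
    using atomic_part[OF b(1)] by auto
   \<comment> \<open>\<open>b\<close> differs from its atomic part \<open>p\<close> by a singular
     element, so \<open>G\<close> may be estimated on finite restrictions of \<open>b\<close>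
     alone.\<close>
   have "G (%x. b x - p x) = 0"
   proof (rule sing)
    show "(%x. b x - p x) \<in> carr A" by (rule diff_in[OF b(1) p(1)])
    show "coord t (%x. b x - p x) = 0" for t
     using functional_diff[OF coord_in[of t, unfolded adual_def] b(1) p(1)] p(2) by simp
   qed
   then have Gp: "G b = G p" using functional_diff[OF G' b(1) p(1)] by simp
   have appr': "cmod (G p) <= \<eta> * vnorm A b + adual_norm A G * \<zeta>" if \<zeta>: "\<zeta> > 0" for \<zeta>
   proof -
    obtain T where T: "finite T" "vnorm A (%x. p x - \<rho> T b x) < \<zeta>" using appr[OF \<zeta>] by blast
    have rT: "\<rho> T b \<in> carr A" by (rule restr_in[OF all_borel b(1)])
    have "cmod (G (\<rho> T b)) <= (\<Sum>x\<in>T. \<eta> * (\<omega> x * cmod (coord x b)))"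
     unfolding restr_finite[OF T(1) b(1)] functional_sum[OF G' T(1) atom_in]
    proof (rule sum_norm_le)
     fix x
     show "cmod (coord x b * G (e x)) <= \<eta> * (\<omega> x * cmod (coord x b))"
     proof (cases "x \<in> S")
      case True
      then show ?thesis using coord_restr[OF a, of x "- S"] by (simp add: b_def)
     next
      case False
      then have "cmod (coord x b) * cmod (G (e x)) <= cmod (coord x b) * (\<eta> * \<omega> x)"
       by (intro mult_left_mono) (auto simp: S_def)
      then show ?thesis by (simp add: norm_mult ac_simps)
     qed
    qed
    also have "\<dots> <= \<eta> * vnorm A b"
     unfolding sum_distrib_left[symmetric] by (intro mult_left_mono coord_sum T b) (use \<eta> in auto)
    finally have 1: "cmod (G (\<rho> T b)) <= \<eta> * vnorm A b" .
    have "cmod (G p - G (\<rho> T b)) <= adual_norm A G * vnorm A (%x. p x - \<rho> T b x)"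
     using adual_bound[OF in_adual[OF G] diff_in[OF p(1) rT]] functional_diff[OF G' p(1) rT] by simp
    also have "\<dots> <= adual_norm A G * \<zeta>" using T sub.norm_nonneg[OF G] by (intro mult_left_mono) auto
    finally show ?thesis using 1 norm_triangle_sub[of "G p" "G (\<rho> T b)"] by linarith
   qed
   have "cmod (G p) <= \<eta> * vnorm A b + e" if "e > 0" for e
   proof -
    \<comment> \<open>The denominator \<open>n + 1\<close> used below avoids a case distinction on
      \<open>n = 0\<close>.\<close>
    define n where "n = adual_norm A G"
    have n: "0 <= n" unfolding n_def by (rule sub.norm_nonneg[OF G])
    then have "cmod (G p) <= \<eta> * vnorm A b + n * (e / (n + 1))"
     unfolding n_def using \<open>e > 0\<close> by (intro appr') (simp add: add_nonneg_pos)
    also have "n * (e / (n + 1)) <= e" using n \<open>e > 0\<close> by (simp add: divide_simps)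
    finally show ?thesis by simp
   qed
   then have "cmod (G p) <= \<eta> * vnorm A b" by (rule field_le_epsilon)
   also have "\<dots> <= \<eta> * vnorm A a" using b \<eta> by (intro mult_left_mono) auto
   finally show "cmod (cut (- S) G a) <= \<eta> * vnorm A a" using a Gp by (simp add: cut_def b_def)
  qed (use \<eta> in simp)
  then have "cmod (\<Psi> (cut (- S) G)) <= norm' \<Psi> * \<eta>"
   using sub.dual_norm_bound[OF P(1) cut_in[OF G all_borel, of "- S"]]
    mult_left_mono[OF _ sub_dual.norm_nonneg[OF P(1)]] order_trans by blast
  moreover have "\<Psi> G = \<Psi> (cut S G) + \<Psi> (cut (- S) G)"
   using top_dual_add[OF P(1) cut_in[OF G all_borel, of S] cut_in[OF G all_borel, of "- S"]]
    cut_split[OF in_adual[OF G] all_borel, of S] by simp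
  ultimately show ?thesis using cut_finite_zero[OF P S G] by simp
 qed
 have "cmod (\<Psi> G) <= 0 + \<delta>" if "\<delta> > 0" for \<delta>
 proof -
  define n where "n = norm' \<Psi>"
  have n: "0 <= n" unfolding n_def by (rule sub_dual.norm_nonneg[OF P(1)])
  then have "cmod (\<Psi> G) <= n * (\<delta> / (n + 1))"
   unfolding n_def using \<open>\<delta> > 0\<close> by (intro bound) (simp add: add_nonneg_pos)
  also have "\<dots> <= \<delta>" using n \<open>\<delta> > 0\<close> by (simp add: divide_simps)
  finally show ?thesis by simp
 qed
 then have "cmod (\<Psi> G) <= 0" by (rule field_le_epsilon)
 then show ?thesis by simp
qed

text \<open>Superadditivity is the additivity of the norm under \<open>dual_restr\<close>; finite
  sets are null because a finite cut is a combination of coordinates.\<close>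

lemma additive_set_function_singular:
 assumes P: "\<Psi> \<in> X'" "!!t. \<Psi> (coord t) = 0"
 shows "additive_set_function (%E. norm' (dual_restr E \<Psi>))"
proof -
 interpret D: restriction "introverted_dual A X" dual_restr by (rule restriction_dual)
 have m: "dual_restr E \<Psi> \<in> carr (introverted_dual A X)" for E using dual_restr_in[OF P(1) all_borel] by simp
 have P': "\<Psi> \<in> carr (introverted_dual A X)" using P by simp
 show ?thesis
 proof
  fix E E'
  show "0 <= norm' (dual_restr E \<Psi>)" by (rule sub_dual.norm_nonneg[OF dual_restr_in[OF P(1) all_borel]])
  have mono: "norm' (dual_restr (E' - E) \<Psi>) <= norm' (dual_restr E' \<Psi>)"
   using D.restr_norm_le[OF all_borel[of "- E"] m[of E']] D.restr_Int[OF all_borel[of "- E"] all_borel[of E'] P']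
   by (simp add: Int_commute Diff_eq)
  have "dual_restr (E \<union> E') \<Psi> = (%x. dual_restr E \<Psi> x + dual_restr (E' - E) \<Psi> x)"
   using D.restr_Un[OF all_borel[of E] all_borel[of "E' - E"] _ P'] by simp
  then show "norm' (dual_restr (E \<union> E') \<Psi>) <= norm' (dual_restr E \<Psi>) + norm' (dual_restr E' \<Psi>)"
   using sub_dual.norm_add[OF dual_restr_in[OF P(1) all_borel[of E]] dual_restr_in[OF P(1) all_borel[of "E' - E"]]] mono
   by simp
  {
   assume d: "E \<inter> E' = {}"
   then have "E \<inter> (E \<union> E') = E" "- E \<inter> (E \<union> E') = E'" by auto
   then show "norm' (dual_restr E \<Psi>) + norm' (dual_restr E' \<Psi>) <= norm' (dual_restr (E \<union> E') \<Psi>)"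
    using D.restr_norm[OF all_borel[of E] m[of "E \<union> E'"]] D.restr_Int[OF all_borel[of E] all_borel[of "E \<union> E'"] P']
     D.restr_Int[OF all_borel[of "- E"] all_borel[of "E \<union> E'"] P'] by simp
  }
  assume "finite E"
  then have "dual_restr E \<Psi> = (%F. 0)" using cut_finite_zero[OF P] by (auto simp: dual_restr_def)
  then show "norm' (dual_restr E \<Psi>) = 0" using sub_dual.norm_zero by simp
 qed
qed

text \<open>\<open>f x\<close> stands for a translate of a functional and \<open>K\<close> for
  \<open>\<Omega>\<close> in one of its two orders. If the level set were infinite, the sets
  \<open>E x\<close> on which \<open>K x\<close> is at least \<open>\<delta>\<close> would all carry
  a fixed mass of \<open>\<Psi>\<close>, and \<open>half_graph\<close> would contradict the
  hypothesis on \<open>K\<close>.\<close>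

lemma finite_level_set_singular:
 assumes P: "\<Psi> \<in> X'" "!!t. \<Psi> (coord t) = 0" and f: "!!x. f x \<in> X" and M: "0 < M" and K1: "!!x y. K x y <= 1"
  and bound: "!!x E c. 0 <= c ==> (!!y. y \<in> E ==> K x y <= c) ==> adual_norm A (cut E (f x)) <= c * \<omega> x * M"
  and K: "!!x y \<delta>. inj (x :: nat => 'g) ==> inj y ==> 0 < \<delta> ==> (\<forall>n m. n <= m --> \<delta> <= K (x n) (y m)) ==> False"
  and \<eta>: "\<eta> > 0"
 shows "finite {x. \<eta> * \<omega> x <= cmod (\<Psi> (f x))}"
proof (rule ccontr)
 assume inf: "infinite {x. \<eta> * \<omega> x <= cmod (\<Psi> (f x))}"
 interpret additive_set_function "%E. norm' (dual_restr E \<Psi>)" by (rule additive_set_function_singular[OF P])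
 define S where "S = norm' \<Psi>"
 have S: "0 <= S" unfolding S_def by (rule sub_dual.norm_nonneg[OF P(1)])
 \<comment> \<open>Chosen so that the part of \<open>f x\<close> off \<open>E x\<close> accounts for
   at most half of \<open>\<eta> * \<omega> x\<close>; adding 1 keeps the denominator
   positive.\<close>
 define \<delta> where "\<delta> = \<eta> / (2 * (S * M + 1))"
 have SM: "0 < S * M + 1" using S M by (intro add_nonneg_pos mult_nonneg_nonneg) auto
 have \<delta>: "\<delta> > 0" "S * (\<delta> * M) <= \<eta> / 2"
 proof -
  show "\<delta> > 0" using \<eta> SM by (simp add: \<delta>_def)
  have "S * (\<delta> * M) = (S * M) * \<eta> / (2 * (S * M + 1))" by (simp add: \<delta>_def)
  also have "\<dots> <= \<eta> / 2" using SM \<eta> by (simp add: divide_simps)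
  finally show "S * (\<delta> * M) <= \<eta> / 2" .
 qed
 define E where "E x = {y. \<delta> <= K x y}" for x
 have "\<eta> / (2 * M) <= norm' (dual_restr (E x) \<Psi>)" if x: "x \<in> {x. \<eta> * \<omega> x <= cmod (\<Psi> (f x))}" for x
 proof -
  have w: "0 < \<omega> x" by (rule weight_pos(1)[OF weight])
  have "cmod (\<Psi> (cut (- E x) (f x))) <= S * adual_norm A (cut (- E x) (f x))"
   unfolding S_def by (rule sub.dual_norm_bound[OF P(1) cut_in[OF f all_borel]])
  also have "\<dots> <= S * (\<delta> * \<omega> x * M)" by (intro mult_left_mono bound S) (use \<delta> in "auto simp: E_def")
  also have "\<dots> = (S * (\<delta> * M)) * \<omega> x" by simp
  also have "\<dots> <= \<eta> / 2 * \<omega> x" using \<delta> w by (intro mult_right_mono) auto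
  finally have 1: "cmod (\<Psi> (cut (- E x) (f x))) <= \<eta> / 2 * \<omega> x" .
  have "\<Psi> (f x) = \<Psi> (cut (E x) (f x)) + \<Psi> (cut (- E x) (f x))"
   using top_dual_add[OF P(1) cut_in[OF f[of x] all_borel, where E="E x"] cut_in[OF f[of x] all_borel, where E="- E x"]]
    cut_split[OF in_adual[OF f[of x]] all_borel, where E="E x"] by simp
  then have "\<eta> * \<omega> x <= cmod (\<Psi> (cut (E x) (f x))) + \<eta> / 2 * \<omega> x"
   using x 1 norm_triangle_ineq[of "\<Psi> (cut (E x) (f x))" "\<Psi> (cut (- E x) (f x))"] by simp
  moreover have "cmod (\<Psi> (cut (E x) (f x))) <= norm' (dual_restr (E x) \<Psi>) * adual_norm A (f x)"
   using sub.dual_norm_bound[OF dual_restr_in[OF P(1) all_borel, of "E x"] f[of x]] f by (simp add: dual_restr_def)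
  \<comment> \<open>The same bound with \<open>E = UNIV\<close> and \<open>c = 1\<close> controls
    the whole norm of \<open>f x\<close>.\<close>
  moreover have "adual_norm A (f x) <= \<omega> x * M"
   using bound[of 1 UNIV x] K1 cut_UNIV[OF in_adual[OF f]] by simp
  then have "norm' (dual_restr (E x) \<Psi>) * adual_norm A (f x) <= norm' (dual_restr (E x) \<Psi>) * (\<omega> x * M)"
   by (intro mult_left_mono nonneg)
  ultimately have "\<omega> x * (\<eta> / 2) <= \<omega> x * (norm' (dual_restr (E x) \<Psi>) * M)" by (simp add: algebra_simps)
  then show ?thesis using w M by (simp add: divide_simps ac_simps)
 qed
 moreover have "0 < \<eta> / (2 * M)" using \<eta> M by simp
 ultimately obtain x :: "nat => 'g" and y where "inj x" "inj y" "\<forall>n m. n <= m --> y m \<in> E (x n)"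
  using half_graph[OF inf, of "\<eta> / (2 * M)" E] by blast
 then show False using K[of x y \<delta>] \<delta>(1) by (auto simp: E_def)
qed

end

section \<open>Norm convergent series and their tails\<close>

lemma infsum_compl_finite:
 fixes g :: "'i => real"
 assumes "g summable_on UNIV" "finite T"
 shows "infsum g (- T) = infsum g UNIV - sum g T"
 using infsum_Un_disjoint[of g T "- T"] assms summable_on_subset_banach[OF assms(1), of "- T"] by simp

lemma infsum_tail_small:
 fixes g :: "'i => real"
 assumes "g summable_on UNIV" "\<eta> > 0"
 obtains T where "finite T" "infsum g (- T) < \<eta>"
proof -
 obtain T where T: "finite T" "dist (sum g T) (infsum g UNIV) <= \<eta> / 2"
  using infsum_finite_approximation[OF assms(1), of "\<eta> / 2"] assms(2) by auto
 have "infsum g (- T) < \<eta>"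
  unfolding infsum_compl_finite[OF assms(1) T(1)] using T(2) assms(2) unfolding dist_real_def by linarith
 then show ?thesis using that T(1) by blast
qed

text \<open>The tail bound makes the series converge to \<open>G\<close> in norm along finite
  subsets, so a bounded functional may be applied term by term.\<close>

lemma (in seminormed_funs) functional_norm_series:
 fixes f :: "'i => 'x => complex"
 assumes \<Psi>: "\<Psi> \<in> top_dual V N" and f: "!!x. f x \<in> V" and G: "G \<in> V" and g: "g summable_on UNIV"
  and b: "!!T. finite T ==> N (%s. G s - (\<Sum>x\<in>T. c x * f x s)) <= infsum g (- T)"
 shows "(\<Sum>\<^sub>\<infinity>x. c x * \<Psi> (f x)) = \<Psi> G"
proof (rule infsumI, unfold has_sum_def)
 have lim: "((%T. dual_norm V N \<Psi> * (infsum g UNIV - sum g T)) \<longlongrightarrow> dual_norm V N \<Psi> * (infsum g UNIV - infsum g UNIV))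
   (finite_subsets_at_top UNIV)"
  using has_sum_infsum[OF g] unfolding has_sum_def by (intro tendsto_intros)
 show "(sum (%x. c x * \<Psi> (f x)) \<longlongrightarrow> \<Psi> G) (finite_subsets_at_top UNIV)"
 proof (rule metric_tendsto_imp_tendsto[OF lim, of _ "\<Psi> G"])
  show "\<forall>\<^sub>F T in finite_subsets_at_top UNIV. dist (\<Sum>x\<in>T. c x * \<Psi> (f x)) (\<Psi> G)
   <= dist (dual_norm V N \<Psi> * (infsum g UNIV - sum g T)) (dual_norm V N \<Psi> * (infsum g UNIV - infsum g UNIV))"
  proof (rule eventually_finite_subsets_at_top_weakI)
   fix T :: "'i set" assume T: "finite T"
   have m: "(%s. \<Sum>x\<in>T. c x * f x s) \<in> V" by (rule sum_in[OF T f])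
   have "dist (\<Sum>x\<in>T. c x * \<Psi> (f x)) (\<Psi> G) = cmod (\<Psi> (%s. G s - (\<Sum>x\<in>T. c x * f x s)))"
    unfolding functional_diff[OF \<Psi> G m] functional_sum[OF \<Psi> T f] by (simp add: dist_norm norm_minus_commute)
   also have "\<dots> <= dual_norm V N \<Psi> * N (%s. G s - (\<Sum>x\<in>T. c x * f x s))"
    by (rule dual_norm_bound[OF \<Psi> diff_in[OF G m]])
   also have "\<dots> <= dual_norm V N \<Psi> * (infsum g UNIV - sum g T)"
    using b[OF T] infsum_compl_finite[OF g T] by (intro mult_left_mono dual_norm_nonneg[OF \<Psi>]) simp
   finally show "dist (\<Sum>x\<in>T. c x * \<Psi> (f x)) (\<Psi> G)
    <= dist (dual_norm V N \<Psi> * (infsum g UNIV - sum g T)) (dual_norm V N \<Psi> * (infsum g UNIV - infsum g UNIV))"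
    by (simp add: dist_real_def)
  qed
 qed
qed

lemma (in atoms) weight_bound_Omega:
 "weight_Omega \<omega> (x, y) <= c ==> \<omega> (x + y) <= c * (\<omega> x * \<omega> y)"
 using weight_pos(1)[OF weight] by (simp add: weight_Omega_def divide_simps mult.assoc split: if_splits)

section \<open>Atomic and singular parts of functionals on an introverted subspace\<close>

context banded_introverted
begin

text \<open>The functional sending \<open>a\<close> to \<open>F\<close> of the product of
  \<open>a\<close> and \<open>b\<close>. Writing it as the action of an evaluation puts it into
  \<open>X\<close> by introversion.\<close>

abbreviation right_act :: "(('x => complex) => complex) => ('x => complex) => ('x => complex) => complex" where
 "right_act F b \<equiv> bidual_act A (evaluation X b) F"

lemma right_act_in: "F \<in> X ==> b \<in> carr A ==> right_act F b \<in> X"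
 by (intro bidual_act_in evaluation_in)

lemma right_act_apply: "F \<in> X ==> a \<in> carr A ==> b \<in> carr A ==> right_act F b a = F (vmult A a b)"
 by (simp add: bidual_act_evaluation)

lemma right_act_norm: "F \<in> X ==> b \<in> carr A ==> adual_norm A (right_act F b) <= adual_norm A F * vnorm A b"
 by (rule order_trans[OF bidual_act_norm[OF evaluation_in(1)]])
  (simp_all add: mult.commute[of "adual_norm A F"] mult_right_mono evaluation_in(2) sub.norm_nonneg)

text \<open>Cutting to \<open>E\<close> restricts the second factor of the product to points with
  \<open>\<Omega> (x, y) <= c\<close>; small \<open>\<Omega>\<close> thus becomes a small
  norm.\<close>

lemma cut_func_act_norm:
 assumes F: "F \<in> X" and c: "0 <= c" "!!y. y \<in> E ==> \<omega> (x + y) <= c * (\<omega> x * \<omega> y)"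
 shows "adual_norm A (cut E (func_act A F (e x))) <= c * \<omega> x * adual_norm A F"
proof (rule adual_norm_le)
 show "0 <= c * \<omega> x * adual_norm A F" using c(1) weight_pos(2)[OF weight] sub.norm_nonneg[OF F] by simp
 fix b assume b: "b \<in> carr A"
 have m: "\<rho> E b \<in> carr A" by (rule restr_in[OF all_borel b])
 have "cmod (F (vmult A (e x) (\<rho> E b))) <= adual_norm A F * vnorm A (vmult A (e x) (\<rho> E b))"
  by (rule adual_bound[OF in_adual[OF F] mult_in[OF atom_in m]])
 also have "\<dots> <= adual_norm A F * (c * \<omega> x * vnorm A b)"
  by (intro mult_left_mono atom_mult_restr b c sub.norm_nonneg[OF F])
 finally show "cmod (cut E (func_act A F (e x)) b) <= c * \<omega> x * adual_norm A F * vnorm A b"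
  using b m by (simp add: cut_def func_act_apply ac_simps)
qed

lemma cut_right_act_norm:
 assumes F: "F \<in> X" and c: "0 <= c" "!!y. y \<in> E ==> \<omega> (y + x) <= c * (\<omega> y * \<omega> x)"
 shows "adual_norm A (cut E (right_act F (e x))) <= c * \<omega> x * adual_norm A F"
proof (rule adual_norm_le)
 show "0 <= c * \<omega> x * adual_norm A F" using c(1) weight_pos(2)[OF weight] sub.norm_nonneg[OF F] by simp
 fix b assume b: "b \<in> carr A"
 have m: "\<rho> E b \<in> carr A" by (rule restr_in[OF all_borel b])
 have "cmod (F (vmult A (\<rho> E b) (e x))) <= adual_norm A F * vnorm A (vmult A (\<rho> E b) (e x))"
  by (rule adual_bound[OF in_adual[OF F] mult_in[OF m atom_in]])
 also have "\<dots> <= adual_norm A F * (c * \<omega> x * vnorm A b)"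
  by (intro mult_left_mono restr_mult_atom b c sub.norm_nonneg[OF F])
 finally show "cmod (cut E (right_act F (e x)) b) <= c * \<omega> x * adual_norm A F * vnorm A b"
  using b m by (simp add: cut_def right_act_apply F atom_in ac_simps)
qed

text \<open>The part of \<open>\<Phi>\<close> carried by the point masses, with the coordinates of
  \<open>\<Phi>\<close> as coefficients; what remains of \<open>\<Phi>\<close> is singular.\<close>

definition atomic :: "((('x => complex) => complex) => complex) => (('x => complex) => complex) => complex" where
 "atomic \<Phi> F = (if F \<in> X then \<Sum>\<^sub>\<infinity>x. \<Phi> (coord x) * F (e x) else 0)"

lemma functional_atom_bound: "F \<in> X ==> cmod (F (e x)) <= adual_norm A F * \<omega> x"
 by (rule order_trans[OF adual_bound[OF in_adual atom_in]]) (auto intro!: mult_left_mono atom_norm sub.norm_nonneg)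

lemma dual_coord_summable:
 assumes "\<Phi> \<in> X'"
 shows "(%x. \<omega> x * cmod (\<Phi> (coord x))) summable_on T" "(\<Sum>\<^sub>\<infinity>x\<in>T. \<omega> x * cmod (\<Phi> (coord x))) <= norm' \<Phi>"
proof -
 interpret D: atoms "introverted_dual A X" \<omega> "%x. evaluation X (e x)" "%t. evaluation X' (coord t)"
  by (rule atoms_dual[OF atoms_axioms coord_mem])
 have w: "cmod (complex_of_real (\<omega> x) * evaluation X' (coord x) \<Phi>) = \<omega> x * cmod (\<Phi> (coord x))" for x
  using assms weight_pos(2)[OF weight, of x] by (simp add: norm_mult evaluation_def)
 have "cmod (complex_of_real (\<omega> x)) <= 1 * \<omega> x" for x using weight_pos(2)[OF weight, of x] by simp
 note D.coord_abs_summable[of \<Phi> "%x. complex_of_real (\<omega> x)" 1 T, unfolded w dual_algebra_simps, OF assms this]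
 then show "(%x. \<omega> x * cmod (\<Phi> (coord x))) summable_on T" "(\<Sum>\<^sub>\<infinity>x\<in>T. \<omega> x * cmod (\<Phi> (coord x))) <= norm' \<Phi>" by auto
qed

lemma coord_multiple_summable:
 assumes P: "\<Phi> \<in> X'" and k: "!!x. cmod (k x) <= M * \<omega> x"
 shows "(%x. \<Phi> (coord x) * k x) summable_on T"
  and "cmod (\<Sum>\<^sub>\<infinity>x\<in>T. \<Phi> (coord x) * k x) <= M * (\<Sum>\<^sub>\<infinity>x\<in>T. \<omega> x * cmod (\<Phi> (coord x)))"
proof -
 have le: "cmod (\<Phi> (coord x) * k x) <= M * (\<omega> x * cmod (\<Phi> (coord x)))" for x
  using mult_right_mono[OF k[of x], of "cmod (\<Phi> (coord x))"] by (simp add: norm_mult ac_simps)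
 have s: "(%x. M * (\<omega> x * cmod (\<Phi> (coord x)))) summable_on T"
  by (intro summable_on_cmult_right dual_coord_summable[OF P])
 have a: "(%x. cmod (\<Phi> (coord x) * k x)) summable_on T"
  by (rule summable_on_comparison_test[OF s le]) simp
 then show "(%x. \<Phi> (coord x) * k x) summable_on T" by (rule abs_summable_summable)
 have "cmod (\<Sum>\<^sub>\<infinity>x\<in>T. \<Phi> (coord x) * k x) <= (\<Sum>\<^sub>\<infinity>x\<in>T. cmod (\<Phi> (coord x) * k x))" by (rule norm_infsum_bound[OF a])
 also have "\<dots> <= (\<Sum>\<^sub>\<infinity>x\<in>T. M * (\<omega> x * cmod (\<Phi> (coord x))))" by (rule infsum_mono[OF a s le])
 finally show "cmod (\<Sum>\<^sub>\<infinity>x\<in>T. \<Phi> (coord x) * k x) <= M * (\<Sum>\<^sub>\<infinity>x\<in>T. \<omega> x * cmod (\<Phi> (coord x)))"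
  by (simp add: infsum_cmult_right')
qed

lemma atomic_bound:
 assumes "\<Phi> \<in> X'" "F \<in> X" shows "cmod (atomic \<Phi> F) <= norm' \<Phi> * adual_norm A F"
 using coord_multiple_summable(2)[OF assms(1) functional_atom_bound[OF assms(2)], of UNIV] assms(2)
  mult_left_mono[OF dual_coord_summable(2)[OF assms(1), of UNIV] sub.norm_nonneg[OF assms(2)]]
 by (simp add: atomic_def mult.commute)

lemma atomic_in: "\<Phi> \<in> X' ==> atomic \<Phi> \<in> X'"
proof (rule top_dualI[where C="norm' \<Phi>"])
 fix F assume P: "\<Phi> \<in> X'" and F: "F \<in> X"
 note s = coord_multiple_summable(1)[OF P functional_atom_bound]
 show "atomic \<Phi> (%x. F x + G x) = atomic \<Phi> F + atomic \<Phi> G" if "G \<in> X" for G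
  using F that subspace_add[OF F that] by (simp add: atomic_def distrib_left infsum_add s)
 show "atomic \<Phi> (%x. c * F x) = c * atomic \<Phi> F" for c
  using F subspace_scale[OF F] by (simp add: atomic_def mult.left_commute infsum_cmult_right')
 show "cmod (atomic \<Phi> F) <= norm' \<Phi> * adual_norm A F" by (rule atomic_bound[OF P F])
qed (simp add: atomic_def)

lemma atomic_coord: "atomic \<Phi> (coord t) = \<Phi> (coord t)"
proof -
 have "(%x. \<Phi> (coord x) * coord t (e x)) = (%x. \<Phi> (coord x) * (if x = t then 1 else 0))"
  by (auto simp: coord_atom)
 then show ?thesis using infsum_single[of "%x. \<Phi> (coord x)" t] coord_mem[of t] by (simp only: atomic_def if_True)
qed

lemma singular_part:
 assumes "\<Phi> \<in> X'"
 shows "(%F. \<Phi> F - atomic \<Phi> F) \<in> X'" "\<Phi> (coord t) - atomic \<Phi> (coord t) = 0"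
 using sub_dual.diff_in[OF assms atomic_in[OF assms]] by (auto simp: atomic_coord)

lemma atomic_diff_finite:
 assumes P: "\<Phi> \<in> X'" and k: "!!x. cmod (k x) <= M * \<omega> x" and T: "finite T"
 shows "cmod ((\<Sum>\<^sub>\<infinity>x. \<Phi> (coord x) * k x) - (\<Sum>x\<in>T. \<Phi> (coord x) * k x))
  <= M * (\<Sum>\<^sub>\<infinity>x\<in>- T. \<omega> x * cmod (\<Phi> (coord x)))"
proof -
 have "(\<Sum>\<^sub>\<infinity>x. \<Phi> (coord x) * k x) = (\<Sum>x\<in>T. \<Phi> (coord x) * k x) + (\<Sum>\<^sub>\<infinity>x\<in>- T. \<Phi> (coord x) * k x)"
  using infsum_Un_disjoint[of "%x. \<Phi> (coord x) * k x" T "- T"] coord_multiple_summable(1)[OF P k] T by simp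
 then show ?thesis using coord_multiple_summable(2)[OF P k, of "- T"] by simp
qed

context
 assumes zero_cluster: "zero_cluster (%p. complex_of_real (weight_Omega \<omega> p))"
begin

text \<open>Left translates of \<open>F\<close> by point masses satisfy the bound of
  \<open>cut_func_act_norm\<close>, and the zero cluster property excludes the half graph. The
  summand 1 in \<open>M\<close> ensures that it is positive also for \<open>F = 0\<close>.\<close>

lemma finite_level_set_left:
 assumes P: "\<Psi> \<in> X'" "!!t. \<Psi> (coord t) = 0" and F: "F \<in> X" and \<eta>: "\<eta> > 0"
 shows "finite {x. \<eta> * \<omega> x <= cmod (\<Psi> (func_act A F (e x)))}"
proof (rule finite_level_set_singular[where K="%x y. weight_Omega \<omega> (x, y)" and M="adual_norm A F + 1", OF P _ _ _ _ _ \<eta>])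
 show "func_act A F (e x) \<in> X" for x by (rule func_act_in[OF F atom_in])
 show "0 < adual_norm A F + 1" using sub.norm_nonneg[OF F] by simp
 show "weight_Omega \<omega> (x, y) <= 1" for x y by (rule weight_Omega_range(2)[OF weight])
 show "adual_norm A (cut E (func_act A F (e x))) <= c * \<omega> x * (adual_norm A F + 1)"
  if c: "0 <= c" "!!y. y \<in> E ==> weight_Omega \<omega> (x, y) <= c" for x E c
  by (rule order_trans[OF cut_func_act_norm[OF F c(1) weight_bound_Omega[OF c(2)]]])
   (use c(1) weight_pos(2)[OF weight, of x] in "auto intro!: mult_left_mono")
 show False if "inj x" "inj y" "0 < \<delta>" "\<forall>n m. n <= m --> \<delta> <= weight_Omega \<omega> (x n, y m)"
  for x y :: "nat => 'g" and \<delta>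
  using zero_cluster_no_half_graph[OF weight zero_cluster that(1-3)] that(4) by blast
qed

lemma finite_level_set_right:
 assumes P: "\<Phi> \<in> X'" "!!t. \<Phi> (coord t) = 0" and F: "F \<in> X" and \<eta>: "\<eta> > 0"
 shows "finite {x. \<eta> * \<omega> x <= cmod (\<Phi> (right_act F (e x)))}"
proof (rule finite_level_set_singular[where K="%x y. weight_Omega \<omega> (y, x)" and M="adual_norm A F + 1", OF P _ _ _ _ _ \<eta>])
 show "right_act F (e x) \<in> X" for x by (rule right_act_in[OF F atom_in])
 show "0 < adual_norm A F + 1" using sub.norm_nonneg[OF F] by simp
 show "weight_Omega \<omega> (y, x) <= 1" for x y by (rule weight_Omega_range(2)[OF weight])
 show "adual_norm A (cut E (right_act F (e x))) <= c * \<omega> x * (adual_norm A F + 1)"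
  if c: "0 <= c" "!!y. y \<in> E ==> weight_Omega \<omega> (y, x) <= c" for x E c
  by (rule order_trans[OF cut_right_act_norm[OF F c(1) weight_bound_Omega[OF c(2)]]])
   (use c(1) weight_pos(2)[OF weight, of x] in "auto intro!: mult_left_mono")
 \<comment> \<open>The sequences enter \<open>\<Omega>\<close> in exchanged order, so the half graph
   lies on the other side of the diagonal and the second alternative of
   \<open>zero_cluster_no_half_graph\<close> applies.\<close>
 show False if "inj x" "inj y" "0 < \<delta>" "\<forall>n m. n <= m --> \<delta> <= weight_Omega \<omega> (y m, x n)"
  for x y :: "nat => 'g" and \<delta>
  using zero_cluster_no_half_graph[OF weight zero_cluster that(2,1,3)] that(4) by blast
qed

text \<open>The functional \<open>bidual_act A \<Psi> F\<close> satisfies the criterion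
  \<open>singular_functional_eq_0\<close>. Its level sets on point masses are finite by the left
  version; that it vanishes on singular \<open>a\<close> is the same criterion for
  \<open>func_act A F a\<close>, with \<open>a\<close> regarded as a singular functional in the
  right version.\<close>

lemma singular_product_zero:
 assumes P: "\<Phi> \<in> X'" "!!t. \<Phi> (coord t) = 0" and Q: "\<Psi> \<in> X'" "!!t. \<Psi> (coord t) = 0" and F: "F \<in> X"
 shows "\<Phi> (bidual_act A \<Psi> F) = 0"
proof (rule singular_functional_eq_0[OF P bidual_act_in[OF Q(1) F]])
 fix a assume a: "a \<in> carr A" "!!t. coord t a = 0"
 have "\<Psi> (func_act A F a) = 0"
 proof (rule singular_functional_eq_0[OF Q func_act_in[OF F a(1)]])
  fix b assume "b \<in> carr A" "!!t. coord t b = 0"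
  then show "func_act A F a b = 0" using singular_mult[OF in_adual[OF F] a(1)] a(2) by (simp add: func_act_apply)
 next
  fix \<eta> :: real assume \<eta>: "\<eta> > 0"
  have "finite {x. \<eta> * \<omega> x <= cmod (evaluation X a (right_act F (e x)))}"
   by (rule finite_level_set_right[OF evaluation_in(1)[OF a(1)] _ F \<eta>]) (simp add: evaluation_apply coord_mem a(2))
  then show "finite {x. \<eta> * \<omega> x <= cmod (func_act A F a (e x))}"
   by (simp add: evaluation_apply right_act_in F atom_in right_act_apply a(1) func_act_apply)
 qed
 then show "bidual_act A \<Psi> F a = 0" by (simp add: bidual_act_def)
next
 fix \<eta> :: real assume "\<eta> > 0"
 then show "finite {x. \<eta> * \<omega> x <= cmod (bidual_act A \<Psi> F (e x))}"
  using finite_level_set_left[OF Q F] by (simp add: bidual_act_def atom_in)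
qed

text \<open>The dual reproduces the structure of \<open>A\<close>: products of singular functionals
  vanish by \<open>singular_product_zero\<close>, and finite restrictions approximate
  \<open>atomic \<Phi>\<close> because the coordinates of \<open>\<Phi>\<close> are summable. Hence
  the regularity criterion applies to the dual algebra as well.\<close>

lemma banded_dual:
 "banded (introverted_dual A X) \<omega> (%x. evaluation X (e x)) (%t. evaluation X' (coord t)) dual_restr"
proof -
 interpret D: atoms "introverted_dual A X" \<omega> "%x. evaluation X (e x)" "%t. evaluation X' (coord t)"
  by (rule atoms_dual[OF atoms_axioms coord_mem])
 interpret R: restriction "introverted_dual A X" dual_restr by (rule restriction_dual)
 show ?thesis
 proof (unfold_locales, unfold dual_algebra_simps)
  show "(E :: 'g set) \<in> Borel" for E by (rule all_borel)
  show "evaluation X' (coord t) (evaluation X (e x)) = (if t = x then 1 else 0)" for t x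
   using evaluation_in(1)[OF atom_in] by (simp add: evaluation_def[of X'] evaluation_apply coord_mem coord_atom)
 next
  fix \<Phi> x assume P: "\<Phi> \<in> X'"
  show "dual_restr {x} \<Phi> = (%F. evaluation X' (coord x) \<Phi> * evaluation X (e x) F)"
  proof
   fix F show "dual_restr {x} \<Phi> F = evaluation X' (coord x) \<Phi> * evaluation X (e x) F"
    using P cut_finite[of "{x}" F] in_adual[of F] top_dual_scale[OF P coord_mem]
    by (simp add: dual_restr_def evaluation_def)
  qed
 next
  fix \<Phi> x c and E :: "'g set"
  assume P: "\<Phi> \<in> X'" and c: "0 <= c" "!!y. y \<in> E ==> \<omega> (x + y) <= c * (\<omega> x * \<omega> y)"
  have m: "dual_restr E \<Phi> \<in> X'" by (rule dual_restr_in[OF P all_borel])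
  show "norm' (arens_mult A X (evaluation X (e x)) (dual_restr E \<Phi>)) <= c * \<omega> x * norm' \<Phi>"
  proof (rule sub.dual_norm_le)
   show "0 <= c * \<omega> x * norm' \<Phi>" using c(1) weight_pos(2)[OF weight] sub_dual.norm_nonneg[OF P] by simp
   fix F assume F: "F \<in> X"
   have "arens_mult A X (evaluation X (e x)) (dual_restr E \<Phi>) F = \<Phi> (cut E (func_act A F (e x)))"
    using bidual_act_in[OF m F] func_act_in[OF F atom_in]
    by (simp add: arens_mult_apply F evaluation_apply bidual_act_def atom_in dual_restr_def)
   moreover have "cmod (\<Phi> (cut E (func_act A F (e x)))) <= norm' \<Phi> * (c * \<omega> x * adual_norm A F)"
    by (rule order_trans[OF sub.dual_norm_bound[OF P cut_in[OF func_act_in[OF F atom_in] all_borel]]])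
     (intro mult_left_mono cut_func_act_norm F c sub_dual.norm_nonneg P)
   ultimately show "cmod (arens_mult A X (evaluation X (e x)) (dual_restr E \<Phi>) F) <= c * \<omega> x * norm' \<Phi> * adual_norm A F"
    by (simp add: ac_simps)
  qed
 next
  fix \<Phi> x c and E :: "'g set"
  assume P: "\<Phi> \<in> X'" and c: "0 <= c" "!!y. y \<in> E ==> \<omega> (y + x) <= c * (\<omega> y * \<omega> x)"
  have m: "dual_restr E \<Phi> \<in> X'" by (rule dual_restr_in[OF P all_borel])
  show "norm' (arens_mult A X (dual_restr E \<Phi>) (evaluation X (e x))) <= c * \<omega> x * norm' \<Phi>"
  proof (rule sub.dual_norm_le)
   show "0 <= c * \<omega> x * norm' \<Phi>" using c(1) weight_pos(2)[OF weight] sub_dual.norm_nonneg[OF P] by simp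
   fix F assume F: "F \<in> X"
   have "arens_mult A X (dual_restr E \<Phi>) (evaluation X (e x)) F = \<Phi> (cut E (right_act F (e x)))"
    using right_act_in[OF F atom_in] by (simp add: arens_mult_apply F dual_restr_def)
   moreover have "cmod (\<Phi> (cut E (right_act F (e x)))) <= norm' \<Phi> * (c * \<omega> x * adual_norm A F)"
    by (rule order_trans[OF sub.dual_norm_bound[OF P cut_in[OF right_act_in[OF F atom_in] all_borel]]])
     (intro mult_left_mono cut_right_act_norm F c sub_dual.norm_nonneg P)
   ultimately show "cmod (arens_mult A X (dual_restr E \<Phi>) (evaluation X (e x)) F) <= c * \<omega> x * norm' \<Phi> * adual_norm A F"
    by (simp add: ac_simps)
  qed
 next
  fix G \<Phi> \<Psi> assume G: "G \<in> adual (introverted_dual A X)" and PQ: "\<Phi> \<in> X'" "\<Psi> \<in> X'"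
   and z: "!!t. evaluation X' (coord t) \<Phi> = 0" "!!t. evaluation X' (coord t) \<Psi> = 0"
  have "arens_mult A X \<Phi> \<Psi> = (%F. 0)"
   using singular_product_zero[OF PQ(1) _ PQ(2)] z PQ by (auto simp: arens_mult_def evaluation_def)
  then show "G (arens_mult A X \<Phi> \<Psi>) = 0"
   using sub_dual.functional_zero[of G] G by (simp add: adual_def)
 next
  fix \<Phi> assume P: "\<Phi> \<in> X'"
  show "\<exists>p\<in>X'. (\<forall>t. evaluation X' (coord t) p = evaluation X' (coord t) \<Phi>) &
    (\<forall>\<eta>>0. \<exists>T. finite T & norm' (%x. p x - dual_restr T \<Phi> x) < \<eta>)"
  proof (intro bexI[of _ "atomic \<Phi>"] conjI allI impI)
   fix t show "evaluation X' (coord t) (atomic \<Phi>) = evaluation X' (coord t) \<Phi>"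
    using P atomic_in[OF P] by (simp add: evaluation_def atomic_coord)
  next
   fix \<eta> :: real assume "\<eta> > 0"
   then obtain T where T: "finite T" "(\<Sum>\<^sub>\<infinity>x\<in>- T. \<omega> x * cmod (\<Phi> (coord x))) < \<eta>"
    by (rule infsum_tail_small[OF dual_coord_summable(1)[OF P]])
   have "norm' (%x. atomic \<Phi> x - dual_restr T \<Phi> x) <= (\<Sum>\<^sub>\<infinity>x\<in>- T. \<omega> x * cmod (\<Phi> (coord x)))"
   proof (rule sub.dual_norm_le)
    show "0 <= (\<Sum>\<^sub>\<infinity>x\<in>- T. \<omega> x * cmod (\<Phi> (coord x)))" by (intro infsum_nonneg) (simp add: weight_pos(2)[OF weight])
    fix F assume F: "F \<in> X"
    have "dual_restr T \<Phi> F = (\<Sum>x\<in>T. \<Phi> (coord x) * F (e x))"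
     using F sub.functional_sum[OF P T(1) coord_mem, of "%x. F (e x)"]
     by (simp add: dual_restr_def cut_finite[OF T(1) in_adual[OF F]] mult.commute)
    then show "cmod (atomic \<Phi> F - dual_restr T \<Phi> F) <= (\<Sum>\<^sub>\<infinity>x\<in>- T. \<omega> x * cmod (\<Phi> (coord x))) * adual_norm A F"
     using atomic_diff_finite[OF P functional_atom_bound[OF F] T(1)] F by (simp add: atomic_def mult.commute)
   qed
   then show "\<exists>T. finite T & norm' (%x. atomic \<Phi> x - dual_restr T \<Phi> x) < \<eta>" using T by force
  qed (rule atomic_in[OF P])
 qed
qed

end

end

text \<open>Split \<open>\<Phi>\<close> into atomic and singular part. The atomic part acts through
  a norm convergent series and gives \<open>G1\<close>. For the singular part split
  \<open>\<Psi>\<close> too: singular times singular vanishes, and the atomic part of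
  \<open>\<Psi>\<close> involves only the values \<open>k y\<close> on point masses, which give
  \<open>G2\<close>. Altogether \<open>\<Psi>\<close> is evaluated at \<open>G1 + G2\<close>, as
  \<open>arens_regularI\<close> requires.\<close>

theorem (in banded) arens_regular_if_zero_cluster:
 assumes z: "zero_cluster (%p. complex_of_real (weight_Omega \<omega> p))"
 shows "arens_regular A"
proof (rule arens_regularI)
 interpret W: introverted A "adual A" by (rule introverted_adual)
 interpret W: banded_introverted A \<omega> e coord \<rho> "adual A"
  by unfold_locales (simp_all add: cut_in_adual coord_in)
 fix \<Phi> F assume P: "\<Phi> \<in> W.X'" and F: "F \<in> adual A"
 let ?S = "%F. \<Phi> F - W.atomic \<Phi> F"
 note S = W.singular_part[OF P]
 define G1 where "G1 b = (if b \<in> carr A then W.atomic \<Phi> (W.right_act F b) else 0)" for b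
 define k where "k y = ?S (W.right_act F (e y))" for y
 define C where "C = W.norm' ?S * adual_norm A F"
 have k: "cmod (k y) <= C * \<omega> y" for y
 proof -
  have "cmod (k y) <= W.norm' ?S * adual_norm A (W.right_act F (e y))"
   unfolding k_def by (rule dual.dual_norm_bound[OF S(1) W.right_act_in[OF F atom_in]])
  also have "\<dots> <= W.norm' ?S * (adual_norm A F * \<omega> y)"
   by (intro mult_left_mono[OF _ W.sub_dual.norm_nonneg[OF S(1)]] order_trans[OF W.right_act_norm[OF F atom_in]]
     mult_left_mono[OF atom_norm dual.norm_nonneg[OF F]])
  finally show ?thesis by (simp add: C_def)
 qed
 define G2 where "G2 = coord_series k"
 have G2: "G2 \<in> adual A" unfolding G2_def by (rule coord_series_in[OF k])
 have G2e: "G2 (e y) = k y" for y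
  using infsum_single[of k y] by (simp add: G2_def coord_series_def atom_in coord_atom)
 have Fe: "cmod (F (vmult A (e x) b)) <= (adual_norm A F * vnorm A b) * \<omega> x" if "b \<in> carr A" for x b
  using W.functional_atom_bound[OF W.right_act_in[OF F that], of x] W.right_act_norm[OF F that]
   mult_right_mono[OF W.right_act_norm[OF F that] weight_pos(2)[OF weight, of x]]
  by (simp add: W.right_act_apply F atom_in that)
 have Fe': "cmod (F (vmult A b (e x))) <= (adual_norm A F * vnorm A b) * \<omega> x" if "b \<in> carr A" for x b
  using adual_product_bound[OF F that atom_in] mult_left_mono[OF atom_norm, of "adual_norm A F * vnorm A b" x]
   dual.norm_nonneg[OF F] norm_nonneg[OF that] by (simp add: mult.assoc) (meson order_trans)
 have G1: "G1 \<in> adual A"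
  unfolding adual_def
 proof (rule top_dualI[where C="W.norm' \<Phi> * adual_norm A F"])
  fix a assume a: "a \<in> carr A"
  show "cmod (G1 a) <= W.norm' \<Phi> * adual_norm A F * vnorm A a"
   using order_trans[OF W.atomic_bound[OF P W.right_act_in[OF F a]]
     mult_left_mono[OF W.right_act_norm[OF F a] W.sub_dual.norm_nonneg[OF P]]] a
   by (simp add: G1_def mult.assoc)
  have "W.right_act F (%x. c * a x) = (%s. c * W.right_act F a s)" for c
   by (auto simp: W.bidual_act_evaluation F a scale_in mult_scale_right)
  then show "G1 (%x. c * a x) = c * G1 a" for c
   using a scale_in[OF a] by (simp add: G1_def top_dual_scale[OF W.atomic_in[OF P]] W.right_act_in F)
  show "G1 (%x. a x + b x) = G1 a + G1 b" if b: "b \<in> carr A" for b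
  proof -
   have "W.right_act F (%x. a x + b x) = (%s. W.right_act F a s + W.right_act F b s)"
    by (auto simp: W.bidual_act_evaluation F a b add_in mult_add_right)
   then show ?thesis
    using a b add_in[OF a b] by (simp add: G1_def top_dual_add[OF W.atomic_in[OF P]] W.right_act_in F)
  qed
 qed (simp add: G1_def)
 have "\<Phi> (bidual_act A \<Psi> F) = \<Psi> (%s. G1 s + G2 s)" if Q: "\<Psi> \<in> W.X'" for \<Psi>
 proof -
  let ?T = "%F. \<Psi> F - W.atomic \<Psi> F"
  note T = W.singular_part[OF Q]
  \<comment> \<open>Expands \<open>G1\<close> as a norm convergent series, so that
    \<open>\<Psi>\<close> may be moved inside the sum defining the atomic part of
    \<open>\<Phi>\<close>.\<close>
  have "(\<Sum>\<^sub>\<infinity>x. \<Phi> (coord x) * \<Psi> (func_act A F (e x))) = \<Psi> G1"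
  proof (rule dual.functional_norm_series[OF Q func_act_in_adual[OF F atom_in] G1])
   show "(%x. adual_norm A F * (\<omega> x * cmod (\<Phi> (coord x)))) summable_on UNIV"
    by (intro summable_on_cmult_right W.dual_coord_summable P)
   fix I :: "'g set" assume I: "finite I"
   show "adual_norm A (%s. G1 s - (\<Sum>x\<in>I. \<Phi> (coord x) * func_act A F (e x) s))
     <= (\<Sum>\<^sub>\<infinity>x\<in>- I. adual_norm A F * (\<omega> x * cmod (\<Phi> (coord x))))"
   proof (rule adual_norm_le)
    show "0 <= (\<Sum>\<^sub>\<infinity>x\<in>- I. adual_norm A F * (\<omega> x * cmod (\<Phi> (coord x))))"
     by (intro infsum_nonneg) (simp add: weight_pos(2)[OF weight] dual.norm_nonneg[OF F])
    fix b assume b: "b \<in> carr A"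
    show "cmod (G1 b - (\<Sum>x\<in>I. \<Phi> (coord x) * func_act A F (e x) b))
      <= (\<Sum>\<^sub>\<infinity>x\<in>- I. adual_norm A F * (\<omega> x * cmod (\<Phi> (coord x)))) * vnorm A b"
     unfolding infsum_cmult_right'
     using W.atomic_diff_finite[OF P Fe[OF b] I] b W.right_act_in[OF F b]
     by (simp add: G1_def W.atomic_def W.right_act_apply F atom_in func_act_apply ac_simps)
   qed
  qed
  then have 1: "W.atomic \<Phi> (bidual_act A \<Psi> F) = \<Psi> G1"
   using W.bidual_act_in[OF Q F] by (simp add: W.atomic_def bidual_act_def atom_in)
  have "(\<Sum>\<^sub>\<infinity>x. \<Psi> (coord x) * ?S (W.right_act F (e x))) = ?S (bidual_act A (W.atomic \<Psi>) F)"
  proof (rule dual.functional_norm_series[OF S(1) W.right_act_in[OF F atom_in] W.bidual_act_in[OF W.atomic_in[OF Q] F]])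
   show "(%x. adual_norm A F * (\<omega> x * cmod (\<Psi> (coord x)))) summable_on UNIV"
    by (intro summable_on_cmult_right W.dual_coord_summable Q)
   fix I :: "'g set" assume I: "finite I"
   show "adual_norm A (%s. bidual_act A (W.atomic \<Psi>) F s - (\<Sum>x\<in>I. \<Psi> (coord x) * W.right_act F (e x) s))
     <= (\<Sum>\<^sub>\<infinity>x\<in>- I. adual_norm A F * (\<omega> x * cmod (\<Psi> (coord x))))"
   proof (rule adual_norm_le)
    show "0 <= (\<Sum>\<^sub>\<infinity>x\<in>- I. adual_norm A F * (\<omega> x * cmod (\<Psi> (coord x))))"
     by (intro infsum_nonneg) (simp add: weight_pos(2)[OF weight] dual.norm_nonneg[OF F])
    fix b assume b: "b \<in> carr A"
    show "cmod (bidual_act A (W.atomic \<Psi>) F b - (\<Sum>x\<in>I. \<Psi> (coord x) * W.right_act F (e x) b))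
      <= (\<Sum>\<^sub>\<infinity>x\<in>- I. adual_norm A F * (\<omega> x * cmod (\<Psi> (coord x)))) * vnorm A b"
     unfolding infsum_cmult_right'
     using W.atomic_diff_finite[OF Q Fe'[OF b] I] b func_act_in_adual[OF F b]
     by (simp add: bidual_act_def[of A "W.atomic \<Psi>"] W.atomic_def W.right_act_apply F atom_in func_act_apply
       ac_simps)
   qed
  qed
  then have "W.atomic \<Psi> G2 = ?S (bidual_act A (W.atomic \<Psi>) F)"
   using G2 by (simp add: W.atomic_def[of \<Psi> G2] G2e k_def)
  \<comment> \<open>\<open>G2\<close> is small on point masses off finite sets, so on
    \<open>G2\<close> the functional \<open>\<Psi>\<close> agrees with its atomic part.\<close>
  moreover have "?T G2 = 0"
  proof (rule W.singular_functional_eq_0[OF T G2])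
   fix b assume "b \<in> carr A" "!!t. coord t b = 0"
   then show "G2 b = 0" by (simp add: G2_def coord_series_def)
  next
   fix \<eta> :: real assume "\<eta> > 0"
   then show "finite {x. \<eta> * \<omega> x <= cmod (G2 (e x))}"
    unfolding G2e k_def by (rule W.finite_level_set_right[OF z S F])
  qed
  moreover have "?S (bidual_act A ?T F) = 0"
   by (rule W.singular_product_zero[OF z S T F])
  moreover have "?S (bidual_act A \<Psi> F) = ?S (bidual_act A (W.atomic \<Psi>) F) + ?S (bidual_act A ?T F)"
  proof -
   have "bidual_act A \<Psi> F = (%a. bidual_act A (W.atomic \<Psi>) F a + bidual_act A ?T F a)"
    by (auto simp: bidual_act_def)
   then show ?thesis
    using top_dual_add[OF S(1) W.bidual_act_in[OF W.atomic_in[OF Q] F] W.bidual_act_in[OF T(1) F]] by simp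
  qed
  ultimately have "?S (bidual_act A \<Psi> F) = \<Psi> G2" by simp
  then show ?thesis using 1 top_dual_add[OF Q G1 G2] by (simp add: diff_eq_eq add.commute)
 qed
 then show "\<exists>G\<in>adual A. \<forall>\<Psi>\<in>W.X'. \<Phi> (bidual_act A \<Psi> F) = \<Psi> G"
  using dual.add_in[OF G1 G2] by blast
qed

section \<open>Weighted convolution algebras and functionals vanishing at infinity\<close>

lemma compact_sum_set:
 fixes C K :: "'a::topological_group_add set"
 assumes "compact C" "compact K"
 shows "compact ((%(x, y). - x + y) ` (C \<times> K))" "compact ((%(x, y). x - y) ` (C \<times> K))"
  "compact ((%(x, y). x + y) ` (C \<times> K))"
 by (intro compact_continuous_image compact_Times assms;
   auto simp: case_prod_beta intro!: continuous_intros)+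

text \<open>Both algebras of the theorem satisfy the bound \<open>mult_restr_norm\<close>, which at the same time expresses
 that the norm is submultiplicative (\<open>c = 1\<close>) and that the support of a product is contained in the
 sum of the supports (\<open>c = 0\<close>).\<close>

locale convolution_algebra = restriction A \<rho>
 for A :: "'x falgebra" and \<rho> :: "'g::{topological_group_add, t2_space} set => ('x => complex) => 'x => complex" +
 fixes \<omega> :: "'g => real"
 assumes weight: "weight \<omega>"
  and mult_restr_norm: "a \<in> carr A ==> b \<in> carr A ==> E \<in> Borel ==> E' \<in> Borel ==> K \<in> Borel ==>
   0 <= c ==> (!!x y. x \<in> E ==> y \<in> E' ==> x + y \<in> K ==> \<omega> (x + y) <= c * (\<omega> x * \<omega> y)) ==>
   vnorm A (\<rho> K (vmult A (\<rho> E a) (\<rho> E' b))) <= c * (vnorm A (\<rho> E a) * vnorm A (\<rho> E' b))"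
  and tight: "a \<in> carr A ==> \<eta> > 0 ==> \<exists>C. compact C & vnorm A (\<rho> (- C) a) < \<eta>"
begin

text \<open>The bound may use the norm of \<open>a\<close> instead of that of its restriction, since
  restricting to \<open>- K\<close> is idempotent.\<close>

definition vanishing :: "(('x => complex) => complex) set" where
 "vanishing = {F \<in> adual A. \<forall>\<eta>>0. \<exists>K. compact K & (\<forall>a\<in>carr A. cmod (F (\<rho> (- K) a)) <= \<eta> * vnorm A a)}"

lemma compact_borel: "compact K ==> K \<in> sets (borel :: 'g measure)" "compact K ==> - K \<in> sets (borel :: 'g measure)"
 by (auto intro: compl_borel borel_closed compact_imp_closed)

lemma vanishing_in_adual: "F \<in> vanishing ==> F \<in> adual A"
 by (simp add: vanishing_def)

lemma vanishingE:
 assumes "F \<in> vanishing" "\<eta> > 0"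
 obtains K where "compact K" "\<forall>a\<in>carr A. cmod (F (\<rho> (- K) a)) <= \<eta> * vnorm A a"
 using assms unfolding vanishing_def by blast

lemma vanishing_mono:
 assumes K: "compact K" "\<forall>a\<in>carr A. cmod (F (\<rho> (- K) a)) <= \<eta> * vnorm A a" "0 <= \<eta>"
  and E: "E \<in> Borel" "E \<subseteq> - K" and a: "a \<in> carr A"
 shows "cmod (F (\<rho> E a)) <= \<eta> * vnorm A a"
proof -
 have "\<rho> E a = \<rho> (- K) (\<rho> E a)"
  using restr_Int[OF compact_borel(2)[OF K(1)] E(1) a] E(2) by (simp add: Int_absorb1)
 then have "cmod (F (\<rho> E a)) <= \<eta> * vnorm A (\<rho> E a)" using K(2) restr_in[OF E(1) a] by metis
 also have "\<dots> <= \<eta> * vnorm A a" by (intro mult_left_mono restr_norm_le E a K)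
 finally show ?thesis .
qed

lemma functional_zero_if_norm_zero:
 assumes "F \<in> adual A" "a \<in> carr A" "vnorm A a <= 0" shows "F a = 0"
 using adual_bound[OF assms(1,2)] norm_nonneg[OF assms(2)] assms(3) by simp

sublocale vanishing: subspace_restriction A vanishing \<rho>
proof
 show "vanishing \<subseteq> adual A" using vanishing_in_adual by blast
 show "(%a. 0) \<in> vanishing"
  using dual.zero_in norm_nonneg by (auto simp: vanishing_def intro!: exI[of _ "{}"])
next
 fix F G assume F: "F \<in> vanishing" and G: "G \<in> vanishing"
 show "(%a. F a + G a) \<in> vanishing"
  unfolding vanishing_def
 proof (intro CollectI conjI allI impI dual.add_in vanishing_in_adual F G)
  fix \<eta> :: real assume "\<eta> > 0"
  then have e: "\<eta> / 2 > 0" by simp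
  obtain K where K: "compact K" "\<forall>a\<in>carr A. cmod (F (\<rho> (- K) a)) <= \<eta> / 2 * vnorm A a" by (rule vanishingE[OF F e])
  obtain L where L: "compact L" "\<forall>a\<in>carr A. cmod (G (\<rho> (- L) a)) <= \<eta> / 2 * vnorm A a" by (rule vanishingE[OF G e])
  have U: "compact (K \<union> L)" using K L by auto
  have "cmod (F (\<rho> (- (K \<union> L)) a) + G (\<rho> (- (K \<union> L)) a)) <= \<eta> * vnorm A a" if a: "a \<in> carr A" for a
   using norm_triangle_ineq[of "F (\<rho> (- (K \<union> L)) a)" "G (\<rho> (- (K \<union> L)) a)"]
    vanishing_mono[OF K _ compact_borel(2)[OF U] _ a] vanishing_mono[OF L _ compact_borel(2)[OF U] _ a] e by simp
  then show "\<exists>K. compact K & (\<forall>a\<in>carr A. cmod (F (\<rho> (- K) a) + G (\<rho> (- K) a)) <= \<eta> * vnorm A a)"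
   using U by blast
 qed
next
 fix F c assume F: "F \<in> vanishing"
 show "(%a. c * F a) \<in> vanishing"
  unfolding vanishing_def
 proof (intro CollectI conjI allI impI dual.scale_in vanishing_in_adual F)
  fix \<eta> :: real assume e: "\<eta> > 0"
  define d where "d = \<eta> / (cmod c + 1)"
  have d: "d > 0" "cmod c * d <= \<eta>" using e by (auto simp: d_def divide_simps add_nonneg_pos)
  obtain K where K: "compact K" "\<forall>a\<in>carr A. cmod (F (\<rho> (- K) a)) <= d * vnorm A a" by (rule vanishingE[OF F d(1)])
  have "cmod (c * F (\<rho> (- K) a)) <= \<eta> * vnorm A a" if a: "a \<in> carr A" for a
  proof -
   have "cmod c * cmod (F (\<rho> (- K) a)) <= cmod c * (d * vnorm A a)" using K(2) a by (intro mult_left_mono) auto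
   also have "\<dots> = (cmod c * d) * vnorm A a" by simp
   also have "\<dots> <= \<eta> * vnorm A a" using d norm_nonneg[OF a] by (intro mult_right_mono) auto
   finally show ?thesis by (simp add: norm_mult)
  qed
  then show "\<exists>K. compact K & (\<forall>a\<in>carr A. cmod (c * F (\<rho> (- K) a)) <= \<eta> * vnorm A a)" using K(1) by blast
 qed
next
 fix F and E :: "'g set" assume F: "F \<in> vanishing" and E: "E \<in> Borel"
 show "cut E F \<in> vanishing"
  unfolding vanishing_def
 proof (intro CollectI conjI allI impI cut_in_adual vanishing_in_adual F E)
  fix \<eta> :: real assume e: "\<eta> > 0"
  obtain K where K: "compact K" "\<forall>a\<in>carr A. cmod (F (\<rho> (- K) a)) <= \<eta> * vnorm A a" by (rule vanishingE[OF F e])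
  have "cmod (cut E F (\<rho> (- K) a)) <= \<eta> * vnorm A a" if a: "a \<in> carr A" for a
   using vanishing_mono[OF K less_imp_le[OF e], of "E \<inter> - K" a] restr_Int[OF E compact_borel(2)[OF K(1)] a] E
    compact_borel(2)[OF K(1)] restr_in[OF compact_borel(2)[OF K(1)] a] a by (simp add: cut_def)
  then show "\<exists>K. compact K & (\<forall>a\<in>carr A. cmod (cut E F (\<rho> (- K) a)) <= \<eta> * vnorm A a)" using K(1) by blast
 qed
qed

text \<open>A functional on the vanishing functionals is concentrated on compact sets, because its norm is
 almost attained at a functional with compact support.\<close>

lemma vanishing_dual_tight:
 assumes P: "\<Psi> \<in> vanishing.X'" and e: "\<eta> > 0"
 shows "\<exists>K. compact K & (\<forall>F\<in>vanishing. cmod (\<Psi> (cut (- K) F)) <= \<eta> * adual_norm A F)"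
proof -
 define S where "S = vanishing.norm' \<Psi>"
 have S: "0 <= S" unfolding S_def by (rule vanishing.sub_dual.norm_nonneg[OF P])
 have "\<exists>F\<in>{F\<in>vanishing. adual_norm A F <= 1}. S - \<eta> / 2 < cmod (\<Psi> F)"
 proof -
  have "S - \<eta> / 2 < (SUP F\<in>{F\<in>vanishing. adual_norm A F <= 1}. cmod (\<Psi> F))"
   using e by (simp add: S_def dual_norm_def)
  then show ?thesis
   using less_cSUP_iff[OF _ vanishing.sub.bdd_above_unit_ball[OF P]] vanishing.subspace_zero vanishing.sub.norm_zero by force
 qed
 then obtain F0 where F0: "F0 \<in> vanishing" "adual_norm A F0 <= 1" "S - \<eta> / 2 < cmod (\<Psi> F0)" by blast
 define d where "d = \<eta> / (2 * (S + 1))"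
 have d: "d > 0" "S * d <= \<eta> / 2" using e S by (auto simp: d_def divide_simps)
 obtain K where K: "compact K" "\<forall>a\<in>carr A. cmod (F0 (\<rho> (- K) a)) <= d * vnorm A a" by (rule vanishingE[OF F0(1) d(1)])
 note bK = compact_borel[OF K(1)]
 have "adual_norm A (cut (- K) F0) <= d"
  by (rule adual_norm_le) (use d K(2) in "auto simp: cut_def")
 then have "S * adual_norm A (cut (- K) F0) <= \<eta> / 2"
  using d(2) mult_left_mono[OF _ S] by (meson order_trans)
 then have 1: "cmod (\<Psi> (cut (- K) F0)) <= \<eta> / 2"
  using vanishing.sub.dual_norm_bound[OF P vanishing.cut_in[OF F0(1) bK(2)]] by (simp add: S_def)
 have "\<Psi> F0 = \<Psi> (cut K F0) + \<Psi> (cut (- K) F0)"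
  using top_dual_add[OF P vanishing.cut_in[OF F0(1) bK(1)] vanishing.cut_in[OF F0(1) bK(2)]]
   cut_split[OF vanishing_in_adual[OF F0(1)] bK(1)] by simp
 then have 2: "S - \<eta> < cmod (\<Psi> (cut K F0))"
  using 1 F0(3) norm_triangle_ineq[of "\<Psi> (cut K F0)" "\<Psi> (cut (- K) F0)"] by simp
 have D: "vanishing.dual_restr E \<Psi> \<in> vanishing.X'" if "E \<in> Borel" for E by (rule vanishing.dual_restr_in[OF P that])
 have "cmod (\<Psi> (cut K F0)) <= vanishing.norm' (vanishing.dual_restr K \<Psi>) * adual_norm A F0"
  using vanishing.sub.dual_norm_bound[OF D[OF bK(1)] F0(1)] F0(1) by (simp add: vanishing.dual_restr_def)
 also have "\<dots> <= vanishing.norm' (vanishing.dual_restr K \<Psi>)"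
  using F0(2) vanishing.sub_dual.norm_nonneg[OF D[OF bK(1)]] vanishing.sub.norm_nonneg[OF F0(1)] by (simp add: mult_left_le)
 \<comment> \<open>The norms of the restrictions of \<open>\<Psi>\<close> to \<open>K\<close> and
   \<open>- K\<close> add up to at most \<open>S\<close>, and the first exceeds
   \<open>S - \<eta>\<close>.\<close>
 finally have 3: "vanishing.norm' (vanishing.dual_restr (- K) \<Psi>) <= \<eta>"
  using 2 vanishing.dual_restr_norm[OF P bK(1)] by (simp add: S_def)
 have "cmod (\<Psi> (cut (- K) F)) <= \<eta> * adual_norm A F" if F: "F \<in> vanishing" for F
 proof -
  have "cmod (\<Psi> (cut (- K) F)) <= vanishing.norm' (vanishing.dual_restr (- K) \<Psi>) * adual_norm A F"
   using vanishing.sub.dual_norm_bound[OF D[OF bK(2)] F] F by (simp add: vanishing.dual_restr_def)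
  also have "\<dots> <= \<eta> * adual_norm A F" by (intro mult_right_mono 3 vanishing.sub.norm_nonneg F)
  finally show ?thesis .
 qed
 then show ?thesis using K(1) by blast
qed

text \<open>The case \<open>c = 0\<close> of \<open>mult_restr_norm\<close>: if no sum falls into
  \<open>K\<close>, the restriction of the product to \<open>K\<close> has norm 0.\<close>

lemma product_off_compact:
 assumes F: "F \<in> adual A" and K: "compact K" "\<forall>a\<in>carr A. cmod (F (\<rho> (- K) a)) <= \<eta> * vnorm A a" "0 <= \<eta>"
  and a: "a \<in> carr A" "b \<in> carr A" and E: "E \<in> Borel" "E' \<in> Borel"
  and off: "!!x y. x \<in> E ==> y \<in> E' ==> x + y \<notin> K"
 shows "cmod (F (vmult A (\<rho> E a) (\<rho> E' b))) <= \<eta> * (vnorm A a * vnorm A b)"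
proof -
 note bK = compact_borel[OF K(1)]
 have m: "\<rho> E a \<in> carr A" "\<rho> E' b \<in> carr A" using a E by (auto intro: restr_in)
 let ?p = "vmult A (\<rho> E a) (\<rho> E' b)"
 have p: "?p \<in> carr A" by (rule mult_in[OF m])
 have "vnorm A (\<rho> K ?p) <= 0 * (vnorm A (\<rho> E a) * vnorm A (\<rho> E' b))"
  by (rule mult_restr_norm[OF a E bK(1)]) (use off in auto)
 then have "F (\<rho> K ?p) = 0" by (intro functional_zero_if_norm_zero F restr_in bK p) simp
 moreover have "F ?p = F (\<rho> K ?p) + F (\<rho> (- K) ?p)"
  using top_dual_add[OF F[unfolded adual_def] restr_in[OF bK(1) p] restr_in[OF bK(2) p]] restr_split[OF bK(1) p] by simp
 ultimately have "cmod (F ?p) <= \<eta> * vnorm A ?p" using K(2) p by simp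
 also have "vnorm A ?p <= vnorm A a * vnorm A b"
  by (rule order_trans[OF norm_mult_le[OF m]]) (intro mult_mono restr_norm_le a E norm_nonneg m)
 finally show ?thesis using K(3) by (simp add: mult_left_mono)
qed

text \<open>Split \<open>a\<close> into a part on a compact \<open>C\<close> and a small rest. Sums
  of points of \<open>C\<close> with points off \<open>L\<close>, the set of all
  \<open>- x + y\<close> with \<open>x\<close> in \<open>C\<close> and \<open>y\<close> in
  \<open>K\<close>, miss \<open>K\<close>, and off \<open>K\<close> the functional \<open>F\<close>
  is small.\<close>

lemma func_act_vanishing:
 assumes F: "F \<in> vanishing" and a: "a \<in> carr A"
 shows "func_act A F a \<in> vanishing"
 unfolding vanishing_def
proof (intro CollectI conjI allI impI)
 have F': "F \<in> adual A" by (rule vanishing_in_adual[OF F])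
 show "func_act A F a \<in> adual A" by (rule func_act_in_adual[OF F' a])
 fix \<eta> :: real assume e: "\<eta> > 0"
 define d where "d = \<eta> / (2 * (vnorm A a + 1))"
 have d: "d > 0" "d * vnorm A a <= \<eta> / 2" using e norm_nonneg[OF a] by (auto simp: d_def divide_simps)
 define d' where "d' = \<eta> / (2 * (adual_norm A F + 1))"
 have d': "d' > 0" "adual_norm A F * d' <= \<eta> / 2" using e dual.norm_nonneg[OF F'] by (auto simp: d'_def divide_simps)
 obtain K where K: "compact K" "\<forall>a\<in>carr A. cmod (F (\<rho> (- K) a)) <= d * vnorm A a" by (rule vanishingE[OF F d(1)])
 obtain C where C: "compact C" "vnorm A (\<rho> (- C) a) < d'" using tight[OF a d'(1)] by blast
 define L where "L = (%(x, y). - x + y) ` (C \<times> K)"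
 have L: "compact L" unfolding L_def by (rule compact_sum_set[OF C(1) K(1)])
 have off: "x + y \<notin> K" if "x \<in> C" "y \<in> - L" for x y
 proof
  assume "x + y \<in> K"
  then have "- x + (x + y) \<in> L" using that(1) unfolding L_def by (intro image_eqI[of _ _ "(x, x + y)"]) auto
  then show False using that(2) by simp
 qed
 have "cmod (func_act A F a (\<rho> (- L) b)) <= \<eta> * vnorm A b" if b: "b \<in> carr A" for b
 proof -
  let ?b = "\<rho> (- L) b"
  have b': "?b \<in> carr A" by (rule restr_in[OF compact_borel(2)[OF L] b])
  have m: "\<rho> C a \<in> carr A" "\<rho> (- C) a \<in> carr A" using a compact_borel[OF C(1)] by (auto intro: restr_in)
  have 1: "cmod (F (vmult A (\<rho> C a) ?b)) <= d * (vnorm A a * vnorm A b)"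
   by (rule product_off_compact[OF F' K less_imp_le[OF d(1)] a b compact_borel(1)[OF C(1)] compact_borel(2)[OF L] off])
  have "cmod (F (vmult A (\<rho> (- C) a) ?b)) <= adual_norm A F * (vnorm A (\<rho> (- C) a) * vnorm A ?b)"
   by (rule adual_product_bound[OF F' m(2) b'])
  also have "\<dots> <= adual_norm A F * (d' * vnorm A b)"
   using C(2) d' by (intro mult_left_mono mult_mono restr_norm_le compact_borel L b norm_nonneg b' dual.norm_nonneg F') auto
  finally have 2: "cmod (F (vmult A (\<rho> (- C) a) ?b)) <= (adual_norm A F * d') * vnorm A b" by simp
  have "F (vmult A a ?b) = F (vmult A (\<rho> C a) ?b) + F (vmult A (\<rho> (- C) a) ?b)"
   using mult_add_left[OF F' m b'] restr_split[OF compact_borel(1)[OF C(1)] a] by simp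
  then have "cmod (F (vmult A a ?b)) <= (d * vnorm A a) * vnorm A b + (adual_norm A F * d') * vnorm A b"
   using 1 2 norm_triangle_ineq[of "F (vmult A (\<rho> C a) ?b)" "F (vmult A (\<rho> (- C) a) ?b)"] by (simp add: mult.assoc)
  also have "\<dots> <= \<eta> / 2 * vnorm A b + \<eta> / 2 * vnorm A b"
   by (intro add_mono mult_right_mono d d' norm_nonneg b)
  finally show ?thesis using b' by (simp add: func_act_apply)
 qed
 then show "\<exists>K. compact K & (\<forall>b\<in>carr A. cmod (func_act A F a (\<rho> (- K) b)) <= \<eta> * vnorm A b)" using L by blast
qed

text \<open>The same argument on the other side, with \<open>\<Psi>\<close> in place of an element
  of \<open>A\<close>: by \<open>vanishing_dual_tight\<close> it is concentrated on a compact
  \<open>C\<close>, and \<open>L\<close> consists of the differences of \<open>K\<close> and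
  \<open>C\<close>.\<close>

lemma bidual_act_vanishing:
 assumes P: "\<Psi> \<in> vanishing.X'" and F: "F \<in> vanishing"
 shows "bidual_act A \<Psi> F \<in> vanishing"
 unfolding vanishing_def
proof (intro CollectI conjI allI impI)
 have F': "F \<in> adual A" by (rule vanishing_in_adual[OF F])
 show "bidual_act A \<Psi> F \<in> adual A"
  by (rule vanishing.bidual_act_in_adual(2)[OF P F func_act_vanishing[OF F]])
 fix \<eta> :: real assume e: "\<eta> > 0"
 define S where "S = vanishing.norm' \<Psi>"
 have S: "0 <= S" unfolding S_def by (rule vanishing.sub_dual.norm_nonneg[OF P])
 define d where "d = \<eta> / (2 * (S + 1))"
 have d: "d > 0" "S * d <= \<eta> / 2" using e S by (auto simp: d_def divide_simps)
 define d' where "d' = \<eta> / (2 * (adual_norm A F + 1))"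
 have d': "d' > 0" "d' * adual_norm A F <= \<eta> / 2" using e dual.norm_nonneg[OF F'] by (auto simp: d'_def divide_simps)
 obtain K where K: "compact K" "\<forall>a\<in>carr A. cmod (F (\<rho> (- K) a)) <= d * vnorm A a" by (rule vanishingE[OF F d(1)])
 obtain C where C: "compact C" "\<forall>F\<in>vanishing. cmod (\<Psi> (cut (- C) F)) <= d' * adual_norm A F"
  using vanishing_dual_tight[OF P d'(1)] by blast
 note bC = compact_borel[OF C(1)]
 define L where "L = (%(x, y). x - y) ` (K \<times> C)"
 have L: "compact L" unfolding L_def by (rule compact_sum_set[OF K(1) C(1)])
 have off: "x + y \<notin> K" if "x \<in> - L" "y \<in> C" for x y
 proof
  assume "x + y \<in> K"
  then have "(x + y) - y \<in> L" using that(2) unfolding L_def by (intro image_eqI[of _ _ "(x + y, y)"]) auto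
  then show False using that(1) by simp
 qed
 have "cmod (bidual_act A \<Psi> F (\<rho> (- L) a)) <= \<eta> * vnorm A a" if a: "a \<in> carr A" for a
 proof -
  let ?a = "\<rho> (- L) a"
  have a': "?a \<in> carr A" by (rule restr_in[OF compact_borel(2)[OF L] a])
  let ?G = "func_act A F ?a"
  have G: "?G \<in> vanishing" by (rule func_act_vanishing[OF F a'])
  have "adual_norm A (cut C ?G) <= d * vnorm A a"
  proof (rule adual_norm_le)
   show "0 <= d * vnorm A a" using d norm_nonneg[OF a] by simp
   fix b assume b: "b \<in> carr A"
   have "cmod (F (vmult A ?a (\<rho> C b))) <= d * (vnorm A a * vnorm A b)"
    by (rule product_off_compact[OF F' K less_imp_le[OF d(1)] a b compact_borel(2)[OF L] bC(1) off])
   then show "cmod (cut C ?G b) <= d * vnorm A a * vnorm A b"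
    using b restr_in[OF bC(1) b] by (simp add: cut_def func_act_apply)
  qed
  then have "S * adual_norm A (cut C ?G) <= (S * d) * vnorm A a" using S by (simp add: mult_left_mono mult.assoc)
  also have "\<dots> <= \<eta> / 2 * vnorm A a" by (intro mult_right_mono d norm_nonneg a)
  finally have 1: "cmod (\<Psi> (cut C ?G)) <= \<eta> / 2 * vnorm A a"
   using vanishing.sub.dual_norm_bound[OF P vanishing.cut_in[OF G bC(1)]] by (simp add: S_def)
  have "cmod (\<Psi> (cut (- C) ?G)) <= d' * adual_norm A ?G" using C(2) G by blast
  also have "\<dots> <= d' * (adual_norm A F * vnorm A a)"
  proof (intro mult_left_mono)
   show "adual_norm A ?G <= adual_norm A F * vnorm A a"
    by (rule order_trans[OF func_act_norm[OF F' a']])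
     (intro mult_left_mono restr_norm_le compact_borel L a dual.norm_nonneg F')
  qed (use d' in simp)
  also have "\<dots> = (d' * adual_norm A F) * vnorm A a" by simp
  also have "\<dots> <= \<eta> / 2 * vnorm A a" by (intro mult_right_mono d' norm_nonneg a)
  finally have 2: "cmod (\<Psi> (cut (- C) ?G)) <= \<eta> / 2 * vnorm A a" .
  have "\<Psi> ?G = \<Psi> (cut C ?G) + \<Psi> (cut (- C) ?G)"
   using top_dual_add[OF P vanishing.cut_in[OF G bC(1)] vanishing.cut_in[OF G bC(2)]]
    cut_split[OF vanishing_in_adual[OF G] bC(1)] by simp
  then have "cmod (\<Psi> ?G) <= \<eta> * vnorm A a"
   using 1 2 norm_triangle_ineq[of "\<Psi> (cut C ?G)" "\<Psi> (cut (- C) ?G)"] by simp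
  then show ?thesis using a' by (simp add: bidual_act_def)
 qed
 then show "\<exists>K. compact K & (\<forall>a\<in>carr A. cmod (bidual_act A \<Psi> F (\<rho> (- K) a)) <= \<eta> * vnorm A a)" using L by blast
qed

lemma introverted_restriction_vanishing: "introverted_restriction A vanishing \<rho>"
 by unfold_locales (auto intro: func_act_vanishing bidual_act_vanishing)

lemma coord_vanishing:
 assumes "F \<in> adual A" "!!a. a \<in> carr A ==> F (\<rho> (- {t}) a) = 0"
 shows "F \<in> vanishing"
 using assms norm_nonneg unfolding vanishing_def by (auto intro!: exI[of _ "{t}"])

end

section \<open>Regularity of convolution algebras with point masses\<close>

locale atomic_convolution_algebra = convolution_algebra A \<rho> \<omega> + atoms A \<omega> e coord
 for A :: "'x falgebra" and \<rho> :: "'g::{topological_group_add, t2_space} set => ('x => complex) => 'x => complex"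
  and \<omega> e coord +
 assumes coord_atom: "coord t (e x) = (if t = x then 1 else 0)"
  and restr_singleton: "a \<in> carr A ==> \<rho> {x} a = (%s. coord x a * e x s)"
begin

lemma coord_in_vanishing: "coord t \<in> vanishing"
proof (rule coord_vanishing[OF coord_in])
 fix a assume a: "a \<in> carr A"
 have b: "{t} \<in> Borel" "- {t} \<in> Borel" by (intro compact_borel; simp)+
 have "(%s. coord t (\<rho> (- {t}) a) * e t s) = (%s. 0)"
  using restr_singleton[OF restr_in[OF b(2) a]] restr_Int[OF b a] restr_empty[OF a] by simp
 then have "coord t (%s. coord t (\<rho> (- {t}) a) * e t s) = coord t (%s. 0)" by simp
 then show "coord t (\<rho> (- {t}) a) = 0"
  using top_dual_scale[OF coord_in[of t, unfolded adual_def] atom_in[of t]]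
   functional_zero[OF coord_in[of t, unfolded adual_def]] coord_atom[of t t] by simp
qed

text \<open>Compact sets are finite here, so tightness approximates every element by finite
  combinations of point masses: an element without coordinates has norm 0, and every element is its
  own atomic part.\<close>

lemma banded_if_discrete:
 assumes discrete: "!!x :: 'g. open {x}"
 shows "banded A \<omega> e coord \<rho>"
proof
 have "open E" for E :: "'g set"
  using open_UN[of E "%x. {x}"] discrete by simp
 then show borel: "E \<in> Borel" for E :: "'g set" by (intro borel_open)
 have fin: "finite C" if C: "compact C" for C :: "'g set"
 proof -
  have "\<exists>D'\<subseteq>(%x. {x}) ` C. finite D' & C \<subseteq> \<Union>D'"
   by (rule compactE[OF C, of "(%x. {x}) ` C"]) (use discrete in auto)
  then obtain D' where "D' \<subseteq> (%x. {x}) ` C" "finite D'" "C \<subseteq> \<Union>D'" by blast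
  then show ?thesis by (auto intro!: finite_subset[of C "\<Union>D'"])
 qed
 show "coord t (e x) = (if t = x then 1 else 0)" for t x by (rule coord_atom)
 show "\<rho> {x} a = (%t. coord x a * e x t)" if "a \<in> carr A" for a x by (rule restr_singleton[OF that])
 \<comment> \<open>Point masses are their own restrictions to \<open>{x}\<close>, so
   \<open>mult_restr_norm\<close> applies to them with a one-point set.\<close>
 have ex: "\<rho> {x} (e x) = e x" for x using restr_singleton[OF atom_in, of x x] coord_atom by simp
 show "vnorm A (vmult A (e x) (\<rho> E b)) <= c * \<omega> x * vnorm A b"
  if b: "b \<in> carr A" and c: "0 <= c" "!!y. y \<in> E ==> \<omega> (x + y) <= c * (\<omega> x * \<omega> y)" for b c E x
 proof -
  have "vnorm A (\<rho> UNIV (vmult A (\<rho> {x} (e x)) (\<rho> E b))) <= c * (vnorm A (\<rho> {x} (e x)) * vnorm A (\<rho> E b))"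
   by (rule mult_restr_norm[OF atom_in b borel borel borel c(1)]) (use c(2) in auto)
  also have "\<dots> <= c * (\<omega> x * vnorm A b)"
   unfolding ex by (intro mult_left_mono mult_mono atom_norm restr_norm_le borel b norm_nonneg restr_in c weight_pos(2)[OF weight])
  finally show ?thesis unfolding ex using restr_UNIV[OF mult_in[OF atom_in restr_in[OF borel b]]] by simp
 qed
 show "vnorm A (vmult A (\<rho> E b) (e x)) <= c * \<omega> x * vnorm A b"
  if b: "b \<in> carr A" and c: "0 <= c" "!!y. y \<in> E ==> \<omega> (y + x) <= c * (\<omega> y * \<omega> x)" for b c E x
 proof -
  have "vnorm A (\<rho> UNIV (vmult A (\<rho> E b) (\<rho> {x} (e x)))) <= c * (vnorm A (\<rho> E b) * vnorm A (\<rho> {x} (e x)))"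
   by (rule mult_restr_norm[OF b atom_in borel borel borel c(1)]) (use c(2) in auto)
  also have "\<dots> <= c * (vnorm A b * \<omega> x)"
   unfolding ex by (intro mult_left_mono mult_mono atom_norm restr_norm_le borel b norm_nonneg restr_in c atom_in)
  finally show ?thesis unfolding ex using restr_UNIV[OF mult_in[OF restr_in[OF borel b] atom_in]] by (simp add: ac_simps)
 qed
 show "F (vmult A a b) = 0"
  if F: "F \<in> adual A" and a: "a \<in> carr A" and b: "b \<in> carr A" and z: "!!t. coord t a = 0" for F a b
 proof -
  have r: "finite T ==> \<rho> T a = (%s. 0)" for T
  proof (induction T rule: finite_induct)
   case (insert x T)
   then show ?case using restr_Un[OF borel borel _ a, of "{x}" T] restr_singleton[OF a, of x] z by simp
  qed (rule restr_empty[OF a])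
  have "vnorm A a <= 0 + \<eta>" if "\<eta> > 0" for \<eta>
  proof -
   obtain C where C: "compact C" "vnorm A (\<rho> (- C) a) < \<eta>" using tight[OF a \<open>\<eta> > 0\<close>] by blast
   then show ?thesis using restr_split[OF borel a, of C] r[OF fin[OF C(1)]] by simp
  qed
  then have "vnorm A a <= 0" by (rule field_le_epsilon)
  then have "vnorm A a = 0" using norm_nonneg[OF a] by simp
  then have "vnorm A (vmult A a b) <= 0" using norm_mult_le[OF a b] by simp
  then show ?thesis by (rule functional_zero_if_norm_zero[OF F mult_in[OF a b]])
 qed
 show "\<exists>p\<in>carr A. (\<forall>t. coord t p = coord t a) & (\<forall>\<eta>>0. \<exists>T. finite T & vnorm A (%x. p x - \<rho> T a x) < \<eta>)"
  if a: "a \<in> carr A" for a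
 proof (intro bexI[of _ a] conjI allI impI a refl)
  fix \<eta> :: real assume "\<eta> > 0"
  then obtain C where C: "compact C" "vnorm A (\<rho> (- C) a) < \<eta>" using tight[OF a] by blast
  have "(%x. a x - \<rho> C a x) = \<rho> (- C) a" using restr_split[OF borel a, of C] by (auto simp: fun_eq_iff diff_eq_eq add.commute)
  then show "\<exists>T. finite T & vnorm A (%x. a x - \<rho> T a x) < \<eta>" using C fin[OF C(1)] by auto
 qed
qed

text \<open>A zero cluster \<open>\<Omega>\<close> gives discreteness and hence
  \<open>banded\<close>, which passes to the dual; conversely the dual of an introverted subspace
  containing the coordinates still has point masses.\<close>

theorem arens_regular_iff_zero_cluster:
 shows "arens_regular A \<longleftrightarrow> zero_cluster (%p. complex_of_real (weight_Omega \<omega> p))"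
  and "arens_regular (bidual A) \<longleftrightarrow> zero_cluster (%p. complex_of_real (weight_Omega \<omega> p))"
  and "arens_regular (introverted_dual A vanishing) \<longleftrightarrow> zero_cluster (%p. complex_of_real (weight_Omega \<omega> p))"
proof -
 let ?z = "zero_cluster (%p. complex_of_real (weight_Omega \<omega> p))"
 have B: "banded A \<omega> e coord \<rho>" if ?z
  by (rule banded_if_discrete[OF zero_cluster_open_singleton[OF weight that]])
 show "arens_regular A \<longleftrightarrow> ?z"
  using zero_cluster_if_arens_regular banded.arens_regular_if_zero_cluster[OF B] by blast
 have dual: "arens_regular (introverted_dual A X) \<longleftrightarrow> ?z"
  if X: "introverted_restriction A X \<rho>" and c: "!!t. coord t \<in> X" for X
 proof -
  interpret X: introverted_restriction A X \<rho> by (rule X)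
  interpret D: atoms "introverted_dual A X" \<omega> "%x. evaluation X (e x)" "%t. evaluation X.X' (coord t)"
   by (rule X.atoms_dual[OF atoms_axioms c])
  show ?thesis
  proof
   assume z: ?z
   interpret banded A \<omega> e coord \<rho> by (rule B[OF z])
   interpret banded_introverted A \<omega> e coord \<rho> X by unfold_locales (rule c)
   show "arens_regular (introverted_dual A X)"
    by (rule banded.arens_regular_if_zero_cluster[OF banded_dual[OF z] z])
  qed (rule D.zero_cluster_if_arens_regular)
 qed
 show "arens_regular (introverted_dual A vanishing) \<longleftrightarrow> ?z"
  by (rule dual[OF introverted_restriction_vanishing coord_in_vanishing])
 have "introverted_restriction A (adual A) \<rho>"
 proof -
  interpret introverted A "adual A" by (rule introverted_adual)
  show ?thesis by unfold_locales (rule cut_in_adual)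
 qed
 then show "arens_regular (bidual A) \<longleftrightarrow> ?z"
  unfolding bidual_def by (rule dual[OF _ coord_in])
qed

end


text \<open>The inequality \<open>coord_sum\<close> is derived: by additivity of the norm points can
  be split off one at a time, and a restriction to \<open>{x}\<close> has norm exactly
  \<open>\<omega> x\<close> times the modulus of the coefficient.\<close>

lemma (in convolution_algebra) atomic_convolution_algebraI:
 fixes e :: "'g => 'x => complex"
 assumes e: "!!x. e x \<in> carr A" "!!x. vnorm A (e x) = \<omega> x"
  and lin: "!!t a b. a \<in> carr A ==> b \<in> carr A ==> coord t (%x. a x + b x) = coord t a + coord t b"
   "!!t a c. a \<in> carr A ==> coord t (%x. c * a x) = c * coord t a" "!!t a. a \<notin> carr A ==> coord t a = 0"
  and mult: "!!t x y. coord t (vmult A (e x) (e y)) = (if t = x + y then 1 else 0)"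
  and atom: "!!t x. coord t (e x) = (if t = x then 1 else 0)"
  and restr: "!!a x. a \<in> carr A ==> \<rho> {x} a = (%s. coord x a * e x s)"
 shows "atomic_convolution_algebra A \<rho> \<omega> e coord"
proof -
 have sum: "(\<Sum>t\<in>T. \<omega> t * cmod (coord t b)) <= vnorm A b" if T: "finite T" and b: "b \<in> carr A" for T b
 proof -
  have bT: "T \<in> Borel" if "finite T" for T :: "'g set" using that by (intro compact_borel finite_imp_compact)
  have "(\<Sum>t\<in>T. \<omega> t * cmod (coord t b)) <= vnorm A (\<rho> T b)" using T
  proof (induction T)
   case (insert x T)
   have b1: "{x} \<in> Borel" "- {x} \<in> Borel" "insert x T \<in> Borel" using insert.hyps by (auto intro!: bT borel_comp)
   have "{x} \<inter> insert x T = {x}" "- {x} \<inter> insert x T = T" using insert.hyps by auto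
   then have "vnorm A (\<rho> {x} b) + vnorm A (\<rho> T b) <= vnorm A (\<rho> (insert x T) b)"
    using restr_norm[OF b1(1) restr_in[OF b1(3) b]] restr_Int[OF b1(1,3) b] restr_Int[OF b1(2,3) b] by simp
   moreover have "vnorm A (\<rho> {x} b) = \<omega> x * cmod (coord x b)" using norm_scale[OF e(1)] e(2) by (simp add: restr[OF b])
   ultimately show ?case using insert by simp
  qed (simp add: norm_nonneg restr_in bT b)
  also have "\<dots> <= vnorm A b" by (rule restr_norm_le[OF bT[OF T] b])
  finally show ?thesis .
 qed
 have "cmod (coord t b) <= 1 * vnorm A b" if "b \<in> carr A" for t b
  using sum[OF _ that, of "{t}"] mult_right_mono[OF weight_ge_1[OF weight], of "cmod (coord t b)" t] by simp
 then have "coord t \<in> adual A" for t unfolding adual_def top_dual_def using lin by blast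
 then show ?thesis by unfold_locales (use e sum mult atom restr weight in auto)
qed

section \<open>Finite Radon measures\<close>

text \<open>Approximation from inside by compact sets, for all Borel sets. For finite measures this
  already contains outer regularity, by complements.\<close>

definition radon_finite :: "'a::topological_space measure => bool" where
 "radon_finite \<nu> \<longleftrightarrow> sets \<nu> = Borel & finite_measure \<nu> &
   (\<forall>E\<in>Borel. \<forall>\<eta>>0. \<exists>K. compact K & K \<subseteq> E & measure \<nu> (E - K) < \<eta>)"

lemma radon_finiteD:
 assumes "radon_finite \<nu>"
 shows "sets \<nu> = Borel" "finite_measure \<nu>" "space \<nu> = UNIV"
 using assms sets_eq_imp_space_eq[of \<nu> borel] by (auto simp: radon_finite_def)

lemma radon_finiteE:
 assumes "radon_finite \<nu>" "E \<in> Borel" "\<eta> > 0"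
 obtains K where "compact K" "K \<subseteq> E" "measure \<nu> (E - K) < \<eta>"
 using assms unfolding radon_finite_def by blast

lemma compact_borel_t2: "compact (K :: 'a::t2_space set) ==> K \<in> Borel"
 by (intro borel_closed compact_imp_closed)

text \<open>Finitely many of the sets exhaust the union up to \<open>\<eta> / 2\<close>; each of
  them is approximated within the share \<open>d\<close> of the other half.\<close>

lemma compact_approx_UN:
 fixes B :: "nat => 'a::t2_space set"
 assumes fin: "finite_measure \<nu>" and sets: "sets \<nu> = Borel" and B: "!!k. B k \<in> Borel"
  and ap: "!!k \<eta>. \<eta> > 0 ==> \<exists>K. compact K & K \<subseteq> B k & measure \<nu> (B k - K) < \<eta>" and \<eta>: "\<eta> > 0"
 shows "\<exists>K. compact K & K \<subseteq> (\<Union>k. B k) & measure \<nu> ((\<Union>k. B k) - K) < \<eta>"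
proof -
 interpret finite_measure \<nu> by (rule fin)
 have UB: "(\<Union>k. B k) \<in> Borel" "(\<Union>k<n. B k) \<in> Borel" for n :: nat
  using B by auto
 have "(%n. measure \<nu> ((\<Union>k. B k) - (\<Union>k<n. B k))) \<longlonglongrightarrow> measure \<nu> (\<Inter>n. (\<Union>k. B k) - (\<Union>k<n. B k))"
  by (rule finite_Lim_measure_decseq) (use UB in "auto simp: sets decseq_def")
 also have "(\<Inter>n. (\<Union>k. B k) - (\<Union>k<n. B k)) = {}"
 proof (rule equals0I)
  fix x assume x: "x \<in> (\<Inter>n. (\<Union>k. B k) - (\<Union>k<n. B k))"
  then obtain k where "x \<in> B k" by auto
  moreover have "x \<notin> (\<Union>i<Suc k. B i)" using x by blast
  ultimately show False by auto
 qed
 finally have "(%n. measure \<nu> ((\<Union>k. B k) - (\<Union>k<n. B k))) \<longlonglongrightarrow> 0" by simp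
 then have "\<forall>\<^sub>F n in sequentially. measure \<nu> ((\<Union>k. B k) - (\<Union>k<n. B k)) < \<eta> / 2"
  by (rule order_tendstoD(2)) (use \<eta> in simp)
 then obtain n where n: "measure \<nu> ((\<Union>k. B k) - (\<Union>k<n. B k)) < \<eta> / 2"
  by (meson eventually_at_top_linorder order_refl)
 define d where "d = \<eta> / (2 * (real n + 1))"
 have d: "d > 0" "real n * d <= \<eta> / 2" using \<eta> by (auto simp: d_def divide_simps)
 have "\<forall>k. \<exists>K. compact K & K \<subseteq> B k & measure \<nu> (B k - K) < d" using ap[OF d(1)] by blast
 from choice[OF this] obtain K where K: "\<forall>k. compact (K k) & K k \<subseteq> B k & measure \<nu> (B k - K k) < d" ..
 have Kb: "K k \<in> Borel" for k using K by (simp add: compact_borel_t2)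
 have UK: "(\<Union>k<n. K k) \<in> Borel" "(\<Union>k<n. B k - K k) \<in> Borel" using B Kb by auto
 let ?K = "\<Union>k<n. K k"
 have "measure \<nu> ((\<Union>k. B k) - ?K) <= measure \<nu> (((\<Union>k. B k) - (\<Union>k<n. B k)) \<union> (\<Union>k<n. B k - K k))"
  by (rule finite_measure_mono) (use UB UK B Kb in "auto simp: sets")
 also have "\<dots> <= measure \<nu> ((\<Union>k. B k) - (\<Union>k<n. B k)) + measure \<nu> (\<Union>k<n. B k - K k)"
  by (rule measure_Un_le) (use UB UK B Kb in "auto simp: sets")
 also have "measure \<nu> (\<Union>k<n. B k - K k) <= (\<Sum>k<n. measure \<nu> (B k - K k))"
  by (rule measure_UNION_le) (use UB UK B Kb in "auto simp: sets")
 also have "\<dots> <= (\<Sum>k<n. d)" by (rule sum_mono) (use K in "auto intro: less_imp_le")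
 also have "\<dots> <= \<eta> / 2" using d by simp
 finally have "measure \<nu> ((\<Union>k. B k) - ?K) < \<eta>" using n by simp
 moreover have "compact ?K" using K by (intro compact_UN) auto
 moreover have "?K \<subseteq> (\<Union>k. B k)" using K by blast
 ultimately show ?thesis by blast
qed

text \<open>The sets that are approximable together with their complement form a \<sigma>-algebra. A
  closed set is approximable because it meets a compact set carrying almost all of the mass in a
  compact set.\<close>

lemma radon_finiteI_open:
 fixes \<nu> :: "'a::t2_space measure"
 assumes fin: "finite_measure \<nu>" and sets: "sets \<nu> = Borel"
  and op: "!!U \<eta>. open U ==> \<eta> > 0 ==> \<exists>K. compact K & K \<subseteq> U & measure \<nu> (U - K) < \<eta>"
 shows "radon_finite \<nu>"
proof -
 interpret finite_measure \<nu> by (rule fin)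
 define P where "P E \<longleftrightarrow> (\<forall>\<eta>>0. \<exists>K. compact K & K \<subseteq> E & measure \<nu> (E - K) < \<eta>)" for E
 have "P E & P (- E)" if E: "E \<in> Borel" for E
 proof -
  have "E \<in> sigma_sets UNIV {S. open S}" using E by (simp add: borel_def)
  then show ?thesis
  proof (induction rule: sigma_sets.induct)
   case (Basic U)
   then have U: "open U" by simp
   have "\<exists>K. compact K & K \<subseteq> - U & measure \<nu> (- U - K) < \<eta>" if e: "\<eta> > 0" for \<eta>
   proof -
    obtain L where L: "compact L" "measure \<nu> (UNIV - L) < \<eta>" using op[OF open_UNIV e] by blast
    have "measure \<nu> (- U - (L - U)) <= measure \<nu> (UNIV - L)"
     by (rule finite_measure_mono) (use compact_borel_t2[OF L(1)] in "auto simp: sets")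
    then show ?thesis using L compact_diff[OF L(1) U] by (intro exI[of _ "L - U"]) auto
   qed
   then show ?case using op[OF U] by (simp add: P_def)
  next
   case Empty show ?case using op[OF open_UNIV] by (auto simp: P_def intro: exI[of _ "{}"])
  next
   case (Compl E) then show ?case by (simp add: Compl_eq_Diff_UNIV[symmetric])
  next
   case (Union E)
   have Eb: "E k \<in> Borel" for k using Union.hyps by (simp add: borel_def)
   have "\<exists>K. compact K & K \<subseteq> (\<Union>k. E k) & measure \<nu> ((\<Union>k. E k) - K) < \<eta>" if e: "\<eta> > 0" for \<eta>
    by (rule compact_approx_UN[OF fin sets Eb _ e]) (use Union.IH in "simp add: P_def")
   moreover have "\<exists>K. compact K & K \<subseteq> - (\<Union>k. E k) & measure \<nu> (- (\<Union>k. E k) - K) < \<eta>" if e: "\<eta> > 0" for \<eta>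
   proof -
    \<comment> \<open>Errors in a geometric series, so that intersecting all approximations of the
      complements loses at most \<open>\<eta> / 2\<close>; the intersection is compact as it lies in
      \<open>K 0\<close>.\<close>
    have "\<eta> / 2 / 2 ^ Suc k > 0" for k using e by simp
    then have "\<forall>k. \<exists>K. compact K & K \<subseteq> - E k & measure \<nu> (- E k - K) < \<eta> / 2 / 2 ^ Suc k"
     using Union.IH unfolding P_def by blast
    from choice[OF this] obtain K where K: "\<forall>k. compact (K k) & K k \<subseteq> - E k & measure \<nu> (- E k - K k) < \<eta> / 2 / 2 ^ Suc k" ..
    have Kb: "- E k - K k \<in> sets \<nu>" for k
     unfolding sets by (intro sets.Diff borel_comp Eb compact_borel_t2) (use K in blast)
    have s: "(%k. \<eta> / 2 / 2 ^ Suc k) sums (\<eta> / 2)"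
     using sums_mult[OF power_half_series, of "\<eta> / 2"] by (simp add: power_divide)
    have le: "measure \<nu> (- E k - K k) <= \<eta> / 2 / 2 ^ Suc k" for k using K by (auto intro: less_imp_le)
    have su: "summable (%k. measure \<nu> (- E k - K k))"
     by (rule summable_comparison_test[OF _ sums_summable[OF s]]) (use le in auto)
    have "measure \<nu> (- (\<Union>k. E k) - (\<Inter>k. K k)) <= measure \<nu> (\<Union>k. - E k - K k)"
     by (rule finite_measure_mono) (use Kb in auto)
    also have "\<dots> <= (\<Sum>k. measure \<nu> (- E k - K k))"
     by (rule finite_measure_subadditive_countably) (use Kb su in auto)
    also have "\<dots> < \<eta>" using suminf_le[OF le su sums_summable[OF s]] sums_unique[OF s] e by simp
    finally show ?thesis
     using K compact_Int_closed[of "K 0" "\<Inter>k. K k"] by (intro exI[of _ "K 0 \<inter> (\<Inter>k. K k)"])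
      (auto simp: Int_absorb1 INF_lower intro: compact_imp_closed closed_INT)
   qed
   ultimately show ?case using P_def by blast
  qed
 qed
 then show ?thesis using sets fin by (simp add: radon_finite_def P_def)
qed

lemma radon_finite_sigma_compact:
 fixes \<nu> :: "'a::t2_space measure"
 assumes r: "radon_finite \<nu>" and E: "E \<in> Borel"
 obtains K :: "nat => 'a set" where "\<forall>n. compact (K n)" "\<forall>n. K n \<subseteq> E" "incseq K" "measure \<nu> (E - (\<Union>n. K n)) = 0"
proof -
 interpret finite_measure \<nu> by (rule radon_finiteD(2)[OF r])
 note sets = radon_finiteD(1)[OF r]
 have "\<forall>n. \<exists>K. compact K & K \<subseteq> E & measure \<nu> (E - K) < 1 / real (Suc n)"
  using radon_finiteE[OF r E] by (metis of_nat_0_less_iff zero_less_Suc zero_less_divide_1_iff)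
 from choice[OF this] obtain L where L: "\<forall>n. compact (L n) & L n \<subseteq> E & measure \<nu> (E - L n) < 1 / real (Suc n)" ..
 define K where "K n = (\<Union>k\<le>n. L k)" for n
 have Lb: "L n \<in> Borel" for n using L by (simp add: compact_borel_t2)
 have "measure \<nu> (E - (\<Union>n. K n)) <= 0 + \<eta>" if "\<eta> > 0" for \<eta>
 proof -
  obtain n where n: "1 / real (Suc n) < \<eta>" using nat_approx_posE[OF \<open>\<eta> > 0\<close>] .
  have "measure \<nu> (E - (\<Union>n. K n)) <= measure \<nu> (E - L n)"
   by (rule finite_measure_mono) (use Lb E in "auto simp: sets K_def")
  also have "\<dots> < 1 / real (Suc n)" using L by blast
  finally show ?thesis using n by simp
 qed
 then have "measure \<nu> (E - (\<Union>n. K n)) <= 0" by (rule field_le_epsilon)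
 then have "measure \<nu> (E - (\<Union>n. K n)) = 0" using measure_nonneg[of \<nu>] by (simp add: order.antisym)
 moreover have "compact (K n)" for n unfolding K_def using L by (intro compact_UN) auto
 moreover have "K n \<subseteq> E" for n unfolding K_def using L by blast
 moreover have "incseq K" unfolding K_def incseq_def by force
 ultimately show ?thesis by (intro that[of K]) auto
qed

text \<open>Up to a \<open>\<nu>\<close>-null set, hence also up to a set null for
  \<open>\<nu>'\<close>, \<open>E\<close> is an increasing union of compact sets; continuity from
  above does the rest.\<close>

lemma radon_finite_absolutely_continuous:
 fixes \<nu> :: "'a::t2_space measure"
 assumes r: "radon_finite \<nu>" and fin: "finite_measure \<nu>'" and sets': "sets \<nu>' = Borel"
  and ac: "!!E. E \<in> Borel ==> measure \<nu> E = 0 ==> measure \<nu>' E = 0"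
 shows "radon_finite \<nu>'"
 unfolding radon_finite_def
proof (intro conjI ballI allI impI fin sets')
 interpret finite_measure \<nu>' by (rule fin)
 fix E :: "'a set" and \<eta> :: real assume E: "E \<in> Borel" and \<eta>: "\<eta> > 0"
 obtain K where K: "\<forall>n. compact (K n)" "\<forall>n. K n \<subseteq> E" "incseq K" "measure \<nu> (E - (\<Union>n. K n)) = 0"
  by (rule radon_finite_sigma_compact[OF r E])
 have Kb: "K n \<in> Borel" for n using K(1) by (simp add: compact_borel_t2)
 have "(%n. measure \<nu>' (E - K n)) \<longlonglongrightarrow> measure \<nu>' (\<Inter>n. E - K n)"
  by (rule finite_Lim_measure_decseq) (use K(3) Kb E in "auto simp: sets' decseq_def incseq_def")
 also have "(\<Inter>n. E - K n) = E - (\<Union>n. K n)" by auto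
 also have "measure \<nu>' (E - (\<Union>n. K n)) = 0" by (rule ac[OF _ K(4)]) (use E Kb in auto)
 finally have "\<forall>\<^sub>F n in sequentially. measure \<nu>' (E - K n) < \<eta>" using \<eta> by (rule order_tendstoD(2))
 then obtain n where "measure \<nu>' (E - K n) < \<eta>" by (meson eventually_at_top_linorder order_refl)
 then show "\<exists>K. compact K & K \<subseteq> E & measure \<nu>' (E - K) < \<eta>" using K(1,2) by blast
qed

lemma radon_finite_distr:
 fixes \<nu> :: "'a::t2_space measure" and f :: "'a => 'b::t2_space"
 assumes r: "radon_finite \<nu>" and f: "continuous_on UNIV f"
 shows "radon_finite (distr \<nu> borel f)"
 unfolding radon_finite_def
proof (intro conjI ballI allI impI)
 interpret finite_measure \<nu> by (rule radon_finiteD(2)[OF r])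
 have m: "f \<in> measurable \<nu> borel"
  using borel_measurable_continuous_onI[OF f] measurable_cong_sets[OF radon_finiteD(1)[OF r] refl] by auto
 show "finite_measure (distr \<nu> borel f)" by (rule finite_measure_distr[OF m])
 fix E :: "'b set" and \<eta> :: real assume E: "E \<in> Borel" and \<eta>: "\<eta> > 0"
 have b: "f -` E \<in> Borel" using measurable_sets[OF borel_measurable_continuous_onI[OF f] E] by simp
 obtain K where K: "compact K" "K \<subseteq> f -` E" "measure \<nu> (f -` E - K) < \<eta>" by (rule radon_finiteE[OF r b \<eta>])
 have fK: "compact (f ` K)" by (rule compact_continuous_image[OF continuous_on_subset[OF f] K(1)]) simp
 then have fKb: "f ` K \<in> Borel" by (rule compact_borel_t2)
 have "measure (distr \<nu> borel f) (E - f ` K) = measure \<nu> (f -` (E - f ` K) \<inter> space \<nu>)"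
  by (rule measure_distr[OF m]) (use E fKb in auto)
 also have "\<dots> <= measure \<nu> (f -` E - K)"
  by (rule finite_measure_mono) (use b K(1) in "auto simp: radon_finiteD[OF r] intro: compact_borel_t2")
 finally show "\<exists>K. compact K & K \<subseteq> E & measure (distr \<nu> borel f) (E - K) < \<eta>" using K fK by (intro exI[of _ "f ` K"]) auto
qed simp

section \<open>Products of finite Radon measures\<close>

text \<open>On a product of two spaces without countable bases the Borel sets need not be generated by
 rectangles. For Radon measures the iterated integrals of Borel functions still make sense and agree,
 because an open set is approximated in measure by finite unions of compact rectangles inside it.\<close>

lemma section_borel:
 assumes "B \<in> sets (borel :: ('a::topological_space \<times> 'b::topological_space) measure)"
 shows "Pair x -` B \<in> Borel" "(%x. (x, y)) -` B \<in> Borel"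
proof -
 have "(%y. (x, y)) \<in> BM" "(%x. (x, y)) \<in> BM"
  by (intro borel_measurable_continuous_onI continuous_intros)+
 from this[THEN measurable_sets, OF assms] show "Pair x -` B \<in> Borel" "(%x. (x, y)) -` B \<in> Borel" by auto
qed

text \<open>The tube lemma. Applied to the complement of the diagonal it also separates a point from
  a compact set.\<close>

lemma compact_tube:
 assumes K: "compact K" and W: "open W" "{x} \<times> K \<subseteq> W"
 shows "\<exists>U V. open U & open V & x \<in> U & K \<subseteq> V & U \<times> V \<subseteq> W"
proof -
 have "\<exists>U V. open U & open V & x \<in> U & y \<in> V & U \<times> V \<subseteq> W" if "y \<in> K" for y
 proof -
  have "(x, y) \<in> W" using W that by auto
  from open_prod_elim[OF W(1) this] show ?thesis by (metis mem_Sigma_iff)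
 qed
 then have "\<forall>y\<in>K. \<exists>p. open (fst p) & open (snd p) & x \<in> fst p & y \<in> snd p & fst p \<times> snd p \<subseteq> W" by fastforce
 from bchoice[OF this] obtain p where
  p: "\<forall>y\<in>K. open (fst (p y)) & open (snd (p y)) & x \<in> fst (p y) & y \<in> snd (p y) & fst (p y) \<times> snd (p y) \<subseteq> W" ..
 have op: "open (snd (p y))" if "y \<in> K" for y using p that by blast
 have cov: "K \<subseteq> (\<Union>y\<in>K. snd (p y))" using p by blast
 obtain T where T: "T \<subseteq> K" "finite T" "K \<subseteq> (\<Union>y\<in>T. snd (p y))" by (rule compactE_image[OF K op cov])
 have "open (\<Inter>y\<in>T. fst (p y))" using p T by (intro open_INT) auto
 moreover have "open (\<Union>y\<in>T. snd (p y))" using p T by (intro open_UN) auto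
 moreover have "x \<in> (\<Inter>y\<in>T. fst (p y))" using p T by auto
 moreover have "(\<Inter>y\<in>T. fst (p y)) \<times> (\<Union>y\<in>T. snd (p y)) \<subseteq> W" using p T(1) by force
 ultimately show ?thesis using T(3) by (intro exI[of _ "\<Inter>y\<in>T. fst (p y)"] exI[of _ "\<Union>y\<in>T. snd (p y)"]) auto
qed

text \<open>Lower semicontinuity of the measure of sections, with a rectangle as witness: a compact
  set nearly filling the section at \<open>x\<close> lies in a tube inside \<open>B\<close>.\<close>

lemma open_section_measure_greater:
 fixes \<nu> :: "'b::t2_space measure" and B :: "('a::t2_space \<times> 'b) set"
 assumes r: "radon_finite \<nu>" and B: "open B" and x: "c < measure \<nu> (Pair x -` B)"
 shows "\<exists>U V. open U & open V & x \<in> U & U \<times> V \<subseteq> B & c < measure \<nu> V"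
proof -
 interpret finite_measure \<nu> by (rule radon_finiteD(2)[OF r])
 note sets = radon_finiteD(1)[OF r]
 have b: "Pair x -` B \<in> Borel" using B by (intro section_borel borel_open)
 obtain K where K: "compact K" "K \<subseteq> Pair x -` B" "measure \<nu> (Pair x -` B - K) < measure \<nu> (Pair x -` B) - c"
  by (rule radon_finiteE[OF r b]) (use x in auto)
 have Kb: "K \<in> Borel" using K(1) by (rule compact_borel_t2)
 have cK: "c < measure \<nu> K"
  using finite_measure_Diff[OF b[folded sets] Kb[folded sets] K(2)] K(3) by simp
 obtain U V where UV: "open U" "open V" "x \<in> U" "K \<subseteq> V" "U \<times> V \<subseteq> B"
 proof -
  have "{x} \<times> K \<subseteq> B" using K(2) by auto
  from compact_tube[OF K(1) B this] show ?thesis using that by blast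
 qed
 have "measure \<nu> K <= measure \<nu> V" by (rule finite_measure_mono) (use UV in "auto simp: sets")
 then show ?thesis using UV cK by (intro exI[of _ U] exI[of _ V]) auto
qed

text \<open>Dynkin's theorem for the open sets, which are stable under finite intersections.\<close>

lemma borel_induct_open [consumes 1, case_names open_set complement disjoint_union]:
 assumes B: "B \<in> sets (borel :: 'a::topological_space measure)"
  and op: "!!U. open U ==> P U"
  and compl: "!!A. A \<in> Borel ==> P A ==> P (- A)"
  and un: "!!A :: nat => _. disjoint_family A ==> (!!i. A i \<in> Borel) ==> (!!i. P (A i)) ==> P (\<Union>i. A i)"
 shows "P B"
proof -
 have eq: "sigma_sets UNIV {S :: 'a set. open S} = Borel" by (simp add: borel_def)
 have "Int_stable {S :: 'a set. open S}" by (auto simp: Int_stable_def)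
 then show ?thesis
 proof (rule sigma_sets_induct_disjoint[of "{S. open S}" UNIV])
  show "B \<in> sigma_sets UNIV {S. open S}" using B eq by simp
  show "P (UNIV - A)" if "A \<in> sigma_sets UNIV {S. open S}" "P A" for A
   using compl[of A] that eq by (simp add: Compl_eq_Diff_UNIV)
  show "P (\<Union>i. A i)" if "disjoint_family A" "range A \<subseteq> sigma_sets UNIV {S. open S}" "!!i. P (A i)" for A :: "nat => _"
   using un[OF that(1) _ that(3)] that(2) eq by auto
 qed (use op in auto)
qed

text \<open>Sections of open sets have lower semicontinuous measure; Dynkin's theorem extends
  measurability to all Borel sets of the product space.\<close>

lemma measurable_section_measure:
 fixes \<nu> :: "'b::t2_space measure"
 assumes r: "radon_finite \<nu>" and B: "B \<in> sets (borel :: ('a::t2_space \<times> 'b) measure)"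
 shows "(%x. measure \<nu> (Pair x -` B)) \<in> BM"
 using B
proof (induction rule: borel_induct_open)
 case (open_set U)
 show ?case
 proof (rule borel_measurableI_greater)
  fix c
  have "open {x. c < measure \<nu> (Pair x -` U)}"
   unfolding open_subopen[of "{x. c < measure \<nu> (Pair x -` U)}"]
  proof (intro ballI)
   fix x assume "x \<in> {x. c < measure \<nu> (Pair x -` U)}"
   then obtain S V where S: "open S" "open V" "x \<in> S" "S \<times> V \<subseteq> U" "c < measure \<nu> V"
    using open_section_measure_greater[OF r open_set, of c x] by auto
   have "measure \<nu> V <= measure \<nu> (Pair z -` U)" if "z \<in> S" for z
    using S that section_borel(1)[OF borel_open[OF open_set], of z]
    by (intro finite_measure.finite_measure_mono[OF radon_finiteD(2)[OF r]]) (auto simp: radon_finiteD(1)[OF r])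
   then show "\<exists>T. open T & x \<in> T & T \<subseteq> {x. c < measure \<nu> (Pair x -` U)}"
    using S by (intro exI[of _ S]) force
  qed
  then show "{x \<in> space borel. c < measure \<nu> (Pair x -` U)} \<in> Borel" by simp
 qed
next
 case (complement A)
 have "measure \<nu> (Pair x -` (- A)) = measure \<nu> UNIV - measure \<nu> (Pair x -` A)" for x
 proof -
  have "Pair x -` (- A) = space \<nu> - Pair x -` A" by (auto simp: radon_finiteD[OF r])
  then show ?thesis
   using finite_measure.finite_measure_compl[OF radon_finiteD(2)[OF r], of "Pair x -` A"] section_borel(1)[OF complement(1), of x]
   by (simp add: radon_finiteD[OF r])
 qed
 then show ?case using complement(2) by simp
next
 case (disjoint_union A)
 have "(%i. measure \<nu> (Pair x -` A i)) sums measure \<nu> (Pair x -` (\<Union>i. A i))" for x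
  unfolding vimage_UN
  by (rule finite_measure.finite_measure_UNION[OF radon_finiteD(2)[OF r]])
   (use disjoint_union(1) section_borel(1)[OF disjoint_union(2)] in "auto simp: disjoint_family_on_def radon_finiteD(1)[OF r]")
 then have eq: "measure \<nu> (Pair x -` (\<Union>i. A i)) = (\<Sum>i. measure \<nu> (Pair x -` A i))" for x by (rule sums_unique)
 show ?case unfolding eq using disjoint_union(3) by (rule borel_measurable_suminf)
qed

lemma measurable_section_emeasure:
 fixes \<nu> :: "'b::t2_space measure"
 assumes r: "radon_finite \<nu>" and B: "B \<in> sets (borel :: ('a::t2_space \<times> 'b) measure)"
 shows "(%x. emeasure \<nu> (Pair x -` B)) \<in> BM"
 using measurable_section_measure[OF assms] by (simp add: finite_measure.emeasure_eq_measure[OF radon_finiteD(2)[OF r]])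

text \<open>Lives on the Borel sets of the product topology, which can be more than the product
  \<sigma>-algebra. The definition is asymmetric; \<open>radon_prod_swap\<close> restores
  symmetry.\<close>

definition radon_prod :: "'a::t2_space measure => 'b::t2_space measure => ('a \<times> 'b) measure" where
 "radon_prod \<mu> \<nu> = measure_of UNIV Borel (%B. \<integral>\<^sup>+x. emeasure \<nu> (Pair x -` B) \<partial>\<mu>)"

lemma sets_radon_prod [simp]: "sets (radon_prod \<mu> \<nu>) = Borel" "space (radon_prod \<mu> \<nu>) = UNIV"
 using sets.sigma_sets_eq[of borel] by (simp_all add: radon_prod_def sets_measure_of_conv space_measure_of_conv)

lemma emeasure_radon_prod:
 fixes \<mu> :: "'a::t2_space measure" and \<nu> :: "'b::t2_space measure"
 assumes rm: "radon_finite \<mu>" and rn: "radon_finite \<nu>" and B: "B \<in> Borel"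
 shows "emeasure (radon_prod \<mu> \<nu>) B = (\<integral>\<^sup>+x. emeasure \<nu> (Pair x -` B) \<partial>\<mu>)"
proof (rule emeasure_measure_of[OF radon_prod_def])
 show "B \<in> sets (radon_prod \<mu> \<nu>)" using B by simp
 show "positive (sets (radon_prod \<mu> \<nu>)) (%B. \<integral>\<^sup>+x. emeasure \<nu> (Pair x -` B) \<partial>\<mu>)"
  by (simp add: positive_def)
 show "countably_additive (sets (radon_prod \<mu> \<nu>)) (%B. \<integral>\<^sup>+x. emeasure \<nu> (Pair x -` B) \<partial>\<mu>)"
  unfolding countably_additive_def
 proof (intro allI impI)
  fix A :: "nat => ('a \<times> 'b) set"
  assume A: "range A \<subseteq> sets (radon_prod \<mu> \<nu>)" "disjoint_family A"
  then have Ab: "A i \<in> Borel" for i by auto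
  have m: "(%x. emeasure \<nu> (Pair x -` A i)) \<in> borel_measurable \<mu>" for i
   using measurable_section_emeasure[OF rn Ab[of i]] measurable_cong_sets[OF radon_finiteD(1)[OF rm] refl] by blast
  have "(\<Sum>i. \<integral>\<^sup>+x. emeasure \<nu> (Pair x -` A i) \<partial>\<mu>) = (\<integral>\<^sup>+x. (\<Sum>i. emeasure \<nu> (Pair x -` A i)) \<partial>\<mu>)"
   by (rule nn_integral_suminf[symmetric]) (rule m)
  also have "\<dots> = (\<integral>\<^sup>+x. emeasure \<nu> (Pair x -` (\<Union>i. A i)) \<partial>\<mu>)"
  proof (rule nn_integral_cong)
   fix x
   show "(\<Sum>i. emeasure \<nu> (Pair x -` A i)) = emeasure \<nu> (Pair x -` (\<Union>i. A i))"
    unfolding vimage_UN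
    by (rule suminf_emeasure) (use A(2) section_borel(1)[OF Ab] in "auto simp: disjoint_family_on_def radon_finiteD(1)[OF rn]")
  qed
  finally show "(\<Sum>i. \<integral>\<^sup>+x. emeasure \<nu> (Pair x -` A i) \<partial>\<mu>) = (\<integral>\<^sup>+x. emeasure \<nu> (Pair x -` (\<Union>i. A i)) \<partial>\<mu>)" .
 qed
qed simp

lemma finite_measure_radon_prod:
 assumes rm: "radon_finite \<mu>" and rn: "radon_finite \<nu>"
 shows "finite_measure (radon_prod \<mu> \<nu>)"
proof
 have "emeasure (radon_prod \<mu> \<nu>) UNIV = emeasure \<nu> UNIV * emeasure \<mu> (space \<mu>)"
  by (subst emeasure_radon_prod[OF assms]) auto
 then show "emeasure (radon_prod \<mu> \<nu>) (space (radon_prod \<mu> \<nu>)) \<noteq> \<infinity>"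
  using finite_measure.emeasure_finite[OF radon_finiteD(2)[OF rm]] finite_measure.emeasure_finite[OF radon_finiteD(2)[OF rn]]
  by (simp add: ennreal_mult_eq_top_iff)
qed

lemma measurable_swap_borel: "prod.swap \<in> borel_measurable (borel :: ('a::topological_space \<times> 'b::topological_space) measure)"
 unfolding prod.swap_def by (intro borel_measurable_continuous_onI continuous_intros)

text \<open>Local to global: each point has a compact neighbourhood relative to \<open>C\<close> on
  which \<open>P\<close> holds, and finitely many of them cover \<open>C\<close>.\<close>

lemma compact_cover_induct:
 fixes C :: "'a::t2_space set"
 assumes C: "compact C" and loc: "!!x. x \<in> C ==> \<exists>U. open U & x \<in> U & (\<forall>F. compact F --> F \<subseteq> U \<inter> C --> P F)"
  and empty: "P {}" and union: "!!F G. P F ==> P G ==> P (F \<union> G)"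
 shows "P C"
proof -
 have "\<exists>U F. open U & x \<in> U & U \<inter> C \<subseteq> F & F \<subseteq> C & P F" if x: "x \<in> C" for x
 proof -
  obtain U where U: "open U" "x \<in> U" "\<forall>F. compact F --> F \<subseteq> U \<inter> C --> P F" using loc[OF x] by (elim exE conjE)
  \<comment> \<open>Hausdorff separation of \<open>x\<close> from \<open>C - U\<close>, so that
    \<open>C - W\<close> is a compact neighbourhood of \<open>x\<close> in \<open>C\<close>
    contained in \<open>U\<close>.\<close>
  have "{x} \<times> (C - U) \<subseteq> {(x, y) |x y. x \<noteq> y}" using U(2) by auto
  from compact_tube[OF compact_diff[OF C U(1)] open_diagonal_complement this]
  obtain V W where VW: "open V" "open W" "x \<in> V" "C - U \<subseteq> W" "V \<times> W \<subseteq> {(x, y) |x y. x \<noteq> y}" by (elim exE conjE)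
  have "P (C - W)" using U(3) compact_diff[OF C VW(2)] VW(4) by blast
  then show ?thesis using VW by (intro exI[of _ V] exI[of _ "C - W"]) auto
 qed
 then have "\<forall>x\<in>C. \<exists>U F. open U & x \<in> U & U \<inter> C \<subseteq> F & F \<subseteq> C & P F" by blast
 from bchoice[OF this] obtain U where "\<forall>x\<in>C. \<exists>F. open (U x) & x \<in> U x & U x \<inter> C \<subseteq> F & F \<subseteq> C & P F" ..
 from bchoice[OF this] obtain F where UF: "\<forall>x\<in>C. open (U x) & x \<in> U x & U x \<inter> C \<subseteq> F x & F x \<subseteq> C & P (F x)" ..
 obtain T where T: "T \<subseteq> C" "finite T" "C \<subseteq> (\<Union>x\<in>T. U x)" by (rule compactE_image[OF C, of C U]) (use UF in auto)
 have "P (\<Union>x\<in>T. F x)" using T(2,1) by (induction rule: finite_induct) (use UF empty union in auto)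
 moreover have "(\<Union>x\<in>T. F x) = C" using T UF by blast
 ultimately show ?thesis by simp
qed

text \<open>The measure of the sections of an open set is lower semicontinuous; on a compact set where it
 oscillates little, the sections are almost exhausted by finitely many compact rectangles.\<close>

lemma radon_finite_prod:
 fixes \<mu> :: "'a::t2_space measure" and \<nu> :: "'b::t2_space measure"
 assumes rm: "radon_finite \<mu>" and rn: "radon_finite \<nu>"
 shows "radon_finite (radon_prod \<mu> \<nu>)"
proof (rule radon_finiteI_open[OF finite_measure_radon_prod[OF assms]])
 interpret M: finite_measure \<mu> by (rule radon_finiteD(2)[OF rm])
 interpret N: finite_measure \<nu> by (rule radon_finiteD(2)[OF rn])
 interpret P: finite_measure "radon_prod \<mu> \<nu>" by (rule finite_measure_radon_prod[OF assms])
 note sm = radon_finiteD(1)[OF rm] and sn = radon_finiteD(1)[OF rn]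
 fix B :: "('a \<times> 'b) set" and \<eta> :: real assume B: "open B" and \<eta>: "\<eta> > 0"
 define g where "g x = measure \<nu> (Pair x -` B)" for x
 have gm: "g \<in> BM" unfolding g_def by (rule measurable_section_measure[OF rn borel_open[OF B]])
 define c where "c = measure \<mu> UNIV"
 define k where "k = measure \<nu> UNIV"
 have ck: "c \<ge> 0" "k \<ge> 0" by (simp_all add: c_def k_def)
 \<comment> \<open>Off an exceptional set, sections lose at most \<open>2 * d\<close>, in total less
   than \<open>\<eta> / 2\<close>; one \<open>d\<close> comes from the width of a slice of
   \<open>g\<close>, the other from the compact rectangle.\<close>
 define d where "d = \<eta> / (4 * (c + 1))"
 have d: "d > 0" "2 * d * c < \<eta> / 2" using \<eta> ck by (simp_all add: d_def field_simps)
 have sec: "Pair x -` (B - K) \<in> sets \<nu>" if "compact K" for x K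
  using section_borel(1)[OF sets.Diff[OF borel_open[OF B] compact_borel_t2[OF that]]] by (simp add: sn)
 define good where "good F \<longleftrightarrow> (\<exists>K. compact K & K \<subseteq> B & (\<forall>x\<in>F. measure \<nu> (Pair x -` (B - K)) <= 2 * d))" for F
 have good: "good C" if C: "compact C" "C \<subseteq> {x. real j * d <= g x & g x < real j * d + d}" for C j
 proof (rule compact_cover_induct[OF C(1)])
  show "good {}" unfolding good_def by (intro exI[of _ "{}"]) auto
  fix F G assume "good F" "good G"
  then obtain K L where K: "compact K" "K \<subseteq> B" "\<forall>x\<in>F. measure \<nu> (Pair x -` (B - K)) <= 2 * d"
   and L: "compact L" "L \<subseteq> B" "\<forall>x\<in>G. measure \<nu> (Pair x -` (B - L)) <= 2 * d" unfolding good_def by (elim exE conjE)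
  have le: "measure \<nu> (Pair x -` (B - (K \<union> L))) <= measure \<nu> (Pair x -` (B - K))"
   "measure \<nu> (Pair x -` (B - (K \<union> L))) <= measure \<nu> (Pair x -` (B - L))" for x
   using sec K L by (auto intro!: N.finite_measure_mono)
  show "good (F \<union> G)" unfolding good_def
  proof (intro exI[of _ "K \<union> L"] conjI ballI)
   fix x assume "x \<in> F \<union> G"
   then show "measure \<nu> (Pair x -` (B - (K \<union> L))) <= 2 * d" using le[of x] K(3) L(3) by (auto intro: order_trans)
  qed (use K L in auto)
 next
  fix x assume x: "x \<in> C"
  have gx: "g x - d < measure \<nu> (Pair x -` B)" using d by (simp add: g_def)
  obtain U V where UV: "open U" "open V" "x \<in> U" "U \<times> V \<subseteq> B" "g x - d < measure \<nu> V"
   using open_section_measure_greater[OF rn B gx] by (elim exE conjE)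
  have "measure \<nu> V - (g x - d) > 0" using UV(5) by simp
  then obtain L where L: "compact L" "L \<subseteq> V" "measure \<nu> (V - L) < measure \<nu> V - (g x - d)" by (rule radon_finiteE[OF rn borel_open[OF UV(2)]])
  have bL: "L \<in> sets \<nu>" using compact_borel_t2[OF L(1)] by (simp add: sn)
  have gL: "g x - d < measure \<nu> L" using N.finite_measure_Diff[of V L] UV(2) bL L(2,3) by (simp add: sn)
  have "good F" if F: "compact F" "F \<subseteq> U \<inter> C" for F unfolding good_def
  proof (intro exI[of _ "F \<times> L"] conjI ballI)
   fix y assume y: "y \<in> F"
   have "Pair y -` (B - F \<times> L) = Pair y -` B - L" using y by auto
   then have "measure \<nu> (Pair y -` (B - F \<times> L)) = g y - measure \<nu> L"
    unfolding g_def using N.finite_measure_Diff[of "Pair y -` B" L] y F(2) UV(4) L(2) bL section_borel(1)[OF borel_open[OF B]]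
    by (fastforce simp: sn)
   moreover have "g y < real j * d + d" "real j * d <= g x" using y x F(2) C(2) by blast+
   ultimately show "measure \<nu> (Pair y -` (B - F \<times> L)) <= 2 * d" using gL by linarith
  qed (use F L UV(4) in "auto intro: compact_Times")
  then show "\<exists>U. open U & x \<in> U & (\<forall>F. compact F --> F \<subseteq> U \<inter> C --> good F)" using UV by blast
 qed
 obtain n :: nat where "k / d < real n" using reals_Archimedean2 by blast
 then have n: "k < real n * d" using d by (simp add: divide_less_eq)
 define E where "E j = {x. real j * d <= g x & g x < real j * d + d}" for j
 have Eb: "E j \<in> Borel" for j unfolding E_def using gm by measurable
 \<comment> \<open>The share of the exceptional set in each of the \<open>n\<close> slices; on that
   set only the crude bound \<open>k\<close> is available.\<close>
 define \<zeta> where "\<zeta> = \<eta> / (2 * (k * n + 1))"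
 have \<zeta>: "\<zeta> > 0" "k * (n * \<zeta>) < \<eta> / 2"
 proof -
  have p: "0 < k * n + 1" using ck(2) by (simp add: add_nonneg_pos)
  show "\<zeta> > 0" using p \<eta> by (simp add: \<zeta>_def)
  have "k * (n * \<zeta>) = \<eta> / 2 * (k * n / (k * n + 1))" by (simp add: \<zeta>_def)
  also have "\<dots> < \<eta> / 2 * 1" using p \<eta> by (intro mult_strict_left_mono) auto
  finally show "k * (n * \<zeta>) < \<eta> / 2" by simp
 qed
 define R where "R j C K \<longleftrightarrow> compact C & C \<subseteq> E j & measure \<mu> (E j - C) < \<zeta> & compact K & K \<subseteq> B & (\<forall>x\<in>C. measure \<nu> (Pair x -` (B - K)) <= 2 * d)" for j C K
 have "\<exists>C K. R j C K" for j
 proof -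
  obtain C where C: "compact C" "C \<subseteq> E j" "measure \<mu> (E j - C) < \<zeta>" by (rule radon_finiteE[OF rm Eb \<zeta>(1)])
  show ?thesis using good[OF C(1) C(2)[unfolded E_def]] C unfolding good_def R_def by (elim exE conjE) (intro exI[of _ C] exI conjI)
 qed
 then have "\<forall>j. \<exists>C K. R j C K" ..
 from choice[OF this] obtain C where "\<forall>j. \<exists>K. R j (C j) K" ..
 from choice[OF this] obtain K where CK: "\<forall>j. R j (C j) (K j)" ..
 note CK = CK[unfolded R_def]
 define L where "L = (\<Union>j<n. K j)"
 define X where "X = (\<Union>j<n. E j - C j)"
 have L: "compact L" "L \<subseteq> B" unfolding L_def using CK by (auto intro!: compact_UN)
 have Xj: "E j - C j \<in> sets \<mu>" for j unfolding sm by (intro sets.Diff Eb compact_borel_t2) (use CK in blast)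
 have le: "emeasure \<nu> (Pair x -` (B - L)) <= ennreal (2 * d) + ennreal k * indicator X x" for x
 proof (cases "x \<in> X")
  case True
  have "measure \<nu> (Pair x -` (B - L)) <= k" unfolding k_def using N.bounded_measure[of "Pair x -` (B - L)"] by (simp add: radon_finiteD(3)[OF rn])
  then have "ennreal (measure \<nu> (Pair x -` (B - L))) <= 0 + ennreal k" by (simp add: ennreal_leI)
  also have "\<dots> <= ennreal (2 * d) + ennreal k" by (intro add_right_mono) simp
  finally show ?thesis using True by (simp add: N.emeasure_eq_measure)
 next
  case False
  \<comment> \<open>The slice containing \<open>x\<close>; \<open>j < n\<close> because
    \<open>g\<close> is bounded by \<open>k < n * d\<close>.\<close>
  define j where "j = nat \<lfloor>g x / d\<rfloor>"
  have gx: "0 <= g x" "g x <= k" unfolding g_def k_def using N.bounded_measure[of "Pair x -` B"] by (simp_all add: radon_finiteD(3)[OF rn])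
  have "real j <= g x / d" "g x / d < real j + 1" using gx(1) d(1) unfolding j_def by (auto simp: of_nat_floor)
  then have j: "real j * d <= g x" "g x < real j * d + d" using d(1) by (auto simp: field_simps)
  have "real j * d < real n * d" using j(1) gx(2) n by linarith
  then have jn: "j < n" using d(1) by simp
  then have "x \<in> C j" using False j unfolding X_def E_def by blast
  then have "measure \<nu> (Pair x -` (B - K j)) <= 2 * d" using CK by blast
  moreover have "measure \<nu> (Pair x -` (B - L)) <= measure \<nu> (Pair x -` (B - K j))"
   by (rule N.finite_measure_mono) (use jn CK sec in "auto simp: L_def")
  ultimately have "measure \<nu> (Pair x -` (B - L)) <= 2 * d" by linarith
  then show ?thesis using False by (simp add: N.emeasure_eq_measure ennreal_leI)
 qed
 have "emeasure (radon_prod \<mu> \<nu>) (B - L) <= (\<integral>\<^sup>+x. ennreal (2 * d) + ennreal k * indicator X x \<partial>\<mu>)"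
  using B compact_borel_t2[OF L(1)] by (subst emeasure_radon_prod[OF rm rn]) (auto intro!: nn_integral_mono le)
 also have "\<dots> = ennreal (2 * d) * emeasure \<mu> UNIV + ennreal k * emeasure \<mu> X"
 proof -
  have "X \<in> sets \<mu>" unfolding X_def using Xj by (intro sets.finite_UN) auto
  then show ?thesis by (simp add: nn_integral_add nn_integral_cmult_indicator radon_finiteD(3)[OF rm])
 qed
 also have "\<dots> = ennreal (2 * d * c + k * measure \<mu> X)"
  using d(1) ck by (simp add: c_def M.emeasure_eq_measure ennreal_mult)
 finally have le: "measure (radon_prod \<mu> \<nu>) (B - L) <= 2 * d * c + k * measure \<mu> X"
  using d(1) ck unfolding P.emeasure_eq_measure by (subst (asm) ennreal_le_iff) simp_all
 have "measure \<mu> X <= (\<Sum>j<n. measure \<mu> (E j - C j))" unfolding X_def using Xj by (intro measure_UNION_le) auto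
 also have "\<dots> <= (\<Sum>j<n. \<zeta>)" using CK by (intro sum_mono) (simp add: less_imp_le)
 finally have "k * measure \<mu> X <= k * (n * \<zeta>)" using ck(2) by (intro mult_left_mono) simp_all
 then have "measure (radon_prod \<mu> \<nu>) (B - L) < \<eta>" using le d(2) \<zeta>(2) by linarith
 then show "\<exists>K. compact K & K \<subseteq> B & measure (radon_prod \<mu> \<nu>) (B - K) < \<eta>" using L by blast
qed simp

text \<open>One inequality on open sets suffices, since it can be applied with the factors
  exchanged. An open set is nearly exhausted by a finite union of open rectangles, which belongs to
  the product \<sigma>-algebra, where the classical theorem applies.\<close>

lemma radon_prod_swap:
 fixes \<mu> :: "'a::t2_space measure" and \<nu> :: "'b::t2_space measure"
 assumes rm: "radon_finite \<mu>" and rn: "radon_finite \<nu>"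
 shows "radon_prod \<mu> \<nu> = distr (radon_prod \<nu> \<mu>) borel prod.swap"
proof (rule measure_eqI_generator_eq[where E="{S. open S}" and \<Omega>=UNIV and A="%_. UNIV"])
 have swb: "emeasure (distr (radon_prod \<nu> \<mu>) borel prod.swap) S = emeasure (radon_prod \<nu> \<mu>) (prod.swap -` S)"
  if "S \<in> Borel" for \<mu> :: "'c::t2_space measure" and \<nu> :: "'d::t2_space measure" and S
  using emeasure_distr[of prod.swap "radon_prod \<nu> \<mu>" borel S] measurable_swap_borel measurable_cong_sets[OF sets_radon_prod(1) refl] that by auto
 have le: "emeasure (radon_prod \<mu> \<nu>) B <= emeasure (radon_prod \<nu> \<mu>) (prod.swap -` B)"
  if rm: "radon_finite \<mu>" and rn: "radon_finite \<nu>" and B: "open B" for \<mu> :: "'c::t2_space measure" and \<nu> :: "'d::t2_space measure" and B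
 proof (rule ennreal_le_epsilon)
  interpret M: finite_measure \<mu> by (rule radon_finiteD(2)[OF rm])
  interpret N: finite_measure \<nu> by (rule radon_finiteD(2)[OF rn])
  interpret pair_sigma_finite \<mu> \<nu> ..
  interpret P: finite_measure "radon_prod \<mu> \<nu>" by (rule finite_measure_radon_prod[OF rm rn])
  fix \<eta> :: real assume e: "\<eta> > 0"
  obtain K where K: "compact K" "K \<subseteq> B" "measure (radon_prod \<mu> \<nu>) (B - K) < \<eta>" by (rule radon_finiteE[OF radon_finite_prod[OF rm rn] borel_open[OF B] e])
  have "\<forall>p\<in>K. \<exists>S. (\<exists>U V. S = U \<times> V & open U & open V & U \<times> V \<subseteq> B) & p \<in> S"
  proof
   fix p assume "p \<in> K"
   then have "p \<in> B" using K(2) by blast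
   from open_prod_elim[OF B this] obtain U V where "open U" "open V" "p \<in> U \<times> V" "U \<times> V \<subseteq> B" .
   then show "\<exists>S. (\<exists>U V. S = U \<times> V & open U & open V & U \<times> V \<subseteq> B) & p \<in> S" by blast
  qed
  from bchoice[OF this] obtain S where S: "\<forall>p\<in>K. (\<exists>U V. S p = U \<times> V & open U & open V & U \<times> V \<subseteq> B) & p \<in> S p" ..
  have So: "open (S p)" if "p \<in> K" for p using S that open_Times by metis
  have "K \<subseteq> (\<Union>p\<in>K. S p)" using S by blast
  from compactE_image[OF K(1) So this] obtain T where T: "T \<subseteq> K" "finite T" "K \<subseteq> (\<Union>p\<in>T. S p)" .
  define R where "R = (\<Union>p\<in>T. S p)"
  have R: "R \<subseteq> B" "open R" unfolding R_def using S T(1) So by blast+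
  have bR: "R \<in> sets (\<mu> \<Otimes>\<^sub>M \<nu>)" unfolding R_def
  proof (rule sets.finite_UN[OF T(2)])
   fix p assume "p \<in> T"
   then obtain U V where "S p = U \<times> V" "open U" "open V" using S T(1) by blast
   then show "S p \<in> sets (\<mu> \<Otimes>\<^sub>M \<nu>)" by (simp add: pair_measureI radon_finiteD(1)[OF rm] radon_finiteD(1)[OF rn])
  qed
  have v: "prod.swap -` R \<in> Borel" "prod.swap -` R \<subseteq> prod.swap -` B" "prod.swap -` B \<in> Borel"
   using R B measurable_sets[OF measurable_swap_borel, of R] measurable_sets[OF measurable_swap_borel, of B] by auto
  have "emeasure (radon_prod \<mu> \<nu>) B = emeasure (radon_prod \<mu> \<nu>) K + emeasure (radon_prod \<mu> \<nu>) (B - K)"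
   using K(2) B compact_borel_t2[OF K(1)] by (subst plus_emeasure) (auto simp: Un_absorb1)
  also have "\<dots> <= emeasure (radon_prod \<mu> \<nu>) R + ennreal \<eta>"
   using K(3) T(3) R e by (intro add_mono emeasure_mono) (auto simp: R_def P.emeasure_eq_measure)
  also have "emeasure (radon_prod \<mu> \<nu>) R = emeasure (radon_prod \<nu> \<mu>) (prod.swap -` R)"
   using emeasure_radon_prod[OF rm rn borel_open[OF R(2)]] emeasure_radon_prod[OF rn rm v(1)] N.emeasure_pair_measure_alt[OF bR] emeasure_pair_measure_alt2[OF bR]
   by (simp add: vimage_comp[symmetric] vimage_def)
  also have "\<dots> <= emeasure (radon_prod \<nu> \<mu>) (prod.swap -` B)" by (rule emeasure_mono) (use v in auto)
  finally show "emeasure (radon_prod \<mu> \<nu>) B <= emeasure (radon_prod \<nu> \<mu>) (prod.swap -` B) + ennreal \<eta>" by (simp add: add_right_mono)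
 qed
 show "Int_stable {S :: ('a \<times> 'b) set. open S}" by (auto simp: Int_stable_def)
 show "sets (radon_prod \<mu> \<nu>) = sigma_sets UNIV {S. open S}" "sets (distr (radon_prod \<nu> \<mu>) borel prod.swap) = sigma_sets UNIV {S. open S}"
  by (simp_all add: borel_def)
 show "emeasure (radon_prod \<mu> \<nu>) UNIV \<noteq> \<infinity>" for i :: nat
  using finite_measure.emeasure_finite[OF finite_measure_radon_prod[OF rm rn]] by simp
 fix B :: "('a \<times> 'b) set" assume "B \<in> {S. open S}"
 then have B: "open B" by simp
 have B': "open (prod.swap -` B)" using B by (intro open_vimage) (auto simp: prod.swap_def intro!: continuous_intros)
 have "prod.swap -` prod.swap -` B = B" by auto
 then show "emeasure (radon_prod \<mu> \<nu>) B = emeasure (distr (radon_prod \<nu> \<mu>) borel prod.swap) B"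
  using le[OF rm rn B] le[OF rn rm B'] swb[OF borel_open[OF B]] by simp
qed auto

section \<open>Tonelli's theorem for finite Radon measures\<close>

lemma borel_section_measurable:
 assumes "f \<in> borel_measurable (borel :: ('a::topological_space \<times> 'b::topological_space) measure)"
 shows "(%y. f (x, y)) \<in> BM" "(%x. f (x, y)) \<in> BM"
proof -
 have "(%y. (x, y)) \<in> BM" "(%x. (x, y)) \<in> BM"
  by (intro borel_measurable_continuous_onI continuous_intros)+
 from this[THEN measurable_compose, OF assms]
 show "(%y. f (x, y)) \<in> BM" "(%x. f (x, y)) \<in> BM" .
qed

lemma nn_integral_radon_prod:
 fixes \<mu> :: "'a::t2_space measure" and \<nu> :: "'b::t2_space measure" and f :: "'a \<times> 'b => ennreal"
 assumes rm: "radon_finite \<mu>" and rn: "radon_finite \<nu>" and f: "f \<in> BM"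
 shows "(%x. \<integral>\<^sup>+y. f (x, y) \<partial>\<nu>) \<in> BM &
  (\<integral>\<^sup>+p. f p \<partial>radon_prod \<mu> \<nu>) = (\<integral>\<^sup>+x. \<integral>\<^sup>+y. f (x, y) \<partial>\<nu> \<partial>\<mu>)"
proof -
 have mm: "g \<in> BM ==> g \<in> borel_measurable \<mu>" for g :: "'a => ennreal"
  using measurable_cong_sets[OF radon_finiteD(1)[OF rm] refl] by blast
 have mn: "g \<in> BM ==> g \<in> borel_measurable \<nu>" for g :: "'b => ennreal"
  using measurable_cong_sets[OF radon_finiteD(1)[OF rn] refl] by blast
 have mp: "g \<in> BM ==> g \<in> borel_measurable (radon_prod \<mu> \<nu>)" for g :: "'a \<times> 'b => ennreal"
  using measurable_cong_sets[OF sets_radon_prod(1) refl] by blast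
 show ?thesis
  using f
 proof (induction rule: borel_measurable_induct)
  case (cong f g) then show ?case by simp
 next
  case (set A)
  have "(\<integral>\<^sup>+y. indicator A (x, y) \<partial>\<nu>) = emeasure \<nu> (Pair x -` A)" for x
  proof -
   have "(\<integral>\<^sup>+y. indicator A (x, y) \<partial>\<nu>) = (\<integral>\<^sup>+y. indicator (Pair x -` A) y \<partial>\<nu>)"
    by (intro nn_integral_cong) (auto simp: indicator_def)
   then show ?thesis using section_borel(1)[OF set] by (simp add: radon_finiteD(1)[OF rn])
  qed
  then show ?case
   using measurable_section_emeasure[OF rn set] emeasure_radon_prod[OF rm rn set] set by simp
 next
  case (mult u c)
  have "(\<integral>\<^sup>+y. c * u (x, y) \<partial>\<nu>) = c * (\<integral>\<^sup>+y. u (x, y) \<partial>\<nu>)" for x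
   by (rule nn_integral_cmult) (rule mn[OF borel_section_measurable(1)[OF mult(2)]])
  then show ?case
   using mult.IH mult(2) borel_measurable_times_ennreal[OF borel_measurable_const, of "%x. \<integral>\<^sup>+y. u (x, y) \<partial>\<nu>" borel c]
   by (simp add: nn_integral_cmult mm mp)
 next
  case (add u v)
  have "(\<integral>\<^sup>+y. v (x, y) + u (x, y) \<partial>\<nu>) = (\<integral>\<^sup>+y. v (x, y) \<partial>\<nu>) + (\<integral>\<^sup>+y. u (x, y) \<partial>\<nu>)" for x
   by (rule nn_integral_add) (auto intro: mn borel_section_measurable(1) add)
  then show ?case using add.IH add.hyps by (auto simp: nn_integral_add mm mp intro!: borel_measurable_add)
 next
  case (seq U)
  have inc: "incseq (%i. U i p)" for p using seq(3) unfolding incseq_def le_fun_def by blast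
  have e: "(\<integral>\<^sup>+y. (SUP i. U i) (x, y) \<partial>\<nu>) = (SUP i. \<integral>\<^sup>+y. U i (x, y) \<partial>\<nu>)" for x
   unfolding SUP_apply
   by (rule nn_integral_monotone_convergence_SUP) (use seq(3) in "auto simp: incseq_def le_fun_def intro: mn borel_section_measurable(1) seq(1)")
  have e2: "(\<integral>\<^sup>+x. (SUP i. \<integral>\<^sup>+y. U i (x, y) \<partial>\<nu>) \<partial>\<mu>) = (SUP i. \<integral>\<^sup>+x. \<integral>\<^sup>+y. U i (x, y) \<partial>\<nu> \<partial>\<mu>)"
   by (rule nn_integral_monotone_convergence_SUP)
    (use seq.IH inc in "auto simp: incseq_def le_fun_def intro!: mm nn_integral_mono")
  have e3: "(\<integral>\<^sup>+p. (SUP i. U i) p \<partial>radon_prod \<mu> \<nu>) = (SUP i. \<integral>\<^sup>+p. U i p \<partial>radon_prod \<mu> \<nu>)"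
   unfolding SUP_apply
   by (rule nn_integral_monotone_convergence_SUP) (use seq in "auto intro: mp")
  show ?case unfolding e e2 e3 using seq.IH by (auto intro!: borel_measurable_SUP)
 qed
qed

lemma nn_integral_radon_swap:
 fixes \<mu> :: "'a::t2_space measure" and \<nu> :: "'b::t2_space measure" and f :: "'a \<times> 'b => ennreal"
 assumes rm: "radon_finite \<mu>" and rn: "radon_finite \<nu>" and f: "f \<in> BM"
 shows "(\<integral>\<^sup>+x. \<integral>\<^sup>+y. f (x, y) \<partial>\<nu> \<partial>\<mu>) = (\<integral>\<^sup>+y. \<integral>\<^sup>+x. f (x, y) \<partial>\<mu> \<partial>\<nu>)"
proof -
 have sw: "prod.swap \<in> measurable (radon_prod \<nu> \<mu>) borel"
  using measurable_swap_borel measurable_cong_sets[OF sets_radon_prod(1) refl] by blast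
 have fs: "(%p. f (prod.swap p)) \<in> BM"
  by (rule measurable_compose[OF measurable_swap_borel f])
 have "(\<integral>\<^sup>+x. \<integral>\<^sup>+y. f (x, y) \<partial>\<nu> \<partial>\<mu>) = (\<integral>\<^sup>+p. f p \<partial>radon_prod \<mu> \<nu>)"
  using nn_integral_radon_prod[OF rm rn f] by simp
 also have "\<dots> = (\<integral>\<^sup>+p. f (prod.swap p) \<partial>radon_prod \<nu> \<mu>)"
  unfolding radon_prod_swap[OF rm rn] by (rule nn_integral_distr[OF sw]) (use f in simp)
 also have "\<dots> = (\<integral>\<^sup>+y. \<integral>\<^sup>+x. f (x, y) \<partial>\<mu> \<partial>\<nu>)"
  using nn_integral_radon_prod[OF rn rm fs] by simp
 finally show ?thesis .
qed

text \<open>The Bochner integral is composed of nonnegative integrals, whose measurability in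
  \<open>x\<close> is known; on the measurable set of those \<open>x\<close> for which the section
  is not integrable it has the default value 0.\<close>

lemma measurable_radon_integral:
 fixes \<nu> :: "'b::t2_space measure" and f :: "'a::t2_space \<times> 'b => complex"
 assumes rn: "radon_finite \<nu>" and f: "f \<in> BM"
 shows "(%x. \<integral>y. f (x, y) \<partial>\<nu>) \<in> BM"
proof -
 have sec: "(%y. f (x, y)) \<in> borel_measurable \<nu>" for x
  using borel_section_measurable(1)[OF f] measurable_cong_sets[OF radon_finiteD(1)[OF rn] refl] by blast
 define g where "g h x = (\<integral>\<^sup>+y. ennreal (h (f (x, y))) \<partial>\<nu>)" for h and x :: 'a
 \<comment> \<open>Any Radon measure serves as first factor, because only the measurability
   statement of \<open>nn_integral_radon_prod\<close> is extracted.\<close>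
 have zero: "radon_finite (null_measure (borel :: 'a measure))"
  unfolding radon_finite_def
  by (auto intro!: finite_measureI exI[of _ "{}"] simp: measure_def)
 have gm: "g h \<in> BM" if "h \<in> BM" for h
 proof -
  have "(%p. ennreal (h (f p))) \<in> BM" using f that by measurable
  from nn_integral_radon_prod[OF zero rn this] show ?thesis unfolding g_def by auto
 qed
 have eq: "(\<integral>y. f (x, y) \<partial>\<nu>) = (if g cmod x < \<infinity>
   then Complex (enn2real (g Re x) - enn2real (g (%z. - Re z) x)) (enn2real (g Im x) - enn2real (g (%z. - Im z) x)) else 0)" for x
 proof (cases "g cmod x < \<infinity>")
  case True
  then have i: "integrable \<nu> (%y. f (x, y))" using sec by (auto simp: integrable_iff_bounded g_def)
  have "Re (\<integral>y. f (x, y) \<partial>\<nu>) = (\<integral>y. Re (f (x, y)) \<partial>\<nu>)" "Im (\<integral>y. f (x, y) \<partial>\<nu>) = (\<integral>y. Im (f (x, y)) \<partial>\<nu>)"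
   using i by simp_all
  then show ?thesis
   using True integrable_Re[OF i] integrable_Im[OF i]
   by (auto simp: complex_eq_iff real_lebesgue_integral_def g_def)
 next
  case False
  then have "\<not> integrable \<nu> (%y. f (x, y))" by (auto simp: integrable_iff_bounded g_def)
  then show ?thesis using False by (simp add: not_integrable_integral_eq)
 qed
 have m: "g cmod \<in> BM" "g Re \<in> BM" "g (%z. - Re z) \<in> BM"
  "g Im \<in> BM" "g (%z. - Im z) \<in> BM"
  by (intro gm; measurable)+
 have C: "(%x. Complex (a x) (b x)) = (%x. complex_of_real (a x) + \<i> * complex_of_real (b x))" for a b :: "'a => real"
  by (auto simp: complex_eq_iff)
 have "(%x. Complex (enn2real (g Re x) - enn2real (g (%z. - Re z) x)) (enn2real (g Im x) - enn2real (g (%z. - Im z) x)))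
  \<in> BM"
  unfolding C using m by measurable
 then show ?thesis unfolding eq using m(1) by (intro measurable_If) auto
qed

section \<open>Complex measures with a density\<close>

definition cm_density :: "'a::topological_space measure => ('a => complex) => 'a set => complex" where
 "cm_density \<nu> h E = (if E \<in> Borel then LINT x:E|\<nu>. h x else 0)"

lemma disjoint_family_lessThan:
 fixes A :: "nat => 'a set"
 assumes "disjoint_family A" shows "(\<Union>k<n. A k) \<inter> A n = {}"
proof -
 have "A k \<inter> A n = {}" if "k < n" for k using assms that by (simp add: disjoint_family_on_def)
 then show ?thesis by blast
qed

text \<open>Finite additivity plus domination gives continuity at the empty set: the remainder of a
  disjoint union has \<open>\<tau>\<close>-measure tending to 0.\<close>

lemma dominated_additive_complex_measure:
 assumes fin: "finite_measure \<tau>" and sets: "sets \<tau> = Borel"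
  and add: "!!A B. A \<in> Borel ==> B \<in> Borel ==> A \<inter> B = {} ==> \<mu> (A \<union> B) = \<mu> A + \<mu> B"
  and dom: "!!E. E \<in> Borel ==> cmod (\<mu> E) <= measure \<tau> E"
  and off: "!!E. E \<notin> Borel ==> \<mu> E = 0"
 shows "complex_borel_measure \<mu>"
 unfolding complex_borel_measure_def
proof (intro conjI allI impI off)
 interpret finite_measure \<tau> by (rule fin)
 fix A :: "nat => 'a set" assume A: "range A \<subseteq> Borel & disjoint_family A"
 then have Ab: "A n \<in> Borel" for n by auto
 have Ub: "(\<Union>n. A n) \<in> Borel" "(\<Union>k<n. A k) \<in> Borel" for n :: nat using Ab by auto
 have empty: "\<mu> {} = 0" using add[of "{}" "{}"] by simp
 have s: "(\<Sum>k<n. \<mu> (A k)) = \<mu> (\<Union>k<n. A k)" for n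
 proof (induction n)
  case (Suc n)
  have "(\<Union>k<n. A k) \<inter> A n = {}" using A by (intro disjoint_family_lessThan) simp
  then show ?case using Suc add[OF Ub(2) Ab, of n n] by (simp add: lessThan_Suc Un_commute)
 qed (simp add: empty)
 let ?R = "%n. (\<Union>n. A n) - (\<Union>k<n. A k)"
 have d: "\<mu> (\<Union>n. A n) - (\<Sum>k<n. \<mu> (A k)) = \<mu> (?R n)" for n
 proof -
  have "(\<Union>k<n. A k) \<union> ?R n = (\<Union>n. A n)" by auto
  moreover have "\<mu> ((\<Union>k<n. A k) \<union> ?R n) = \<mu> (\<Union>k<n. A k) + \<mu> (?R n)" by (rule add) (use Ub in auto)
  ultimately show ?thesis by (simp add: s)
 qed
 have "(%n. measure \<tau> (?R n)) \<longlonglongrightarrow> measure \<tau> (\<Inter>n. ?R n)"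
  by (rule finite_Lim_measure_decseq) (use Ub in "auto simp: sets decseq_def")
 also have "(\<Inter>n. ?R n) = {}"
 proof (rule equals0I)
  fix x assume x: "x \<in> (\<Inter>n. ?R n)"
  then obtain k where "x \<in> A k" by auto
  moreover have "x \<notin> (\<Union>i<Suc k. A i)" using x by blast
  ultimately show False by auto
 qed
 finally have lim: "(%n. measure \<tau> (?R n)) \<longlonglongrightarrow> 0" by simp
 have "cmod (\<mu> (?R n)) <= measure \<tau> (?R n)" for n by (rule dom) (use Ub in auto)
 from Lim_null_comparison[OF always_eventually[OF allI[OF this]] lim] have "(%n. \<mu> (?R n)) \<longlonglongrightarrow> 0" .
 then have "(%n. \<mu> (\<Union>n. A n) - \<mu> (?R n)) \<longlonglongrightarrow> \<mu> (\<Union>n. A n) - 0" by (intro tendsto_intros)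
 then show "(%n. \<mu> (A n)) sums \<mu> (\<Union>n. A n)" unfolding sums_def d[symmetric] by simp
qed

section \<open>The total variation\<close>

definition variation_fun :: "('a::topological_space set => complex) => 'a set => ennreal" where
 "variation_fun \<mu> E = (SUP P\<in>{P. finite P & P \<subseteq> Borel & disjoint P & \<Union>P \<subseteq> E}. (\<Sum>B\<in>P. ennreal (cmod (\<mu> B))))"

lemma variation_fun_upper:
 "finite P ==> P \<subseteq> Borel ==> disjoint P ==> \<Union>P \<subseteq> E ==> (\<Sum>B\<in>P. ennreal (cmod (\<mu> B))) <= variation_fun \<mu> E"
 unfolding variation_fun_def by (rule SUP_upper) simp

lemma variation_fun_least:
 "(!!P. finite P ==> P \<subseteq> Borel ==> disjoint P ==> \<Union>P \<subseteq> E ==> (\<Sum>B\<in>P. ennreal (cmod (\<mu> B))) <= c) ==> variation_fun \<mu> E <= c"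
 unfolding variation_fun_def by (rule SUP_least) simp

lemma cmod_le_variation_fun: "E \<in> Borel ==> ennreal (cmod (\<mu> E)) <= variation_fun \<mu> E"
 using variation_fun_upper[of "{E}" E \<mu>] by simp

lemma variation_fun_le:
 assumes "sets \<nu> = Borel" "!!B. B \<in> Borel ==> ennreal (cmod (\<mu> B)) <= emeasure \<nu> B" "E \<in> Borel"
 shows "variation_fun \<mu> E <= emeasure \<nu> E"
proof (rule variation_fun_least)
 fix P assume P: "finite P" "P \<subseteq> Borel" "disjoint P" "\<Union>P \<subseteq> E"
 have "(\<Sum>B\<in>P. ennreal (cmod (\<mu> B))) <= (\<Sum>B\<in>P. emeasure \<nu> B)" using P assms(2) by (intro sum_mono) auto
 also have "\<dots> = emeasure \<nu> (\<Union>B\<in>P. B)"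
  by (rule sum_emeasure) (use P assms(1) in "auto simp: disjoint_family_on_def disjoint_def")
 also have "\<dots> <= emeasure \<nu> E" using P assms by (intro emeasure_mono) auto
 finally show "(\<Sum>B\<in>P. ennreal (cmod (\<mu> B))) <= emeasure \<nu> E" .
qed

lemma sets_variation [simp]: "sets (variation \<mu>) = Borel" "space (variation \<mu>) = UNIV"
 using sets.sigma_sets_eq[of borel] by (simp_all add: variation_def sets_measure_of_conv space_measure_of_conv)

lemma complex_borel_measure_empty: "complex_borel_measure \<mu> ==> \<mu> {} = 0"
proof -
 assume "complex_borel_measure \<mu>"
 then have "(%n::nat. \<mu> {}) sums \<mu> (\<Union>n::nat. {})"
  unfolding complex_borel_measure_def by (elim conjE allE[of _ "%_. {}"]) (auto simp: disjoint_family_on_def)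
 then have "summable (%n::nat. \<mu> {})" by (rule sums_summable)
 then show ?thesis by (simp add: summable_const_iff)
qed

text \<open>\<open>measure_of\<close> yields the zero measure unless its argument is countably
  additive, so this classical fact has to be proved before any value of \<open>variation\<close> can
  be read off.\<close>

lemma emeasure_variation:
 assumes c: "complex_borel_measure \<mu>" and E: "E \<in> Borel"
 shows "emeasure (variation \<mu>) E = variation_fun \<mu> E"
proof (rule emeasure_measure_of[where \<Omega>=UNIV and A="Borel" and \<mu>="variation_fun \<mu>"])
 note empty = complex_borel_measure_empty[OF c]
 show "variation \<mu> = measure_of UNIV Borel (variation_fun \<mu>)" unfolding variation_def variation_fun_def[abs_def] ..
 show "E \<in> sets (variation \<mu>)" using E by simp
 have "variation_fun \<mu> {} <= 0"
 proof (rule variation_fun_least)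
  fix P :: "'a set set" assume "\<Union>P \<subseteq> {}"
  then have "ennreal (cmod (\<mu> B)) = 0" if "B \<in> P" for B using that empty by (cases "B = {}") auto
  then show "(\<Sum>B\<in>P. ennreal (cmod (\<mu> B))) <= 0" by simp
 qed
 then show "positive (sets (variation \<mu>)) (variation_fun \<mu>)" by (simp add: positive_def)
 have super: "variation_fun \<mu> A + variation_fun \<mu> B <= variation_fun \<mu> (A \<union> B)" if d: "A \<inter> B = {}" for A B
 proof -
  have ne: "{P :: 'a set set. finite P & P \<subseteq> Borel & disjoint P & \<Union>P \<subseteq> S} \<noteq> {}" for S
   by (auto intro!: exI[of _ "{}"])
  show ?thesis
   unfolding variation_fun_def[of \<mu> A] variation_fun_def[of \<mu> B] ennreal_SUP_add_left[OF ne, symmetric]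
    ennreal_SUP_add_right[OF ne]
  proof (intro SUP_least)
   fix P Q
   assume P: "P \<in> {P. finite P & P \<subseteq> Borel & disjoint P & \<Union>P \<subseteq> A}"
    and Q: "Q \<in> {P. finite P & P \<subseteq> Borel & disjoint P & \<Union>P \<subseteq> B}"
   have z: "ennreal (cmod (\<mu> S)) = 0" if "S \<in> P \<inter> Q" for S
   proof -
    have "S = {}" using that P Q d by blast
    then show ?thesis using empty by simp
   qed
   have "(\<Sum>S\<in>P. ennreal (cmod (\<mu> S))) + (\<Sum>S\<in>Q. ennreal (cmod (\<mu> S))) = (\<Sum>S\<in>P \<union> Q. ennreal (cmod (\<mu> S)))"
    using P Q z by (intro sum.union_inter_neutral[symmetric]) auto
   also have "\<dots> <= variation_fun \<mu> (A \<union> B)"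
   proof (rule variation_fun_upper)
    show "disjoint (P \<union> Q)" using P Q d by (intro disjoint_union) blast+
   qed (use P Q in auto)
   finally show "(\<Sum>S\<in>P. ennreal (cmod (\<mu> S))) + (\<Sum>S\<in>Q. ennreal (cmod (\<mu> S))) <= variation_fun \<mu> (A \<union> B)" .
  qed
 qed
 have mono: "variation_fun \<mu> A <= variation_fun \<mu> B" if "A \<subseteq> B" for A B
  unfolding variation_fun_def by (rule SUP_subset_mono) (use that in auto)
 show "countably_additive (sets (variation \<mu>)) (variation_fun \<mu>)"
  unfolding countably_additive_def
 proof (intro allI impI antisym)
  fix A :: "nat => 'a set" assume A: "range A \<subseteq> sets (variation \<mu>)" "disjoint_family A"
  then have Ab: "A n \<in> Borel" for n by auto
  have fin: "(\<Sum>k<n. variation_fun \<mu> (A k)) <= variation_fun \<mu> (\<Union>k<n. A k)" for n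
  proof (induction n)
   case (Suc n)
   have "(\<Union>k<n. A k) \<inter> A n = {}" by (rule disjoint_family_lessThan[OF A(2)])
   from order_trans[OF add_right_mono[OF Suc] super[OF this]]
   show ?case by (simp add: lessThan_Suc Un_commute add.commute)
  qed simp
  show "(\<Sum>k. variation_fun \<mu> (A k)) <= variation_fun \<mu> (\<Union>k. A k)"
  proof (rule suminf_le_const)
   show "(\<Sum>k<n. variation_fun \<mu> (A k)) <= variation_fun \<mu> (\<Union>k. A k)" for n
    by (rule order_trans[OF fin mono]) auto
  qed simp
  show "variation_fun \<mu> (\<Union>k. A k) <= (\<Sum>k. variation_fun \<mu> (A k))"
  proof (rule variation_fun_least)
   fix P assume P: "finite P" "P \<subseteq> Borel" "disjoint P" "\<Union>P \<subseteq> (\<Union>k. A k)"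
   \<comment> \<open>Each member of the partition is cut along the sets \<open>A k\<close>;
     countable additivity of \<open>\<mu>\<close> and the triangle inequality bound it by the
     pieces.\<close>
   have sub: "ennreal (cmod (\<mu> B)) <= (\<Sum>k. ennreal (cmod (\<mu> (B \<inter> A k))))" if B: "B \<in> P" for B
   proof -
    have "(%k. \<mu> (B \<inter> A k)) sums \<mu> (\<Union>k. B \<inter> A k)"
    proof -
     have "range (%k. B \<inter> A k) \<subseteq> Borel & disjoint_family (%k. B \<inter> A k)"
      using A(2) Ab P B by (auto simp: disjoint_family_on_def)
     then show ?thesis using c unfolding complex_borel_measure_def by blast
    qed
    moreover have "(\<Union>k. B \<inter> A k) = B" using P B by auto
    ultimately have "(%k. \<mu> (B \<inter> A k)) sums \<mu> B" by simp
    then have "(%n. ennreal (cmod (\<Sum>k<n. \<mu> (B \<inter> A k)))) \<longlonglongrightarrow> ennreal (cmod (\<mu> B))"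
     unfolding sums_def by (intro tendsto_ennrealI tendsto_norm)
    then show ?thesis
    proof (rule LIMSEQ_le_const2, intro exI[of _ 0] allI impI)
     fix n
     have "ennreal (cmod (\<Sum>k<n. \<mu> (B \<inter> A k))) <= ennreal (\<Sum>k<n. cmod (\<mu> (B \<inter> A k)))"
      by (intro ennreal_leI norm_sum)
     also have "\<dots> = (\<Sum>k<n. ennreal (cmod (\<mu> (B \<inter> A k))))" by simp
     also have "\<dots> <= (\<Sum>k. ennreal (cmod (\<mu> (B \<inter> A k))))" by (rule sum_le_suminf) auto
     finally show "ennreal (cmod (\<Sum>k<n. \<mu> (B \<inter> A k))) <= (\<Sum>k. ennreal (cmod (\<mu> (B \<inter> A k))))" .
    qed
   qed
   have part: "(\<Sum>B\<in>P. ennreal (cmod (\<mu> (B \<inter> S)))) <= variation_fun \<mu> S" if S: "S \<in> Borel" for S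
   proof -
    have "(\<Sum>B\<in>(%B. B \<inter> S) ` P. ennreal (cmod (\<mu> B))) = (\<Sum>B\<in>P. ennreal (cmod (\<mu> (B \<inter> S))))"
    \<comment> \<open>Different members of \<open>P\<close> have the same trace on \<open>S\<close>
      only if it is empty, where \<open>\<mu>\<close> vanishes.\<close>
    proof (subst sum.reindex_nontrivial[OF P(1)])
     fix B B' assume "B \<in> P" "B' \<in> P" "B \<noteq> B'" "B \<inter> S = B' \<inter> S"
     then have "B \<inter> S = {}" using P(3) unfolding disjoint_def by blast
     then show "ennreal (cmod (\<mu> (B \<inter> S))) = 0" using empty by simp
    qed simp
    moreover have "(\<Sum>B\<in>(%B. B \<inter> S) ` P. ennreal (cmod (\<mu> B))) <= variation_fun \<mu> S"
    proof (rule variation_fun_upper)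
     show "disjoint ((%B. B \<inter> S) ` P)" using P(3) unfolding disjoint_def by blast
    qed (use P S in auto)
    ultimately show ?thesis by simp
   qed
   have "(\<Sum>B\<in>P. ennreal (cmod (\<mu> B))) <= (\<Sum>B\<in>P. \<Sum>k. ennreal (cmod (\<mu> (B \<inter> A k))))" by (rule sum_mono) (rule sub)
   also have "\<dots> = (\<Sum>k. \<Sum>B\<in>P. ennreal (cmod (\<mu> (B \<inter> A k))))" by (rule suminf_sum[symmetric]) auto
   also have "\<dots> <= (\<Sum>k. variation_fun \<mu> (A k))" by (rule suminf_le[OF part[OF Ab]]) auto
   finally show "(\<Sum>B\<in>P. ennreal (cmod (\<mu> B))) <= (\<Sum>k. variation_fun \<mu> (A k))" .
  qed
 qed
qed simp

lemma set_integrable_if_integrable: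
 fixes f :: "'a => 'b::{banach, second_countable_topology}"
 shows "integrable \<nu> f ==> B \<in> sets \<nu> ==> set_integrable \<nu> B f"
 unfolding set_integrable_def by (rule integrable_mult_indicator)

text \<open>Where \<open>s\<close> is constant there is no cancellation, so the integral of its
  modulus is the modulus of its integral; \<open>h\<close> is exchanged for \<open>s\<close> and
  back, which accounts for the factor 2.\<close>

lemma integral_cmod_le_simple:
 fixes h s :: "'a => complex"
 assumes h: "integrable \<nu> h" and s: "integrable \<nu> s" and B: "B \<in> sets \<nu>" and z: "!!x. x \<in> B ==> s x = z"
 shows "(LINT x:B|\<nu>. cmod (h x)) <= cmod (LINT x:B|\<nu>. h x) + 2 * (LINT x:B|\<nu>. cmod (h x - s x))"
proof -
 have i: "set_integrable \<nu> B h" "set_integrable \<nu> B s" "set_integrable \<nu> B (%x. h x - s x)"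
  "set_integrable \<nu> B (%x. cmod (h x))" "set_integrable \<nu> B (%x. cmod (s x))" "set_integrable \<nu> B (%x. cmod (h x - s x))"
  using h s B by (auto intro!: set_integrable_if_integrable)
 let ?D = "LINT x:B|\<nu>. cmod (h x - s x)"
 have "(LINT x:B|\<nu>. cmod (h x)) <= (LINT x:B|\<nu>. cmod (s x) + cmod (h x - s x))"
  by (rule set_integral_mono[OF i(4) set_integral_add(1)[OF i(5,6)]]) (metis norm_triangle_sub add.commute)
 also have "\<dots> = (LINT x:B|\<nu>. cmod (s x)) + ?D" by (rule set_integral_add(2)[OF i(5,6)])
 also have "(LINT x:B|\<nu>. cmod (s x)) = cmod (LINT x:B|\<nu>. s x)"
 proof -
  have "(LINT x:B|\<nu>. cmod (s x)) = (LINT x:B|\<nu>. cmod z)" "(LINT x:B|\<nu>. s x) = (LINT x:B|\<nu>. z)"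
   by (auto intro!: set_lebesgue_integral_cong B simp: z)
  moreover have "(\<integral>x. indicat_real B x *\<^sub>R z \<partial>\<nu>) = (\<integral>x. indicat_real B x \<partial>\<nu>) *\<^sub>R z"
  proof (cases "z = 0")
   case False
   have "(%x. indicat_real B x *\<^sub>R cmod (s x)) = (%x. indicat_real B x *\<^sub>R cmod z)"
    by (auto simp: indicator_def z fun_eq_iff)
   then have "integrable \<nu> (%x. indicat_real B x *\<^sub>R cmod z)"
    using i(5) unfolding set_integrable_def by simp
   then have "integrable \<nu> (%x. indicat_real B x)" using False by simp
   then show ?thesis by (rule integral_scaleR_left)
  qed simp
  moreover have "0 <= (\<integral>x. indicat_real B x \<partial>\<nu>)" by (rule integral_nonneg_AE) auto
  ultimately show ?thesis by (simp add: set_lebesgue_integral_def)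
 qed
 also have "cmod (LINT x:B|\<nu>. s x) <= cmod (LINT x:B|\<nu>. h x) + cmod (LINT x:B|\<nu>. h x - s x)"
  using norm_triangle_sub[of "LINT x:B|\<nu>. s x" "LINT x:B|\<nu>. h x"] set_integral_diff(2)[OF i(1,2)]
  by (simp add: norm_minus_commute)
 also have "cmod (LINT x:B|\<nu>. h x - s x) <= ?D" by (rule set_integral_norm_bound[OF i(3)])
 finally show ?thesis by simp
qed

lemma ennreal_set_integral_cmod:
 assumes "integrable \<nu> h" "B \<in> sets \<nu>"
 shows "ennreal (LINT x:B|\<nu>. cmod (h x)) = emeasure (density \<nu> (%x. ennreal (cmod (h x)))) B"
proof -
 have m: "(%x. ennreal (cmod (h x))) \<in> borel_measurable \<nu>" using assms(1) by auto
 have "integrable \<nu> (%x. indicat_real B x * cmod (h x))"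
  using integrable_mult_indicator[OF assms(2) integrable_norm[OF assms(1)]] by simp
 then have "ennreal (LINT x:B|\<nu>. cmod (h x)) = (\<integral>\<^sup>+x. ennreal (indicat_real B x * cmod (h x)) \<partial>\<nu>)"
  unfolding set_lebesgue_integral_def by (subst nn_integral_eq_integral) auto
 also have "\<dots> = (\<integral>\<^sup>+x. ennreal (cmod (h x)) * indicator B x \<partial>\<nu>)"
  by (intro nn_integral_cong) (auto simp: indicator_def)
 finally show ?thesis by (simp add: emeasure_density[OF m assms(2)])
qed

lemma finite_measure_density_integrable:
 fixes h :: "'a => 'b::{banach, second_countable_topology}"
 assumes "integrable \<nu> h" shows "finite_measure (density \<nu> (%x. ennreal (norm (h x))))"
proof
 have m: "(%x. ennreal (norm (h x))) \<in> borel_measurable \<nu>" using assms by auto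
 have "emeasure (density \<nu> (%x. ennreal (norm (h x)))) (space \<nu>) = (\<integral>\<^sup>+x. ennreal (norm (h x)) \<partial>\<nu>)"
  by (subst emeasure_density[OF m]) (auto intro!: nn_integral_cong)
 then show "emeasure (density \<nu> (%x. ennreal (norm (h x)))) (space (density \<nu> (%x. ennreal (norm (h x))))) \<noteq> \<infinity>"
  using assms by (auto simp: integrable_iff_bounded)
qed

lemma cm_density_bound:
 assumes "integrable \<nu> h" "sets \<nu> = Borel" "E \<in> Borel"
 shows "ennreal (cmod (cm_density \<nu> h E)) <= emeasure (density \<nu> (%x. ennreal (cmod (h x)))) E"
proof -
 have "set_integrable \<nu> E h" using assms by (intro set_integrable_if_integrable) auto
 then have "cmod (LINT x:E|\<nu>. h x) <= (LINT x:E|\<nu>. cmod (h x))" by (rule set_integral_norm_bound)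
 from ennreal_leI[OF this] show ?thesis using ennreal_set_integral_cmod[of \<nu> h E] assms by (simp add: cm_density_def)
qed

lemma complex_borel_measure_cm_density:
 assumes h: "integrable \<nu> h" and sets: "sets \<nu> = Borel"
 shows "complex_borel_measure (cm_density \<nu> h)"
proof (rule dominated_additive_complex_measure[OF finite_measure_density_integrable[OF h]])
 show "sets (density \<nu> (%x. ennreal (cmod (h x)))) = Borel" by (simp add: sets)
 fix A B :: "'a set" assume "A \<in> Borel" "B \<in> Borel" "A \<inter> B = {}"
 then show "cm_density \<nu> h (A \<union> B) = cm_density \<nu> h A + cm_density \<nu> h B"
  using h by (auto simp: cm_density_def sets intro!: set_integral_Un set_integrable_if_integrable)
next
 fix E :: "'a set" assume "E \<in> Borel"
 then show "cmod (cm_density \<nu> h E) <= measure (density \<nu> (%x. ennreal (cmod (h x)))) E"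
  using cm_density_bound[OF h sets] finite_measure.emeasure_eq_measure[OF finite_measure_density_integrable[OF h]]
  by (simp add: ennreal_le_iff)
qed (simp add: cm_density_def)

text \<open>The upper bound is the triangle inequality. For the lower bound, partition
  \<open>E\<close> into the level sets of a simple function close to \<open>h\<close> in mean, on
  which \<open>integral_cmod_le_simple\<close> controls cancellation.\<close>

lemma variation_cm_density:
 assumes h: "integrable \<nu> h" and sets: "sets \<nu> = Borel"
 shows "variation (cm_density \<nu> h) = density \<nu> (%x. ennreal (cmod (h x)))"
proof (rule measure_eqI)
 show "sets (variation (cm_density \<nu> h)) = sets (density \<nu> (%x. ennreal (cmod (h x))))" by (simp add: sets)
 fix E assume "E \<in> sets (variation (cm_density \<nu> h))"
 then have E: "E \<in> Borel" by simp
 have spc: "space \<nu> = UNIV" using sets_eq_imp_space_eq[OF sets] by simp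
 show "emeasure (variation (cm_density \<nu> h)) E = emeasure (density \<nu> (%x. ennreal (cmod (h x)))) E"
  unfolding emeasure_variation[OF complex_borel_measure_cm_density[OF h sets] E]
 proof (rule antisym)
  show "variation_fun (cm_density \<nu> h) E <= emeasure (density \<nu> (%x. ennreal (cmod (h x)))) E"
   by (rule variation_fun_le) (use cm_density_bound[OF h sets] E in "auto simp: sets")
  obtain F where F: "!!i. simple_function \<nu> (F i)" "!!x. x \<in> space \<nu> ==> (%i. F i x) \<longlonglongrightarrow> h x"
   "!!i x. x \<in> space \<nu> ==> dist (F i x) 0 <= 2 * dist (h x) 0"
   using borel_measurable_implies_sequence_metric[OF borel_measurable_integrable[OF h], of 0] by blast
  have Fi: "integrable \<nu> (F i)" for i
   by (rule Bochner_Integration.integrable_bound[of \<nu> "%x. 2 * cmod (h x)"])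
    (use F h in "auto intro: borel_measurable_simple_function")
  have "(%i. \<integral>x. cmod (h x - F i x) \<partial>\<nu>) \<longlonglongrightarrow> (\<integral>x. 0 \<partial>\<nu>)"
  \<comment> \<open>The approximants satisfy \<open>cmod (F i x) <= 2 * cmod (h x)\<close>, hence
    the majorant with factor 3.\<close>
  proof (rule integral_dominated_convergence[where w="%x. 3 * cmod (h x)"])
   show "AE x in \<nu>. (%i. cmod (h x - F i x)) \<longlonglongrightarrow> 0"
   proof (rule AE_I2)
    fix x assume "x \<in> space \<nu>"
    from tendsto_norm[OF tendsto_diff[OF tendsto_const F(2)[OF this]], of "h x"]
    show "(%i. cmod (h x - F i x)) \<longlonglongrightarrow> 0" by simp
   qed
   show "AE x in \<nu>. norm (cmod (h x - F i x)) <= 3 * cmod (h x)" for i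
   proof (rule AE_I2)
    fix x assume "x \<in> space \<nu>"
    then show "norm (cmod (h x - F i x)) <= 3 * cmod (h x)"
     using F(3)[of x i] norm_triangle_ineq4[of "h x" "F i x"] by simp
   qed
  qed (use h Fi in auto)
  then have lim: "(%i. \<integral>x. cmod (h x - F i x) \<partial>\<nu>) \<longlonglongrightarrow> 0" by simp
  have "emeasure (density \<nu> (%x. ennreal (cmod (h x)))) E <= variation_fun (cm_density \<nu> h) E + ennreal (2 * (\<integral>x. cmod (h x - F i x) \<partial>\<nu>))" for i
  proof -
   let ?s = "F i"
   define Z where "Z = ?s ` UNIV"
   have Z: "finite Z" using F(1)[of i] unfolding Z_def simple_function_def spc by simp
   define B where "B z = E \<inter> ?s -` {z}" for z
   have Bs: "B z \<in> Borel" for z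
    using simple_functionD(2)[OF F(1)[of i], of "{z}"] E by (auto simp: B_def spc sets)
   have UB: "(\<Union>z\<in>Z. B z) = E" unfolding B_def Z_def by auto
   have dB: "disjoint_family_on B Z" unfolding B_def disjoint_family_on_def by auto
   have i1: "set_integrable \<nu> S (%x. cmod (h x))" "set_integrable \<nu> S (%x. cmod (h x - ?s x))" if "S \<in> Borel" for S
    using h Fi that by (auto simp: sets intro!: set_integrable_if_integrable)
   have "(LINT x:E|\<nu>. cmod (h x)) = (\<Sum>z\<in>Z. LINT x:B z|\<nu>. cmod (h x))"
    unfolding UB[symmetric] by (rule set_integral_finite_Union[OF Z dB]) (use i1(1) Bs in "auto simp: sets")
   also have "\<dots> <= (\<Sum>z\<in>Z. cmod (LINT x:B z|\<nu>. h x) + 2 * (LINT x:B z|\<nu>. cmod (h x - ?s x)))"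
    by (intro sum_mono integral_cmod_le_simple h Fi) (use Bs in "auto simp: sets B_def")
   also have "\<dots> = (\<Sum>z\<in>Z. cmod (cm_density \<nu> h (B z))) + 2 * (\<Sum>z\<in>Z. LINT x:B z|\<nu>. cmod (h x - ?s x))"
    using Bs by (simp add: sum.distrib sum_distrib_left cm_density_def)
   also have "(\<Sum>z\<in>Z. LINT x:B z|\<nu>. cmod (h x - ?s x)) = (LINT x:E|\<nu>. cmod (h x - ?s x))"
    unfolding UB[symmetric] by (rule set_integral_finite_Union[symmetric, OF Z dB]) (use i1(2) Bs in "auto simp: sets")
   also have "\<dots> <= (\<integral>x. cmod (h x - ?s x) \<partial>\<nu>)"
    unfolding set_lebesgue_integral_def
    by (rule integral_mono) (use i1(2)[OF E, unfolded set_integrable_def] h Fi in "auto simp: indicator_def")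
   finally have r: "(LINT x:E|\<nu>. cmod (h x)) <= (\<Sum>z\<in>Z. cmod (cm_density \<nu> h (B z))) + 2 * (\<integral>x. cmod (h x - ?s x) \<partial>\<nu>)" by simp
   have "(\<Sum>z\<in>Z. ennreal (cmod (cm_density \<nu> h (B z)))) = (\<Sum>S\<in>B ` Z. ennreal (cmod (cm_density \<nu> h S)))"
   proof (subst sum.reindex_nontrivial[OF Z])
    fix z z' assume "z \<in> Z" "z' \<in> Z" "z \<noteq> z'" "B z = B z'"
    then have "B z = {}" unfolding B_def by auto
    then show "ennreal (cmod (cm_density \<nu> h (B z))) = 0" by (simp add: cm_density_def set_lebesgue_integral_def)
   qed simp
   also have "\<dots> <= variation_fun (cm_density \<nu> h) E"
   proof (rule variation_fun_upper)
    show "disjoint (B ` Z)" unfolding disjoint_def B_def by auto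
   qed (use Z Bs UB in auto)
   finally have v: "(\<Sum>z\<in>Z. ennreal (cmod (cm_density \<nu> h (B z)))) <= variation_fun (cm_density \<nu> h) E" .
   have "emeasure (density \<nu> (%x. ennreal (cmod (h x)))) E = ennreal (LINT x:E|\<nu>. cmod (h x))"
    using ennreal_set_integral_cmod[OF h, of E] E by (simp add: sets)
   also have "\<dots> <= ennreal ((\<Sum>z\<in>Z. cmod (cm_density \<nu> h (B z))) + 2 * (\<integral>x. cmod (h x - ?s x) \<partial>\<nu>))"
    by (rule ennreal_leI[OF r])
   also have "\<dots> = (\<Sum>z\<in>Z. ennreal (cmod (cm_density \<nu> h (B z)))) + ennreal (2 * (\<integral>x. cmod (h x - ?s x) \<partial>\<nu>))"
    by (subst ennreal_plus) (auto intro!: sum_nonneg integral_nonneg_AE)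
   finally show ?thesis using v by (meson add_right_mono order_trans)
  qed
  moreover have "(%i. variation_fun (cm_density \<nu> h) E + ennreal (2 * (\<integral>x. cmod (h x - F i x) \<partial>\<nu>)))
   \<longlonglongrightarrow> variation_fun (cm_density \<nu> h) E + ennreal (2 * 0)"
   by (intro tendsto_add tendsto_ennrealI tendsto_mult lim tendsto_const)
  ultimately show "emeasure (density \<nu> (%x. ennreal (cmod (h x)))) E <= variation_fun (cm_density \<nu> h) E"
   by (intro LIMSEQ_le_const[of _ "variation_fun (cm_density \<nu> h) E"]) auto
 qed
qed

section \<open>Radon-Nikodym densities and integrals against complex measures\<close>

lemma measurable_borel_iff: "sets \<nu> = Borel ==> f \<in> measurable \<nu> N \<longleftrightarrow> f \<in> measurable borel N"
 using measurable_cong_sets[of \<nu> borel N N] by simp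

text \<open>The sum of \<open>\<nu>\<close> and \<open>\<rho>\<close> is a positive measure
  absolutely continuous with respect to \<open>\<nu>\<close>; subtracting 1 from its Radon-Nikodym
  density gives a density of \<open>\<rho>\<close>.\<close>

lemma signed_measure_has_density:
 fixes \<rho> :: "'a::topological_space set => real"
 assumes fin: "finite_measure \<nu>" and sets: "sets \<nu> = Borel"
  and add: "!!A :: nat => 'a set. range A \<subseteq> Borel ==> disjoint_family A ==> (%n. \<rho> (A n)) sums \<rho> (\<Union>n. A n)"
  and dom: "!!E. E \<in> Borel ==> \<bar>\<rho> E\<bar> <= measure \<nu> E"
 shows "\<exists>r. r \<in> BM & integrable \<nu> r & (\<forall>E\<in>Borel. \<rho> E = (LINT x:E|\<nu>. r x))"
proof -
 interpret finite_measure \<nu> by (rule fin)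
 have sp: "space \<nu> = UNIV" using sets_eq_imp_space_eq[OF sets] by simp
 define F where "F E = ennreal (measure \<nu> E + \<rho> E)" for E
 have nn: "0 <= measure \<nu> E + \<rho> E" if "E \<in> Borel" for E using dom[OF that] by (auto simp: abs_le_iff)
 define N where "N = measure_of UNIV (sets (borel :: 'a measure)) F"
 have setsN: "sets N = Borel" using sets.sigma_sets_eq[of borel] by (simp add: N_def sets_measure_of_conv)
 have emN: "emeasure N E = F E" if "E \<in> Borel" for E
 proof (rule emeasure_measure_of[OF N_def])
  have "\<rho> {} = 0" using dom[of "{}"] by simp
  then show "positive (sets N) F" by (simp add: positive_def F_def)
  show "countably_additive (sets N) F"
   unfolding countably_additive_def setsN
  proof (intro allI impI)
   fix A :: "nat => 'a set" assume A: "range A \<subseteq> Borel" "disjoint_family A"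
   have "(%n. measure \<nu> (A n)) sums measure \<nu> (\<Union>n. A n)"
    by (rule finite_measure_UNION) (use A in "auto simp: sets")
   from sums_add[OF this add[OF A]] show "(\<Sum>n. F (A n)) = F (\<Union>n. A n)"
    unfolding F_def by (intro suminf_ennreal_eq nn) (use A in auto)
  qed
 qed (use that setsN in auto)
 have "absolutely_continuous \<nu> N"
 proof (unfold absolutely_continuous_def, rule subsetI)
  fix E assume "E \<in> null_sets \<nu>"
  then have E: "E \<in> Borel" "measure \<nu> E = 0" by (auto simp: sets measure_def null_sets_def)
  then have "\<rho> E = 0" using dom by force
  then show "E \<in> null_sets N" using E emN setsN by (simp add: null_sets_def F_def)
 qed
 from Radon_Nikodym[OF this] obtain f where f: "f \<in> borel_measurable \<nu>" "density \<nu> f = N" using sets setsN by auto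
 have fin': "(\<integral>\<^sup>+x. f x \<partial>\<nu>) < \<infinity>"
 proof -
  have "(\<integral>\<^sup>+x. f x \<partial>\<nu>) = emeasure N UNIV"
   unfolding f(2)[symmetric] by (subst emeasure_density[OF f(1)]) (auto simp: sets)
  then show ?thesis using emN[of UNIV] by (simp add: F_def)
 qed
 then have ae: "AE x in \<nu>. f x \<noteq> \<infinity>" using nn_integral_noteq_infinite[OF f(1)] by simp
 define g where "g x = enn2real (f x)" for x
 have gm: "g \<in> borel_measurable \<nu>" unfolding g_def using f(1) by simp
 have g: "(\<integral>\<^sup>+x. ennreal (g x) * indicator E x \<partial>\<nu>) = emeasure N E" if "E \<in> Borel" for E
 proof -
  have "(\<integral>\<^sup>+x. ennreal (g x) * indicator E x \<partial>\<nu>) = (\<integral>\<^sup>+x. f x * indicator E x \<partial>\<nu>)"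
   by (rule nn_integral_cong_AE) (use ae in "eventually_elim, auto simp: g_def ennreal_enn2real_if")
  then show ?thesis using that emeasure_density[OF f(1), of E] by (simp add: sets f(2))
 qed
 have gi: "integrable \<nu> g"
  using g[of UNIV] emN[of UNIV] gm by (simp add: integrable_iff_bounded F_def g_def)
 have "\<rho> E = (LINT x:E|\<nu>. g x - 1)" if E: "E \<in> Borel" for E
 proof -
  have i: "set_integrable \<nu> E g" "set_integrable \<nu> E (%x. 1 :: real)"
   using gi E by (auto intro!: set_integrable_if_integrable simp: sets)
  have "ennreal (LINT x:E|\<nu>. g x) = (\<integral>\<^sup>+x. ennreal (indicat_real E x * g x) \<partial>\<nu>)"
   using i(1) unfolding set_lebesgue_integral_def set_integrable_def
   by (subst nn_integral_eq_integral) (auto simp: g_def)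
  also have "\<dots> = (\<integral>\<^sup>+x. ennreal (g x) * indicator E x \<partial>\<nu>)" by (intro nn_integral_cong) (auto simp: indicator_def)
  also have "\<dots> = ennreal (measure \<nu> E + \<rho> E)" using g[OF E] emN[OF E] by (simp add: F_def)
  finally have "(LINT x:E|\<nu>. g x) = measure \<nu> E + \<rho> E"
   using nn[OF E] by (subst (asm) ennreal_inj) (auto simp: set_lebesgue_integral_def g_def intro!: integral_nonneg_AE)
  moreover have "(LINT x:E|\<nu>. (1::real)) = measure \<nu> E" using E by (simp add: set_lebesgue_integral_def sets sp)
  ultimately show ?thesis using set_integral_diff(2)[OF i] by simp
 qed
 moreover have "(%x. g x - 1) \<in> BM" using gm by (simp add: measurable_borel_iff[OF sets])
 ultimately show ?thesis using gi by (intro exI[of _ "%x. g x - 1"]) auto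
qed

lemma complex_measure_has_density:
 assumes c: "complex_borel_measure \<mu>" and fin: "finite_measure \<nu>" and sets: "sets \<nu> = Borel"
  and dom: "!!E. E \<in> Borel ==> cmod (\<mu> E) <= measure \<nu> E"
 obtains h where "h \<in> BM" "integrable \<nu> h" "\<mu> = cm_density \<nu> h"
proof -
 have add: "(%n. \<mu> (A n)) sums \<mu> (\<Union>n. A n)" if "range A \<subseteq> Borel" "disjoint_family A" for A :: "nat => _"
  using c that unfolding complex_borel_measure_def by blast
 obtain r where r: "r \<in> BM" "integrable \<nu> r" "\<forall>E\<in>Borel. Re (\<mu> E) = (LINT x:E|\<nu>. r x)"
  using signed_measure_has_density[OF fin sets, of "%E. Re (\<mu> E)"] sums_Re[OF add] order_trans[OF abs_Re_le_cmod dom] by auto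
 obtain s where s: "s \<in> BM" "integrable \<nu> s" "\<forall>E\<in>Borel. Im (\<mu> E) = (LINT x:E|\<nu>. s x)"
  using signed_measure_has_density[OF fin sets, of "%E. Im (\<mu> E)"] sums_Im[OF add] order_trans[OF abs_Im_le_cmod dom] by auto
 define h where "h x = complex_of_real (r x) + \<i> * complex_of_real (s x)" for x
 have h: "h \<in> BM" "integrable \<nu> h" unfolding h_def using r s by auto
 have "\<mu> E = cm_density \<nu> h E" for E
 proof (cases "E \<in> Borel")
  case True
  have i: "set_integrable \<nu> E h" using h(2) True by (intro set_integrable_if_integrable) (auto simp: sets)
  have "Re (LINT x:E|\<nu>. h x) = (LINT x:E|\<nu>. Re (h x))" "Im (LINT x:E|\<nu>. h x) = (LINT x:E|\<nu>. Im (h x))"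
   using i unfolding set_lebesgue_integral_def set_integrable_def
   by (simp_all add: integral_Re[symmetric] integral_Im[symmetric])
  moreover have "Re (h x) = r x" "Im (h x) = s x" for x by (simp_all add: h_def)
  ultimately show ?thesis using True r(3) s(3) by (simp add: cm_density_def complex_eq_iff)
 next
  case False
  then show ?thesis using c by (simp add: cm_density_def complex_borel_measure_def)
 qed
 then show ?thesis using that[OF h] by blast
qed

text \<open>The supremum is attained at the part of \<open>E\<close> on which \<open>r\<close> is
  positive, as in the Hahn decomposition.\<close>

lemma jordan_pos_density:
 assumes r: "integrable \<nu> r" and sets: "sets \<nu> = Borel" and \<rho>: "!!B. B \<in> Borel ==> \<rho> B = (LINT x:B|\<nu>. r x)"
 shows "jordan_pos \<rho> = density \<nu> (%x. ennreal (max 0 (r x)))"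
proof -
 let ?D = "density \<nu> (%x. ennreal (max 0 (r x)))"
 have sp: "space \<nu> = UNIV" using sets_eq_imp_space_eq[OF sets] by simp
 have m: "(%x. ennreal (max 0 (r x))) \<in> borel_measurable \<nu>" using r by auto
 have pos: "ennreal (LINT x:B|\<nu>. max 0 (r x)) = emeasure ?D B" if B: "B \<in> Borel" for B
 proof -
  have "integrable \<nu> (%x. indicat_real B x * max 0 (r x))"
   using integrable_mult_indicator[of B \<nu> "%x. max 0 (r x)"] r B by (simp add: sets)
  then have "ennreal (LINT x:B|\<nu>. max 0 (r x)) = (\<integral>\<^sup>+x. ennreal (indicat_real B x * max 0 (r x)) \<partial>\<nu>)"
   unfolding set_lebesgue_integral_def by (subst nn_integral_eq_integral) auto
  also have "\<dots> = (\<integral>\<^sup>+x. ennreal (max 0 (r x)) * indicator B x \<partial>\<nu>)" by (intro nn_integral_cong) (auto simp: indicator_def)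
  finally show ?thesis using emeasure_density[OF m, of B] B by (simp add: sets)
 qed
 have sup: "(SUP B\<in>{B \<in> Borel. B \<subseteq> E}. ennreal (\<rho> B)) = emeasure ?D E" if E: "E \<in> Borel" for E
 proof (rule antisym)
  show "(SUP B\<in>{B \<in> Borel. B \<subseteq> E}. ennreal (\<rho> B)) <= emeasure ?D E"
  proof (rule SUP_least)
   fix B assume "B \<in> {B \<in> Borel. B \<subseteq> E}"
   then have B: "B \<in> Borel" "B \<subseteq> E" by auto
   have "\<rho> B <= (LINT x:B|\<nu>. max 0 (r x))"
    unfolding \<rho>[OF B(1)] by (rule set_integral_mono) (use r B in "auto intro!: set_integrable_if_integrable simp: sets")
   from ennreal_leI[OF this] show "ennreal (\<rho> B) <= emeasure ?D E"
    using pos[OF B(1)] emeasure_mono[OF B(2), of ?D] E by (simp add: sets)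
  qed
  let ?B = "E \<inter> {x. 0 < r x}"
  have "{x \<in> space \<nu>. 0 < r x} \<in> sets \<nu>" using r by measurable
  then have B: "?B \<in> Borel" using E by (simp add: sets sp)
  have "emeasure ?D E = emeasure ?D ?B"
   using E B by (simp add: emeasure_density[OF m] sets) (intro nn_integral_cong, auto simp: indicator_def max_def)
  also have "\<dots> = ennreal (LINT x:?B|\<nu>. max 0 (r x))" by (rule pos[OF B, symmetric])
  also have "(LINT x:?B|\<nu>. max 0 (r x)) = \<rho> ?B"
   unfolding \<rho>[OF B] by (rule set_lebesgue_integral_cong) (use B in "auto simp: sets")
  also have "ennreal (\<rho> ?B) <= (SUP B\<in>{B \<in> Borel. B \<subseteq> E}. ennreal (\<rho> B))" by (rule SUP_upper) (use B in auto)
  finally show "emeasure ?D E <= (SUP B\<in>{B \<in> Borel. B \<subseteq> E}. ennreal (\<rho> B))" .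
 qed
 have "jordan_pos \<rho> = measure_of UNIV Borel (emeasure ?D)"
  unfolding jordan_pos_def by (rule measure_of_eq) (use sup sets.sigma_sets_eq[of borel] in auto)
 also have "\<dots> = measure_of (space ?D) (sets ?D) (emeasure ?D)" by (simp add: sets sp)
 finally show ?thesis unfolding measure_of_of_measure .
qed

text \<open>Each Jordan part of the real and imaginary parts has a density by
  \<open>jordan_pos_density\<close>; they recombine since \<open>max 0 a - max 0 (- a) = a\<close>,
  and each is integrable because \<open>f x * h x\<close> is.\<close>

lemma cm_integral_density:
 fixes f :: "'a::topological_space => complex"
 assumes h: "integrable \<nu> h" and sets: "sets \<nu> = Borel" and f: "f \<in> BM"
  and fh: "integrable \<nu> (%x. f x * h x)"
 shows "cm_integral (cm_density \<nu> h) f = (\<integral>x. f x * h x \<partial>\<nu>)"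
proof -
 have fm: "f \<in> borel_measurable \<nu>" using f by (simp add: measurable_borel_iff[OF sets])
 have part: "integral\<^sup>L (jordan_pos (%E. p (cm_density \<nu> h E))) f = (\<integral>x. max 0 (p (h x)) *\<^sub>R f x \<partial>\<nu>) &
  integrable \<nu> (%x. max 0 (p (h x)) *\<^sub>R f x)"
  if p: "bounded_linear p" "!!z. \<bar>p z\<bar> <= cmod z" for p :: "complex => real"
 proof
  have ph: "integrable \<nu> (%x. p (h x))" by (rule integrable_bounded_linear[OF p(1) h])
  have eq: "p (cm_density \<nu> h B) = (LINT x:B|\<nu>. p (h x))" if B: "B \<in> Borel" for B
  proof -
   have "integrable \<nu> (%x. indicat_real B x *\<^sub>R h x)" using h B by (intro integrable_mult_indicator) (auto simp: sets)
   from integral_bounded_linear[OF p(1) this] show ?thesis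
    using B linear_scale[OF bounded_linear.linear[OF p(1)]] by (simp add: cm_density_def set_lebesgue_integral_def)
  qed
  have mm: "(%x. max 0 (p (h x))) \<in> borel_measurable \<nu>" using ph by auto
  have J: "jordan_pos (%E. p (cm_density \<nu> h E)) = density \<nu> (%x. ennreal (max 0 (p (h x))))"
   by (rule jordan_pos_density[OF ph sets]) (rule eq)
  show "integral\<^sup>L (jordan_pos (%E. p (cm_density \<nu> h E))) f = (\<integral>x. max 0 (p (h x)) *\<^sub>R f x \<partial>\<nu>)"
   unfolding J by (rule integral_density[OF fm mm]) auto
  show "integrable \<nu> (%x. max 0 (p (h x)) *\<^sub>R f x)"
  proof (rule Bochner_Integration.integrable_bound[OF fh])
   show "(%x. max 0 (p (h x)) *\<^sub>R f x) \<in> borel_measurable \<nu>" using mm fm by auto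
   show "AE x in \<nu>. norm (max 0 (p (h x)) *\<^sub>R f x) <= norm (f x * h x)"
   proof (rule AE_I2)
    fix x
    have "max 0 (p (h x)) <= cmod (h x)" using p(2)[of "h x"] by auto
    then show "norm (max 0 (p (h x)) *\<^sub>R f x) <= norm (f x * h x)"
     by (simp add: norm_mult mult.commute mult_left_mono)
   qed
  qed
 qed
 note R = part[OF bounded_linear_Re abs_Re_le_cmod] and I = part[OF bounded_linear_Im abs_Im_le_cmod]
 have mR: "integral\<^sup>L (jordan_pos (%E. - Re (cm_density \<nu> h E))) f = (\<integral>x. max 0 (- Re (h x)) *\<^sub>R f x \<partial>\<nu>) &
  integrable \<nu> (%x. max 0 (- Re (h x)) *\<^sub>R f x)"
  by (rule part) (use bounded_linear_minus[OF bounded_linear_Re] abs_Re_le_cmod in auto)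
 have mI: "integral\<^sup>L (jordan_pos (%E. - Im (cm_density \<nu> h E))) f = (\<integral>x. max 0 (- Im (h x)) *\<^sub>R f x \<partial>\<nu>) &
  integrable \<nu> (%x. max 0 (- Im (h x)) *\<^sub>R f x)"
  by (rule part) (use bounded_linear_minus[OF bounded_linear_Im] abs_Im_le_cmod in auto)
 have "cm_integral (cm_density \<nu> h) f =
  (\<integral>x. (max 0 (Re (h x)) *\<^sub>R f x - max 0 (- Re (h x)) *\<^sub>R f x) + \<i> * (max 0 (Im (h x)) *\<^sub>R f x - max 0 (- Im (h x)) *\<^sub>R f x) \<partial>\<nu>)"
  unfolding cm_integral_def using R I mR mI by simp
 also have "\<dots> = (\<integral>x. f x * h x \<partial>\<nu>)"
 proof (rule Bochner_Integration.integral_cong)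
  fix x
  have "max 0 a *\<^sub>R z - max 0 (- a) *\<^sub>R z = a *\<^sub>R z" for a :: real and z :: complex
   by (simp add: max_def scaleR_left_distrib[symmetric])
  moreover have "h x = complex_of_real (Re (h x)) + \<i> * complex_of_real (Im (h x))" by (rule complex_eq)
  ultimately show "(max 0 (Re (h x)) *\<^sub>R f x - max 0 (- Re (h x)) *\<^sub>R f x) +
   \<i> * (max 0 (Im (h x)) *\<^sub>R f x - max 0 (- Im (h x)) *\<^sub>R f x) = f x * h x"
   by (simp add: scaleR_conv_of_real) (metis distrib_left mult.commute mult.left_commute)
 qed simp
 finally show ?thesis .
qed

section \<open>The weighted measure algebra\<close>

text \<open>Compact sets inside \<open>- E\<close> have open complements around \<open>E\<close>, so
  outer regularity at \<open>E\<close> is inner regularity at \<open>- E\<close>.\<close>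

lemma regular_iff_radon_finite:
 fixes \<mu> :: "'a::t2_space set => complex"
 assumes c: "complex_borel_measure \<mu>" and fin: "finite_measure (variation \<mu>)"
 shows "\<mu> \<in> regular_complex_measures \<longleftrightarrow> radon_finite (variation \<mu>)"
proof
 interpret finite_measure "variation \<mu>" by (rule fin)
 assume r: "\<mu> \<in> regular_complex_measures"
 show "radon_finite (variation \<mu>)"
  unfolding radon_finite_def
 proof (intro conjI ballI allI impI fin sets_variation)
  fix E :: "'a set" and \<eta> :: real assume E: "E \<in> Borel" and e: "\<eta> > 0"
  have eq: "emeasure (variation \<mu>) E = (SUP K\<in>{K. compact K & K \<subseteq> E}. emeasure (variation \<mu>) K)"
   using r E unfolding regular_complex_measures_def by blast
  show "\<exists>K. compact K & K \<subseteq> E & measure (variation \<mu>) (E - K) < \<eta>"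
  proof (cases "measure (variation \<mu>) E = 0")
   case True
   then show ?thesis using e by (intro exI[of _ "{}"]) simp
  next
   case False
   then have "0 < measure (variation \<mu>) E" by (simp add: less_le)
   then have "ennreal (measure (variation \<mu>) E - \<eta>) < emeasure (variation \<mu>) E"
    using e by (simp add: emeasure_eq_measure ennreal_lessI)
   then obtain K where K: "compact K" "K \<subseteq> E" "ennreal (measure (variation \<mu>) E - \<eta>) < emeasure (variation \<mu>) K"
    unfolding eq less_SUP_iff by auto
   then have "measure (variation \<mu>) E - \<eta> < measure (variation \<mu>) K"
    by (simp add: emeasure_eq_measure ennreal_less_iff) (metis ennreal_leI measure_nonneg not_le)
   then show ?thesis
    using K finite_measure_Diff[of E K] E compact_borel_t2[OF K(1)] by (intro exI[of _ K]) simp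
  qed
 qed
next
 interpret finite_measure "variation \<mu>" by (rule fin)
 assume r: "radon_finite (variation \<mu>)"
 let ?V = "variation \<mu>"
 show "\<mu> \<in> regular_complex_measures"
  unfolding regular_complex_measures_def
 proof (intro CollectI conjI ballI c)
  fix E :: "'a set" assume E: "E \<in> Borel"
  show "emeasure ?V E = (SUP K\<in>{K. compact K & K \<subseteq> E}. emeasure ?V K)"
  proof (rule antisym)
   show "emeasure ?V E <= (SUP K\<in>{K. compact K & K \<subseteq> E}. emeasure ?V K)"
   proof (rule ennreal_le_epsilon)
    fix e :: real assume "e > 0"
    then obtain K where K: "compact K" "K \<subseteq> E" "measure ?V (E - K) < e" by (rule radon_finiteE[OF r E])
    have "emeasure ?V E = emeasure ?V K + emeasure ?V (E - K)"
     using plus_emeasure[of K ?V "E - K"] K E compact_borel_t2[OF K(1)] by (simp add: Un_absorb1)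
    also have "\<dots> <= (SUP K\<in>{K. compact K & K \<subseteq> E}. emeasure ?V K) + ennreal e"
     using K by (intro add_mono SUP_upper) (auto simp: emeasure_eq_measure intro!: ennreal_leI)
    finally show "emeasure ?V E <= (SUP K\<in>{K. compact K & K \<subseteq> E}. emeasure ?V K) + ennreal e" .
   qed
  qed (use E in "auto intro!: SUP_least emeasure_mono")
  show "emeasure ?V E = (INF U\<in>{U. open U & E \<subseteq> U}. emeasure ?V U)"
  proof (rule antisym)
   show "(INF U\<in>{U. open U & E \<subseteq> U}. emeasure ?V U) <= emeasure ?V E"
   proof (rule ennreal_le_epsilon)
    fix e :: real assume "e > 0"
    have cE: "- E \<in> Borel" using E by (simp add: borel_comp)
    obtain K where K: "compact K" "K \<subseteq> - E" "measure ?V (- E - K) < e" by (rule radon_finiteE[OF r cE \<open>e > 0\<close>])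
    have "(INF U\<in>{U. open U & E \<subseteq> U}. emeasure ?V U) <= emeasure ?V (- K)"
     by (rule INF_lower) (use K in "auto intro!: open_Compl compact_imp_closed")
    also have "\<dots> = emeasure ?V E + emeasure ?V (- E - K)"
    proof -
     have "E \<union> (- E - K) = - K" "E \<inter> (- E - K) = {}" using K(2) by auto
     then show ?thesis using plus_emeasure[of E ?V "- E - K"] E cE compact_borel_t2[OF K(1)] by simp
    qed
    also have "\<dots> <= emeasure ?V E + ennreal e" using K by (intro add_left_mono) (auto simp: emeasure_eq_measure intro!: ennreal_leI)
    finally show "(INF U\<in>{U. open U & E \<subseteq> U}. emeasure ?V U) <= emeasure ?V E + ennreal e" .
   qed
  qed (use E in "auto intro!: INF_greatest emeasure_mono")
 qed
qed

lemma radon_finite_return: "radon_finite (return borel (x :: 'a::t2_space))"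
 unfolding radon_finite_def
proof (intro conjI ballI allI impI)
 show "finite_measure (return borel x)" by (intro finite_measureI) simp
 fix E :: "'a set" and \<eta> :: real assume E: "E \<in> Borel" and e: "\<eta> > 0"
 have "measure (return borel x) (E - E \<inter> {x}) = 0"
  using E by (subst measure_return) (auto simp: indicator_def)
 then show "\<exists>K. compact K & K \<subseteq> E & measure (return borel x) (E - K) < \<eta>"
  using e by (intro exI[of _ "E \<inter> {x}"]) (auto intro: finite_imp_compact)
qed simp

text \<open>A common dominating Radon measure lets two complex measures be written as densities with
  respect to the same measure, where sums are computed pointwise.\<close>

lemma ex_radon_sum:
 fixes \<mu> \<nu> :: "'a::t2_space measure"
 assumes m: "radon_finite \<mu>" and n: "radon_finite \<nu>"
 shows "\<exists>\<tau>. radon_finite \<tau> & (\<forall>E\<in>Borel. measure \<tau> E = measure \<mu> E + measure \<nu> E)"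
proof -
 interpret M: finite_measure \<mu> by (rule radon_finiteD(2)[OF m])
 interpret N: finite_measure \<nu> by (rule radon_finiteD(2)[OF n])
 define \<tau> where "\<tau> = measure_of UNIV (sets (borel :: 'a measure)) (%E. emeasure \<mu> E + emeasure \<nu> E)"
 have sets: "sets \<tau> = Borel" using sets.sigma_sets_eq[of borel] by (simp add: \<tau>_def sets_measure_of_conv)
 have em: "emeasure \<tau> E = emeasure \<mu> E + emeasure \<nu> E" if "E \<in> Borel" for E
 proof (rule emeasure_measure_of[OF \<tau>_def])
  show "countably_additive (sets \<tau>) (%E. emeasure \<mu> E + emeasure \<nu> E)"
   unfolding countably_additive_def sets
  proof (intro allI impI)
   fix A :: "nat => 'a set" assume A: "range A \<subseteq> Borel" "disjoint_family A"
   have "(\<Sum>n. emeasure \<mu> (A n) + emeasure \<nu> (A n)) = (\<Sum>n. emeasure \<mu> (A n)) + (\<Sum>n. emeasure \<nu> (A n))"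
    by (rule suminf_add[symmetric]) auto
   then show "(\<Sum>n. emeasure \<mu> (A n) + emeasure \<nu> (A n)) = emeasure \<mu> (\<Union>n. A n) + emeasure \<nu> (\<Union>n. A n)"
    using A by (simp add: suminf_emeasure radon_finiteD(1)[OF m] radon_finiteD(1)[OF n])
  qed
 qed (use that sets in "auto simp: positive_def")
 have ms: "measure \<tau> E = measure \<mu> E + measure \<nu> E" if "E \<in> Borel" for E
  using em[OF that] M.emeasure_finite[of E] N.emeasure_finite[of E]
  by (simp add: measure_def enn2real_plus top.not_eq_extremum del: M.emeasure_finite N.emeasure_finite)
 have fin: "finite_measure \<tau>"
  using em[of UNIV] sets_eq_imp_space_eq[OF sets] M.emeasure_finite N.emeasure_finite by (intro finite_measureI) simp
 have "radon_finite \<tau>"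
  unfolding radon_finite_def
 proof (intro conjI ballI allI impI sets fin)
  fix E :: "'a set" and \<eta> :: real assume E: "E \<in> Borel" and "\<eta> > 0"
  then have e: "\<eta> / 2 > 0" by simp
  obtain K where K: "compact K" "K \<subseteq> E" "measure \<mu> (E - K) < \<eta> / 2" by (rule radon_finiteE[OF m E e])
  obtain L where L: "compact L" "L \<subseteq> E" "measure \<nu> (E - L) < \<eta> / 2" by (rule radon_finiteE[OF n E e])
  have b: "K \<in> Borel" "L \<in> Borel" using K L by (auto intro: compact_borel_t2)
  have "measure \<mu> (E - (K \<union> L)) <= measure \<mu> (E - K)" "measure \<nu> (E - (K \<union> L)) <= measure \<nu> (E - L)"
   using E b by (auto intro!: M.finite_measure_mono N.finite_measure_mono simp: radon_finiteD(1)[OF m] radon_finiteD(1)[OF n])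
  then have "measure \<tau> (E - (K \<union> L)) < \<eta>" using K L E b by (simp add: ms)
  then show "\<exists>K. compact K & K \<subseteq> E & measure \<tau> (E - K) < \<eta>" using K L by (intro exI[of _ "K \<union> L"]) auto
 qed
 then show ?thesis using ms by blast
qed

lemma cm_density_cong_add:
 assumes "integrable \<nu> h" "integrable \<nu> k" "sets \<nu> = Borel"
 shows "cm_density \<nu> (%x. h x + k x) = (%E. cm_density \<nu> h E + cm_density \<nu> k E)"
proof
 fix E
 show "cm_density \<nu> (%x. h x + k x) E = cm_density \<nu> h E + cm_density \<nu> k E"
  using set_integral_add(2)[OF set_integrable_if_integrable[OF assms(1)] set_integrable_if_integrable[OF assms(2)], of E] assms(3)
  by (auto simp: cm_density_def)
qed

lemma cm_density_scale: "cm_density \<nu> (%x. c * h x) = (%E. c * cm_density \<nu> h E)"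
 by (auto simp: cm_density_def)

lemma cmod_le_variation:
 assumes "complex_borel_measure a" "finite_measure (variation a)" "E \<in> Borel"
 shows "cmod (a E) <= measure (variation a) E"
 using cmod_le_variation_fun[OF assms(3), of a] emeasure_variation[OF assms(1,3)] finite_measure.emeasure_eq_measure[OF assms(2), of E]
 by (metis ennreal_le_iff measure_nonneg)

definition M_restr :: "'a::topological_space set => ('a set => complex) => 'a set => complex" where
 "M_restr E \<mu> = (%B. if B \<in> Borel then \<mu> (B \<inter> E) else 0)"

lemma M_restr_density: "E \<in> Borel ==> M_restr E (cm_density \<nu> h) = cm_density \<nu> (%x. indicator E x * h x)"
 by (auto simp: M_restr_def cm_density_def set_lebesgue_integral_def indicator_def fun_eq_iff
   intro!: Bochner_Integration.integral_cong)

definition point_mass :: "'a::topological_space => 'a set => complex" where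
 "point_mass x = (%E. if E \<in> Borel then indicator E x else 0)"

locale weighted_group =
 fixes \<omega> :: "'a::{topological_group_add, t2_space} => real"
 assumes w: "weight \<omega>"
begin

abbreviation "M \<equiv> carr (M_alg \<omega>)"
abbreviation "N \<equiv> vnorm (M_alg \<omega>)"

lemma weight_borel: "\<omega> \<in> BM"
 by (rule borel_measurable_continuous_onI[OF weight_continuous[OF w]])

text \<open>Reduces membership in \<open>M_alg\<close> and its norm to integrals of the density; as
  \<open>\<omega>\<close> is at least 1, the density itself is integrable.\<close>

lemma cm_density_in_M_alg:
 assumes r: "radon_finite \<nu>" and hb: "h \<in> BM" and i: "integrable \<nu> (%x. \<omega> x * cmod (h x))"
 shows "integrable \<nu> h" "cm_density \<nu> h \<in> M" "N (cm_density \<nu> h) = (\<integral>x. \<omega> x * cmod (h x) \<partial>\<nu>)"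
proof -
 note sets = radon_finiteD(1)[OF r]
 note bm = measurable_borel_iff[OF sets]
 show h: "integrable \<nu> h"
 proof (rule Bochner_Integration.integrable_bound[OF i])
  show "AE x in \<nu>. norm (h x) <= norm (\<omega> x * cmod (h x))"
   using mult_right_mono[OF weight_ge_1[OF w], of "cmod (h _)"] weight_pos(2)[OF w] by (intro AE_I2) simp
 qed (simp add: bm hb)
 have radon: "radon_finite (variation (cm_density \<nu> k))" if k: "integrable \<nu> k" for k
  unfolding variation_cm_density[OF k sets]
 proof (rule radon_finite_absolutely_continuous[OF r finite_measure_density_integrable[OF k]])
  fix E :: "'a set" assume E: "E \<in> Borel" "measure \<nu> E = 0"
  then have "E \<in> null_sets \<nu>" by (simp add: null_sets_def sets finite_measure.emeasure_eq_measure[OF radon_finiteD(2)[OF r]])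
  moreover have "(%x. ennreal (cmod (k x))) \<in> borel_measurable \<nu>" using k by auto
  ultimately have "emeasure (density \<nu> (%x. ennreal (cmod (k x)))) E = 0"
   using absolutely_continuousI_density[of "%x. ennreal (cmod (k x))" \<nu>] unfolding absolutely_continuous_def null_sets_def by auto
  then show "measure (density \<nu> (%x. ennreal (cmod (k x)))) E = 0" by (simp add: measure_def)
 qed (simp add: sets)
 have regular: "cm_density \<nu> k \<in> regular_complex_measures" if k: "integrable \<nu> k" for k
  using regular_iff_radon_finite[OF complex_borel_measure_cm_density[OF k sets]] radon[OF k] radon_finiteD(2) by blast
 have wi: "integrable \<nu> (%x. complex_of_real (\<omega> x) * h x)"
  by (rule Bochner_Integration.integrable_bound[OF i])
   (use hb weight_borel weight_pos(2)[OF w] in "auto simp: bm norm_mult")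
 have W: "weighted_measure \<omega> (cm_density \<nu> h) = cm_density \<nu> (%x. complex_of_real (\<omega> x) * h x)"
 proof
  fix E
  show "weighted_measure \<omega> (cm_density \<nu> h) E = cm_density \<nu> (%x. complex_of_real (\<omega> x) * h x) E"
  proof (cases "E \<in> Borel")
   case True
   have f: "(%x. complex_of_real (\<omega> x) * indicator E x) \<in> BM" using True weight_borel by measurable
   have eq: "complex_of_real (\<omega> x) * indicator E x * h x = indicat_real E x *\<^sub>R (complex_of_real (\<omega> x) * h x)" for x
    by (auto simp: indicator_def)
   have "cm_integral (cm_density \<nu> h) (%x. complex_of_real (\<omega> x) * indicator E x) = (\<integral>x. complex_of_real (\<omega> x) * indicator E x * h x \<partial>\<nu>)"
    by (rule cm_integral_density[OF h sets f]) (unfold eq, use wi True in "intro integrable_mult_indicator, auto simp: sets")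
   then show ?thesis using True by (simp add: weighted_measure_def cm_density_def set_lebesgue_integral_def eq)
  qed (simp add: weighted_measure_def cm_density_def)
 qed
 have "integrable (variation (cm_density \<nu> h)) \<omega>"
  unfolding variation_cm_density[OF h sets]
  by (subst integrable_density) (use i hb weight_borel in "auto simp: bm mult.commute")
 then show "cm_density \<nu> h \<in> M" using regular[OF h] regular[OF wi] by (simp add: M_alg_def W)
 have "N (cm_density \<nu> h) = measure (density \<nu> (%x. ennreal (cmod (complex_of_real (\<omega> x) * h x)))) UNIV"
  by (simp add: M_alg_def W variation_cm_density[OF wi sets])
 also have "\<dots> = enn2real (ennreal (LINT x:UNIV|\<nu>. cmod (complex_of_real (\<omega> x) * h x)))"
  using ennreal_set_integral_cmod[OF wi, of UNIV] by (simp add: measure_def sets)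
 also have "\<dots> = (\<integral>x. \<omega> x * cmod (h x) \<partial>\<nu>)"
  using weight_pos(2)[OF w] by (simp add: set_lebesgue_integral_def norm_mult integral_nonneg_AE)
 finally show "N (cm_density \<nu> h) = (\<integral>x. \<omega> x * cmod (h x) \<partial>\<nu>)" .
qed

text \<open>As \<open>\<omega>\<close> is at least 1, its integrability makes the variation finite,
  and regularity takes the form \<open>radon_finite\<close>.\<close>

lemma M_algD:
 assumes a: "a \<in> M"
 shows "complex_borel_measure a" "radon_finite (variation a)" "integrable (variation a) \<omega>"
proof -
 show c: "complex_borel_measure a" and i: "integrable (variation a) \<omega>"
  using a by (auto simp: M_alg_def regular_complex_measures_def)
 have "emeasure (variation a) UNIV = (\<integral>\<^sup>+x. 1 \<partial>variation a)" by simp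
 also have "\<dots> <= (\<integral>\<^sup>+x. ennreal (norm (\<omega> x)) \<partial>variation a)"
  by (rule nn_integral_mono) (use weight_ge_1[OF w] in "auto intro!: order_trans[OF _ abs_ge_self]")
 also have "\<dots> < \<infinity>" using i by (simp add: integrable_iff_bounded)
 finally have "finite_measure (variation a)" by (intro finite_measureI) simp
 then show "radon_finite (variation a)" using regular_iff_radon_finite[OF c] a by (auto simp: M_alg_def)
qed

lemma M_alg_density:
 assumes a: "complex_borel_measure a" "integrable (variation a) \<omega>" and fin: "finite_measure \<nu>" and sets: "sets \<nu> = Borel"
  and dom: "!!E. E \<in> Borel ==> cmod (a E) <= measure \<nu> E"
 obtains h where "h \<in> BM" "integrable \<nu> (%x. \<omega> x * cmod (h x))" "a = cm_density \<nu> h" "integrable \<nu> h"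
proof -
 obtain h where h: "h \<in> BM" "integrable \<nu> h" "a = cm_density \<nu> h"
  by (rule complex_measure_has_density[OF a(1) fin sets dom])
 have "integrable \<nu> (%x. cmod (h x) *\<^sub>R \<omega> x)"
  using a(2) unfolding h(3) variation_cm_density[OF h(2) sets]
  by (subst (asm) integrable_density) (use h(1) weight_borel in "auto simp: measurable_borel_iff[OF sets]")
 then show ?thesis using that[OF h(1) _ h(3,2)] by (simp add: mult.commute)
qed

lemma M_alg_variation_density:
 assumes c: "complex_borel_measure a" and r: "radon_finite (variation a)" and i: "integrable (variation a) \<omega>"
 obtains h where "h \<in> BM" "integrable (variation a) (%x. \<omega> x * cmod (h x))"
  "a = cm_density (variation a) h" "integrable (variation a) h"
 by (rule M_alg_density[OF c i radon_finiteD(2)[OF r] sets_variation(1) cmod_le_variation[OF c radon_finiteD(2)[OF r]]])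

lemma M_algI:
 assumes c: "complex_borel_measure a" and r: "radon_finite (variation a)" and i: "integrable (variation a) \<omega>"
 shows "a \<in> M"
proof -
 obtain h where h: "h \<in> BM" "integrable (variation a) (%x. \<omega> x * cmod (h x))"
  "a = cm_density (variation a) h" "integrable (variation a) h" by (rule M_alg_variation_density[OF assms])
 show ?thesis by (subst h(3)) (rule cm_density_in_M_alg(2)[OF r h(1,2)])
qed

lemma M_alg_norm:
 assumes a: "a \<in> M" shows "ennreal (N a) = (\<integral>\<^sup>+x. ennreal (\<omega> x) \<partial>variation a)"
proof -
 note r = M_algD(2)[OF a]
 obtain h where h: "h \<in> BM" "integrable (variation a) (%x. \<omega> x * cmod (h x))"
  "a = cm_density (variation a) h" "integrable (variation a) h" by (rule M_alg_variation_density[OF M_algD[OF a]])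
 have "ennreal (N a) = (\<integral>\<^sup>+x. ennreal (\<omega> x * cmod (h x)) \<partial>variation a)"
  using cm_density_in_M_alg(3)[OF r h(1,2)] h(3) weight_pos(2)[OF w] by (subst nn_integral_eq_integral[OF h(2)]) auto
 also have "\<dots> = (\<integral>\<^sup>+x. ennreal (cmod (h x)) * ennreal (\<omega> x) \<partial>variation a)"
  using weight_pos(2)[OF w] by (simp add: ennreal_mult' mult.commute)
 also have "\<dots> = (\<integral>\<^sup>+x. ennreal (\<omega> x) \<partial>density (variation a) (%x. ennreal (cmod (h x))))"
  by (rule nn_integral_density[symmetric]) (use h weight_borel in "auto simp: measurable_borel_iff[OF sets_variation(1)]")
 also have "density (variation a) (%x. ennreal (cmod (h x))) = variation a"
  using variation_cm_density[OF h(4) sets_variation(1)] h(3) by simp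
 finally show ?thesis .
qed

lemma M_alg_common_density:
 assumes a: "a \<in> M" and b: "b \<in> M"
 obtains \<nu> h k where "radon_finite \<nu>" "h \<in> BM" "k \<in> BM"
  "integrable \<nu> (%x. \<omega> x * cmod (h x))" "integrable \<nu> (%x. \<omega> x * cmod (k x))" "a = cm_density \<nu> h" "b = cm_density \<nu> k"
  "integrable \<nu> h" "integrable \<nu> k"
proof -
 obtain \<nu> where \<nu>: "radon_finite \<nu>" "\<forall>E\<in>Borel. measure \<nu> E = measure (variation a) E + measure (variation b) E"
  using ex_radon_sum[OF M_algD(2)[OF a] M_algD(2)[OF b]] by blast
 have d: "cmod (c E) <= measure \<nu> E" if "c = a \<or> c = b" "E \<in> Borel" for c E
 proof -
  have "cmod (c E) <= measure (variation c) E"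
   using that a b by (intro cmod_le_variation M_algD radon_finiteD(2)) auto
  then show ?thesis using that \<nu>(2) by (auto intro: order_trans)
 qed
 note fs = radon_finiteD(2)[OF \<nu>(1)] radon_finiteD(1)[OF \<nu>(1)]
 obtain h where h: "h \<in> BM" "integrable \<nu> (%x. \<omega> x * cmod (h x))" "a = cm_density \<nu> h" "integrable \<nu> h"
  by (rule M_alg_density[OF M_algD(1,3)[OF a] fs]) (use d in auto)
 obtain k where k: "k \<in> BM" "integrable \<nu> (%x. \<omega> x * cmod (k x))" "b = cm_density \<nu> k" "integrable \<nu> k"
  by (rule M_alg_density[OF M_algD(1,3)[OF b] fs]) (use d in auto)
 show ?thesis by (rule that[OF \<nu>(1) h(1) k(1) h(2) k(2) h(3) k(3) h(4) k(4)])
qed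

lemma seminormed_funs_M_alg: "seminormed_funs M N"
proof
 have "cm_density (return borel (0::'a)) (%x. 0) = (%E. 0 :: complex)" by (auto simp: cm_density_def set_lebesgue_integral_def)
 then show "(%E. 0) \<in> M"
  using cm_density_in_M_alg(2)[OF radon_finite_return, of "%x. 0" 0] by simp
next
 fix a b assume a: "a \<in> M" and b: "b \<in> M"
 obtain \<nu> h k where \<nu>: "radon_finite \<nu>" and h: "h \<in> BM" and k: "k \<in> BM"
  and ih: "integrable \<nu> (%x. \<omega> x * cmod (h x))" and ik: "integrable \<nu> (%x. \<omega> x * cmod (k x))"
  and ab: "a = cm_density \<nu> h" "b = cm_density \<nu> k" and i: "integrable \<nu> h" "integrable \<nu> k"
  by (rule M_alg_common_density[OF a b])
 have eq: "(%E. a E + b E) = cm_density \<nu> (%x. h x + k x)"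
  unfolding ab by (rule cm_density_cong_add[symmetric, OF i radon_finiteD(1)[OF \<nu>]])
 have hk: "(%x. h x + k x) \<in> BM" using h k by measurable
 have le: "\<omega> x * cmod (h x + k x) <= \<omega> x * cmod (h x) + \<omega> x * cmod (k x)" for x
  using mult_left_mono[OF norm_triangle_ineq weight_pos(2)[OF w]] by (simp add: distrib_left)
 have s: "integrable \<nu> (%x. \<omega> x * cmod (h x) + \<omega> x * cmod (k x))" using ih ik by simp
 have ihk: "integrable \<nu> (%x. \<omega> x * cmod (h x + k x))"
 proof (rule Bochner_Integration.integrable_bound[OF s])
  show "(%x. \<omega> x * cmod (h x + k x)) \<in> borel_measurable \<nu>"
   using hk weight_borel by (simp add: measurable_borel_iff[OF radon_finiteD(1)[OF \<nu>]])
  show "AE x in \<nu>. norm (\<omega> x * cmod (h x + k x)) <= norm (\<omega> x * cmod (h x) + \<omega> x * cmod (k x))"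
   using le weight_pos(2)[OF w] by (intro AE_I2) (simp add: abs_mult)
 qed
 show "(%E. a E + b E) \<in> M" unfolding eq by (rule cm_density_in_M_alg(2)[OF \<nu> hk ihk])
 show "N (%E. a E + b E) <= N a + N b"
  unfolding eq cm_density_in_M_alg(3)[OF \<nu> hk ihk] unfolding ab cm_density_in_M_alg(3)[OF \<nu> h ih] cm_density_in_M_alg(3)[OF \<nu> k ik]
   Bochner_Integration.integral_add[OF ih ik, symmetric] by (rule integral_mono[OF ihk s le])
next
 fix a c assume a: "a \<in> M"
 note r = M_algD(2)[OF a]
 obtain h where h: "h \<in> BM" "integrable (variation a) (%x. \<omega> x * cmod (h x))"
  "a = cm_density (variation a) h" by (rule M_alg_variation_density[OF M_algD[OF a]])
 have ch: "(%x. c * h x) \<in> BM" "integrable (variation a) (%x. \<omega> x * cmod (c * h x))"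
  using h by (auto simp: norm_mult mult.left_commute)
 have eq: "(%E. c * a E) = cm_density (variation a) (%x. c * h x)" by (subst h(3)) (rule cm_density_scale[symmetric])
 show "(%E. c * a E) \<in> M" unfolding eq by (rule cm_density_in_M_alg(2)[OF r ch])
 have "N (%E. c * a E) = cmod c * (\<integral>x. \<omega> x * cmod (h x) \<partial>variation a)"
  unfolding eq cm_density_in_M_alg(3)[OF r ch] by (simp add: norm_mult mult.left_commute)
 then show "N (%E. c * a E) = cmod c * N a" using cm_density_in_M_alg(3)[OF r h(1,2)] h(3) by simp
next
 fix a assume "a \<in> M" show "0 <= N a" by (simp add: M_alg_def)
qed

lemma M_restr_M_alg:
 assumes a: "a \<in> M" and E: "E \<in> Borel"
 shows "M_restr E a \<in> M" "variation (M_restr E a) = density (variation a) (indicator E)"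
proof -
 note r = M_algD(2)[OF a]
 obtain h where h: "h \<in> BM" "integrable (variation a) (%x. \<omega> x * cmod (h x))"
  "a = cm_density (variation a) h" "integrable (variation a) h" by (rule M_alg_variation_density[OF M_algD[OF a]])
 have Ev: "E \<in> sets (variation a)" using E by simp
 have k: "(%x. indicator E x * h x) \<in> BM" using h(1) E by measurable
 have eq: "\<omega> x * cmod (indicator E x * h x) = indicat_real E x *\<^sub>R (\<omega> x * cmod (h x))" for x by (auto simp: indicator_def)
 have ik: "integrable (variation a) (%x. \<omega> x * cmod (indicator E x * h x))"
  unfolding eq by (rule integrable_mult_indicator[OF Ev h(2)])
 have R: "M_restr E a = cm_density (variation a) (%x. indicator E x * h x)" by (subst h(3)) (rule M_restr_density[OF E])
 show "M_restr E a \<in> M" unfolding R by (rule cm_density_in_M_alg(2)[OF r k ik])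
 have m: "(%x. ennreal (cmod (h x))) \<in> borel_measurable (variation a)" "(indicator E :: 'a => ennreal) \<in> borel_measurable (variation a)"
  using h(1) E by (auto simp: measurable_borel_iff[OF sets_variation(1)])
 have "variation (M_restr E a) = density (variation a) (%x. ennreal (cmod (h x)) * indicator E x)"
  unfolding R variation_cm_density[OF cm_density_in_M_alg(1)[OF r k ik] sets_variation(1)]
  by (rule density_cong) (use h(1) E in "auto simp: measurable_borel_iff[OF sets_variation(1)] indicator_def")
 also have "\<dots> = density (density (variation a) (%x. ennreal (cmod (h x)))) (indicator E)"
  by (rule density_density_eq[symmetric, OF m])
 also have "density (variation a) (%x. ennreal (cmod (h x))) = variation a"
  using variation_cm_density[OF h(4) sets_variation(1)] h(3) by simp
 finally show "variation (M_restr E a) = density (variation a) (indicator E)" .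
qed

lemma nn_integral_M_restr:
 assumes a: "a \<in> M" and E: "E \<in> Borel" and f: "f \<in> BM"
 shows "(\<integral>\<^sup>+x. f x \<partial>variation (M_restr E a)) = (\<integral>\<^sup>+x. f x * indicator E x \<partial>variation a)"
 unfolding M_restr_M_alg(2)[OF a E]
 by (subst nn_integral_density) (use f E in "auto simp: measurable_borel_iff[OF sets_variation(1)] mult.commute")

lemma M_alg_additive: "a \<in> M ==> A \<in> Borel ==> B \<in> Borel ==> A \<inter> B = {} ==> a (A \<union> B) = a A + a B"
proof -
 assume a: "a \<in> M" and AB: "A \<in> Borel" "B \<in> Borel" "A \<inter> B = {}"
 obtain h where h: "h \<in> BM" "integrable (variation a) (%x. \<omega> x * cmod (h x))"
  "a = cm_density (variation a) h" "integrable (variation a) h" by (rule M_alg_variation_density[OF M_algD[OF a]])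
 have "cm_density (variation a) h (A \<union> B) = cm_density (variation a) h A + cm_density (variation a) h B"
  using AB h(4) by (auto simp: cm_density_def intro!: set_integral_Un set_integrable_if_integrable)
 then show ?thesis using h(3) by simp
qed

lemma M_alg_outside: "a \<in> M ==> B \<notin> Borel ==> a B = 0"
 using M_algD(1)[of a] by (simp add: complex_borel_measure_def)

lemma cm_integral_bounded:
 assumes a: "a \<in> M" and f: "f \<in> BM" "!!x. cmod (f x) <= C"
 shows "b \<in> M ==> cm_integral (%E. a E + b E) f = cm_integral a f + cm_integral b f"
  and "cm_integral (%E. c * a E) f = c * cm_integral a f"
  and "g \<in> BM ==> (!!x. cmod (g x) <= D) ==> cm_integral a (%x. f x + g x) = cm_integral a f + cm_integral a g"
  and "cm_integral a (%x. c * f x) = c * cm_integral a f"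
  and "ennreal (cmod (cm_integral a f)) <= (\<integral>\<^sup>+x. ennreal (cmod (f x)) \<partial>variation a)"
proof -
 have bi: "integrable \<nu> (%x. f x * h x)" if h: "integrable \<nu> h" and s: "sets \<nu> = Borel"
  and f: "f \<in> BM" "!!x. cmod (f x) <= C" for \<nu> :: "'a measure" and f h and C :: real
 proof (rule Bochner_Integration.integrable_bound[OF integrable_mult_right[OF integrable_norm[OF h], of C]])
  show "(%x. f x * h x) \<in> borel_measurable \<nu>" using f(1) h by (simp add: measurable_borel_iff[OF s, symmetric])
  show "AE x in \<nu>. norm (f x * h x) <= norm (C * norm (h x))"
  proof (rule AE_I2)
   fix x
   have "norm (f x * h x) <= C * norm (h x)" using f(2)[of x] by (simp add: norm_mult mult_right_mono)
   then show "norm (f x * h x) <= norm (C * norm (h x))" by simp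
  qed
 qed
 show "cm_integral (%E. a E + b E) f = cm_integral a f + cm_integral b f" if b: "b \<in> M"
 proof -
  obtain \<nu> h k where \<nu>: "radon_finite \<nu>" and ab: "a = cm_density \<nu> h" "b = cm_density \<nu> k" and i: "integrable \<nu> h" "integrable \<nu> k"
   by (rule M_alg_common_density[OF a b])
  note s = radon_finiteD(1)[OF \<nu>]
  have ihk: "integrable \<nu> (%x. h x + k x)" using i by simp
  show ?thesis
   unfolding ab cm_density_cong_add[OF i s, symmetric]
    cm_integral_density[OF ihk s f(1) bi[OF ihk s f]] cm_integral_density[OF i(1) s f(1) bi[OF i(1) s f]]
    cm_integral_density[OF i(2) s f(1) bi[OF i(2) s f]]
   using bi[OF i(1) s f] bi[OF i(2) s f] by (simp add: distrib_left)
 qed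
 note s = sets_variation(1)
 obtain h where h: "a = cm_density (variation a) h" "integrable (variation a) h" by (rule M_alg_variation_density[OF M_algD[OF a]])
 have ca: "cm_integral a f = (\<integral>x. f x * h x \<partial>variation a)" if f: "f \<in> BM" "!!x. cmod (f x) <= C" for f and C :: real
  by (subst h(1)) (rule cm_integral_density[OF h(2) s f(1) bi[OF h(2) s f]])
 show "cm_integral (%E. c * a E) f = c * cm_integral a f"
 proof -
  have ch: "integrable (variation a) (%x. c * h x)" using h(2) by simp
  have e: "(%E. c * a E) = cm_density (variation a) (%x. c * h x)" by (subst h(1)) (rule cm_density_scale[symmetric])
  show ?thesis
   unfolding e cm_integral_density[OF ch s f(1) bi[OF ch s f]] ca[OF f] by (simp add: mult.left_commute)
 qed
 show "cm_integral a (%x. f x + g x) = cm_integral a f + cm_integral a g" if g: "g \<in> BM" "!!x. cmod (g x) <= D"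
 proof -
  have fg: "(%x. f x + g x) \<in> BM" using f(1) g(1) by measurable
  have le: "cmod (f x + g x) <= C + D" for x using norm_triangle_ineq[of "f x" "g x"] f(2)[of x] g(2)[of x] by linarith
  show ?thesis
   unfolding ca[OF f] ca[OF g] ca[OF fg le] using bi[OF h(2) s f] bi[OF h(2) s g] by (simp add: distrib_right)
 qed
 show "cm_integral a (%x. c * f x) = c * cm_integral a f"
 proof -
  have cf: "(%x. c * f x) \<in> BM" using f(1) by measurable
  have le: "cmod (c * f x) <= cmod c * C" for x using f(2)[of x] by (simp add: norm_mult mult_left_mono)
  show ?thesis unfolding ca[OF f] ca[OF cf le] by (simp add: mult.assoc)
 qed
 have "ennreal (cmod (cm_integral a f)) <= (\<integral>\<^sup>+x. ennreal (cmod (f x * h x)) \<partial>variation a)"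
  unfolding ca[OF f] by (rule integral_norm_bound_ennreal[OF bi[OF h(2) s f]])
 also have "\<dots> = (\<integral>\<^sup>+x. ennreal (cmod (h x)) * ennreal (cmod (f x)) \<partial>variation a)"
  by (simp add: norm_mult ennreal_mult' mult.commute)
 also have "\<dots> = (\<integral>\<^sup>+x. ennreal (cmod (f x)) \<partial>density (variation a) (%x. ennreal (cmod (h x))))"
  by (rule nn_integral_density[symmetric]) (use borel_measurable_integrable[OF h(2)] f(1) in "auto simp: measurable_borel_iff[OF s]")
 also have "density (variation a) (%x. ennreal (cmod (h x))) = variation a"
  using variation_cm_density[OF h(2) s] h(1) by simp
 finally show "ennreal (cmod (cm_integral a f)) <= (\<integral>\<^sup>+x. ennreal (cmod (f x)) \<partial>variation a)" .
qed

end

section \<open>Convolution of measures\<close>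

lemma measurable_plus_pair:
 "(%p. fst p + snd p) \<in> borel_measurable (borel :: ('a::topological_monoid_add \<times> 'a) measure)"
 by (intro borel_measurable_continuous_onI continuous_intros)

lemma measurable_proj_borel:
 "fst \<in> borel_measurable (borel :: ('a::topological_space \<times> 'b::topological_space) measure)"
 "snd \<in> borel_measurable (borel :: ('a::topological_space \<times> 'b::topological_space) measure)"
 by (intro borel_measurable_continuous_onI continuous_intros)+

context weighted_group begin

abbreviation "mulM \<equiv> vmult (M_alg \<omega>)"

lemmas N_nonneg = seminormed_funs.norm_nonneg[OF seminormed_funs_M_alg]
lemmas mvb = measurable_borel_iff[OF sets_variation(1)]

lemma mult_apply:
 "(E :: 'a set) \<in> Borel ==> mulM a b E = cm_integral a (%x. cm_integral b (%y. indicator E (x + y)))"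
 "E \<notin> Borel ==> mulM a b E = 0"
 by (simp_all add: M_alg_def)

lemma indicator_translate_borel:
 "(E :: 'a set) \<in> Borel ==> (%y. indicator E (x + y) :: complex) \<in> BM"
 using borel_section_measurable(1)[OF measurable_compose[OF measurable_plus_pair borel_measurable_indicator[of E borel]], of x] by simp

text \<open>The integrand is Borel on the product space but need not be measurable for the product
  \<sigma>-algebra; measurability in \<open>x\<close> comes from
  \<open>measurable_radon_integral\<close>.\<close>

lemma cm_integral_translate:
 assumes b: "b \<in> M" and E: "E \<in> Borel"
 shows "(%x. cm_integral b (%y. indicator E (x + y))) \<in> BM"
  and "ennreal (cmod (cm_integral b (%y. indicator E (x + y)))) <= (\<integral>\<^sup>+y. indicator E (x + y) \<partial>variation b)"
  and "cmod (cm_integral b (%y. indicator E (x + y))) <= measure (variation b) UNIV"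
proof -
 note r = M_algD(2)[OF b]
 interpret finite_measure "variation b" by (rule radon_finiteD(2)[OF r])
 obtain h where h: "h \<in> BM" "b = cm_density (variation b) h" "integrable (variation b) h"
  by (rule M_alg_variation_density[OF M_algD[OF b]])
 have bd: "cmod (indicator E (x + y)) <= 1" for x y by (simp add: indicator_def)
 note m = indicator_translate_borel[OF E]
 have eq: "cm_integral b (%y. indicator E (x + y)) = (\<integral>y. indicator E (x + y) * h y \<partial>variation b)" for x
 proof -
  have "integrable (variation b) (%y. indicator E (x + y) * h y)"
   by (rule Bochner_Integration.integrable_bound[OF h(3)])
    (use m h in "auto simp: mvb norm_mult indicator_def")
  then show ?thesis using cm_integral_density[OF h(3) sets_variation(1) m] h(2) by simp
 qed
 have "(%p. indicator E (fst p + snd p) * h (snd p)) \<in> BM"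
  by (intro borel_measurable_times measurable_compose[OF measurable_plus_pair borel_measurable_indicator]
    measurable_compose[OF measurable_proj_borel(2) h(1)] E)
 from measurable_radon_integral[OF r this]
 show "(%x. cm_integral b (%y. indicator E (x + y))) \<in> BM" by (simp add: eq)
 have "ennreal (cmod (cm_integral b (%y. indicator E (x + y)))) <= (\<integral>\<^sup>+y. ennreal (cmod (indicator E (x + y))) \<partial>variation b)"
  by (rule cm_integral_bounded(5)[OF b m bd])
 also have "(%y. ennreal (cmod (indicator E (x + y)))) = (%y. indicator E (x + y))" by (auto simp: indicator_def)
 finally show le: "ennreal (cmod (cm_integral b (%y. indicator E (x + y)))) <= (\<integral>\<^sup>+y. indicator E (x + y) \<partial>variation b)" .
 also have "\<dots> <= (\<integral>\<^sup>+y. 1 \<partial>variation b)" by (rule nn_integral_mono) (simp add: indicator_def)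
 also have "\<dots> = ennreal (measure (variation b) UNIV)" by (simp add: emeasure_eq_measure)
 finally show "cmod (cm_integral b (%y. indicator E (x + y))) <= measure (variation b) UNIV" by simp
qed

text \<open>The convolution is dominated by the image of the product of the two variations under
  addition. That image is a Radon measure, and Tonelli's theorem evaluates integrals against
  it.\<close>

lemma nn_integral_mult_le:
 assumes a: "a \<in> M" and b: "b \<in> M"
 shows "complex_borel_measure (mulM a b)" "radon_finite (variation (mulM a b))"
  and "f \<in> BM ==> (\<integral>\<^sup>+z. f z \<partial>variation (mulM a b)) <= (\<integral>\<^sup>+x. \<integral>\<^sup>+y. f (x + y) \<partial>variation b \<partial>variation a)"
proof -
 let ?p = "mulM a b"
 define \<tau> where "\<tau> = distr (radon_prod (variation a) (variation b)) borel (%p. fst p + snd p)"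
 note rp = M_algD(2)[OF a] M_algD(2)[OF b]
 have r: "radon_finite \<tau>"
  unfolding \<tau>_def by (intro radon_finite_distr radon_finite_prod rp continuous_intros)
 interpret finite_measure \<tau> by (rule radon_finiteD(2)[OF r])
 note s = radon_finiteD(1)[OF r]
 have nn: "(\<integral>\<^sup>+z. f z \<partial>\<tau>) = (\<integral>\<^sup>+x. \<integral>\<^sup>+y. f (x + y) \<partial>variation b \<partial>variation a)" if f: "f \<in> BM" for f
 proof -
  have "(\<integral>\<^sup>+z. f z \<partial>\<tau>) = (\<integral>\<^sup>+p. f (fst p + snd p) \<partial>radon_prod (variation a) (variation b))"
   unfolding \<tau>_def by (rule nn_integral_distr) (use f measurable_plus_pair in "auto simp: measurable_borel_iff[OF sets_radon_prod(1)]")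
  then show ?thesis
   using conjunct2[OF nn_integral_radon_prod[OF rp measurable_compose[OF measurable_plus_pair f]]] by simp
 qed
 have le: "ennreal (cmod (?p E)) <= emeasure \<tau> E" if E: "E \<in> Borel" for E
 proof -
  have "ennreal (cmod (?p E)) <= (\<integral>\<^sup>+x. ennreal (cmod (cm_integral b (%y. indicator E (x + y)))) \<partial>variation a)"
   unfolding mult_apply(1)[OF E] by (rule cm_integral_bounded(5)[OF a cm_integral_translate(1,3)[OF b E]])
  also have "\<dots> <= (\<integral>\<^sup>+x. \<integral>\<^sup>+y. indicator E (x + y) \<partial>variation b \<partial>variation a)"
   by (rule nn_integral_mono) (rule cm_integral_translate(2)[OF b E])
  also have "\<dots> = emeasure \<tau> E" using nn[of "indicator E"] E by (simp add: s)
  finally show ?thesis .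
 qed
 show c: "complex_borel_measure ?p"
 proof (rule dominated_additive_complex_measure[OF finite_measure_axioms s])
  fix A B :: "'a set" assume AB: "A \<in> Borel" "B \<in> Borel" "A \<inter> B = {}"
  have i: "(%y. indicator (A \<union> B) (x + y) :: complex) = (%y. indicator A (x + y) + indicator B (x + y))" for x
   using AB(3) by (auto simp: indicator_def fun_eq_iff of_bool_def)
  have bd: "cmod (indicator E (x + y)) <= 1" for E and x y :: 'a by (simp add: indicator_def)
  have "cm_integral b (%y. indicator (A \<union> B) (x + y)) = cm_integral b (%y. indicator A (x + y)) + cm_integral b (%y. indicator B (x + y))" for x
   unfolding i by (rule cm_integral_bounded(3)[OF b indicator_translate_borel[OF AB(1)] bd indicator_translate_borel[OF AB(2)] bd])
  then show "?p (A \<union> B) = ?p A + ?p B"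
   using cm_integral_bounded(3)[OF a cm_integral_translate(1,3)[OF b AB(1)] cm_integral_translate(1,3)[OF b AB(2)]] AB
   by (simp add: mult_apply)
 qed (use le mult_apply in "auto simp: emeasure_eq_measure")
 have vle: "emeasure (variation ?p) E <= emeasure \<tau> E" if E: "E \<in> Borel" for E
  unfolding emeasure_variation[OF c E] by (rule variation_fun_le[OF s le E])
 have fin: "finite_measure (variation ?p)"
  using vle[of UNIV] emeasure_finite[of UNIV] by (intro finite_measureI) (auto simp: top_unique)
 show "radon_finite (variation ?p)"
 proof (rule radon_finite_absolutely_continuous[OF r fin])
  show "measure (variation ?p) E = 0" if "E \<in> Borel" "measure \<tau> E = 0" for E
  proof -
   have "emeasure \<tau> E = 0" using that(2) by (simp add: emeasure_eq_measure)
   then show ?thesis using vle[OF that(1)] by (simp add: measure_def)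
  qed
 qed simp
 show "(\<integral>\<^sup>+z. f z \<partial>variation ?p) <= (\<integral>\<^sup>+x. \<integral>\<^sup>+y. f (x + y) \<partial>variation b \<partial>variation a)" if f: "f \<in> BM" for f
  unfolding nn[OF f, symmetric]
 proof (rule nn_integral_mono_measure)
  show "variation ?p <= \<tau>"
  proof (intro less_eq_measure.intros(3) le_funI)
   fix E show "emeasure (variation ?p) E <= emeasure \<tau> E"
    using vle[of E] by (cases "E \<in> Borel") (simp_all add: emeasure_notin_sets)
  qed (simp_all add: s radon_finiteD(3)[OF r])
 qed (simp add: s)
qed

lemma M_mult_in:
 assumes a: "a \<in> M" and b: "b \<in> M" shows "mulM a b \<in> M"
proof (rule M_algI[OF nn_integral_mult_le(1,2)[OF a b]])
 have wb: "(%x. ennreal (\<omega> x)) \<in> BM" using weight_borel by measurable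
 have "(\<integral>\<^sup>+z. ennreal (\<omega> z) \<partial>variation (mulM a b)) <= (\<integral>\<^sup>+x. \<integral>\<^sup>+y. ennreal (\<omega> (x + y)) \<partial>variation b \<partial>variation a)"
  by (rule nn_integral_mult_le(3)[OF a b wb])
 also have "\<dots> <= (\<integral>\<^sup>+x. \<integral>\<^sup>+y. ennreal (\<omega> x) * ennreal (\<omega> y) \<partial>variation b \<partial>variation a)"
  using weight_mult[OF w] weight_pos(2)[OF w] by (intro nn_integral_mono) (simp add: ennreal_mult[symmetric] ennreal_leI)
 also have "\<dots> = ennreal (N a) * ennreal (N b)"
  unfolding M_alg_norm[OF a] M_alg_norm[OF b] using wb
  by (simp add: nn_integral_cmult nn_integral_multc mvb)
 also have "\<dots> < \<infinity>" by (simp add: ennreal_mult_less_top)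
 finally show "integrable (variation (mulM a b)) \<omega>"
  using weight_borel weight_pos(2)[OF w] by (intro integrableI_nonneg) (auto simp: mvb)
qed

lemma M_mult_restr_norm:
 assumes a: "a \<in> M" and b: "b \<in> M" and E: "E \<in> Borel" "E' \<in> Borel" "K \<in> Borel" and c: "0 <= c"
  and le: "!!x y. x \<in> E ==> y \<in> E' ==> x + y \<in> K ==> \<omega> (x + y) <= c * (\<omega> x * \<omega> y)"
 shows "N (M_restr K (mulM (M_restr E a) (M_restr E' b))) <= c * (N (M_restr E a) * N (M_restr E' b))"
proof -
 note a' = M_restr_M_alg(1)[OF a E(1)] and b' = M_restr_M_alg(1)[OF b E(2)]
 note p = M_mult_in[OF a' b']
 have wb: "(%x. ennreal (\<omega> x)) \<in> BM" using weight_borel by measurable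
 have fb: "(%x. ennreal (\<omega> x) * indicator K x) \<in> BM" using wb E(3) by measurable
 have wi: "(\<integral>\<^sup>+x. ennreal (\<omega> x) * indicator E x \<partial>variation a) = ennreal (N (M_restr E a))" if "a \<in> M" "E \<in> Borel" for a E
  unfolding M_alg_norm[OF M_restr_M_alg(1)[OF that]] by (rule nn_integral_M_restr[OF that wb, symmetric])
 have "ennreal (N (M_restr K (mulM (M_restr E a) (M_restr E' b)))) =
   (\<integral>\<^sup>+z. ennreal (\<omega> z) * indicator K z \<partial>variation (mulM (M_restr E a) (M_restr E' b)))"
  by (rule wi[OF p E(3), symmetric])
 also have "\<dots> <= (\<integral>\<^sup>+x. \<integral>\<^sup>+y. ennreal (\<omega> (x + y)) * indicator K (x + y) \<partial>variation (M_restr E' b) \<partial>variation (M_restr E a))"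
  by (rule nn_integral_mult_le(3)[OF a' b' fb])
 also have "\<dots> = (\<integral>\<^sup>+x. (\<integral>\<^sup>+y. ennreal (\<omega> (x + y)) * indicator K (x + y) \<partial>variation (M_restr E' b)) * indicator E x \<partial>variation a)"
  by (rule nn_integral_M_restr[OF a E(1)])
   (use conjunct1[OF nn_integral_radon_prod[OF M_algD(2)[OF a'] M_algD(2)[OF b'] measurable_compose[OF measurable_plus_pair fb]]] in simp)
 \<comment> \<open>The indicators of \<open>E\<close>, \<open>E'\<close> and \<open>K\<close> leave
   only points at which the hypothesis on \<open>\<omega>\<close> applies; the majorant
   factorises.\<close>
 also have "\<dots> <= (\<integral>\<^sup>+x. \<integral>\<^sup>+y. ennreal c * (ennreal (\<omega> x) * indicator E x) * (ennreal (\<omega> y) * indicator E' y) \<partial>variation b \<partial>variation a)"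
 proof (rule nn_integral_mono)
  fix x
  have m: "(%y. ennreal (\<omega> (x + y)) * indicator K (x + y)) \<in> BM"
   using borel_section_measurable(1)[OF measurable_compose[OF measurable_plus_pair fb], of x] by simp
  have "(\<integral>\<^sup>+y. ennreal (\<omega> (x + y)) * indicator K (x + y) \<partial>variation (M_restr E' b)) * indicator E x =
    (\<integral>\<^sup>+y. ennreal (\<omega> (x + y)) * indicator K (x + y) * indicator E' y \<partial>variation b) * indicator E x"
   using nn_integral_M_restr[OF b E(2) m] by simp
  also have "\<dots> = (\<integral>\<^sup>+y. ennreal (\<omega> (x + y)) * indicator K (x + y) * indicator E' y * indicator E x \<partial>variation b)"
   by (rule nn_integral_multc[symmetric]) (use m E in "auto simp: mvb")
  also have "\<dots> <= (\<integral>\<^sup>+y. ennreal c * (ennreal (\<omega> x) * indicator E x) * (ennreal (\<omega> y) * indicator E' y) \<partial>variation b)"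
   by (rule nn_integral_mono)
    (use le c weight_pos(2)[OF w] in "auto simp: indicator_def ennreal_mult[symmetric] mult.assoc intro!: ennreal_leI")
  finally show "(\<integral>\<^sup>+y. ennreal (\<omega> (x + y)) * indicator K (x + y) \<partial>variation (M_restr E' b)) * indicator E x <= \<dots>" .
 qed
 also have "\<dots> = ennreal c * ennreal (N (M_restr E a)) * ennreal (N (M_restr E' b))"
  unfolding wi[OF a E(1), symmetric] wi[OF b E(2), symmetric] using wb E
  by (simp add: nn_integral_cmult nn_integral_multc mvb)
 also have "\<dots> = ennreal (c * (N (M_restr E a) * N (M_restr E' b)))"
  using c N_nonneg a' b' by (simp add: ennreal_mult mult.assoc)
 finally show ?thesis
  using c N_nonneg a' b' by (subst (asm) ennreal_le_iff) simp_all
qed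

lemma M_mult_bilinear:
 assumes a: "a \<in> M" and b: "b \<in> M"
 shows "a' \<in> M ==> mulM (%E. a E + a' E) b = (%E. mulM a b E + mulM a' b E)"
  and "b' \<in> M ==> mulM a (%E. b E + b' E) = (%E. mulM a b E + mulM a b' E)"
  and "mulM (%E. c * a E) b = (%E. c * mulM a b E)"
  and "mulM a (%E. c * b E) = (%E. c * mulM a b E)"
proof -
 have bd: "cmod (indicator E (x + y)) <= 1" for E and x y :: 'a by (simp add: indicator_def)
 note t = cm_integral_translate(1,3)[OF b]
 note i = indicator_translate_borel
 show "mulM (%E. a E + a' E) b = (%E. mulM a b E + mulM a' b E)" if "a' \<in> M"
  using cm_integral_bounded(1)[OF a t that] by (auto simp: M_alg_def)
 show "mulM (%E. c * a E) b = (%E. c * mulM a b E)"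
  using cm_integral_bounded(2)[OF a t] by (auto simp: M_alg_def)
 show "mulM a (%E. b E + b' E) = (%E. mulM a b E + mulM a b' E)" if b': "b' \<in> M"
  using cm_integral_bounded(3)[OF a t cm_integral_translate(1,3)[OF b']] cm_integral_bounded(1)[OF b i bd b'] by (auto simp: M_alg_def)
 show "mulM a (%E. c * b E) = (%E. c * mulM a b E)"
  using cm_integral_bounded(4)[OF a t] cm_integral_bounded(2)[OF b i bd] by (auto simp: M_alg_def)
qed

section \<open>Point masses, tightness and functionals vanishing at infinity for measures\<close>

definition M_coord :: "'a => ('a set => complex) => complex" where
 "M_coord t a = (if a \<in> M then a {t} else 0)"

lemma point_mass_M:
 shows "point_mass x \<in> M" "N (point_mass x) = \<omega> x"
  and "f \<in> BM ==> (!!y. cmod (f y) <= C) ==> cm_integral (point_mass x) f = f x"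
proof -
 have p: "point_mass x = cm_density (return borel x) (%_. 1)"
  by (auto simp: point_mass_def cm_density_def set_lebesgue_integral_def integral_return indicator_def)
 have i: "integrable (return borel x) f" if "f \<in> BM" for f :: "'a => 'c::{banach, second_countable_topology}"
  using that by (intro integrableI_bounded) (auto simp: nn_integral_return)
 note c = cm_density_in_M_alg[OF radon_finite_return, of "%_. 1" x]
 show "point_mass x \<in> M" "N (point_mass x) = \<omega> x"
  unfolding p using c i[OF weight_borel] weight_borel by (auto simp: integral_return)
 show "cm_integral (point_mass x) f = f x" if "f \<in> BM" "!!y. cmod (f y) <= C"
  unfolding p by (subst cm_integral_density) (use that i i[of "%_. 1 :: complex"] in "auto simp: integral_return")
qed

lemma M_restr_norm_eq:
 assumes a: "a \<in> M" and E: "E \<in> Borel" shows "ennreal (N (M_restr E a)) = (\<integral>\<^sup>+x. ennreal (\<omega> x) * indicator E x \<partial>variation a)"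
 unfolding M_alg_norm[OF M_restr_M_alg(1)[OF assms]] by (rule nn_integral_M_restr[OF assms]) (use weight_borel in measurable)

text \<open>The measure with density \<open>\<omega>\<close> against the variation is finite and
  absolutely continuous, hence again Radon; a compact set carrying almost all of it works.\<close>

lemma M_tight:
 assumes a: "a \<in> M" and e: "\<eta> > 0" shows "\<exists>C. compact C & N (M_restr (- C) a) < \<eta>"
proof -
 let ?\<nu> = "density (variation a) (%x. ennreal (norm (\<omega> x)))"
 interpret finite_measure ?\<nu> by (rule finite_measure_density_integrable[OF M_algD(3)[OF a]])
 have ac: "measure ?\<nu> E = 0" if E: "E \<in> Borel" "measure (variation a) E = 0" for E
 proof -
  have "E \<in> null_sets (variation a)"
   using E finite_measure.emeasure_eq_measure[OF radon_finiteD(2)[OF M_algD(2)[OF a]]] by (simp add: null_sets_def)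
  then show ?thesis
   using absolutely_continuousI_density[of "%x. ennreal (norm (\<omega> x))" "variation a"] weight_borel
   unfolding absolutely_continuous_def null_sets_def by (auto simp: mvb measure_def)
 qed
 have r: "radon_finite ?\<nu>"
  by (rule radon_finite_absolutely_continuous[OF M_algD(2)[OF a] finite_measure_axioms _ ac]) simp
 obtain C where C: "compact C" "measure ?\<nu> (UNIV - C) < \<eta>" by (rule radon_finiteE[OF r _ e, of UNIV]) auto
 have b: "- C \<in> Borel" using compact_borel_t2[OF C(1)] by (rule borel_comp)
 have "ennreal (N (M_restr (- C) a)) = emeasure ?\<nu> (- C)"
  unfolding M_restr_norm_eq[OF a b] using weight_borel weight_pos(2)[OF w] b by (simp add: emeasure_density mvb)
 also have "\<dots> < ennreal \<eta>" unfolding emeasure_eq_measure Compl_eq_Diff_UNIV using C(2) e by (intro ennreal_lessI)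
 finally show ?thesis
  using C(1) N_nonneg[OF M_restr_M_alg(1)[OF a b]] by (auto simp: ennreal_less_iff)
qed

lemma restriction_M_alg: "restriction (M_alg \<omega>) M_restr"
proof -
 interpret seminormed_funs M N by (rule seminormed_funs_M_alg)
 have U: "M_restr UNIV a = a" if "a \<in> M" for a using M_alg_outside[OF that] by (auto simp: M_restr_def)
 show ?thesis
 proof
  fix a b assume a: "a \<in> M" and b: "b \<in> M"
  show "mulM a b \<in> M" by (rule M_mult_in[OF a b])
  show "N (mulM a b) <= N a * N b"
   using M_mult_restr_norm[OF a b, of UNIV UNIV UNIV 1] weight_mult[OF w] U[OF a] U[OF b] U[OF M_mult_in[OF a b]] by simp
  fix F assume F: "F \<in> adual (M_alg \<omega>)"
  note add = top_dual_add[OF F[unfolded adual_def]] and scale = top_dual_scale[OF F[unfolded adual_def]]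
  show "F (mulM (%x. a x + a' x) b) = F (mulM a b) + F (mulM a' b)" if "a' \<in> M" for a'
   using M_mult_bilinear(1)[OF a b that] add[OF M_mult_in[OF a b] M_mult_in[OF that b]] by simp
  show "F (mulM a (%x. b x + b' x)) = F (mulM a b) + F (mulM a b')" if "b' \<in> M" for b'
   using M_mult_bilinear(2)[OF a b that] add[OF M_mult_in[OF a b] M_mult_in[OF a that]] by simp
  show "F (mulM (%x. c * a x) b) = c * F (mulM a b)" for c
   using M_mult_bilinear(3)[OF a b] scale[OF M_mult_in[OF a b]] by simp
  show "F (mulM a (%x. c * b x)) = c * F (mulM a b)" for c
   using M_mult_bilinear(4)[OF a b] scale[OF M_mult_in[OF a b]] by simp
 next
  show "M_restr UNIV a = a" if "a \<in> M" for a by (rule U[OF that])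
 next
  fix E E' :: "'a set" and a assume E: "E \<in> Borel" and a: "a \<in> M"
  show "M_restr E a \<in> M" by (rule M_restr_M_alg(1)[OF a E])
  show "M_restr E (%x. a x + b x) = (%x. M_restr E a x + M_restr E b x)" for b by (auto simp: M_restr_def)
  show "M_restr E (%x. c * a x) = (%x. c * M_restr E a x)" for c by (auto simp: M_restr_def)
  show "M_restr E (M_restr E' a) = M_restr (E \<inter> E') a" if "E' \<in> Borel"
   using E that by (auto simp: M_restr_def Int_assoc)
  show "M_restr (E \<union> E') a = (%x. M_restr E a x + M_restr E' a x)" if "E' \<in> Borel" "E \<inter> E' = {}"
  proof
   fix B show "M_restr (E \<union> E') a B = M_restr E a B + M_restr E' a B"
    using M_alg_additive[OF a, of "B \<inter> E" "B \<inter> E'"] E that by (auto simp: M_restr_def Int_Un_distrib)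
  qed
  note cE = borel_comp[OF E]
  have "ennreal (N (M_restr E a) + N (M_restr (- E) a)) = ennreal (N (M_restr E a)) + ennreal (N (M_restr (- E) a))"
   by (rule ennreal_plus) (intro norm_nonneg M_restr_M_alg a E cE)+
  also have "\<dots> = (\<integral>\<^sup>+x. ennreal (\<omega> x) * indicator E x + ennreal (\<omega> x) * indicator (- E) x \<partial>variation a)"
   unfolding M_restr_norm_eq[OF a E] M_restr_norm_eq[OF a cE]
   by (rule nn_integral_add[symmetric]) (use weight_borel E cE in "auto simp: mvb")
  also have "\<dots> = ennreal (N a)" unfolding M_alg_norm[OF a] by (rule nn_integral_cong) (auto simp: indicator_def)
  finally show "N (M_restr E a) + N (M_restr (- E) a) <= N a"
   using norm_nonneg[OF a] norm_nonneg[OF M_restr_M_alg(1)[OF a E]] norm_nonneg[OF M_restr_M_alg(1)[OF a cE]] by (subst (asm) ennreal_inj) auto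
 qed
qed

theorem atomic_convolution_algebra_M_alg: "atomic_convolution_algebra (M_alg \<omega>) M_restr \<omega> point_mass M_coord"
proof -
 interpret restriction "M_alg \<omega>" M_restr by (rule restriction_M_alg)
 interpret convolution_algebra "M_alg \<omega>" M_restr \<omega> by unfold_locales (fact w M_mult_restr_norm M_tight)+
 have t: "{t} \<in> Borel" for t :: 'a by (intro compact_borel_t2) simp
 show ?thesis
 proof (rule atomic_convolution_algebraI)
  show "point_mass x \<in> M" "N (point_mass x) = \<omega> x" for x by (rule point_mass_M)+
  show "M_coord t (mulM (point_mass x) (point_mass y)) = (if t = x + y then 1 else 0)" for t x y
  proof -
   have "cm_integral (point_mass y) (%y. indicator {t} (x + y)) = indicator {t} (x + y)"
    by (rule point_mass_M(3)[OF indicator_translate_borel[OF t], where C = 1]) (simp add: indicator_def)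
   then show ?thesis
    using M_mult_in[OF point_mass_M(1) point_mass_M(1)]
    by (simp add: M_coord_def mult_apply(1)[OF t] point_mass_M(3)[OF cm_integral_translate(1,3)[OF point_mass_M(1) t]])
  qed
  show "M_coord t (point_mass x) = (if t = x then 1 else 0)" for t x
   using point_mass_M(1) by (simp add: M_coord_def point_mass_def indicator_def)
  show "M_restr {x} a = (%s. M_coord x a * point_mass x s)" if a: "a \<in> M" for a x
  proof
   fix B
   have "B \<inter> {x} = (if x \<in> B then {x} else {})" by auto
   then show "M_restr {x} a B = M_coord x a * point_mass x B"
    using a complex_borel_measure_empty[OF M_algD(1)[OF a]] by (simp add: M_restr_def M_coord_def point_mass_def)
  qed
 qed (use add_in scale_in in "simp_all add: M_coord_def")
qed

text \<open>Normalising the restriction of a measure to \<open>- K\<close> turns the condition on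
  measures of norm 1 into a norm bound; conversely a measure whose variation vanishes on
  \<open>K\<close> equals its restriction to \<open>- K\<close>.\<close>

theorem M_star_eq_vanishing: "M_star \<omega> = convolution_algebra.vanishing (M_alg \<omega>) M_restr"
proof -
 interpret atomic_convolution_algebra "M_alg \<omega>" M_restr \<omega> point_mass M_coord by (rule atomic_convolution_algebra_M_alg)
 have "F \<in> vanishing" if F: "F \<in> M_star \<omega>" for F
 proof -
  have Fd: "F \<in> adual (M_alg \<omega>)" using F by (simp add: M_star_def)
  have "\<exists>K. compact K & (\<forall>a\<in>M. cmod (F (M_restr (- K) a)) <= \<eta> * N a)" if e: "\<eta> > 0" for \<eta>
  proof -
   obtain K where K: "compact K" "\<forall>\<mu>\<in>M. emeasure (variation \<mu>) K = 0 & N \<mu> = 1 --> cmod (F \<mu>) < \<eta>"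
    using F e unfolding M_star_def by blast
   note bK = compact_borel[OF K(1)]
   have "cmod (F (M_restr (- K) a)) <= \<eta> * N a" if a: "a \<in> M" for a
   proof (cases "N (M_restr (- K) a) = 0")
    case True
    then show ?thesis using functional_zero_if_norm_zero[OF Fd restr_in[OF bK(2) a]] norm_nonneg[OF a] e by simp
   next
    case False
    define s where "s = N (M_restr (- K) a)"
    have s: "s > 0" using False norm_nonneg[OF restr_in[OF bK(2) a]] by (simp add: s_def)
    define b where "b = (%x. complex_of_real (1 / s) * a x)"
    have b: "b \<in> M" unfolding b_def by (rule scale_in[OF a])
    have R: "M_restr (- K) b = (%x. complex_of_real (1 / s) * M_restr (- K) a x)" unfolding b_def by (rule restr_scale[OF bK(2) a])
    have "N (M_restr (- K) b) = 1" unfolding R norm_scale[OF restr_in[OF bK(2) a]] s_def[symmetric] using s by (simp add: norm_divide)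
    moreover have "emeasure (variation (M_restr (- K) b)) K = 0"
     unfolding M_restr_M_alg(2)[OF b bK(2)] using bK
     by (subst emeasure_density) (simp_all add: mvb indicator_inter_arith[symmetric])
    ultimately have "cmod (F (M_restr (- K) b)) < \<eta>" using K(2) restr_in[OF bK(2) b] by blast
    then have "cmod (F (M_restr (- K) a)) <= \<eta> * s"
     unfolding R top_dual_scale[OF Fd[unfolded adual_def] restr_in[OF bK(2) a]] using s by (simp add: norm_divide divide_simps)
    also have "\<dots> <= \<eta> * N a" unfolding s_def using restr_norm_le[OF bK(2) a] e by (intro mult_left_mono) auto
    finally show ?thesis .
   qed
   then show ?thesis using K(1) by blast
  qed
  then show ?thesis using Fd by (simp add: vanishing_def)
 qed
 moreover have "F \<in> M_star \<omega>" if F: "F \<in> vanishing" for F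
  unfolding M_star_def
 proof (intro CollectI conjI allI impI)
  show "F \<in> adual (M_alg \<omega>)" using F by (simp add: vanishing_def)
  fix \<eta> :: real assume e: "\<eta> > 0"
  \<comment> \<open>Half of \<open>\<eta>\<close> turns the non-strict bound of
    \<open>vanishing\<close> into the strict one of \<open>M_star\<close>.\<close>
  then have "\<eta> / 2 > 0" by simp
  then obtain K where K: "compact K" "\<forall>a\<in>M. cmod (F (M_restr (- K) a)) <= \<eta> / 2 * N a"
   using F unfolding vanishing_def by blast
  note bK = compact_borel[OF K(1)]
  have "cmod (F \<mu>) < \<eta>" if \<mu>: "\<mu> \<in> M" "emeasure (variation \<mu>) K = 0" "N \<mu> = 1" for \<mu>
  proof -
   note fin = radon_finiteD(2)[OF M_algD(2)[OF \<mu>(1)]]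
   have "M_restr K \<mu> B = 0" for B
   proof (cases "B \<in> Borel")
    case True
    then have "cmod (\<mu> (B \<inter> K)) <= measure (variation \<mu>) (B \<inter> K)"
     using bK by (intro cmod_le_variation M_algD(1) \<mu> fin) auto
    also have "\<dots> <= measure (variation \<mu>) K" using bK by (intro finite_measure.finite_measure_mono[OF fin]) auto
    also have "\<dots> = 0" using \<mu>(2) by (simp add: measure_def)
    finally show ?thesis using True by (simp add: M_restr_def)
   qed (simp add: M_restr_def)
   then have "M_restr (- K) \<mu> = \<mu>" using restr_split[OF bK(1) \<mu>(1)] by (auto simp: fun_eq_iff)
   then show ?thesis using K(2) \<mu> e by force
  qed
  then show "\<exists>K. compact K & (\<forall>\<mu>\<in>M. emeasure (variation \<mu>) K = 0 & N \<mu> = 1 --> cmod (F \<mu>) < \<eta>)"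
   using K(1) by blast
 qed
 ultimately show ?thesis by blast
qed

end

section \<open>Haar measure\<close>

text \<open>Haar measure need not be \<sigma>-finite, but integrable functions vanish off sets of
  this kind, and on them integrals can be exchanged.\<close>

definition sigma_bounded :: "'a::topological_space set => bool" where
 "sigma_bounded E \<longleftrightarrow> (\<exists>\<K>. countable \<K> & (\<forall>K\<in>\<K>. compact K) & E \<subseteq> \<Union>\<K>)"

lemma sigma_bounded_compact: "compact K ==> sigma_bounded K"
 unfolding sigma_bounded_def by (intro exI[of _ "{K}"]) auto

lemma sigma_bounded_subset: "sigma_bounded E ==> E' \<subseteq> E ==> sigma_bounded E'"
 unfolding sigma_bounded_def by (meson subset_trans)

lemma sigma_bounded_UN:
 assumes "countable I" "!!i. i \<in> I ==> sigma_bounded (E i)" shows "sigma_bounded (\<Union>i\<in>I. E i)"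
proof -
 have "\<forall>i\<in>I. \<exists>\<K>. countable \<K> & (\<forall>K\<in>\<K>. compact K) & E i \<subseteq> \<Union>\<K>" using assms(2) by (simp add: sigma_bounded_def)
 then obtain k where "\<forall>i\<in>I. countable (k i) & (\<forall>K\<in>k i. compact K) & E i \<subseteq> \<Union>(k i)" by (rule bchoice[THEN exE])
 then show ?thesis unfolding sigma_bounded_def using assms(1) by (intro exI[of _ "\<Union>i\<in>I. k i"]) fastforce
qed

lemma compact_plus: "compact C ==> compact K ==> compact ((%(x, y). x + y) ` (C \<times> K :: ('a::topological_monoid_add \<times> 'a) set))"
 by (intro compact_continuous_image compact_Times) (auto intro!: continuous_intros simp: case_prod_unfold)

lemma sigma_bounded_plus:
 assumes "sigma_bounded E" "sigma_bounded E'"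
 shows "sigma_bounded ((%(x, y). x + y) ` (E \<times> E' :: ('a::topological_monoid_add \<times> 'a) set))"
proof -
 obtain A B where A: "countable A" "\<forall>K\<in>A. compact K" "E \<subseteq> \<Union>A" and B: "countable B" "\<forall>K\<in>B. compact K" "E' \<subseteq> \<Union>B"
  using assms unfolding sigma_bounded_def by (elim exE conjE)
 have "sigma_bounded (\<Union>(K, L)\<in>A \<times> B. (%(x, y). x + y) ` (K \<times> L))"
  using A B by (intro sigma_bounded_UN) (auto intro!: sigma_bounded_compact compact_plus)
 then show ?thesis
 proof (rule sigma_bounded_subset, intro subsetI)
  fix z assume "z \<in> (%(x, y). x + y) ` (E \<times> E')"
  then obtain x y where xy: "x \<in> E" "y \<in> E'" "z = x + y" by auto
  obtain K L where KL: "K \<in> A" "x \<in> K" "L \<in> B" "y \<in> L" using xy A(3) B(3) by blast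
  show "z \<in> (\<Union>(K, L)\<in>A \<times> B. (%(x, y). x + y) ` (K \<times> L))"
   by (rule UN_I[of "(K, L)"]) (use KL xy(3) in auto)
 qed
qed

lemma sigma_bounded_incseq:
 assumes "sigma_bounded E"
 obtains K :: "nat => 'a::topological_space set" where "\<forall>n. compact (K n)" "incseq K" "E \<subseteq> (\<Union>n. K n)"
proof -
 obtain \<K> where K: "countable \<K>" "\<forall>K\<in>\<K>. compact K" "E \<subseteq> \<Union>\<K>" using assms unfolding sigma_bounded_def by (elim exE conjE)
 define L where "L = from_nat_into (insert {} \<K>)"
 have r: "range L = insert {} \<K>" unfolding L_def using K(1) by (intro range_from_nat_into) auto
 have c: "compact (L n)" for n using r K(2) by (metis compact_empty insert_iff rangeI)
 show ?thesis
 proof (rule that)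
  show "\<forall>n. compact (\<Union>k\<le>n. L k)" using c by auto
  show "incseq (%n. \<Union>k\<le>n. L k)" by (intro monoI UN_mono) auto
  have "\<Union>\<K> \<subseteq> (\<Union>n. L n)" using r by auto
  also have "\<dots> \<subseteq> (\<Union>n. \<Union>k\<le>n. L k)" by (intro UN_mono) auto
  finally show "E \<subseteq> (\<Union>n. \<Union>k\<le>n. L k)" using K(3) by simp
 qed
qed

locale haar =
 fixes m :: "'a::{topological_group_add, t2_space} measure"
 assumes haar: "left_haar_measure m" and lc: "locally_compact_space (euclidean :: 'a topology)"
begin

lemma sets_m: "sets m = Borel" and space_m: "space m = UNIV" and UNIV_nonzero: "emeasure m UNIV \<noteq> 0"
 and compact_finite: "compact K ==> emeasure m K < \<infinity>"
 and translate: "E \<in> Borel ==> emeasure m ((+) x ` E) = emeasure m E"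
 and outer_regular: "E \<in> Borel ==> emeasure m E = (INF U\<in>{U. open U & E \<subseteq> U}. emeasure m U)"
 and inner_regular: "open U ==> emeasure m U = (SUP K\<in>{K. compact K & K \<subseteq> U}. emeasure m K)"
proof -
 note h = haar[unfolded left_haar_measure_def]
 show "sets m = Borel" by (rule conjunct1[OF h])
 from sets_eq_imp_space_eq[OF this] show "space m = UNIV" by simp
 show "emeasure m UNIV \<noteq> 0" using h by (elim conjE)
 show "compact K ==> emeasure m K < \<infinity>" using h by (elim conjE) (drule spec, erule mp)
 show "E \<in> Borel ==> emeasure m ((+) x ` E) = emeasure m E"
  using h by (elim conjE) (drule bspec, assumption, erule spec)
 show "E \<in> Borel ==> emeasure m E = (INF U\<in>{U. open U & E \<subseteq> U}. emeasure m U)"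
  using h by (elim conjE) (erule bspec)
 show "open U ==> emeasure m U = (SUP K\<in>{K. compact K & K \<subseteq> U}. emeasure m K)"
  using h by (elim conjE) (drule spec, erule mp)
qed

lemmas mb = measurable_borel_iff[OF sets_m]

lemma nn_integral_translate:
 assumes f: "f \<in> BM" shows "(\<integral>\<^sup>+y. f (x + y) \<partial>m) = (\<integral>\<^sup>+y. f y \<partial>m)"
proof -
 have p: "(+) x \<in> BM"
  using borel_section_measurable(1)[OF measurable_plus_pair, of x] by simp
 have v: "(+) x -` E = (+) (- x) ` E" for E by (auto simp: image_iff intro!: bexI[of _ "x + _"])
 have "distr m borel ((+) x) = m"
  by (rule measure_eqI) (use p in "auto simp: sets_m mb emeasure_distr space_m v translate")
 then have "(\<integral>\<^sup>+y. f y \<partial>m) = (\<integral>\<^sup>+y. f y \<partial>distr m borel ((+) x))" by simp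
 also have "\<dots> = (\<integral>\<^sup>+y. f (x + y) \<partial>m)" by (rule nn_integral_distr) (use p f in "auto simp: mb")
 finally show ?thesis ..
qed

text \<open>Finitely many translates of a null open set would cover any given compact set; inner
  regularity would then make the whole group null.\<close>

lemma open_positive:
 assumes U: "open U" "U \<noteq> {}" shows "emeasure m U > 0"
proof (rule ccontr)
 assume "\<not> emeasure m U > 0"
 then have z: "emeasure m U = 0" by simp
 have oT: "open ((+) x ` U)" for x
 proof -
  have "(+) x ` U = (%y. - x + y) -` U" by (auto simp: image_iff intro!: bexI[of _ "- x + _"])
  then show ?thesis using U(1) by (auto intro!: open_vimage continuous_intros)
 qed
 obtain u where u: "u \<in> U" using U(2) by blast
 have "emeasure m K = 0" if K: "compact K" for K
 proof -
  have c: "K \<subseteq> (\<Union>x\<in>UNIV. (+) x ` U)"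
   using u by (auto simp: image_iff intro!: exI[of _ "_ - u"] bexI[of _ u])
  obtain X where X: "finite X" "K \<subseteq> (\<Union>x\<in>X. (+) x ` U)" by (rule compactE_image[OF K, of UNIV "%x. (+) x ` U"]) (use oT c in auto)
  have "emeasure m K <= emeasure m (\<Union>x\<in>X. (+) x ` U)"
   by (rule emeasure_mono[OF X(2)]) (unfold sets_m, intro borel_open open_UN ballI oT)
  also have "\<dots> <= (\<Sum>x\<in>X. emeasure m ((+) x ` U))"
   by (rule emeasure_subadditive_finite[OF X(1)]) (auto simp: sets_m intro!: borel_open oT)
  also have "\<dots> = 0" using z U by (simp add: translate)
  finally show ?thesis by simp
 qed
 then have "emeasure m UNIV <= 0" unfolding inner_regular[OF open_UNIV] by (intro SUP_least) simp
 then show False using UNIV_nonzero by simp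
qed

lemma outer_approx:
 assumes E: "E \<in> Borel" "emeasure m E < \<infinity>" and e: "\<eta> > 0"
 obtains U where "open U" "E \<subseteq> U" "emeasure m (U - E) < ennreal \<eta>"
proof -
 have "\<exists>U\<in>{U. open U & E \<subseteq> U}. emeasure m U < emeasure m E + ennreal \<eta>"
  by (rule INF_approx_ennreal[OF e outer_regular]) (use E in auto)
 then obtain U where U: "open U" "E \<subseteq> U" "emeasure m U < emeasure m E + ennreal \<eta>" by blast
 have "emeasure m U = emeasure m E + emeasure m (U - E)"
  using E U by (subst plus_emeasure) (auto simp: sets_m Un_absorb1)
 then show ?thesis using that U E(2) by (simp add: ennreal_add_left_cancel_less)
qed

text \<open>Inner regularity is given for open sets only. Take an open \<open>U\<close> around
  \<open>E\<close> and a compact \<open>L\<close> nearly filling \<open>U\<close>, and remove from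
  \<open>L\<close> an open set around \<open>U - E\<close> of only slightly larger measure.\<close>

lemma inner_approx:
 assumes E: "E \<in> Borel" "emeasure m E < \<infinity>" and e: "\<eta> > 0"
 obtains K where "compact K" "K \<subseteq> E" "emeasure m (E - K) < ennreal \<eta>"
proof -
 have e2: "\<eta> / 2 > 0" using e by simp
 obtain U where U: "open U" "E \<subseteq> U" "emeasure m (U - E) < ennreal 1" by (rule outer_approx[OF E, of 1]) auto
 have bU: "U \<in> Borel" using U(1) by simp
 have fU: "emeasure m U < \<infinity>"
 proof -
  have "emeasure m U = emeasure m E + emeasure m (U - E)"
   using E U by (subst plus_emeasure) (auto simp: sets_m Un_absorb1)
  also have "\<dots> < \<infinity>" using E(2) U(3) by (simp add: less_top[symmetric]) (metis ennreal_one_less_top order_less_trans order_less_irrefl)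
  finally show ?thesis .
 qed
 have "\<exists>K\<in>{K. compact K & K \<subseteq> U}. emeasure m U < emeasure m K + ennreal (\<eta> / 2)"
  by (rule SUP_approx_ennreal[OF e2 _ inner_regular]) (use U fU in auto)
 then obtain L where L: "compact L" "L \<subseteq> U" "emeasure m U < emeasure m L + ennreal (\<eta> / 2)" by blast
 have bL: "L \<in> Borel" by (rule compact_borel_t2[OF L(1)])
 have "emeasure m U = emeasure m L + emeasure m (U - L)"
  using bL bU L(2) by (subst plus_emeasure) (auto simp: sets_m Un_absorb1)
 then have L3: "emeasure m (U - L) < ennreal (\<eta> / 2)" using L(3) compact_finite[OF L(1)] by (simp add: ennreal_add_left_cancel_less)
 have f: "emeasure m (U - E) < \<infinity>" using U(3) by (metis ennreal_less_top infinity_ennreal_def order_less_trans)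
 obtain V where V: "open V" "U - E \<subseteq> V" "emeasure m (V - (U - E)) < ennreal (\<eta> / 2)"
  by (rule outer_approx[OF _ f e2]) (use bU E in auto)
 have bV: "V \<in> Borel" using V(1) by simp
 show ?thesis
 proof (rule that)
  show "compact (L - V)" by (rule compact_diff[OF L(1) V(1)])
  show "L - V \<subseteq> E" using L(2) V(2) by blast
  have "emeasure m (E - (L - V)) <= emeasure m ((U - L) \<union> (V - (U - E)))"
   by (rule emeasure_mono) (use U(2) bU bL bV E in "auto simp: sets_m")
  also have "\<dots> <= emeasure m (U - L) + emeasure m (V - (U - E))"
   by (rule emeasure_subadditive) (use bU bL bV E in "auto simp: sets_m")
  also have "\<dots> < ennreal (\<eta> / 2) + ennreal (\<eta> / 2)" by (rule add_strict_mono[OF L3 V(3)])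
  also have "\<dots> = ennreal \<eta>" using e by (simp add: ennreal_plus[symmetric] del: ennreal_plus)
  finally show "emeasure m (E - (L - V)) < ennreal \<eta>" .
 qed
qed

text \<open>Where \<open>g\<close> lies between \<open>1 / (k + 1)\<close> and \<open>k + 1\<close>
  the Haar measure is finite, so compact approximation transfers from Haar measure to the density;
  these sets exhaust the support of \<open>g\<close>.\<close>

lemma radon_finite_density:
 assumes g: "g \<in> BM" and g0: "!!x. 0 <= g x" and fin: "(\<integral>\<^sup>+x. ennreal (g x) \<partial>m) < \<infinity>"
 shows "radon_finite (density m (%x. ennreal (g x)))" (is "radon_finite ?\<nu>")
proof -
 have em: "emeasure ?\<nu> E = (\<integral>\<^sup>+x. ennreal (g x) * indicator E x \<partial>m)" if "E \<in> Borel" for E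
  using that g by (intro emeasure_density) (auto simp: sets_m mb)
 have fm: "finite_measure ?\<nu>" using fin em[of UNIV] by (intro finite_measureI) (simp add: space_m)
 interpret finite_measure ?\<nu> by (rule fm)
 have s: "sets ?\<nu> = Borel" by (simp add: sets_m)
 show ?thesis
  unfolding radon_finite_def
 proof (intro conjI ballI allI impI s fm)
  fix E :: "'a set" and \<eta> :: real assume E: "E \<in> Borel" and e: "\<eta> > 0"
  define B where "B k = {x \<in> E. 1 / real (Suc k) <= g x & g x <= real (Suc k)}" for k
  have B: "B k \<in> Borel" for k
  proof -
   have "B k = E \<inter> g -` {1 / real (Suc k)..real (Suc k)}" by (auto simp: B_def)
   then show ?thesis using E measurable_sets[OF g, of "{1 / real (Suc k)..real (Suc k)}"] by simp
  qed
  have Bf: "emeasure m (B k) < \<infinity>" for k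
  proof -
   have "emeasure m (B k) = (\<integral>\<^sup>+x. indicator (B k) x \<partial>m)" using B by (simp add: sets_m)
   also have "\<dots> <= (\<integral>\<^sup>+x. ennreal (real (Suc k)) * ennreal (g x) \<partial>m)"
   proof (rule nn_integral_mono)
    fix x show "indicator (B k) x <= ennreal (real (Suc k)) * ennreal (g x)"
     using g0[of x] by (auto simp: B_def indicator_def ennreal_mult[symmetric] field_simps simp del: of_nat_Suc intro!: ennreal_ge_1[THEN iffD2])
   qed
   also have "\<dots> = ennreal (real (Suc k)) * (\<integral>\<^sup>+x. ennreal (g x) \<partial>m)" using g by (intro nn_integral_cmult) (simp add: mb)
   also have "\<dots> < \<infinity>" using fin by (simp add: ennreal_mult_less_top)
   finally show ?thesis .
  qed
  have "\<exists>K. compact K & K \<subseteq> B k & measure ?\<nu> (B k - K) < \<delta>" if d: "\<delta> > 0" for k \<delta>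
  proof -
   have "\<delta> / real (Suc k) > 0" using d by simp
   then obtain K where K: "compact K" "K \<subseteq> B k" "emeasure m (B k - K) < ennreal (\<delta> / real (Suc k))" by (rule inner_approx[OF B Bf])
   have bK: "B k - K \<in> Borel" using B compact_borel_t2[OF K(1)] by auto
   have "emeasure ?\<nu> (B k - K) <= (\<integral>\<^sup>+x. ennreal (real (Suc k)) * indicator (B k - K) x \<partial>m)"
    unfolding em[OF bK] by (rule nn_integral_mono) (auto simp: B_def indicator_def simp del: of_nat_Suc)
   also have "\<dots> = ennreal (real (Suc k)) * emeasure m (B k - K)" using bK by (simp add: nn_integral_cmult_indicator sets_m)
   also have "\<dots> < ennreal (real (Suc k)) * ennreal (\<delta> / real (Suc k))"
    using K(3) by (intro ennreal_mult_strict_left_mono) (auto simp del: of_nat_Suc)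
   also have "\<dots> = ennreal \<delta>" using d by (simp add: ennreal_mult[symmetric] del: of_nat_Suc)
   finally show ?thesis using K d by (intro exI[of _ K]) (simp add: emeasure_eq_measure ennreal_less_iff)
  qed
  then have "\<exists>K. compact K & K \<subseteq> (\<Union>k. B k) & measure ?\<nu> ((\<Union>k. B k) - K) < \<eta>"
   by (intro compact_approx_UN[OF fm s B _ e]) blast
  then obtain K where K: "compact K" "K \<subseteq> (\<Union>k. B k)" "measure ?\<nu> ((\<Union>k. B k) - K) < \<eta>" by (elim exE conjE)
  have bK: "K \<in> Borel" by (rule compact_borel_t2[OF K(1)])
  have un: "(\<Union>k. B k) \<in> Borel" using B by auto
  have z: "g x = 0" if x: "x \<in> E" "x \<notin> (\<Union>k. B k)" for x
  proof (rule ccontr)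
   assume "g x \<noteq> 0"
   then have p: "g x > 0" using g0[of x] by simp
   obtain k where k: "max (g x) (1 / g x) < real k" using reals_Archimedean2 by blast
   then have "x \<in> B k" using p x(1) by (auto simp: B_def field_simps)
   then show False using x(2) by blast
  qed
  have "emeasure ?\<nu> (E - (\<Union>k. B k)) = (\<integral>\<^sup>+x. 0 \<partial>m)"
   unfolding em[OF sets.Diff[OF E un]] by (rule nn_integral_cong) (use z in "auto simp: indicator_def")
  then have z': "measure ?\<nu> (E - (\<Union>k. B k)) = 0" by (simp add: measure_def)
  have "measure ?\<nu> (E - K) <= measure ?\<nu> (((\<Union>k. B k) - K) \<union> (E - (\<Union>k. B k)))"
   by (rule finite_measure_mono) (use un bK E in "auto simp: sets_m")
  also have "\<dots> <= measure ?\<nu> ((\<Union>k. B k) - K) + measure ?\<nu> (E - (\<Union>k. B k))"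
   by (rule measure_Un_le) (use un bK E in "auto simp: sets_m")
  finally show "\<exists>K. compact K & K \<subseteq> E & measure ?\<nu> (E - K) < \<eta>" using K z' by (intro exI[of _ K]) (auto simp: B_def)
 qed
qed

lemma ex_compact_nbhd: "\<exists>U V. open U & compact V & (x :: 'a) \<in> U & U \<subseteq> V"
 using lc unfolding locally_compact_space_def by simp

text \<open>The subgroup generated by a compact neighbourhood of 0 is open and \<open>\<sigma>\<close>-compact; an open set of
 finite measure meets only countably many of its cosets.\<close>

lemma ex_open_sigma_bounded_subgroup:
 obtains H :: "'a set" where "open H" "sigma_bounded H" "0 \<in> H" "\<forall>x\<in>H. \<forall>y\<in>H. x + y \<in> H" "\<forall>x\<in>H. - x \<in> H"
proof -
 obtain U V :: "'a set" where UV: "open U" "compact V" "0 \<in> U" "U \<subseteq> V" using ex_compact_nbhd[of 0] by (elim exE conjE)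
 define D where "D = V \<union> uminus ` V"
 have D: "compact D" "0 \<in> D" "U \<subseteq> D" "\<forall>x\<in>D. - x \<in> D"
  using UV by (auto simp: D_def intro!: compact_Un compact_continuous_image continuous_intros)
 \<comment> \<open>\<open>S n\<close> is the set of sums of \<open>n + 1\<close> elements of the
   symmetric compact neighbourhood \<open>D\<close>.\<close>
 define S where "S = rec_nat D (%_ T. (%(x, y). x + y) ` (T \<times> D))"
 have S: "S 0 = D" "S (Suc n) = (%(x, y). x + y) ` (S n \<times> D)" for n by (simp_all add: S_def)
 have c: "compact (S n)" for n by (induction n) (auto simp: S D intro!: compact_plus)
 let ?H = "\<Union>n. S n"
 have step: "x + y \<in> ?H" if "x \<in> ?H" "y \<in> D" for x y
 proof -
  obtain n where "x \<in> S n" using \<open>x \<in> ?H\<close> by blast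
  then have "x + y \<in> S (Suc n)" using that(2) by (auto simp: S intro: image_eqI[of _ _ "(x, y)"])
  then show ?thesis by blast
 qed
 have plus: "x \<in> ?H ==> y \<in> S n ==> x + y \<in> ?H" for x y n
 proof (induction n arbitrary: y)
  case (Suc n)
  then obtain u v where uv: "u \<in> S n" "v \<in> D" "y = u + v" by (auto simp: S)
  show ?case using step[OF Suc.IH[OF Suc.prems(1) uv(1)] uv(2)] uv(3) by (simp add: add.assoc)
 qed (use step in "auto simp: S")
 have DH: "D \<subseteq> ?H" using S(1) by blast
 have neg: "y \<in> S n ==> - y \<in> ?H" for y n
 proof (induction n arbitrary: y)
  case 0 then show ?case using D(4) DH by (auto simp: S)
 next
  case (Suc n)
  then obtain u v where uv: "u \<in> S n" "v \<in> D" "y = u + v" by (auto simp: S)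
  obtain k where k: "- u \<in> S k" using Suc.IH[OF uv(1)] by blast
  have "- v + - u \<in> ?H" by (rule plus[OF _ k]) (use uv(2) D(4) DH in blast)
  then show ?case using uv(3) by (simp add: minus_add)
 qed
 show ?thesis
 proof (rule that)
  show "open ?H"
  proof (subst open_subopen, intro ballI)
   fix x assume x: "x \<in> ?H"
   have "open ((%y. - x + y) -` U)" using UV(1) by (auto intro!: open_vimage continuous_intros)
   moreover have "y \<in> ?H" if y: "- x + y \<in> U" for y
    using step[OF x, of "- x + y"] y D(3) by (auto simp: add.assoc[symmetric])
   ultimately show "\<exists>T. open T & x \<in> T & T \<subseteq> ?H" using UV(3) by (intro exI[of _ "(%y. - x + y) -` U"]) auto
  qed
  show "sigma_bounded ?H" by (rule sigma_bounded_UN) (auto intro: sigma_bounded_compact c)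
  show "0 \<in> ?H" using D(2) DH by blast
  show "\<forall>x\<in>?H. \<forall>y\<in>?H. x + y \<in> ?H" using plus by blast
  show "\<forall>x\<in>?H. - x \<in> ?H" using neg by blast
 qed
qed

lemma sigma_bounded_finite_measure:
 assumes E: "E \<in> Borel" "emeasure m E < \<infinity>" shows "sigma_bounded E"
proof -
 obtain H :: "'a set" where H: "open H" "sigma_bounded H" "0 \<in> H" "\<forall>x\<in>H. \<forall>y\<in>H. x + y \<in> H" "\<forall>x\<in>H. - x \<in> H"
  by (rule ex_open_sigma_bounded_subgroup)
 obtain U where U: "open U" "E \<subseteq> U" "emeasure m (U - E) < ennreal 1" by (rule outer_approx[OF E, of 1]) auto
 have fU: "emeasure m U \<noteq> \<infinity>"
 proof -
  have "emeasure m U = emeasure m E + emeasure m (U - E)"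
   using E U by (subst plus_emeasure) (auto simp: sets_m Un_absorb1)
  then show ?thesis using E(2) U(3) by (auto simp: top_unique)
 qed
 define Q where "Q = (%x. {y. - x + y \<in> H}) ` U"
 have oQ: "open q" if "q \<in> Q" for q
 proof -
  obtain x where "q = (%y. - x + y) -` H" using \<open>q \<in> Q\<close> by (auto simp: Q_def)
  then show ?thesis using H(1) by (auto intro!: open_vimage continuous_intros)
 qed
 have disj: "disjoint Q"
 proof -
  have "{z. - x + z \<in> H} = {z. - y + z \<in> H}" if "- x + t \<in> H" "- y + t \<in> H" for x y t
  proof -
   have "- x + y \<in> H" using H(4)[rule_format, OF that(1) H(5)[rule_format, OF that(2)]] by (simp add: minus_add add.assoc)
   moreover from H(5)[rule_format, OF this] have "- y + x \<in> H" by (simp add: minus_add)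
   ultimately show ?thesis
    using H(4)[rule_format, of "- x + y" "- y + _"] H(4)[rule_format, of "- y + x" "- x + _"] by (auto simp: add.assoc)
  qed
  then show ?thesis unfolding Q_def disjoint_def by (auto simp del: ex_in_conv)
 qed
 \<comment> \<open>\<open>U\<close> meets each of these cosets in a nonempty open set, of positive
   measure; since the cosets are disjoint and \<open>U\<close> has finite measure, there are only
   countably many.\<close>
 have pos: "measure m (U \<inter> q) > 0" if q: "q \<in> Q" for q
 proof -
  have ne: "U \<inter> q \<noteq> {}" using q H(3) by (auto simp: Q_def)
  have "emeasure m (U \<inter> q) \<noteq> 0" using open_positive[OF open_Int[OF U(1) oQ[OF q]] ne] by simp
  moreover have "emeasure m (U \<inter> q) \<noteq> \<infinity>"
   using emeasure_mono[of "U \<inter> q" U m] U(1) fU by (auto simp: sets_m top_unique)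
  ultimately show ?thesis by (simp add: measure_def enn2real_positive_iff less_top[symmetric] zero_less_iff_neq_zero)
 qed
 have "(%q. measure m (U \<inter> q)) summable_on Q"
 proof (rule nonneg_bdd_above_summable_on)
  show "bdd_above (sum (%q. measure m (U \<inter> q)) ` {F. F \<subseteq> Q & finite F})"
  proof (rule bdd_aboveI2)
   fix F assume F: "F \<in> {F. F \<subseteq> Q & finite F}"
   have "(\<Sum>q\<in>F. measure m (U \<inter> q)) = measure m (\<Union>q\<in>F. U \<inter> q)"
   proof (rule measure_finite_Union[symmetric])
    show "disjoint_family_on ((\<inter>) U) F" using disj F unfolding disjoint_def disjoint_family_on_def by blast
    show "emeasure m (U \<inter> q) \<noteq> \<infinity>" if "q \<in> F" for q
     using emeasure_mono[of "U \<inter> q" U m] U(1) fU by (auto simp: sets_m top_unique)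
   qed (use F U oQ in "auto simp: sets_m")
   also have "\<dots> <= measure m U"
    by (rule measure_mono_fmeasurable) (use F U oQ fU in "auto simp: fmeasurable_def sets_m less_top intro!: borel_open open_Int open_Union")
   finally show "(\<Sum>q\<in>F. measure m (U \<inter> q)) <= measure m U" .
  qed
 qed simp
 then have "countable {q \<in> Q. measure m (U \<inter> q) \<noteq> 0}" by (intro abs_summable_countable) simp
 moreover have "{q \<in> Q. measure m (U \<inter> q) \<noteq> 0} = Q" using pos by force
 ultimately have cQ: "countable Q" by simp
 have "sigma_bounded (\<Union>q\<in>Q. q)"
 proof (rule sigma_bounded_UN[OF cQ])
  fix q assume "q \<in> Q"
  then obtain x where x: "q = {y. - x + y \<in> H}" by (auto simp: Q_def)
  show "sigma_bounded q"
   by (rule sigma_bounded_subset[OF sigma_bounded_plus[OF sigma_bounded_compact[of "{x}"] H(2)]])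
    (auto simp: x image_iff add.assoc[symmetric] intro!: bexI[of _ "- x + _"])
 qed
 then show ?thesis by (rule sigma_bounded_subset) (use U(2) H(3) in "auto simp: Q_def")
qed

end

section \<open>Tonelli's theorem with a Haar factor\<close>

context haar begin

text \<open>By Chebyshev's inequality the sets on which \<open>g\<close> is at least
  \<open>1 / (k + 1)\<close> have finite measure and are therefore \<sigma>-bounded.\<close>

lemma sigma_bounded_support:
 assumes g: "g \<in> BM" and g0: "!!x. 0 <= g x" and fin: "(\<integral>\<^sup>+x. ennreal (g x) \<partial>m) < \<infinity>"
 shows "sigma_bounded {x. g x \<noteq> 0}"
proof -
 have "sigma_bounded {x. 1 / real (Suc k) <= g x}" for k
 proof (rule sigma_bounded_finite_measure)
  show B: "{x. 1 / real (Suc k) <= g x} \<in> Borel" using borel_measurable_le[OF borel_measurable_const g] by simp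
  have "emeasure m {x. 1 / real (Suc k) <= g x} = (\<integral>\<^sup>+x. indicator {x. 1 / real (Suc k) <= g x} x \<partial>m)"
   using B by (simp add: sets_m)
  also have "\<dots> <= (\<integral>\<^sup>+x. ennreal (real (Suc k)) * ennreal (g x) \<partial>m)"
  proof (rule nn_integral_mono)
   fix x show "indicator {x. 1 / real (Suc k) <= g x} x <= ennreal (real (Suc k)) * ennreal (g x)"
    using g0[of x] by (auto simp: indicator_def ennreal_mult[symmetric] field_simps simp del: of_nat_Suc intro!: ennreal_ge_1[THEN iffD2])
  qed
  also have "\<dots> = ennreal (real (Suc k)) * (\<integral>\<^sup>+x. ennreal (g x) \<partial>m)" using g by (intro nn_integral_cmult) (simp add: mb)
  also have "\<dots> < \<infinity>" using fin by (simp add: ennreal_mult_less_top)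
  finally show "emeasure m {x. 1 / real (Suc k) <= g x} < \<infinity>" .
 qed
 then have "sigma_bounded (\<Union>k\<in>UNIV. {x. 1 / real (Suc k) <= g x})" by (intro sigma_bounded_UN) simp_all
 then show ?thesis
 proof (rule sigma_bounded_subset)
  show "{x. g x \<noteq> 0} \<subseteq> (\<Union>k::nat. {x. 1 / real (Suc k) <= g x})"
  proof
   fix x assume "x \<in> {x. g x \<noteq> 0}"
   then have p: "g x > 0" using g0[of x] by simp
   then obtain k where "inverse (real (Suc k)) < g x" using reals_Archimedean by blast
   then show "x \<in> (\<Union>k::nat. {x. 1 / real (Suc k) <= g x})" by (auto simp: inverse_eq_divide intro!: exI[of _ k])
  qed
 qed
qed

text \<open>On each compact \<open>K n\<close> Haar measure restricts to a finite Radon measure, so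
  the order of integration can be exchanged there; monotone convergence along \<open>K n\<close>
  reaches all of \<open>D\<close>.\<close>

lemma nn_integral_haar_swap:
 fixes \<nu> :: "'b::t2_space measure"
 assumes r: "radon_finite \<nu>" and f: "f \<in> BM" and D: "sigma_bounded D" and z: "!!x y. x \<notin> D ==> f (x, y) = 0"
 shows "(\<integral>\<^sup>+x. \<integral>\<^sup>+y. f (x, y) \<partial>\<nu> \<partial>m) = (\<integral>\<^sup>+y. \<integral>\<^sup>+x. f (x, y) \<partial>m \<partial>\<nu>)"
proof -
 obtain K where K: "\<forall>n. compact (K n)" "incseq K" "D \<subseteq> (\<Union>n. K n)" by (rule sigma_bounded_incseq[OF D])
 have bK: "K n \<in> Borel" for n using K(1) compact_borel_t2 by blast
 note s = radon_finiteD(1)[OF r]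
 have rn: "radon_finite (density m (%x. ennreal (indicator (K n) x)))" for n
  by (rule radon_finite_density) (use K(1) bK compact_finite in "auto simp: ennreal_indicator sets_m")
 note sect = borel_section_measurable[OF f]
 have m1: "(%x. \<integral>\<^sup>+y. f (x, y) \<partial>\<nu>) \<in> BM" by (rule conjunct1[OF nn_integral_radon_prod[OF radon_finite_return r f]])
 have den: "(\<integral>\<^sup>+x. f (x, y) * indicator (K n) x \<partial>m) = (\<integral>\<^sup>+x. f (x, y) \<partial>density m (%x. ennreal (indicator (K n) x)))" for y n
  using sect bK by (subst nn_integral_density) (auto simp: mb ennreal_indicator mult.commute)
 have m2: "(%y. \<integral>\<^sup>+x. f (x, y) * indicator (K n) x \<partial>m) \<in> BM" for n
  using conjunct1[OF nn_integral_radon_prod[OF r rn measurable_compose[OF measurable_swap_borel f], of n]] by (simp add: den prod.swap_def)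
 have eq: "(\<integral>\<^sup>+x. (\<integral>\<^sup>+y. f (x, y) \<partial>\<nu>) * indicator (K n) x \<partial>m) = (\<integral>\<^sup>+y. \<integral>\<^sup>+x. f (x, y) * indicator (K n) x \<partial>m \<partial>\<nu>)" for n
  unfolding den nn_integral_radon_swap[OF rn r f, symmetric]
  using m1 bK by (subst nn_integral_density) (auto simp: mb ennreal_indicator mult.commute)
 have sup: "(SUP n. g x * indicator (K n) x) = (g x :: ennreal)" if "x \<notin> D ==> g x = 0" for g x
 proof (cases "x \<in> D")
  case True
  then obtain n where "x \<in> K n" using K(3) by blast
  then show ?thesis by (intro antisym SUP_least SUP_upper2[of n]) (auto simp: indicator_def)
 qed (simp add: that)
 have inc: "incseq (%n x. g x * indicator (K n) x)" for g :: "'a => ennreal"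
  using K(2) by (auto simp: incseq_def le_fun_def indicator_def subset_iff)
 have "(\<integral>\<^sup>+x. \<integral>\<^sup>+y. f (x, y) \<partial>\<nu> \<partial>m) = (\<integral>\<^sup>+x. (SUP n. (\<integral>\<^sup>+y. f (x, y) \<partial>\<nu>) * indicator (K n) x) \<partial>m)"
  using z by (intro nn_integral_cong sup[symmetric]) simp
 also have "\<dots> = (SUP n. \<integral>\<^sup>+x. (\<integral>\<^sup>+y. f (x, y) \<partial>\<nu>) * indicator (K n) x \<partial>m)"
  by (rule nn_integral_monotone_convergence_SUP[OF inc]) (use m1 bK in "auto simp: mb")
 also have "\<dots> = (SUP n. \<integral>\<^sup>+y. \<integral>\<^sup>+x. f (x, y) * indicator (K n) x \<partial>m \<partial>\<nu>)" by (simp only: eq)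
 also have "\<dots> = (\<integral>\<^sup>+y. (SUP n. \<integral>\<^sup>+x. f (x, y) * indicator (K n) x \<partial>m) \<partial>\<nu>)"
 proof (rule nn_integral_monotone_convergence_SUP[symmetric])
  show "incseq (%n y. \<integral>\<^sup>+x. f (x, y) * indicator (K n) x \<partial>m)"
   using K(2) by (auto simp: incseq_def le_fun_def indicator_def subset_iff intro!: nn_integral_mono)
 qed (use m2 in "simp add: measurable_borel_iff[OF s]")
 also have "\<dots> = (\<integral>\<^sup>+y. \<integral>\<^sup>+x. f (x, y) \<partial>m \<partial>\<nu>)"
 proof (rule nn_integral_cong)
  fix y
  have "(SUP n. \<integral>\<^sup>+x. f (x, y) * indicator (K n) x \<partial>m) = (\<integral>\<^sup>+x. (SUP n. f (x, y) * indicator (K n) x) \<partial>m)"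
   by (rule nn_integral_monotone_convergence_SUP[OF inc, symmetric]) (use sect bK in "auto simp: mb")
  also have "\<dots> = (\<integral>\<^sup>+x. f (x, y) \<partial>m)" using z by (intro nn_integral_cong sup) simp
  finally show "(SUP n. \<integral>\<^sup>+x. f (x, y) * indicator (K n) x \<partial>m) = (\<integral>\<^sup>+x. f (x, y) \<partial>m)" .
 qed
 finally show ?thesis .
qed

end

section \<open>The algebra \<open>L\<^sup>1(G, \<omega>)\<close>\<close>

locale weighted_haar = haar m for m :: "'a::{topological_group_add, t2_space} measure" +
 fixes \<omega> :: "'a => real"
 assumes w: "weight \<omega>"
begin

abbreviation "L \<equiv> carr (L1_alg m \<omega>)"
abbreviation "mulL \<equiv> vmult (L1_alg m \<omega>)"
abbreviation "NL \<equiv> vnorm (L1_alg m \<omega>)"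

lemma w_borel: "\<omega> \<in> BM" "(%x. ennreal (\<omega> x)) \<in> BM"
 using borel_measurable_continuous_onI[OF weight_continuous[OF w]] by auto

lemma w_nonneg: "0 <= \<omega> x" by (rule weight_pos(2)[OF w])

lemma L1_iff: "\<phi> \<in> L \<longleftrightarrow> \<phi> \<in> BM & (\<integral>\<^sup>+x. ennreal (\<omega> x * cmod (\<phi> x)) \<partial>m) < \<infinity>"
proof -
 have "(%x. complex_of_real (\<omega> x) * \<phi> x) \<in> BM" if "\<phi> \<in> BM"
  using that w_borel by measurable
 then show ?thesis using w_nonneg by (auto simp: L1_alg_def mb integrable_iff_bounded norm_mult)
qed

lemma L1_norm: "\<phi> \<in> L ==> ennreal (NL \<phi>) = (\<integral>\<^sup>+x. ennreal (\<omega> x * cmod (\<phi> x)) \<partial>m)"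
proof -
 assume "\<phi> \<in> L"
 then have "integrable m (%x. cmod (complex_of_real (\<omega> x) * \<phi> x))" by (simp add: L1_alg_def)
 from nn_integral_eq_integral[OF this] show ?thesis using w_nonneg by (simp add: L1_alg_def norm_mult)
qed

lemma L1_norm_nonneg: "0 <= NL \<phi>" by (simp add: L1_alg_def)

lemma L1D:
 assumes "\<phi> \<in> L"
 shows "\<phi> \<in> BM" "(\<integral>\<^sup>+x. ennreal (cmod (\<phi> x)) \<partial>m) < \<infinity>"
proof -
 show "\<phi> \<in> BM" using assms by (simp add: L1_iff)
 have "(\<integral>\<^sup>+x. ennreal (cmod (\<phi> x)) \<partial>m) <= (\<integral>\<^sup>+x. ennreal (\<omega> x * cmod (\<phi> x)) \<partial>m)"
  using mult_right_mono[OF weight_ge_1[OF w]] by (intro nn_integral_mono ennreal_leI) auto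
 also have "\<dots> < \<infinity>" using assms by (simp add: L1_iff)
 finally show "(\<integral>\<^sup>+x. ennreal (cmod (\<phi> x)) \<partial>m) < \<infinity>" .
qed

lemma L1_mono:
 assumes "\<phi> \<in> L" "\<psi> \<in> BM" "!!x. cmod (\<psi> x) <= cmod (\<phi> x)"
 shows "\<psi> \<in> L"
proof -
 have "(\<integral>\<^sup>+x. ennreal (\<omega> x * cmod (\<psi> x)) \<partial>m) <= (\<integral>\<^sup>+x. ennreal (\<omega> x * cmod (\<phi> x)) \<partial>m)"
  using assms(3) w_nonneg by (intro nn_integral_mono ennreal_leI mult_left_mono) auto
 then show ?thesis using assms by (auto simp: L1_iff intro: le_less_trans)
qed

lemma seminormed_funs_L1: "seminormed_funs L NL"
proof
 show "(%x. 0) \<in> L" by (simp add: L1_iff)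
next
 fix \<phi> \<psi> assume p: "\<phi> \<in> L" "\<psi> \<in> L"
 have b: "(%x. ennreal (\<omega> x * cmod (\<phi> x))) \<in> borel_measurable m" "(%x. ennreal (\<omega> x * cmod (\<psi> x))) \<in> borel_measurable m"
  using L1D(1)[OF p(1)] L1D(1)[OF p(2)] w_borel unfolding mb by measurable
 have "(\<integral>\<^sup>+x. ennreal (\<omega> x * cmod (\<phi> x + \<psi> x)) \<partial>m) <= (\<integral>\<^sup>+x. ennreal (\<omega> x * cmod (\<phi> x)) + ennreal (\<omega> x * cmod (\<psi> x)) \<partial>m)"
  using mult_left_mono[OF norm_triangle_ineq w_nonneg] w_nonneg
  by (intro nn_integral_mono) (simp add: ennreal_plus[symmetric] distrib_left[symmetric] ennreal_leI del: ennreal_plus)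
 also have "\<dots> = ennreal (NL \<phi>) + ennreal (NL \<psi>)" using p b by (simp add: nn_integral_add L1_norm)
 finally have le: "(\<integral>\<^sup>+x. ennreal (\<omega> x * cmod (\<phi> x + \<psi> x)) \<partial>m) <= ennreal (NL \<phi> + NL \<psi>)" using L1_norm_nonneg by simp
 have "(%x. \<phi> x + \<psi> x) \<in> BM" using L1D(1)[OF p(1)] L1D(1)[OF p(2)] by measurable
 then show i: "(%x. \<phi> x + \<psi> x) \<in> L" using le by (auto simp: L1_iff intro: le_less_trans)
 show "NL (%x. \<phi> x + \<psi> x) <= NL \<phi> + NL \<psi>" using le L1_norm_nonneg unfolding L1_norm[OF i, symmetric] by (subst (asm) ennreal_le_iff) auto
next
 fix \<phi> c assume p: "\<phi> \<in> L"
 have "(\<integral>\<^sup>+x. ennreal (\<omega> x * cmod (c * \<phi> x)) \<partial>m) = (\<integral>\<^sup>+x. ennreal (cmod c) * ennreal (\<omega> x * cmod (\<phi> x)) \<partial>m)"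
  using w_nonneg by (simp add: ennreal_mult[symmetric] norm_mult mult.left_commute)
 also have "\<dots> = ennreal (cmod c) * ennreal (NL \<phi>)" unfolding L1_norm[OF p]
  by (rule nn_integral_cmult) (use L1D(1)[OF p] w_borel in "simp add: mb")
 finally have eq: "(\<integral>\<^sup>+x. ennreal (\<omega> x * cmod (c * \<phi> x)) \<partial>m) = ennreal (cmod c * NL \<phi>)" using L1_norm_nonneg by (simp add: ennreal_mult)
 then show i: "(%x. c * \<phi> x) \<in> L" using L1D(1)[OF p] by (simp add: L1_iff)
 show "NL (%x. c * \<phi> x) = cmod c * NL \<phi>" using eq L1_norm_nonneg unfolding L1_norm[OF i, symmetric] by simp
qed (rule L1_norm_nonneg)

lemma diff_pair_borel: "(%p. - snd p + fst p) \<in> borel_measurable (borel :: ('a \<times> 'a) measure)"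
 by (intro borel_measurable_continuous_onI continuous_intros)

text \<open>Factoring \<open>\<phi>\<close> into \<open>sgn\<close> and modulus turns the
  convolution into an integral against the finite Radon measure with density
  \<open>cmod (\<phi> x)\<close>, where \<open>measurable_radon_integral\<close> applies.\<close>

lemma convolution_borel:
 assumes p: "\<phi> \<in> L" and q: "\<psi> \<in> BM"
 shows "mulL \<phi> \<psi> \<in> BM"
proof -
 have pb: "\<phi> \<in> BM" by (rule L1D(1)[OF p])
 have r: "radon_finite (density m (%x. ennreal (cmod (\<phi> x))))"
  by (rule radon_finite_density) (use pb L1D(2)[OF p] in auto)
 have "(%p. sgn (\<phi> (snd p)) * \<psi> (- snd p + fst p)) \<in> BM"
  by (intro borel_measurable_times measurable_compose[OF diff_pair_borel q] measurable_compose[OF measurable_proj_borel(2)] borel_measurable_sgn)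
   (use pb in measurable)
 note m = measurable_radon_integral[OF r this]
 have "mulL \<phi> \<psi> x = (\<integral>y. sgn (\<phi> y) * \<psi> (- y + x) \<partial>density m (%x. ennreal (cmod (\<phi> x))))" for x
 proof -
  have "(%y. sgn (\<phi> y) * \<psi> (- y + x)) \<in> borel_measurable m"
   using borel_section_measurable(1)[OF \<open>(%p. sgn (\<phi> (snd p)) * \<psi> (- snd p + fst p)) \<in> BM\<close>, of x] by (simp add: mb)
  then have "(\<integral>y. sgn (\<phi> y) * \<psi> (- y + x) \<partial>density m (%x. ennreal (cmod (\<phi> x)))) = (\<integral>y. cmod (\<phi> y) *\<^sub>R (sgn (\<phi> y) * \<psi> (- y + x)) \<partial>m)"
   by (rule integral_density) (use pb in "auto simp: mb")
  also have "\<dots> = mulL \<phi> \<psi> x"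
   unfolding L1_alg_def falgebra.simps
   by (rule Bochner_Integration.integral_cong) (auto simp: sgn_div_norm scaleR_conv_of_real)
  finally show ?thesis ..
 qed
 then have "mulL \<phi> \<psi> = (%x. \<integral>y. sgn (\<phi> y) * \<psi> (- y + x) \<partial>density m (%x. ennreal (cmod (\<phi> x))))" by (rule ext)
 then show ?thesis using m by simp
qed

definition abs_convolution :: "('a => complex) => ('a => complex) => 'a => ennreal" where
 "abs_convolution \<phi> \<psi> x = (\<integral>\<^sup>+y. ennreal (cmod (\<phi> y * \<psi> (- y + x))) \<partial>m)"

text \<open>Exchange the integrals and translate the inner one. The free factor \<open>f\<close> is
  later the weight restricted to a set, so that one bound covers norm and support of
  products.\<close>

lemma nn_integral_abs_convolution:
 assumes p: "\<phi> \<in> L" and q: "\<psi> \<in> L"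
 shows "abs_convolution \<phi> \<psi> \<in> BM"
  and "f \<in> BM ==> 0 <= c ==>
   (!!x y. \<phi> y \<noteq> 0 ==> \<psi> x \<noteq> 0 ==> f (y + x) <= ennreal (c * (\<omega> y * \<omega> x))) ==>
   (\<integral>\<^sup>+x. f x * abs_convolution \<phi> \<psi> x \<partial>m) <= ennreal (c * (NL \<phi> * NL \<psi>))"
  and "(\<integral>\<^sup>+x. abs_convolution \<phi> \<psi> x \<partial>m) = (\<integral>\<^sup>+x. ennreal (cmod (\<phi> x)) \<partial>m) * (\<integral>\<^sup>+x. ennreal (cmod (\<psi> x)) \<partial>m)"
proof -
 let ?S = "{y. \<phi> y \<noteq> 0}" and ?T = "{x. \<psi> x \<noteq> 0}"
 define \<nu> where "\<nu> = density m (%x. ennreal (cmod (\<phi> x)))"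
 have pb: "\<phi> \<in> BM" and qb: "\<psi> \<in> BM" by (rule L1D(1)[OF p] L1D(1)[OF q])+
 have r: "radon_finite \<nu>" unfolding \<nu>_def by (rule radon_finite_density) (use pb L1D(2)[OF p] in auto)
 have S: "?S \<in> Borel" using pb by measurable
 have D: "sigma_bounded ((%(x, y). x + y) ` (?S \<times> ?T))"
  using sigma_bounded_support[of "%x. cmod (\<phi> x)"] sigma_bounded_support[of "%x. cmod (\<psi> x)"] pb qb L1D(2)[OF p] L1D(2)[OF q]
  by (intro sigma_bounded_plus) auto
 \<comment> \<open>The factor \<open>indicator ?S\<close> is invisible to \<open>\<nu>\<close>,
   whose density vanishes off \<open>?S\<close>; it confines the first variable to sums of support
   points, a \<sigma>-bounded set.\<close>
 define g where "g f = (%p. f (fst p) * (ennreal (cmod (\<psi> (- snd p + fst p))) * indicator ?S (snd p)))" for f :: "'a => ennreal"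
 have gb: "g f \<in> BM" if "f \<in> BM" for f
 proof -
  have "(%x. ennreal (cmod (\<psi> x))) \<in> BM" using qb by measurable
  then show ?thesis unfolding g_def
   by (intro borel_measurable_times_ennreal measurable_compose[OF measurable_proj_borel(1) that] measurable_compose[OF diff_pair_borel]
     measurable_compose[OF measurable_proj_borel(2) borel_measurable_indicator[OF S]])
 qed
 have inner: "f x * abs_convolution \<phi> \<psi> x = (\<integral>\<^sup>+y. g f (x, y) \<partial>\<nu>)" if f: "f \<in> BM" for f x
 proof -
  have m: "(%y. g f (x, y)) \<in> borel_measurable m" "(%y. g (%_. 1) (x, y)) \<in> borel_measurable m"
   using borel_section_measurable(1)[OF gb[OF f], of x] borel_section_measurable(1)[OF gb[of "%_. 1"], of x] by (simp_all add: mb)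
  have pm: "(%y. ennreal (cmod (\<phi> y))) \<in> borel_measurable m" using pb by (simp add: mb)
  have "(\<integral>\<^sup>+y. g f (x, y) \<partial>\<nu>) = (\<integral>\<^sup>+y. f x * (ennreal (cmod (\<phi> y)) * g (%_. 1) (x, y)) \<partial>m)"
   unfolding \<nu>_def nn_integral_density[OF pm m(1)] by (simp add: g_def ac_simps)
  also have "\<dots> = f x * (\<integral>\<^sup>+y. ennreal (cmod (\<phi> y)) * g (%_. 1) (x, y) \<partial>m)"
   by (rule nn_integral_cmult) (use pm m in simp)
  also have "(\<integral>\<^sup>+y. ennreal (cmod (\<phi> y)) * g (%_. 1) (x, y) \<partial>m) = abs_convolution \<phi> \<psi> x"
   unfolding abs_convolution_def by (rule nn_integral_cong) (simp add: g_def indicator_def norm_mult ennreal_mult)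
  finally show ?thesis ..
 qed
 have "abs_convolution \<phi> \<psi> = (%x. \<integral>\<^sup>+y. g (%_. 1) (x, y) \<partial>\<nu>)" using inner[of "%_. 1"] by auto
 then show "abs_convolution \<phi> \<psi> \<in> BM" using conjunct1[OF nn_integral_radon_prod[OF r r gb[of "%_. 1"]]] by simp
 have swap: "(\<integral>\<^sup>+x. f x * abs_convolution \<phi> \<psi> x \<partial>m) = (\<integral>\<^sup>+y. \<integral>\<^sup>+x. g f (y + x, y) \<partial>m \<partial>\<nu>)" if f: "f \<in> BM" for f
  unfolding inner[OF f] nn_integral_translate[OF borel_section_measurable(2)[OF gb[OF f]]]
 proof (rule nn_integral_haar_swap[OF r gb[OF f] D])
  fix x y assume "x \<notin> (%(x, y). x + y) ` (?S \<times> ?T)"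
  moreover have "x \<in> (%(x, y). x + y) ` (?S \<times> ?T)" if "y \<in> ?S" "- y + x \<in> ?T"
   by (rule image_eqI[of _ _ "(y, - y + x)"]) (use that in "auto simp: add.assoc[symmetric]")
  ultimately show "g f (x, y) = 0" by (fastforce simp: g_def indicator_def)
 qed
 have pm: "(%y. ennreal (cmod (\<phi> y))) \<in> borel_measurable m" and qm: "(%y. ennreal (cmod (\<psi> y))) \<in> borel_measurable m"
  using pb qb by (simp_all add: mb)
 have "(\<integral>\<^sup>+x. abs_convolution \<phi> \<psi> x \<partial>m) = (\<integral>\<^sup>+y. indicator ?S y * (\<integral>\<^sup>+x. ennreal (cmod (\<psi> x)) \<partial>m) \<partial>\<nu>)"
  using swap[of "%_. 1"] qm by (simp add: g_def nn_integral_multc mult.commute)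
 also have "\<dots> = (\<integral>\<^sup>+y. ennreal (cmod (\<phi> y)) * (\<integral>\<^sup>+x. ennreal (cmod (\<psi> x)) \<partial>m) \<partial>m)"
  unfolding \<nu>_def using pm S by (subst nn_integral_density) (auto simp: mb intro!: nn_integral_cong split: split_indicator)
 also have "\<dots> = (\<integral>\<^sup>+x. ennreal (cmod (\<phi> x)) \<partial>m) * (\<integral>\<^sup>+x. ennreal (cmod (\<psi> x)) \<partial>m)" by (rule nn_integral_multc[OF pm])
 finally show "(\<integral>\<^sup>+x. abs_convolution \<phi> \<psi> x \<partial>m) = (\<integral>\<^sup>+x. ennreal (cmod (\<phi> x)) \<partial>m) * (\<integral>\<^sup>+x. ennreal (cmod (\<psi> x)) \<partial>m)" .
 show "(\<integral>\<^sup>+x. f x * abs_convolution \<phi> \<psi> x \<partial>m) <= ennreal (c * (NL \<phi> * NL \<psi>))"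
  if f: "f \<in> BM" and c: "0 <= c"
   and le: "!!x y. \<phi> y \<noteq> 0 ==> \<psi> x \<noteq> 0 ==> f (y + x) <= ennreal (c * (\<omega> y * \<omega> x))"
 proof -
  have "(\<integral>\<^sup>+x. f x * abs_convolution \<phi> \<psi> x \<partial>m) <= (\<integral>\<^sup>+y. ennreal (c * \<omega> y) * ennreal (NL \<psi>) \<partial>\<nu>)"
   unfolding swap[OF f]
  proof (rule nn_integral_mono)
   fix y
   have "(\<integral>\<^sup>+x. g f (y + x, y) \<partial>m) <= (\<integral>\<^sup>+x. ennreal (c * \<omega> y) * ennreal (\<omega> x * cmod (\<psi> x)) \<partial>m)"
   proof (rule nn_integral_mono)
    fix x
    show "g f (y + x, y) <= ennreal (c * \<omega> y) * ennreal (\<omega> x * cmod (\<psi> x))"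
    proof (cases "\<phi> y \<noteq> 0 & \<psi> x \<noteq> 0")
     case True
     then have "f (y + x) * ennreal (cmod (\<psi> x)) <= ennreal (c * (\<omega> y * \<omega> x)) * ennreal (cmod (\<psi> x))"
      by (intro mult_right_mono le) auto
     then show ?thesis using True c w_nonneg by (simp add: g_def ennreal_mult[symmetric] mult.assoc)
    qed (auto simp: g_def)
   qed
   also have "\<dots> = ennreal (c * \<omega> y) * ennreal (NL \<psi>)" unfolding L1_norm[OF q]
    by (rule nn_integral_cmult) (use qb w_borel in "simp add: mb")
   finally show "(\<integral>\<^sup>+x. g f (y + x, y) \<partial>m) <= ennreal (c * \<omega> y) * ennreal (NL \<psi>)" .
  qed
  also have "\<dots> = (\<integral>\<^sup>+y. ennreal (c * NL \<psi>) * ennreal (\<omega> y * cmod (\<phi> y)) \<partial>m)"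
   unfolding \<nu>_def using pb w_borel c w_nonneg L1_norm_nonneg
   by (subst nn_integral_density) (auto simp: mb ennreal_mult[symmetric] ac_simps intro!: nn_integral_cong)
  also have "\<dots> = ennreal (c * NL \<psi>) * ennreal (NL \<phi>)" unfolding L1_norm[OF p]
   by (rule nn_integral_cmult) (use pb w_borel in "simp add: mb")
  finally show ?thesis using c L1_norm_nonneg by (simp add: ennreal_mult[symmetric] ac_simps)
 qed
qed

text \<open>Where the convolution integral does not exist, \<open>mulL\<close> has the default value
  0 and the inequality is trivial.\<close>

lemma cmod_convolution_le: "ennreal (cmod (mulL \<phi> \<psi> x)) <= abs_convolution \<phi> \<psi> x"
proof (cases "integrable m (%y. \<phi> y * \<psi> (- y + x))")
 case True
 then show ?thesis using integral_norm_bound_ennreal[OF True] by (simp add: L1_alg_def abs_convolution_def)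
qed (simp add: L1_alg_def not_integrable_integral_eq)

lemma convolution_restr_norm:
 assumes p: "\<phi> \<in> L" and q: "\<psi> \<in> L" and K: "K \<in> Borel" and c: "0 <= c"
  and le: "!!x y. \<phi> y \<noteq> 0 ==> \<psi> x \<noteq> 0 ==> y + x \<in> K ==> \<omega> (y + x) <= c * (\<omega> y * \<omega> x)"
 shows "(%x. indicator K x * mulL \<phi> \<psi> x) \<in> L"
  and "NL (%x. indicator K x * mulL \<phi> \<psi> x) <= c * (NL \<phi> * NL \<psi>)"
proof -
 have "(\<integral>\<^sup>+x. ennreal (\<omega> x * cmod (indicator K x * mulL \<phi> \<psi> x)) \<partial>m) \<le>
   (\<integral>\<^sup>+x. ennreal (\<omega> x) * indicator K x * abs_convolution \<phi> \<psi> x \<partial>m)"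
 proof (rule nn_integral_mono)
  fix x
  have "ennreal (\<omega> x * cmod (indicator K x * mulL \<phi> \<psi> x)) = ennreal (\<omega> x) * indicator K x * ennreal (cmod (mulL \<phi> \<psi> x))"
   using w_nonneg by (simp add: indicator_def ennreal_mult norm_mult)
  also have "\<dots> <= ennreal (\<omega> x) * indicator K x * abs_convolution \<phi> \<psi> x" by (intro mult_left_mono cmod_convolution_le) simp
  finally show "ennreal (\<omega> x * cmod (indicator K x * mulL \<phi> \<psi> x)) <= \<dots>" .
 qed
 also have "\<dots> <= ennreal (c * (NL \<phi> * NL \<psi>))"
  by (rule nn_integral_abs_convolution(2)[OF p q _ c])
   (use w_borel K le c w_nonneg in "auto simp: indicator_def ennreal_leI")
 finally have b: "(\<integral>\<^sup>+x. ennreal (\<omega> x * cmod (indicator K x * mulL \<phi> \<psi> x)) \<partial>m) <= ennreal (c * (NL \<phi> * NL \<psi>))" .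
 have "(%x. indicator K x * mulL \<phi> \<psi> x) \<in> BM"
  using convolution_borel[OF p L1D(1)[OF q]] K by measurable
 then show i: "(%x. indicator K x * mulL \<phi> \<psi> x) \<in> L" using b by (auto simp: L1_iff intro: le_less_trans)
 show "NL (%x. indicator K x * mulL \<phi> \<psi> x) <= c * (NL \<phi> * NL \<psi>)"
  using b c L1_norm_nonneg unfolding L1_norm[OF i, symmetric] by (subst (asm) ennreal_le_iff) auto
qed

lemma convolution_in: "\<phi> \<in> L ==> \<psi> \<in> L ==> mulL \<phi> \<psi> \<in> L"
 and convolution_norm: "\<phi> \<in> L ==> \<psi> \<in> L ==> NL (mulL \<phi> \<psi>) <= NL \<phi> * NL \<psi>"
 using convolution_restr_norm[of \<phi> \<psi> UNIV 1] weight_mult[OF w] by simp_all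

text \<open>Since \<open>\<omega>\<close> is at least 1, the choice \<open>f = 1\<close> and
  \<open>c = 1\<close> is admissible in the preceding bound; a finite integral makes
  \<open>abs_convolution\<close> finite almost everywhere.\<close>

lemma AE_convolution_integrable:
 assumes p: "\<phi> \<in> L" and q: "\<psi> \<in> L" shows "AE x in m. integrable m (%y. \<phi> y * \<psi> (- y + x))"
proof -
 have g: "1 <= \<omega> x * \<omega> y" for x y using mult_mono[OF weight_ge_1[OF w] weight_ge_1[OF w], of x y] w_nonneg by simp
 have "(\<integral>\<^sup>+x. 1 * abs_convolution \<phi> \<psi> x \<partial>m) <= ennreal (1 * (NL \<phi> * NL \<psi>))"
  by (rule nn_integral_abs_convolution(2)[OF p q, of "%_. 1"]) (use g in auto)
 then have "(\<integral>\<^sup>+x. abs_convolution \<phi> \<psi> x \<partial>m) \<noteq> \<infinity>" by (auto simp: top_unique)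
 then have "AE x in m. abs_convolution \<phi> \<psi> x \<noteq> \<infinity>"
  by (intro nn_integral_PInf_AE) (simp add: mb nn_integral_abs_convolution(1)[OF p q])
 then show ?thesis
 proof (rule AE_mp, intro AE_I2 impI)
  fix x assume x: "abs_convolution \<phi> \<psi> x \<noteq> \<infinity>"
  have "(%y. \<phi> y * \<psi> (- y + x)) \<in> BM"
   using borel_section_measurable(1)[OF measurable_compose[OF diff_pair_borel L1D(1)[OF q]], of x] L1D(1)[OF p] by (simp add: borel_measurable_times)
  then show "integrable m (%y. \<phi> y * \<psi> (- y + x))"
   using x by (simp add: integrable_iff_bounded mb abs_convolution_def less_top)
 qed
qed

lemma L1_eq_AE:
 assumes F: "F \<in> adual (L1_alg m \<omega>)" and p: "\<phi> \<in> L" "\<psi> \<in> L" and e: "AE x in m. \<phi> x = \<psi> x" shows "F \<phi> = F \<psi>"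
proof -
 interpret seminormed_funs L NL by (rule seminormed_funs_L1)
 have "(\<integral>\<^sup>+x. ennreal (\<omega> x * cmod (\<phi> x - \<psi> x)) \<partial>m) = (\<integral>\<^sup>+x. 0 \<partial>m)" by (rule nn_integral_cong_AE) (use e in auto)
 then have "NL (%x. \<phi> x - \<psi> x) = 0" using L1_norm[OF diff_in[OF p]] L1_norm_nonneg[of "%x. \<phi> x - \<psi> x"] by simp
 then show ?thesis by (rule functional_eq_of_norm_diff[OF F[unfolded adual_def] p])
qed

definition L1_restr :: "'a set => ('a => complex) => 'a => complex" where
 "L1_restr E \<phi> = (%x. indicator E x * \<phi> x)"

lemma L1_restr_in: "E \<in> Borel ==> \<phi> \<in> L ==> L1_restr E \<phi> \<in> L"
 unfolding L1_restr_def
 by (rule L1_mono, assumption, rule borel_measurable_times, simp, rule L1D(1)) (auto simp: indicator_def)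

lemma L1_restr_norm_eq:
 assumes E: "E \<in> Borel" and p: "\<phi> \<in> L"
 shows "ennreal (NL (L1_restr E \<phi>)) = (\<integral>\<^sup>+x. ennreal (\<omega> x * cmod (\<phi> x)) * indicator E x \<partial>m)"
 unfolding L1_norm[OF L1_restr_in[OF assms]] by (rule nn_integral_cong) (simp add: L1_restr_def indicator_def)

lemma L1_tight:
 assumes p: "\<phi> \<in> L" and e: "\<eta> > 0" shows "\<exists>C. compact C & NL (L1_restr (- C) \<phi>) < \<eta>"
proof -
 let ?\<nu> = "density m (%x. ennreal (\<omega> x * cmod (\<phi> x)))"
 have pb: "(%x. \<omega> x * cmod (\<phi> x)) \<in> BM" using L1D(1)[OF p] w_borel(1) by measurable
 have r: "radon_finite ?\<nu>" by (rule radon_finite_density[OF pb]) (use p w_nonneg in "auto simp: L1_iff")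
 interpret finite_measure ?\<nu> by (rule radon_finiteD(2)[OF r])
 obtain C where C: "compact C" "measure ?\<nu> (UNIV - C) < \<eta>" by (rule radon_finiteE[OF r _ e, of UNIV]) auto
 have b: "- C \<in> Borel" using compact_borel_t2[OF C(1)] by (rule borel_comp)
 have "ennreal (NL (L1_restr (- C) \<phi>)) = emeasure ?\<nu> (- C)"
  unfolding L1_restr_norm_eq[OF b p] using pb b by (subst emeasure_density) (auto simp: mb sets_m)
 also have "\<dots> < ennreal \<eta>" unfolding emeasure_eq_measure Compl_eq_Diff_UNIV using C(2) e by (intro ennreal_lessI)
 finally show ?thesis using C(1) L1_norm_nonneg by (auto simp: ennreal_less_iff)
qed

theorem convolution_algebra_L1: "convolution_algebra (L1_alg m \<omega>) L1_restr \<omega>"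
proof -
 interpret seminormed_funs L NL by (rule seminormed_funs_L1)
 let ?c = "mulL"
 have c: "?c \<phi> \<psi> x = (\<integral>y. \<phi> y * \<psi> (- y + x) \<partial>m)" for \<phi> \<psi> x by (simp add: L1_alg_def)
 show ?thesis
 proof
  fix \<phi> \<psi> assume p: "\<phi> \<in> L" and q: "\<psi> \<in> L"
  show "?c \<phi> \<psi> \<in> L" "NL (?c \<phi> \<psi>) <= NL \<phi> * NL \<psi>" by (rule convolution_in[OF p q] convolution_norm[OF p q])+
  fix F assume F: "F \<in> adual (L1_alg m \<omega>)"
  note add = top_dual_add[OF F[unfolded adual_def]] and scale = top_dual_scale[OF F[unfolded adual_def] convolution_in[OF p q]]
  show "F (?c (%x. \<phi> x + \<phi>' x) \<psi>) = F (?c \<phi> \<psi>) + F (?c \<phi>' \<psi>)" if p': "\<phi>' \<in> L" for \<phi>'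
   unfolding add[OF convolution_in[OF p q] convolution_in[OF p' q], symmetric]
  proof (rule L1_eq_AE[OF F convolution_in[OF add_in[OF p p'] q] add_in[OF convolution_in[OF p q] convolution_in[OF p' q]]])
   \<comment> \<open>Additivity holds wherever both convolution integrals on the right exist, that
     is almost everywhere.\<close>
   show "AE x in m. ?c (%x. \<phi> x + \<phi>' x) \<psi> x = ?c \<phi> \<psi> x + ?c \<phi>' \<psi> x"
    using AE_convolution_integrable[OF p q] AE_convolution_integrable[OF p' q] by eventually_elim (simp add: c distrib_right)
  qed
  show "F (?c \<phi> (%x. \<psi> x + \<psi>' x)) = F (?c \<phi> \<psi>) + F (?c \<phi> \<psi>')" if q': "\<psi>' \<in> L" for \<psi>'
   unfolding add[OF convolution_in[OF p q] convolution_in[OF p q'], symmetric]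
  proof (rule L1_eq_AE[OF F convolution_in[OF p add_in[OF q q']] add_in[OF convolution_in[OF p q] convolution_in[OF p q']]])
   show "AE x in m. ?c \<phi> (%x. \<psi> x + \<psi>' x) x = ?c \<phi> \<psi> x + ?c \<phi> \<psi>' x"
    using AE_convolution_integrable[OF p q] AE_convolution_integrable[OF p q'] by eventually_elim (simp add: c distrib_left)
  qed
  have "?c (%x. k * \<phi> x) \<psi> = (%x. k * ?c \<phi> \<psi> x)" "?c \<phi> (%x. k * \<psi> x) = (%x. k * ?c \<phi> \<psi> x)" for k
   by (simp_all add: c[abs_def] fun_eq_iff mult.assoc mult.left_commute[of _ k])
  then show "F (?c (%x. k * \<phi> x) \<psi>) = k * F (?c \<phi> \<psi>)" "F (?c \<phi> (%x. k * \<psi> x)) = k * F (?c \<phi> \<psi>)" for k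
   using scale by simp_all
 next
  fix E E' :: "'a set" and \<phi> assume E: "E \<in> Borel" and p: "\<phi> \<in> L"
  show "L1_restr E \<phi> \<in> L" by (rule L1_restr_in[OF E p])
  show "L1_restr E (%x. \<phi> x + \<psi> x) = (%x. L1_restr E \<phi> x + L1_restr E \<psi> x)" for \<psi> by (simp add: L1_restr_def distrib_left)
  show "L1_restr E (%x. c * \<phi> x) = (%x. c * L1_restr E \<phi> x)" for c by (simp add: L1_restr_def mult.left_commute)
  show "L1_restr E (L1_restr E' \<phi>) = L1_restr (E \<inter> E') \<phi>" by (auto simp: L1_restr_def indicator_def)
  show "L1_restr (E \<union> E') \<phi> = (%x. L1_restr E \<phi> x + L1_restr E' \<phi> x)" if "E \<inter> E' = {}" using that by (auto simp: L1_restr_def indicator_def fun_eq_iff)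
  note cE = borel_comp[OF E]
  have "ennreal (NL (L1_restr E \<phi>) + NL (L1_restr (- E) \<phi>)) = ennreal (NL (L1_restr E \<phi>)) + ennreal (NL (L1_restr (- E) \<phi>))"
   by (rule ennreal_plus) (rule L1_norm_nonneg)+
  also have "\<dots> = (\<integral>\<^sup>+x. ennreal (\<omega> x * cmod (\<phi> x)) * indicator E x + ennreal (\<omega> x * cmod (\<phi> x)) * indicator (- E) x \<partial>m)"
   unfolding L1_restr_norm_eq[OF E p] L1_restr_norm_eq[OF cE p]
   by (rule nn_integral_add[symmetric]) (use w_borel L1D(1)[OF p] E cE in "auto simp: mb")
  also have "\<dots> = ennreal (NL \<phi>)" unfolding L1_norm[OF p] by (rule nn_integral_cong) (auto simp: indicator_def)
  finally show "NL (L1_restr E \<phi>) + NL (L1_restr (- E) \<phi>) <= NL \<phi>"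
   using L1_norm_nonneg by (subst (asm) ennreal_inj) auto
 next
  show "L1_restr UNIV \<phi> = \<phi>" for \<phi> by (simp add: L1_restr_def)
  show "weight \<omega>" by (rule w)
  show "NL (L1_restr K (?c (L1_restr E \<phi>) (L1_restr E' \<psi>))) <= c * (NL (L1_restr E \<phi>) * NL (L1_restr E' \<psi>))"
   if "\<phi> \<in> L" "\<psi> \<in> L" "E \<in> Borel" "E' \<in> Borel" "K \<in> Borel" "0 <= c"
    "!!x y. x \<in> E ==> y \<in> E' ==> x + y \<in> K ==> \<omega> (x + y) <= c * (\<omega> x * \<omega> y)" for \<phi> \<psi> E E' K c
   unfolding L1_restr_def[of K]
   by (rule convolution_restr_norm(2)[OF L1_restr_in[OF that(3,1)] L1_restr_in[OF that(4,2)] that(5,6)])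
    (use that(7) in "auto simp: L1_restr_def indicator_def split: if_splits")
  show "\<exists>C. compact C & NL (L1_restr (- C) \<phi>) < \<eta>" if "\<phi> \<in> L" "\<eta> > 0" for \<phi> \<eta> by (rule L1_tight[OF that])
 qed
qed

end

section \<open>The dual of L1 and the functionals vanishing at infinity\<close>

lemma AE_le_1_if_set_integral_le:
 assumes fin: "finite_measure \<nu>" and sets: "sets \<nu> = Borel" and h: "h \<in> BM" "integrable \<nu> h"
  and le: "!!E. E \<in> Borel ==> ennreal (cmod (LINT x:E|\<nu>. h x)) <= emeasure \<nu> E"
 shows "AE x in \<nu>. cmod (h x) <= 1"
proof -
 interpret finite_measure \<nu> by (rule fin)
 \<comment> \<open>The hypothesis makes \<open>\<nu>\<close> dominate the variation of
   \<open>cm_density \<nu> h\<close>, whose density is \<open>cmod (h x)\<close>; comparing both on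
   \<open>?E\<close> shows that \<open>?E\<close> is null.\<close>
 let ?E = "{x. 1 < cmod (h x)}"
 have E: "?E \<in> Borel" using h(1) by measurable
 have "emeasure (density \<nu> (%x. ennreal (cmod (h x)))) ?E <= emeasure \<nu> ?E"
  unfolding variation_cm_density[OF h(2) sets, symmetric]
   emeasure_variation[OF complex_borel_measure_cm_density[OF h(2) sets] E]
  by (rule variation_fun_le[OF sets _ E]) (use le in "simp add: cm_density_def")
 then have "ennreal (LINT x:?E|\<nu>. cmod (h x)) <= ennreal (measure \<nu> ?E)"
  using ennreal_set_integral_cmod[OF h(2), of ?E] E by (simp add: sets emeasure_eq_measure)
 then have l: "(LINT x:?E|\<nu>. cmod (h x)) <= measure \<nu> ?E" by simp
 have i: "integrable \<nu> (%x. indicator ?E x * (cmod (h x) - 1))" (is "integrable \<nu> ?f")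
  using integrable_mult_indicator[of ?E \<nu> "%x. cmod (h x) - 1"] E h(2) by (simp add: sets)
 have "(\<integral>x. ?f x \<partial>\<nu>) = (LINT x:?E|\<nu>. cmod (h x)) - measure \<nu> ?E"
  using set_integral_diff(2)[of \<nu> ?E "%x. cmod (h x)" "%_. 1"] h(2) E
  by (simp add: set_lebesgue_integral_def set_integrable_if_integrable sets integrable_mult_indicator)
 then have "(\<integral>x. ?f x \<partial>\<nu>) <= 0" using l by simp
 moreover have nn: "0 <= ?f x" for x by (simp add: indicator_def)
 ultimately have "(\<integral>x. ?f x \<partial>\<nu>) = 0" by (intro antisym integral_nonneg_AE) auto
 then have "AE x in \<nu>. ?f x = 0" using integral_nonneg_eq_0_iff_AE[OF i] nn by simp
 then show ?thesis by eventually_elim (auto simp: indicator_def split: if_splits)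
qed

text \<open>The dual of L1 for a finite measure: \<open>T\<close> on indicators is a complex measure
  dominated by \<open>\<nu>\<close>, its density represents \<open>T\<close> on simple functions,
  and dominated convergence extends this.\<close>

lemma functional_has_density:
 fixes T :: "('a::topological_space => complex) => complex"
 assumes fin: "finite_measure \<nu>" and sets: "sets \<nu> = Borel"
  and add: "!!u v. integrable \<nu> u ==> integrable \<nu> v ==> T (%x. u x + v x) = T u + T v"
  and scale: "!!c u. integrable \<nu> u ==> T (%x. c * u x) = c * T u"
  and bound: "!!u. integrable \<nu> u ==> cmod (T u) <= (\<integral>x. cmod (u x) \<partial>\<nu>)"
 shows "\<exists>h. h \<in> BM & (\<forall>x. cmod (h x) <= 1) & (\<forall>u. integrable \<nu> u --> T u = (\<integral>x. h x * u x \<partial>\<nu>))"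
proof -
 interpret finite_measure \<nu> by (rule fin)
 note mb = measurable_borel_iff[OF sets] and sp = sets_eq_imp_space_eq[OF sets]
 have ii: "integrable \<nu> (indicator E :: 'a => complex)" if "E \<in> Borel" for E
 proof -
  have "(%x. indicat_real E x *\<^sub>R (1 :: complex)) = indicator E" by (auto simp: indicator_def)
  then show ?thesis using integrable_mult_indicator[of E \<nu> "%_. 1 :: complex"] that by (simp add: sets)
 qed
 define \<mu> where "\<mu> E = (if E \<in> Borel then T (indicator E) else 0)" for E
 have dom: "cmod (\<mu> E) <= measure \<nu> E" if E: "E \<in> Borel" for E
 proof -
  have "(%x. cmod (indicator E x)) = (indicator E :: 'a => real)" by (auto simp: indicator_def)
  then show ?thesis using bound[OF ii[OF E]] E by (simp add: \<mu>_def sets)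
 qed
 have c: "complex_borel_measure \<mu>"
 proof (rule dominated_additive_complex_measure[OF fin sets _ dom])
  fix A B :: "'a set" assume AB: "A \<in> Borel" "B \<in> Borel" "A \<inter> B = {}"
  have "(indicator (A \<union> B) :: 'a => complex) = (%x. indicator A x + indicator B x)" using AB(3) by (auto simp: indicator_def fun_eq_iff)
  then show "\<mu> (A \<union> B) = \<mu> A + \<mu> B" using AB add[OF ii[OF AB(1)] ii[OF AB(2)]] by (simp add: \<mu>_def)
 qed (simp_all add: \<mu>_def)
 obtain h where h: "h \<in> BM" "integrable \<nu> h" "\<mu> = cm_density \<nu> h"
  by (rule complex_measure_has_density[OF c fin sets dom])
 have le1: "AE x in \<nu>. cmod (h x) <= 1"
  by (rule AE_le_1_if_set_integral_le[OF fin sets h(1,2)]) (use dom h(3) in "simp add: cm_density_def emeasure_eq_measure")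
 \<comment> \<open>Truncation changes \<open>h\<close> on a null set only and makes the bound hold
   everywhere.\<close>
 define k where "k x = (if cmod (h x) <= 1 then h x else 0)" for x
 have "{x. cmod (h x) <= 1} \<in> Borel" using h(1) by measurable
 then have k: "k \<in> BM" "cmod (k x) <= 1" for x
  using h(1) measurable_If_set[of h borel borel "%_. 0" "{x. cmod (h x) <= 1}"] by (simp_all add: k_def[abs_def])
 have ku: "integrable \<nu> (%x. k x * u x)" if u: "integrable \<nu> u" for u
 proof (rule Bochner_Integration.integrable_bound[OF u])
  show "(%x. k x * u x) \<in> borel_measurable \<nu>" using k(1) u by (auto simp: mb[symmetric])
  show "AE x in \<nu>. norm (k x * u x) <= norm (u x)" using mult_right_mono[OF k(2)] by (auto simp: norm_mult)
 qed
 have "T u = (\<integral>x. k x * u x \<partial>\<nu>)" if "integrable \<nu> u" for u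
  using that
 proof (induction rule: integrable_induct)
  case (base A a)
  then have A: "A \<in> Borel" by (simp add: sets)
  have e: "indicat_real A x *\<^sub>R a = a * indicator A x" for x by (simp add: indicator_def)
  have "T (%x. indicat_real A x *\<^sub>R a) = a * (LINT x:A|\<nu>. h x)"
   unfolding e using scale[OF ii[OF A], of a] A fun_cong[OF h(3), of A] by (simp add: \<mu>_def cm_density_def)
  also have "(LINT x:A|\<nu>. h x) = (\<integral>x. k x * indicator A x \<partial>\<nu>)"
   unfolding set_lebesgue_integral_def
   by (rule integral_cong_AE) (use le1 h(1) k(1) A in "auto simp: mb sets k_def[abs_def] indicator_def")
  finally show ?case by (simp add: e mult.left_commute)
 next
  case (add f g)
  then show ?case using assms(3)[of f g] ku[of f] ku[of g] by (simp add: distrib_left)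
 next
  case (lim f s)
  have bd: "AE x in \<nu>. norm (s i x) <= 2 * norm (f x)" for i using lim(3) sp by (intro AE_I2) auto
  have fb: "f \<in> borel_measurable \<nu>" "!!i. s i \<in> borel_measurable \<nu>" "!!i. integrable \<nu> (s i)" using lim by auto
  have cv: "AE x in \<nu>. (%i. s i x) \<longlonglongrightarrow> f x" using lim(2) by (intro AE_I2)
  have A: "(%i. \<integral>x. k x * s i x \<partial>\<nu>) \<longlonglongrightarrow> (\<integral>x. k x * f x \<partial>\<nu>)"
  proof (rule integral_dominated_convergence)
   show "integrable \<nu> (%x. 2 * norm (f x))" using lim(4) by simp
   show "AE x in \<nu>. (%i. k x * s i x) \<longlonglongrightarrow> k x * f x" using cv by eventually_elim (intro tendsto_intros)
   show "AE x in \<nu>. norm (k x * s i x) <= 2 * norm (f x)" for i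
    using bd[of i] by eventually_elim (metis k(2) mult_left_le_one_le norm_ge_zero norm_mult order_trans)
  qed (use fb k(1) in "auto simp: mb")
  have B: "(%i. T (s i)) \<longlonglongrightarrow> T f"
  proof (rule Lim_null_comparison[THEN LIM_zero_cancel])
   show "\<forall>\<^sub>F i in sequentially. norm (T (s i) - T f) <= (\<integral>x. cmod (s i x - f x) \<partial>\<nu>)"
   proof (intro always_eventually allI)
    fix i
    have "T (%x. s i x + (- 1) * f x) = T (s i) + (- 1) * T f" using fb(3)[of i] lim(4) assms(3)[of "s i" "%x. (- 1) * f x"] scale[of f "- 1"] by simp
    then show "norm (T (s i) - T f) <= (\<integral>x. cmod (s i x - f x) \<partial>\<nu>)" using bound[of "%x. s i x + (- 1) * f x"] fb(3)[of i] lim(4) by simp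
   qed
   have "(%i. \<integral>x. cmod (s i x - f x) \<partial>\<nu>) \<longlonglongrightarrow> (\<integral>x. cmod (f x - f x) \<partial>\<nu>)"
   proof (rule integral_dominated_convergence)
    show "integrable \<nu> (%x. 3 * norm (f x))" using lim(4) by simp
    show "AE x in \<nu>. (%i. cmod (s i x - f x)) \<longlonglongrightarrow> cmod (f x - f x)" using cv by eventually_elim (intro tendsto_intros)
    show "AE x in \<nu>. norm (cmod (s i x - f x)) <= 3 * norm (f x)" for i
     using bd[of i] by eventually_elim (use norm_triangle_ineq4 in "smt (verit) real_norm_def norm_ge_zero")
   qed (use fb in auto)
   then show "(%i. \<integral>x. cmod (s i x - f x) \<partial>\<nu>) \<longlonglongrightarrow> 0" by simp
  qed
  show ?case by (rule LIMSEQ_unique[OF B]) (use A lim.IH in simp)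
 qed
 then show ?thesis using k by blast
qed

context weighted_haar begin

sublocale conv: convolution_algebra "L1_alg m \<omega>" L1_restr \<omega> by (rule convolution_algebra_L1)

lemma Linf_functional_bound:
 assumes f: "f \<in> BM" "AE x in m. cmod (f x) <= c * \<omega> x" and p: "\<phi> \<in> L"
 shows "integrable m (%x. f x * \<phi> x)" "cmod (\<integral>x. f x * \<phi> x \<partial>m) <= c * NL \<phi>"
proof -
 have i: "integrable m (%x. c * (\<omega> x * cmod (\<phi> x)))"
  using p w_borel(1) w_nonneg by (intro integrable_mult_right) (auto simp: L1_iff integrable_iff_bounded mb)
 have AE: "AE x in m. norm (f x * \<phi> x) <= c * (\<omega> x * cmod (\<phi> x))"
  using f(2) by eventually_elim (use mult_right_mono in "fastforce simp: norm_mult mult.assoc[symmetric]")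
 show i2: "integrable m (%x. f x * \<phi> x)"
  by (rule Bochner_Integration.integrable_bound[OF i])
   (use AE f(1) L1D(1)[OF p] in "auto simp: mb intro: order_trans[OF _ abs_ge_self]")
 have "cmod (\<integral>x. f x * \<phi> x \<partial>m) <= (\<integral>x. c * (\<omega> x * cmod (\<phi> x)) \<partial>m)"
  by (rule order_trans[OF integral_norm_bound]) (rule integral_mono_AE[OF integrable_norm[OF i2] i AE])
 also have "\<dots> = c * NL \<phi>" using w_nonneg by (simp add: L1_alg_def norm_mult)
 finally show "cmod (\<integral>x. f x * \<phi> x \<partial>m) <= c * NL \<phi>" .
qed

lemma Linf_functional_adual:
 assumes f: "f \<in> BM" "AE x in m. cmod (f x) <= c * \<omega> x"
 shows "Linf_functional m \<omega> f \<in> adual (L1_alg m \<omega>)"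
 unfolding adual_def top_dual_def Linf_functional_def
 using Linf_functional_bound[OF f] conv.add_in conv.scale_in
 by (auto simp: distrib_left mult.left_commute intro!: exI[of _ c])

lemma AE_le_Linf_norm:
 assumes "f \<in> BM" "Linf_norm m \<omega> f <= ennreal c" "0 <= c" shows "AE x in m. cmod (f x) <= c * \<omega> x"
 using esssup_AE[of "%x. ennreal (cmod (f x) / \<omega> x)" m]
proof eventually_elim
 case (elim x)
 then have "ennreal (cmod (f x) / \<omega> x) <= ennreal c" using assms(2) by (simp add: Linf_norm_def)
 then show ?case using assms(3) weight_pos(1)[OF w, of x] by (simp add: divide_le_eq)
qed

lemma compact_restr_in:
 assumes E: "E \<in> Borel" "E \<subseteq> K" and K: "compact K" and k: "k \<in> BM" "!!x. cmod (k x) <= 1"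
 shows "(%x. indicator E x * k x) \<in> L"
proof -
 obtain B where B: "\<forall>y\<in>\<omega> ` K. norm y <= B"
  using compact_imp_bounded[OF compact_continuous_image[OF continuous_on_subset[OF weight_continuous[OF w]] K]] by (auto simp: bounded_iff)
 have "(\<integral>\<^sup>+x. ennreal (\<omega> x * cmod (indicator E x * k x)) \<partial>m) <= (\<integral>\<^sup>+x. ennreal B * indicator K x \<partial>m)"
 proof (rule nn_integral_mono)
  fix x show "ennreal (\<omega> x * cmod (indicator E x * k x)) <= ennreal B * indicator K x"
   using B E(2) mult_mono[of "\<omega> x" B "cmod (k x)" 1] k(2)[of x] w_nonneg[of x] by (auto simp: indicator_def intro!: ennreal_leI)
 qed
 also have "\<dots> < \<infinity>" using compact_finite[OF K] compact_borel_t2[OF K] by (simp add: nn_integral_cmult_indicator sets_m ennreal_mult_less_top)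
 finally show ?thesis using E(1) k(1) by (simp add: L1_iff)
qed

text \<open>Tested against the indicator of \<open>{|f| > \<eta>\<omega>}\<close> times the conjugate phase of \<open>f\<close>.\<close>

lemma AE_le_if_functional_le:
 assumes f: "f \<in> BM" "!!x. cmod (f x) <= c * \<omega> x" and K: "compact K" and E: "E \<in> Borel" "E \<subseteq> K"
  and e0: "0 <= \<eta>" and le: "!!\<phi>. \<phi> \<in> L ==> cmod (\<integral>x. f x * L1_restr E \<phi> x \<partial>m) <= \<eta> * NL \<phi>"
 shows "AE x in m. x \<in> E --> cmod (f x) <= \<eta> * \<omega> x"
proof -
 define B where "B = {x \<in> E. \<eta> * \<omega> x < cmod (f x)}"
 have Bb: "B \<in> Borel"
 proof -
  have "{x. \<eta> * \<omega> x < cmod (f x)} \<in> Borel" using f(1) w_borel(1) by measurable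
  then show ?thesis using E(1) unfolding B_def by (simp add: Collect_conj_eq sets.Int)
 qed
 define \<phi> where "\<phi> x = indicator B x * (cnj (f x) / cmod (f x))" for x
 have p: "\<phi> \<in> L" unfolding \<phi>_def[abs_def]
 proof (rule compact_restr_in[OF Bb _ K])
  have "cnj \<in> BM" by (intro borel_measurable_continuous_onI continuous_intros)
  then show "(%x. cnj (f x) / cmod (f x)) \<in> BM" using f(1) measurable_compose[OF f(1), of cnj] by measurable
 qed (use E(2) in "auto simp: B_def norm_divide")
 have z: "f x * cnj (f x) / cmod (f x) = cmod (f x)" for x by (simp add: complex_norm_square[symmetric] power2_eq_square)
 have e: "f x * L1_restr E \<phi> x = complex_of_real (indicator B x * cmod (f x))" for x
  using z[of x] by (auto simp: L1_restr_def \<phi>_def B_def indicator_def)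
 have ip: "integrable m (%x. indicator B x * cmod (f x))"
  using integrable_norm[OF Linf_functional_bound(1)[OF f(1) AE_I2[OF f(2)] L1_restr_in[OF E(1) p]]] unfolding e by (simp add: norm_mult)
 have n: "\<omega> x * cmod (\<phi> x) = indicator B x * (if f x = 0 then 0 else \<omega> x)" for x by (auto simp: \<phi>_def norm_mult norm_divide indicator_def)
 have iw: "integrable m (%x. \<omega> x * cmod (\<phi> x))"
  using p w_borel(1) w_nonneg by (auto simp: L1_iff integrable_iff_bounded mb)
 have "(\<integral>x. indicator B x * cmod (f x) \<partial>m) <= \<eta> * NL \<phi>"
  using le[OF p] unfolding e integral_complex_of_real by (simp add: integral_nonneg_AE)
 also have "NL \<phi> = (\<integral>x. \<omega> x * cmod (\<phi> x) \<partial>m)" using w_nonneg by (simp add: L1_alg_def norm_mult)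
 finally have "(\<integral>x. indicator B x * cmod (f x) - \<eta> * (\<omega> x * cmod (\<phi> x)) \<partial>m) <= 0" using ip iw by simp
 moreover have nn: "0 <= indicator B x * cmod (f x) - \<eta> * (\<omega> x * cmod (\<phi> x))" for x
  by (auto simp: n indicator_def B_def)
 ultimately have "(\<integral>x. indicator B x * cmod (f x) - \<eta> * (\<omega> x * cmod (\<phi> x)) \<partial>m) = 0" by (intro antisym integral_nonneg_AE) auto
 then have "AE x in m. indicator B x * cmod (f x) - \<eta> * (\<omega> x * cmod (\<phi> x)) = 0"
  using integral_nonneg_eq_0_iff_AE[of m "%x. indicator B x * cmod (f x) - \<eta> * (\<omega> x * cmod (\<phi> x))"] ip iw nn by simp
 then show ?thesis
  by eventually_elim (use e0 w_nonneg in "auto simp: n indicator_def B_def not_le split: if_splits")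
qed

lemma Linf0_functional_vanishing:
 assumes f: "f \<in> Linf0 m \<omega>" shows "Linf_functional m \<omega> f \<in> conv.vanishing"
proof -
 have fb: "f \<in> BM" and fin: "Linf_norm m \<omega> f < \<infinity>" using f by (auto simp: Linf0_def Linf_def mb)
 have ad: "Linf_functional m \<omega> f \<in> adual (L1_alg m \<omega>)"
  by (rule Linf_functional_adual[OF fb AE_le_Linf_norm[OF fb, of "enn2real (Linf_norm m \<omega> f)"]]) (use fin in auto)
 have "\<exists>K. compact K & (\<forall>\<phi>\<in>L. cmod (Linf_functional m \<omega> f (L1_restr (- K) \<phi>)) <= \<eta> * NL \<phi>)" if e: "\<eta> > 0" for \<eta>
 proof -
  obtain K where K: "compact K" "Linf_norm m \<omega> (%x. f x * indicator (- K) x) < ennreal \<eta>" using f e unfolding Linf0_def by auto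
  have cK: "- K \<in> Borel" using compact_borel_t2[OF K(1)] by (rule borel_comp)
  have g: "(%x. f x * indicator (- K) x) \<in> BM" using fb cK by measurable
  have "cmod (Linf_functional m \<omega> f (L1_restr (- K) \<phi>)) <= \<eta> * NL \<phi>" if p: "\<phi> \<in> L" for \<phi>
   using Linf_functional_bound(2)[OF g AE_le_Linf_norm[OF g] p, of \<eta>] K(2) e L1_restr_in[OF cK p]
   by (simp add: Linf_functional_def L1_restr_def mult.assoc)
  then show ?thesis using K(1) by blast
 qed
 then show ?thesis using ad by (simp add: conv.vanishing_def)
qed

text \<open>\<open>F\<close> ignores everything off the \<sigma>-compact set \<open>D\<close>, on
  which the weighted Haar measure is \<sigma>-finite. A positive integrable factor \<open>g\<close>
  turns it into a finite measure \<open>\<nu>\<close>, where \<open>functional_has_density\<close>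
  applies; the density is then carried back.\<close>

lemma vanishing_has_density:
 assumes F: "F \<in> conv.vanishing" shows "\<exists>f\<in>Linf0 m \<omega>. F = Linf_functional m \<omega> f"
proof -
 have Fd: "F \<in> adual (L1_alg m \<omega>)" using F by (simp add: conv.vanishing_def)
 have "\<exists>K. compact K & (\<forall>\<phi>\<in>L. cmod (F (L1_restr (- K) \<phi>)) <= 1 / real (Suc n) * NL \<phi>)" for n
 proof -
  have "1 / real (Suc n) > 0" by simp
  then show ?thesis using F unfolding conv.vanishing_def by blast
 qed
 then have "\<forall>n. \<exists>K. compact K & (\<forall>\<phi>\<in>L. cmod (F (L1_restr (- K) \<phi>)) <= 1 / real (Suc n) * NL \<phi>)" by blast
 then obtain K where K: "\<forall>n. compact (K n) & (\<forall>\<phi>\<in>L. cmod (F (L1_restr (- K n) \<phi>)) <= 1 / real (Suc n) * NL \<phi>)" by (rule choice[THEN exE])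
 have bK: "K n \<in> Borel" for n using K compact_borel_t2 by blast
 define D where "D = (\<Union>n. K n)"
 have bD: "D \<in> Borel" unfolding D_def using bK by auto
 have F0: "F (L1_restr (- D) \<phi>) = 0" if p: "\<phi> \<in> L" for \<phi>
 proof -
  have "cmod (F (L1_restr (- D) \<phi>)) <= 1 / real (Suc n) * NL (L1_restr (- D) \<phi>)" for n
  proof -
   have "L1_restr (- K n) (L1_restr (- D) \<phi>) = L1_restr (- D) \<phi>" by (auto simp: L1_restr_def D_def indicator_def fun_eq_iff)
   then show ?thesis using K L1_restr_in[OF borel_comp[OF bD] p] by metis
  qed
  moreover have "(%n. 1 / real (Suc n) * NL (L1_restr (- D) \<phi>)) \<longlonglongrightarrow> 0 * NL (L1_restr (- D) \<phi>)"
   by (intro tendsto_mult tendsto_const lim_1_over_n[THEN LIMSEQ_Suc])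
  ultimately have "cmod (F (L1_restr (- D) \<phi>)) <= 0" by (intro LIMSEQ_le_const[of _ 0]) auto
  then show ?thesis by simp
 qed
 \<comment> \<open>The summand 1 makes \<open>C\<close> positive, so that it can be cancelled also
   when \<open>F = 0\<close>.\<close>
 define C where "C = adual_norm (L1_alg m \<omega>) F + 1"
 have C: "C > 0" "cmod (F \<phi>) <= C * NL \<phi>" if "\<phi> \<in> L" for \<phi>
  using conv.adual_bound[OF Fd that] conv.dual.norm_nonneg[OF Fd] L1_norm_nonneg[of \<phi>] by (auto simp: C_def distrib_right)
 have C0: "C > 0" using C(1)[OF conv.zero_in] .
 let ?M = "density m (%x. ennreal (\<omega> x) * indicator D x)"
 have em: "emeasure ?M E = (\<integral>\<^sup>+x. ennreal (\<omega> x) * indicator (D \<inter> E) x \<partial>m)" if "E \<in> Borel" for E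
  using that bD w_borel(2) by (subst emeasure_density) (auto simp: mb sets_m indicator_inter_arith mult.assoc)
 interpret S: sigma_finite_measure ?M
 proof
  show "\<exists>A. countable A & A \<subseteq> sets ?M & \<Union>A = space ?M & (\<forall>a\<in>A. emeasure ?M a \<noteq> \<infinity>)"
  proof (intro exI[of _ "insert (- D) (range K)"] conjI ballI)
   fix a assume "a \<in> insert (- D) (range K)"
   then consider "a = - D" | n where "a = K n" by auto
   then show "emeasure ?M a \<noteq> \<infinity>"
   proof cases
    case 2
    have "(%x. indicator (K n) x * (1 :: complex)) \<in> L" by (rule compact_restr_in[OF bK order_refl]) (use K in auto)
    moreover have "D \<inter> K n = K n" by (auto simp: D_def)
    moreover have "ennreal (\<omega> x * cmod (indicator (K n) x)) = ennreal (\<omega> x) * indicator (K n) x" for x by (simp add: indicator_def)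
    ultimately show ?thesis using 2 by (simp add: em[OF bK] L1_iff) (metis less_irrefl)
   qed (simp add: em[OF borel_comp[OF bD]])
  qed (use bK bD borel_comp[OF bD] in "auto simp: sets_m space_m D_def")
 qed
 obtain g0 where g0: "g0 \<in> borel_measurable ?M" "integral\<^sup>N ?M g0 \<noteq> \<infinity>" "\<forall>x\<in>space ?M. 0 < g0 x & g0 x < \<infinity>"
  using S.Ex_finite_integrable_function by (elim bexE conjE)
 define g where "g x = enn2real (g0 x)" for x
 have g0b: "g0 \<in> BM" using g0(1) by (simp add: mb)
 have g: "g \<in> BM" "!!x. 0 < g x" "!!x. ennreal (g x) = g0 x"
  using g0b g0(3) by (auto simp: g_def[abs_def] space_m enn2real_positive_iff)
 define \<nu> where "\<nu> = density m (%x. ennreal (C * \<omega> x * g x * indicator D x))"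
 have db: "(%x. C * \<omega> x * g x * indicator D x) \<in> BM" using w_borel(1) g(1) bD by measurable
 have d0: "0 <= C * \<omega> x * g x * indicator D x" for x using C0 w_nonneg g(2)[of x] by (simp add: less_imp_le)
 have "(\<integral>\<^sup>+x. ennreal (C * \<omega> x * g x * indicator D x) \<partial>m) = (\<integral>\<^sup>+x. ennreal C * (ennreal (\<omega> x) * indicator D x * g0 x) \<partial>m)"
  using C0 w_nonneg g by (intro nn_integral_cong) (simp add: indicator_def ennreal_mult less_imp_le mult.assoc)
 also have "\<dots> = ennreal C * integral\<^sup>N ?M g0"
  using w_borel(2) bD g0b by (simp add: nn_integral_cmult nn_integral_density mb)
 also have "\<dots> < \<infinity>" using g0(2) by (simp add: ennreal_mult_less_top top.not_eq_extremum)
 finally have fin: "finite_measure \<nu>"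
  using db unfolding \<nu>_def by (intro finite_measureI) (simp add: emeasure_density mb sets_m space_m)
 have sets: "sets \<nu> = Borel" by (simp add: \<nu>_def sets_m)
 have iff: "integrable \<nu> u \<longleftrightarrow> integrable m (%x. (C * \<omega> x * g x * indicator D x) *\<^sub>R u x)"
  and eq: "(\<integral>x. u x \<partial>\<nu>) = (\<integral>x. (C * \<omega> x * g x * indicator D x) *\<^sub>R u x \<partial>m)" if "u \<in> BM" for u :: "'a => complex"
  unfolding \<nu>_def using integrable_density[of u m, OF _ _ AE_I2[OF d0]] integral_density[of u m, OF _ _ AE_I2[OF d0]] that db by (simp_all add: mb)
 \<comment> \<open>Multiplication by \<open>g\<close> on \<open>D\<close> carries the norm of L1 of
   \<open>\<nu>\<close> to \<open>C * NL\<close>; the factor \<open>C\<close> makes \<open>T\<close>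
   a contraction.\<close>
 define T where "T u = F (L1_restr D (%x. complex_of_real (g x) * u x))" for u
 have G: "L1_restr D (%x. complex_of_real (g x) * u x) \<in> L"
  "C * NL (L1_restr D (%x. complex_of_real (g x) * u x)) = (\<integral>x. cmod (u x) \<partial>\<nu>)" if u: "integrable \<nu> u" for u
 proof -
  have ub: "u \<in> BM" using borel_measurable_integrable[OF u] by (simp add: measurable_borel_iff[OF sets])
  have n: "norm ((C * \<omega> x * g x * indicator D x) *\<^sub>R u x) = C * (\<omega> x * cmod (L1_restr D (%x. complex_of_real (g x) * u x) x))" for x
   using C0 w_nonneg[of x] g(2)[of x] by (simp add: L1_restr_def norm_mult indicator_def less_imp_le)
  have i: "integrable m (%x. C * (\<omega> x * cmod (L1_restr D (%x. complex_of_real (g x) * u x) x)))"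
   using integrable_norm[OF u[unfolded iff[OF ub]]] unfolding n .
  have "L1_restr D (%x. complex_of_real (g x) * u x) \<in> BM"
   unfolding L1_restr_def using bD g(1) ub by measurable
  moreover have "integrable m (%x. \<omega> x * cmod (L1_restr D (%x. complex_of_real (g x) * u x) x))" using i C0 by simp
  ultimately show "L1_restr D (%x. complex_of_real (g x) * u x) \<in> L"
   using w_nonneg by (simp add: L1_iff integrable_iff_bounded)
  have "(\<integral>x. cmod (u x) \<partial>\<nu>) = (\<integral>x. (C * \<omega> x * g x * indicator D x) *\<^sub>R cmod (u x) \<partial>m)"
   unfolding \<nu>_def using ub db d0 by (intro integral_density) (auto simp: mb)
  also have "\<dots> = (\<integral>x. C * (\<omega> x * cmod (L1_restr D (%x. complex_of_real (g x) * u x) x)) \<partial>m)"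
   by (intro Bochner_Integration.integral_cong[OF refl]) (use n in "simp only: norm_scaleR abs_of_nonneg[OF d0] real_scaleR_def")
  also have "\<dots> = C * NL (L1_restr D (%x. complex_of_real (g x) * u x))" using w_nonneg by (simp add: L1_alg_def norm_mult)
  finally show "C * NL (L1_restr D (%x. complex_of_real (g x) * u x)) = (\<integral>x. cmod (u x) \<partial>\<nu>)" ..
 qed
 obtain h where h: "h \<in> BM" "\<forall>x. cmod (h x) <= 1" "\<forall>u. integrable \<nu> u --> T u = (\<integral>x. h x * u x \<partial>\<nu>)"
 proof -
  have "\<exists>h. h \<in> BM & (\<forall>x. cmod (h x) <= 1) & (\<forall>u. integrable \<nu> u --> T u = (\<integral>x. h x * u x \<partial>\<nu>))"
  proof (rule functional_has_density[OF fin sets])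
   fix u :: "'a => complex" and c assume u: "integrable \<nu> u"
   show "cmod (T u) <= (\<integral>x. cmod (u x) \<partial>\<nu>)" using C(2)[OF G(1)[OF u]] G(2)[OF u] by (simp add: T_def)
   have "L1_restr D (%x. complex_of_real (g x) * (c * u x)) = (%x. c * L1_restr D (%x. complex_of_real (g x) * u x) x)" by (auto simp: L1_restr_def)
   then show "T (%x. c * u x) = c * T u" using top_dual_scale[OF Fd[unfolded adual_def] G(1)[OF u]] by (simp add: T_def)
  next
   fix u v :: "'a => complex" assume u: "integrable \<nu> u" and v: "integrable \<nu> v"
   have "L1_restr D (%x. complex_of_real (g x) * (u x + v x)) =
     (%x. L1_restr D (%x. complex_of_real (g x) * u x) x + L1_restr D (%x. complex_of_real (g x) * v x) x)"
    by (auto simp: L1_restr_def distrib_left)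
   then show "T (%x. u x + v x) = T u + T v" using top_dual_add[OF Fd[unfolded adual_def] G(1)[OF u] G(1)[OF v]] by (simp add: T_def)
  qed
  then show ?thesis using that by (elim exE conjE)
 qed
 \<comment> \<open>No \<open>g\<close> remains: the factor in the density of \<open>\<nu>\<close>
   cancels against the division by \<open>g\<close> in the test function \<open>?u\<close>
   below.\<close>
 define f where "f x = complex_of_real (C * \<omega> x * indicator D x) * h x" for x
 have fb: "f \<in> BM" unfolding f_def[abs_def] using w_borel(1) bD h(1) by measurable
 have fle: "cmod (f x) <= C * \<omega> x" for x
  using mult_left_le[of "cmod (h x)" "C * \<omega> x"] h(2) C0 w_nonneg[of x] by (auto simp: f_def norm_mult indicator_def)
 have Ff: "F \<phi> = (\<integral>x. f x * \<phi> x \<partial>m)" if p: "\<phi> \<in> L" for \<phi>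
 proof -
  let ?u = "%x. \<phi> x / complex_of_real (g x)"
  have ub: "?u \<in> BM" using L1D(1)[OF p] g(1) by measurable
  have gu: "(%x. complex_of_real (g x) * ?u x) = \<phi>" using g(2) by (auto simp: fun_eq_iff less_imp_neq[symmetric])
  have e: "(C * \<omega> x * g x * indicator D x) *\<^sub>R (v * ?u x) = complex_of_real (C * \<omega> x * indicator D x) * v * \<phi> x" for x v
   using g(2)[of x] by (simp add: scaleR_conv_of_real field_simps)
  have "integrable m (%x. complex_of_real (C * \<omega> x * indicator D x) * \<phi> x)"
   by (rule Linf_functional_bound(1)[OF _ _ p, of _ C])
    (use w_borel(1) w_nonneg C0 bD in "auto simp: indicator_def norm_mult less_imp_le")
  then have iu: "integrable \<nu> ?u" unfolding iff[OF ub] using e[of _ 1] by (simp add: scaleR_conv_of_real)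
  have "F \<phi> = F (L1_restr D \<phi>) + F (L1_restr (- D) \<phi>)"
   using top_dual_add[OF Fd[unfolded adual_def] L1_restr_in[OF bD p] L1_restr_in[OF borel_comp[OF bD] p]] conv.restr_split[OF bD p] by simp
  also have "\<dots> = T ?u" unfolding T_def gu F0[OF p] by simp
  also have "\<dots> = (\<integral>x. h x * ?u x \<partial>\<nu>)" using h(3) iu by blast
  also have "\<dots> = (\<integral>x. (C * \<omega> x * g x * indicator D x) *\<^sub>R (h x * ?u x) \<partial>m)" by (rule eq) (use h(1) ub in measurable)
  also have "\<dots> = (\<integral>x. f x * \<phi> x \<partial>m)" by (simp only: f_def e)
  finally show ?thesis .
 qed
 have norm: "Linf_norm m \<omega> k <= ennreal c" if "k \<in> BM" "AE x in m. cmod (k x) <= c * \<omega> x" for k c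
  unfolding Linf_norm_def
 proof (rule esssup_I)
  show "(%x. ennreal (cmod (k x) / \<omega> x)) \<in> borel_measurable m" using that(1) w_borel(1) by (simp add: mb)
  show "AE x in m. ennreal (cmod (k x) / \<omega> x) <= ennreal c"
   using that(2) by eventually_elim (use weight_pos(1)[OF w] in "auto simp: divide_le_eq intro!: ennreal_leI")
 qed
 have "\<exists>K. compact K & Linf_norm m \<omega> (%x. f x * indicator (- K) x) < ennreal \<eta>" if e: "\<eta> > 0" for \<eta>
 proof -
  have "\<eta> / 2 > 0" using e by simp
  then obtain K' where K': "compact K'" "\<forall>\<phi>\<in>L. cmod (F (L1_restr (- K') \<phi>)) <= \<eta> / 2 * NL \<phi>" using F unfolding conv.vanishing_def by blast
  have cK: "- K' \<in> Borel" using compact_borel_t2[OF K'(1)] by (rule borel_comp)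
  \<comment> \<open>Estimated on each compact \<open>K n\<close> separately, since the test
    functions of \<open>AE_le_if_functional_le\<close> are supported in a compact set; countably
    many null sets are then united.\<close>
  have "AE x in m. x \<in> K n \<inter> - K' --> cmod (f x) <= \<eta> / 2 * \<omega> x" for n
  proof (rule AE_le_if_functional_le[OF fb fle, of "K n"])
   fix \<phi> assume p: "\<phi> \<in> L"
   have r: "L1_restr (K n \<inter> - K') \<phi> = L1_restr (- K') (L1_restr (K n) \<phi>)" by (auto simp: L1_restr_def indicator_def)
   have "cmod (F (L1_restr (- K') (L1_restr (K n) \<phi>))) <= \<eta> / 2 * NL (L1_restr (K n) \<phi>)" using K'(2) L1_restr_in[OF bK p] by blast
   also have "\<dots> <= \<eta> / 2 * NL \<phi>" using conv.restr_norm_le[OF bK p] e by (intro mult_left_mono) auto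
   finally show "cmod (\<integral>x. f x * L1_restr (K n \<inter> - K') \<phi> x \<partial>m) <= \<eta> / 2 * NL \<phi>"
    unfolding r using Ff[OF L1_restr_in[OF cK L1_restr_in[OF bK p]]] by simp
  qed (use K bK cK e in auto)
  then have "AE x in m. \<forall>n. x \<in> K n \<inter> - K' --> cmod (f x) <= \<eta> / 2 * \<omega> x" unfolding AE_all_countable by blast
  then have "AE x in m. cmod (f x * indicator (- K') x) <= \<eta> / 2 * \<omega> x"
  proof eventually_elim
   case (elim x)
   show ?case
   proof (cases "x \<in> D \<inter> - K'")
    case True then show ?thesis using elim by (auto simp: D_def)
   qed (use e w_nonneg[of x] in "auto simp: f_def indicator_def")
  qed
  then have "Linf_norm m \<omega> (%x. f x * indicator (- K') x) <= ennreal (\<eta> / 2)" by (intro norm) (use fb cK in measurable)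
  also have "\<dots> < ennreal \<eta>" using e by (intro ennreal_lessI) auto
  finally show ?thesis using K'(1) by blast
 qed
 moreover have "f \<in> Linf m \<omega>" using norm[OF fb AE_I2[OF fle]] fb by (auto simp: Linf_def mb intro: le_less_trans)
 ultimately have "f \<in> Linf0 m \<omega>" by (simp add: Linf0_def)
 moreover have "F = Linf_functional m \<omega> f"
  using Ff Fd by (auto simp: Linf_functional_def adual_def top_dual_def fun_eq_iff)
 ultimately show ?thesis by blast
qed

theorem Linf0_functionals_eq_vanishing: "Linf0_functionals m \<omega> = conv.vanishing"
 using Linf0_functional_vanishing vanishing_has_density by (auto simp: Linf0_functionals_def)

end

section \<open>Non-discrete groups\<close>

text \<open>Pick \<open>c\<close> different from 0 in \<open>W\<close> and separate it from 0.
  Continuity of addition at \<open>(c, 0)\<close> and \<open>(0, c)\<close> keeps sums of a point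
  near \<open>c\<close> and a point near 0 close to \<open>c\<close>, hence outside a small
  \<open>V\<close>; two orders occur because the group may be noncommutative.\<close>

lemma ex_separated_sum:
 assumes nd: "\<not> open {0 :: 'a::{topological_group_add, t2_space}}" and W: "open W" "0 \<in> W"
 shows "\<exists>V U. open V & 0 \<in> V & V \<subseteq> W & open U & U \<noteq> {} & U \<subseteq> W &
  (\<forall>u\<in>U. \<forall>v\<in>V. u + v \<in> W - V & v + u \<in> W - (V :: 'a set))"
proof -
 have "W \<noteq> {0}" using nd W(1) by auto
 then obtain c where c: "c \<in> W" "c \<noteq> 0" using W(2) by blast
 obtain P Q where PQ: "open P" "open Q" "0 \<in> P" "c \<in> Q" "P \<inter> Q = {}" using hausdorff[of 0 c] c(2) by auto
 have o: "open ((%p. fst p + snd p) -` (W \<inter> Q) :: ('a \<times> 'a) set)"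
  by (intro open_vimage open_Int W PQ continuous_intros)
 have m: "(c, 0) \<in> (%p. fst p + snd p) -` (W \<inter> Q)" "(0, c) \<in> (%p. fst p + snd p) -` (W \<inter> Q)" using c PQ by auto
 obtain U1 V1 where 1: "open U1" "open V1" "(c, 0) \<in> U1 \<times> V1" "U1 \<times> V1 \<subseteq> (%p. fst p + snd p) -` (W \<inter> Q)"
  by (rule open_prod_elim[OF o m(1)])
 obtain V2 U2 where 2: "open V2" "open U2" "(0, c) \<in> V2 \<times> U2" "V2 \<times> U2 \<subseteq> (%p. fst p + snd p) -` (W \<inter> Q)"
  by (rule open_prod_elim[OF o m(2)])
 show ?thesis
 proof (rule exI[of _ "V1 \<inter> V2 \<inter> P \<inter> W"], rule exI[of _ "U1 \<inter> U2 \<inter> W"], intro conjI ballI)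
  show "U1 \<inter> U2 \<inter> W \<noteq> {}" using 1 2 c by auto
  fix u v assume uv: "u \<in> U1 \<inter> U2 \<inter> W" "v \<in> V1 \<inter> V2 \<inter> P \<inter> W"
  have "(u, v) \<in> U1 \<times> V1" "(v, u) \<in> V2 \<times> U2" using uv by auto
  then have "u + v \<in> W \<inter> Q" "v + u \<in> W \<inter> Q" using 1(4) 2(4) by fastforce+
  then show "u + v \<in> W - V1 \<inter> V2 \<inter> P \<inter> W" "v + u \<in> W - V1 \<inter> V2 \<inter> P \<inter> W" using PQ(5) by auto
 qed (use 1 2 PQ W in auto)
qed

lemma tendsto_if_le:
 "(%k. if n <= k then 1 else 0) \<longlonglongrightarrow> (1 :: complex)" "(%k. if k <= n then 1 else 0) \<longlonglongrightarrow> (0 :: complex)" for n :: nat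
 by (rule tendsto_eventually, use eventually_ge_at_top[of n] in "eventually_elim, simp")
  (rule tendsto_eventually, use eventually_gt_at_top[of n] in "eventually_elim, simp")

context weighted_haar begin

definition avg :: "'a set => 'a => complex" where
 "avg U x = complex_of_real (indicator U x / measure m U)"

lemma avg:
 assumes U: "open U" "U \<noteq> {}" "U \<subseteq> K" and K: "compact K" and B: "\<forall>x\<in>K. \<omega> x <= B"
 shows "avg U \<in> L" "(\<integral>\<^sup>+x. ennreal (cmod (avg U x)) \<partial>m) = 1" "NL (avg U) <= B"
proof -
 have bU: "U \<in> Borel" using U(1) by simp
 have fin: "emeasure m U < \<infinity>" using emeasure_mono[OF U(3), of m] compact_finite[OF K] compact_borel_t2[OF K] by (auto simp: sets_m)
 then have p: "measure m U > 0" using open_positive[OF U(1,2)] by (simp add: measure_def enn2real_positive_iff)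
 have e: "ennreal (measure m U) = emeasure m U" using fin by (simp add: emeasure_eq_ennreal_measure)
 have "(%x. indicator U x * (1 :: complex)) \<in> L" by (rule compact_restr_in[OF bU U(3) K]) auto
 from conv.scale_in[OF this, of "1 / measure m U"] show i: "avg U \<in> L"
  by (rule back_subst[of "%x. x \<in> L"]) (auto simp: avg_def[abs_def] indicator_def)
 have c: "cmod (avg U x) = 1 / measure m U * indicator U x" for x using p by (simp add: avg_def indicator_def norm_divide)
 have I: "(\<integral>\<^sup>+x. ennreal b * ennreal (1 / measure m U * indicator U x) \<partial>m) = ennreal b" if "0 <= b" for b
 proof -
  have "(\<integral>\<^sup>+x. ennreal b * ennreal (1 / measure m U * indicator U x) \<partial>m) = (\<integral>\<^sup>+x. ennreal (b / measure m U) * indicator U x \<partial>m)"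
   using p that by (intro nn_integral_cong) (simp add: indicator_def ennreal_mult[symmetric])
  also have "\<dots> = ennreal (b / measure m U) * ennreal (measure m U)" using bU by (simp add: nn_integral_cmult_indicator sets_m e)
  also have "\<dots> = ennreal b" using p that by (simp add: ennreal_mult[symmetric])
  finally show ?thesis .
 qed
 show "(\<integral>\<^sup>+x. ennreal (cmod (avg U x)) \<partial>m) = 1" using I[of 1] by (simp add: c)
 have B0: "0 <= B" using U(2,3) B w_nonneg by (meson equals0I order_trans subsetD)
 have "ennreal (NL (avg U)) <= (\<integral>\<^sup>+x. ennreal B * ennreal (1 / measure m U * indicator U x) \<partial>m)"
  unfolding L1_norm[OF i] c
 proof (rule nn_integral_mono)
  fix x show "ennreal (\<omega> x * (1 / measure m U * indicator U x)) <= ennreal B * ennreal (1 / measure m U * indicator U x)"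
   using B B0 U(3) p by (auto simp: indicator_def ennreal_mult[symmetric] divide_right_mono intro!: ennreal_leI)
 qed
 then show "NL (avg U) <= B" using I[OF B0] B0 by simp
qed

text \<open>The convolution of the two averages is a probability density concentrated on the sums of
  \<open>U\<close> and \<open>V\<close>, where \<open>f\<close> is constant.\<close>

lemma integral_avg_convolution:
 assumes U: "open U" "U \<noteq> {}" "U \<subseteq> K" and V: "open V" "V \<noteq> {}" "V \<subseteq> K" and K: "compact K" and B: "\<forall>x\<in>K. \<omega> x <= B"
  and f: "\<forall>u\<in>U. \<forall>v\<in>V. f (u + v) = c"
 shows "(\<integral>x. f x * mulL (avg U) (avg V) x \<partial>m) = c"
proof -
 let ?p = "mulL (avg U) (avg V)"
 note a = avg[OF U K B] and b = avg[OF V K B]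
 define r where "r x = (\<integral>y. (indicator U y / measure m U) * (indicator V (- y + x) / measure m V) \<partial>m)" for x
 have p: "?p x = complex_of_real (r x)" for x
  by (simp add: L1_alg_def avg_def r_def integral_complex_of_real[symmetric] del: integral_complex_of_real)
 have r0: "0 <= r x" for x unfolding r_def by (rule integral_nonneg_AE) simp
 have e: "f x * ?p x = c * ?p x" for x
 proof (cases "\<exists>y. y \<in> U & - y + x \<in> V")
  case True
  then obtain y where "y \<in> U" "- y + x \<in> V" by blast
  with f have "f (y + (- y + x)) = c" by blast
  then show ?thesis by (simp add: add.assoc[symmetric])
 next
  case False
  then have "(%y. avg U y * avg V (- y + x)) = (%y. 0)" by (auto simp: avg_def indicator_def fun_eq_iff)
  then show ?thesis by (simp add: L1_alg_def)
 qed
 have "(\<integral>x. f x * ?p x \<partial>m) = c * complex_of_real (\<integral>x. r x \<partial>m)" by (simp only: e) (simp add: p)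
 moreover have "(\<integral>x. r x \<partial>m) = 1"
 proof -
  have rb: "r \<in> borel_measurable m"
   using measurable_compose[OF convolution_borel[OF a(1) L1D(1)[OF b(1)]] borel_measurable_Re] by (simp add: mb p)
  have "(\<integral>\<^sup>+x. ennreal (r x) \<partial>m) = (\<integral>\<^sup>+x. abs_convolution (avg U) (avg V) x \<partial>m)"
  proof (rule nn_integral_cong_AE)
   show "AE x in m. ennreal (r x) = abs_convolution (avg U) (avg V) x"
    using AE_convolution_integrable[OF a(1) b(1)]
   proof eventually_elim
    case (elim x)
    have e: "avg U y * avg V (- y + x) = complex_of_real ((indicator U y / measure m U) * (indicator V (- y + x) / measure m V))" for y
     by (simp add: avg_def)
    have "integrable m (%y. (indicator U y / measure m U) * (indicator V (- y + x) / measure m V))"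
     using integrable_Re[OF elim[unfolded e]] by simp
    from nn_integral_eq_integral[OF this] show ?case
     unfolding r_def abs_convolution_def e norm_of_real by simp
   qed
  qed
  also have "\<dots> = ennreal 1" using nn_integral_abs_convolution(3)[OF a(1) b(1)] a(2) b(2) by simp
  finally show ?thesis using integral_eq_nn_integral[OF rb] r0 by simp
 qed
 ultimately show ?thesis by simp
qed

text \<open>Shrinking neighbourhoods \<open>W\<^sub>k\<close> of 0 and sets \<open>U\<^sub>k \<subseteq> W\<^sub>k\<close> such that \<open>U\<^sub>i + U\<^sub>j\<close> and \<open>U\<^sub>j + U\<^sub>i\<close> lie in
 \<open>W\<^sub>i - W\<^sub>i\<^sub>+\<^sub>1\<close> for \<open>i < j\<close>. The indicator of the even shells separates \<open>n <= k\<close> from \<open>n > k\<close>.\<close>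

lemma ex_half_graph_functional:
 assumes nd: "\<not> open {0 :: 'a}"
 shows "\<exists>F a b C. F \<in> conv.vanishing & (\<forall>n::nat. a n \<in> L & NL (a n) <= C & b n \<in> L & NL (b n) <= C) &
  (\<forall>n k. F (mulL (a n) (b k)) = (if n <= k then 1 else 0))"
proof -
 obtain W0 K :: "'a set" where W0: "open W0" "compact K" "0 \<in> W0" "W0 \<subseteq> K" using ex_compact_nbhd[of 0] by (elim exE conjE)
 obtain B where B: "\<forall>y\<in>\<omega> ` K. norm y <= B"
  using compact_imp_bounded[OF compact_continuous_image[OF continuous_on_subset[OF weight_continuous[OF w]] W0(2)]] by (auto simp: bounded_iff)
 then have Bw: "\<forall>x\<in>K. \<omega> x <= B" using abs_ge_self order_trans by fastforce
 let ?Q = "%W V. \<exists>U. V \<subseteq> W & open U & U \<noteq> {} & U \<subseteq> W & (\<forall>u\<in>U. \<forall>v\<in>V. u + v \<in> W - V & v + u \<in> W - (V :: 'a set))"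
 have "\<exists>W. \<forall>n. (open (W n) & 0 \<in> W n & W n \<subseteq> K) & ?Q (W n) (W (Suc n))"
 proof (rule dependent_nat_choice)
  show "\<exists>W. open W & 0 \<in> W & W \<subseteq> K" using W0 by blast
  fix W :: "'a set" and n :: nat assume W: "open W & 0 \<in> W & W \<subseteq> K"
  obtain V U where "open V" "0 \<in> V" "V \<subseteq> W" "open U" "U \<noteq> {}" "U \<subseteq> W" "\<forall>u\<in>U. \<forall>v\<in>V. u + v \<in> W - V & v + u \<in> W - V"
   using ex_separated_sum[OF nd, of W] W by (elim exE conjE) auto
  then show "\<exists>V. (open V & 0 \<in> V & V \<subseteq> K) & ?Q W V" using W by (intro exI[of _ V]) auto
 qed
 then obtain W where W: "\<forall>n. (open (W n) & 0 \<in> W n & W n \<subseteq> K) & ?Q (W n) (W (Suc n))" ..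
 then have "\<forall>n. ?Q (W n) (W (Suc n))" by blast
 then obtain U where U: "\<forall>n. W (Suc n) \<subseteq> W n & open (U n) & U n \<noteq> {} & U n \<subseteq> W n &
   (\<forall>u\<in>U n. \<forall>v\<in>W (Suc n). u + v \<in> W n - W (Suc n) & v + u \<in> W n - W (Suc n))" by (rule choice[THEN exE])
 have dec: "W j \<subseteq> W i" if "i <= j" for i j using decseq_SucI[of W] U that by (simp add: decseq_def)
 have UU: "u + v \<in> W i - W (Suc i)" "v + u \<in> W i - W (Suc i)" if "i < j" "u \<in> U i" "v \<in> U j" for i j u v
  using that U dec[of "Suc i" j] by (meson Suc_leI subsetD)+
 \<comment> \<open>The union of the even shells. A sum of points of \<open>U i\<close> and
   \<open>U j\<close> with \<open>i < j\<close>, in either order, lies in shell \<open>i\<close>, so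
   the indicator reads off the parity of the smaller index.\<close>
 define S where "S = (\<Union>k. W (2 * k) - W (Suc (2 * k)))"
 define f :: "'a => complex" where "f = indicator S"
 have bS: "S \<in> Borel" unfolding S_def using W by (intro sets.countable_UN) auto
 have SK: "S \<subseteq> K" using W by (auto simp: S_def)
 have f: "f x = (if even i then 1 else 0)" if x: "x \<in> W i - W (Suc i)" for x i
 proof (cases "even i")
  case True
  then obtain k where "i = 2 * k" by blast
  then show ?thesis using x by (auto simp: f_def S_def indicator_def)
 next
  case False
  have "x \<notin> W (2 * k) - W (Suc (2 * k))" for k
  proof
   assume k: "x \<in> W (2 * k) - W (Suc (2 * k))"
   have "2 * k \<noteq> i" using False by auto
   then consider "Suc (2 * k) <= i" | "Suc i <= 2 * k" by linarith
   then show False using k x dec by cases blast+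
  qed
  then show ?thesis using False by (auto simp: f_def S_def)
 qed
 have fb: "f \<in> BM" unfolding f_def using bS by simp
 have fle: "AE x in m. cmod (f x) <= 1 * \<omega> x" using weight_ge_1[OF w] w_nonneg by (intro AE_I2) (auto simp: f_def indicator_def)
 define F where "F = Linf_functional m \<omega> f"
 have Fv: "F \<in> conv.vanishing"
  unfolding conv.vanishing_def F_def
 proof (intro CollectI conjI allI impI Linf_functional_adual[OF fb fle] exI[of _ K] W0(2) ballI)
  fix \<eta> :: real and \<phi> assume "\<eta> > 0" "\<phi> \<in> L"
  have "(%x. f x * L1_restr (- K) \<phi> x) = (%x. 0)" using SK by (auto simp: f_def L1_restr_def indicator_def fun_eq_iff)
  then show "cmod (Linf_functional m \<omega> f (L1_restr (- K) \<phi>)) <= \<eta> * NL \<phi>"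
   using \<open>\<eta> > 0\<close> L1_norm_nonneg by (simp add: Linf_functional_def)
 qed
 have U1: "open (U n)" for n using spec[OF U, of n] by (elim conjE)
 have U2: "U n \<noteq> {}" for n using spec[OF U, of n] by (elim conjE)
 have U3: "U n \<subseteq> K" for n using spec[OF U, of n] spec[OF W, of n] by (elim conjE) (rule order_trans)
 note UK = U1 U2 U3
 note av = avg[OF UK W0(2) Bw]
 \<comment> \<open>Even positions for the first factor, odd ones for the second: the smaller of
   \<open>2 * n\<close> and \<open>2 * k + 1\<close> is even precisely when
   \<open>n <= k\<close>.\<close>
 have "F (mulL (avg (U (2 * n))) (avg (U (Suc (2 * k))))) = (if n <= k then 1 else 0)" for n k
 proof -
  have "f (u + v) = (if n <= k then 1 else 0)" if uv: "u \<in> U (2 * n)" "v \<in> U (Suc (2 * k))" for u v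
  proof (cases "n <= k")
   case True
   then have "2 * n < Suc (2 * k)" by simp
   from f[OF UU(1)[OF this uv]] show ?thesis using True by simp
  next
   case False
   then have "Suc (2 * k) < 2 * n" by simp
   from f[OF UU(2)[OF this uv(2,1)]] show ?thesis using False by simp
  qed
  then have "\<forall>u\<in>U (2 * n). \<forall>v\<in>U (Suc (2 * k)). f (u + v) = (if n <= k then 1 else 0)" by blast
  from integral_avg_convolution[OF UK UK W0(2) Bw this]
  show ?thesis using convolution_in[OF av(1) av(1)] by (simp add: F_def Linf_functional_def)
 qed
 then show ?thesis using Fv av
  by (intro exI[of _ F] exI[of _ "%n. avg (U (2 * n))"] exI[of _ "%n. avg (U (Suc (2 * n)))"] exI[of _ B]) simp
qed

text \<open>For the sequences of averages the two iterated limits are 1 and 0. The functional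
  vanishes at infinity, so one example serves the algebra, its bidual and the dual of the vanishing
  functionals.\<close>

theorem open_singleton_if_arens_regular_L1:
 assumes "arens_regular (L1_alg m \<omega>) \<or> arens_regular (bidual (L1_alg m \<omega>)) \<or> arens_regular (introverted_dual (L1_alg m \<omega>) conv.vanishing)"
 shows "open {0 :: 'a}"
proof (rule ccontr)
 assume nd: "\<not> open {0 :: 'a}"
 obtain F a b C where F: "F \<in> conv.vanishing"
  and ab: "\<forall>n::nat. a n \<in> L & NL (a n) <= C & b n \<in> L & NL (b n) <= C"
  and H: "\<forall>n k. F (mulL (a n) (b k)) = (if n <= k then 1 else 0)"
  using ex_half_graph_functional[OF nd] by (elim exE conjE)
 have Fd: "F \<in> adual (L1_alg m \<omega>)" using F by (simp add: conv.vanishing_def)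
 have a: "a n \<in> L" "NL (a n) <= C" and b: "b n \<in> L" "NL (b n) <= C" for n using ab by auto
 have l: "(%k. F (mulL (a n) (b k))) \<longlonglongrightarrow> 1" "(%k. F (mulL (a k) (b n))) \<longlonglongrightarrow> 0" for n
  using H tendsto_if_le by simp_all
 interpret A: introverted "L1_alg m \<omega>" "adual (L1_alg m \<omega>)" by (rule conv.introverted_adual)
 interpret V: introverted_restriction "L1_alg m \<omega>" conv.vanishing L1_restr by (rule conv.introverted_restriction_vanishing)
 have "(1 :: complex) = 0"
  using assms
 proof (elim disjE)
  assume "arens_regular (L1_alg m \<omega>)"
  from conv.arens_regular_iterated_limits[OF this Fd a b l(1) tendsto_const l(2) tendsto_const] show ?thesis .
 next
  assume "arens_regular (bidual (L1_alg m \<omega>))"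
  from A.regular_dual_iterated_limits[OF this[unfolded bidual_def] Fd a b l(1) tendsto_const l(2) tendsto_const] show ?thesis .
 next
  assume "arens_regular (introverted_dual (L1_alg m \<omega>) conv.vanishing)"
  from V.regular_dual_iterated_limits[OF this F a b l(1) tendsto_const l(2) tendsto_const] show ?thesis .
 qed
 then show False by simp
qed

text \<open>On a discrete group every point has Haar measure \<open>m {0}\<close>; dividing by this
  number makes convolution of atoms agree with addition of points.\<close>

definition L1_atom :: "'a => 'a => complex" where
 "L1_atom x t = indicator {x} t / complex_of_real (measure m {0})"

definition L1_coord :: "'a => ('a => complex) => complex" where
 "L1_coord t \<phi> = (if \<phi> \<in> L then \<phi> t * measure m {0} else 0)"

theorem atomic_convolution_algebra_L1:
 assumes d: "open {0 :: 'a}"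
 shows "atomic_convolution_algebra (L1_alg m \<omega>) L1_restr \<omega> L1_atom L1_coord"
proof -
 let ?c = "measure m {0}"
 have bx: "{x} \<in> Borel" for x :: 'a by (intro compact_borel_t2) simp
 have em: "emeasure m {x} = ennreal ?c" for x
  using translate[OF bx, of x 0] compact_finite[of "{0}"] by (simp add: emeasure_eq_ennreal_measure)
 have c: "?c > 0" using open_positive[OF d] em[of 0] by simp
 have ind: "(\<integral>\<^sup>+t. f t * indicator {x} t \<partial>m) = f x * ennreal ?c" for f x
 proof -
  have "(\<integral>\<^sup>+t. f t * indicator {x} t \<partial>m) = (\<integral>\<^sup>+t. f x * indicator {x} t \<partial>m)" by (rule nn_integral_cong) (simp add: indicator_def)
  then show ?thesis using bx by (simp add: nn_integral_cmult_indicator sets_m em)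
 qed
 have atom: "L1_atom x \<in> L" for x
 proof -
  have "(%t. indicator {x} t * (1 / complex_of_real ?c)) \<in> L \<longleftrightarrow> True"
   using conv.scale_in[OF compact_restr_in[OF bx order_refl, of x "%_. 1"], of "1 / complex_of_real ?c"] by (simp add: mult.commute)
  then show ?thesis by (simp add: L1_atom_def[abs_def])
 qed
 show ?thesis
 proof (rule conv.atomic_convolution_algebraI)
  show "L1_atom x \<in> L" for x by (rule atom)
  show "NL (L1_atom x) = \<omega> x" for x
  proof -
   have "ennreal (NL (L1_atom x)) = (\<integral>\<^sup>+t. ennreal (\<omega> t / ?c) * indicator {x} t \<partial>m)"
    unfolding L1_norm[OF atom] using c by (intro nn_integral_cong) (simp add: L1_atom_def indicator_def norm_divide)
   also have "\<dots> = ennreal (\<omega> x)" using c w_nonneg by (simp add: ind ennreal_mult[symmetric])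
   finally show ?thesis using w_nonneg L1_norm_nonneg by simp
  qed
  show "L1_coord t (mulL (L1_atom x) (L1_atom y)) = (if t = x + y then 1 else 0)" for t x y
  proof -
   have e: "L1_atom x z * L1_atom y (- z + t) = indicat_real {x} z *\<^sub>R (L1_atom y (- x + t) / ?c)" for z
    by (simp add: L1_atom_def indicator_def)
   have "mulL (L1_atom x) (L1_atom y) t = L1_atom y (- x + t)"
    using c em[of x] bx[of x] by (simp add: L1_alg_def e measure_def sets_m integral_scaleR_left scaleR_conv_of_real)
   moreover have "- x + t = y \<longleftrightarrow> t = x + y" by (metis add.assoc add.right_inverse add.left_inverse add_0)
   ultimately show ?thesis using c convolution_in[OF atom atom] by (simp add: L1_coord_def L1_atom_def indicator_def)
  qed
  show "L1_coord t (L1_atom x) = (if t = x then 1 else 0)" for t x using atom c by (simp add: L1_coord_def L1_atom_def)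
  show "L1_restr {x} a = (%s. L1_coord x a * L1_atom x s)" if "a \<in> L" for a x
   using that c by (auto simp: L1_restr_def L1_coord_def L1_atom_def indicator_def)
 qed (use conv.add_in conv.scale_in in "simp_all add: L1_coord_def distrib_right")
qed

text \<open>Either side of each equivalence forces the group to be discrete, through regularity or
  through the zero cluster property, and then \<open>atomic_convolution_algebra_L1\<close> is
  available.\<close>

theorem arens_regular_L1_iff:
 defines "z \<equiv> zero_cluster (%p. complex_of_real (weight_Omega \<omega> p))"
 shows "arens_regular (L1_alg m \<omega>) \<longleftrightarrow> z" and "arens_regular (bidual (L1_alg m \<omega>)) \<longleftrightarrow> z"
  and "arens_regular (introverted_dual (L1_alg m \<omega>) conv.vanishing) \<longleftrightarrow> z"
proof -
 have "z ==> open {0 :: 'a}" unfolding z_def by (rule zero_cluster_open_singleton[OF w])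
 note D = this open_singleton_if_arens_regular_L1
  atomic_convolution_algebra.arens_regular_iff_zero_cluster[OF atomic_convolution_algebra_L1, folded z_def]
 show "arens_regular (L1_alg m \<omega>) \<longleftrightarrow> z" using D(1,2,3) by argo
 show "arens_regular (bidual (L1_alg m \<omega>)) \<longleftrightarrow> z" using D(1,2,4) by argo
 show "arens_regular (introverted_dual (L1_alg m \<omega>) conv.vanishing) \<longleftrightarrow> z" using D(1,2,5) by argo
qed

end

theorem theorem2p2:
 fixes \<omega> :: "'a::{topological_group_add, t2_space} \<Rightarrow> real"
  and m :: "'a measure"
 assumes "locally_compact_space (euclidean :: 'a topology)"
  and "left_haar_measure m"
  and "weight \<omega>"
 defines "a \<equiv> arens_regular (introverted_dual (M_alg \<omega>) (M_star \<omega>))"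
  and "b \<equiv> arens_regular (L1_alg m \<omega>)"
  and "c \<equiv> arens_regular (M_alg \<omega>)"
  and "d \<equiv> arens_regular (bidual (L1_alg m \<omega>))"
  and "e \<equiv> arens_regular (bidual (M_alg \<omega>))"
  and "f \<equiv> arens_regular (introverted_dual (L1_alg m \<omega>) (Linf0_functionals m \<omega>))"
  and "g \<equiv> finite (UNIV :: 'a set) \<or> zero_cluster (\<lambda>p. complex_of_real (weight_Omega \<omega> p))"
 shows "(a \<longleftrightarrow> b) \<and> (b \<longleftrightarrow> c) \<and> (c \<longleftrightarrow> d) \<and> (d \<longleftrightarrow> e) \<and> (e \<longleftrightarrow> f) \<and> (f \<longleftrightarrow> g) \<and>
  (g \<longrightarrow> euclidean = discrete_topology (UNIV :: 'a set) \<and> countable (UNIV :: 'a set))"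
proof -
 interpret L: weighted_haar m \<omega> by unfold_locales (rule assms)+
 interpret M: weighted_group \<omega> by unfold_locales (rule assms)
 let ?z = "zero_cluster (\<lambda>p. complex_of_real (weight_Omega \<omega> p))"
 note M = atomic_convolution_algebra.arens_regular_iff_zero_cluster[OF M.atomic_convolution_algebra_M_alg, folded M.M_star_eq_vanishing]
 note L = L.arens_regular_L1_iff[folded L.Linf0_functionals_eq_vanishing]
 \<comment> \<open>A finite group has no injective sequences, so the zero cluster property holds
   vacuously.\<close>
 have "?z" if "finite (UNIV :: 'a set)"
  using finite_subset[OF subset_UNIV that] range_inj_infinite unfolding zero_cluster_def by blast
 then have g: "g \<longleftrightarrow> ?z" unfolding g_def by blast
 have "euclidean = discrete_topology (UNIV :: 'a set) \<and> countable (UNIV :: 'a set)" if ?z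
 proof
  show "euclidean = discrete_topology (UNIV :: 'a set)"
   using discrete_topology_unique[of UNIV "euclidean :: 'a topology"] zero_cluster_open_singleton[OF assms(3) that] by simp
  show "countable (UNIV :: 'a set)" by (rule zero_cluster_countable[OF assms(3) that])
 qed
 then show ?thesis
  unfolding a_def b_def c_def d_def e_def f_def M L using g by blast
qed

end
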